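(* Let $\mathfrak g\subset J^1\mathfrak t$ be a surjective infinitesimal geometric structure on a transitive Lie algebroid $\mathfrak t$ over $M$. Assume that $\mathfrak g$ is $\Theta$-reduced, and that the lower coboundary morphism $\delta$ associated with $\mathfrak g$ is injective. Then $\mathfrak g$ has an associated Cartan algebroid, namely $\mathfrak g$ itself equipped with a canonical (i.e. determined by $\mathfrak g\subset J^1\mathfrak t$) Cartan connection $\nabla^{(1)}$. The $\nabla^{(1)}$-parallel sections of $\mathfrak g$ coincide with the prolonged symmetries of $\mathfrak g$, i.e. with the sections $J^1W$ where $W$ is a symmetry of $\mathfrak g$.
   Context: Everything is $C^\infty$. A Lie algebroid $\mathfrak t$ over $M$ is transitive if its anchor $\#\colon\mathfrak t\to TM$ is surjective. $J^kE$ is the bundle of $k$-jets of sections of $E$, and $J^k\sigma$ the prolongation of a section $\sigma$. $J^1\mathfrak t$ is a Lie algebroid with anchor $J^1\mathfrak t\to\mathfrak t\xrightarrow{\#}TM$ and the unique bracket with $[J^1X,J^1Y]=J^1[X,Y]$. There is an exact sequence $0\to T^*M\otimes\mathfrak t\to J^1\mathfrak t\to\mathfrak t\to0$, the inclusion sending, on sections, $df\otimes X$ to $fJ^1X-J^1(fX)$. An infinitesimal geometric structure on $\mathfrak t$ is a subalgebroid (constant-rank subbundle closed under bracket) $\mathfrak g\subset J^1\mathfrak t$. It is surjective if the restricted projection $a\colon\mathfrak g\to\mathfrak t$ is surjective; its structure kernel is $\mathfrak h:=\ker a\subset T^*M\otimes\mathfrak t$. A symmetry of $\mathfrak g$ is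 a section $W$ of $\mathfrak t$ with $J^1W$ a section of $\mathfrak g$. The prolongation is $\mathfrak g^{(1)}:=J^1\mathfrak g\cap J^2\mathfrak t\subset J^1\mathfrak g$, where $J^1\mathfrak g$ and $J^2\mathfrak t$ are regarded as subsets of $J^1(J^1\mathfrak t)$, the latter via $J^2W(m)\mapsto J^1(J^1W)(m)$. The $\Theta$-reduction of $\mathfrak g$ is $p(\mathfrak g^{(1)})\subset\mathfrak g$, where $p\colon J^1\mathfrak g\to\mathfrak g$ is the projection; $\mathfrak g$ is $\Theta$-reduced if $p(\mathfrak g^{(1)})=\mathfrak g$. The lower coboundary morphism is $\delta\colon T^*M\otimes\mathfrak h\to\Lambda^2(T^*M)\otimes\mathfrak t$, $\delta(\epsilon)(U_1,U_2)=\epsilon(U_1)U_2-\epsilon(U_2)U_1$. A Cartan connection on a Lie algebroid $\mathfrak g$ is a linear connection $\nabla$ on $\mathfrak g$ such that the splitting $s_\nabla\colon\mathfrak g\to J^1\mathfrak g$, $s_\nabla X=J^1X+\nabla X$, of $0\to T^*M\otimes\mathfrak g\to J^1\mathfrak g\to\mathfrak g\to0$ is a Lie algebroid morphism. A Cartan algebroid is a Lie algebroid equipped with a Cartan connection. An associated Cartan algebroid of $\mathfrak g$ is one whose parallel sections are in natural one-to-one correspondence with the symmetries of $\mathfrak g$. *)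

theory Defs
  imports "HOL-Analysis.Analysis" "HOL-Algebra.Module"
begin

section \<open>Smooth functions and manifolds\<close>

primrec times_differentiable_on ::
  "nat \<Rightarrow> ('a::real_normed_vector \<Rightarrow> 'b::real_normed_vector) \<Rightarrow> 'a set \<Rightarrow> bool" where
  "times_differentiable_on 0 f S \<longleftrightarrow> continuous_on S f"
| "times_differentiable_on (Suc k) f S \<longleftrightarrow> (\<forall>x\<in>S. f differentiable (at x)) \<and>
     (\<forall>v. times_differentiable_on k (\<lambda>x. frechet_derivative f (at x) v) S)"

text \<open>Only used for open \<open>S\<close>.\<close>

definition C_infinity_on ::
  "('a::real_normed_vector \<Rightarrow> 'b::real_normed_vector) \<Rightarrow> 'a set \<Rightarrow> bool" where
  "C_infinity_on f S \<longleftrightarrow> (\<forall>k. times_differentiable_on k f S)"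

text \<open>The manifold is the whole type \<open>'m\<close>; its smooth structure is given by an atlas of charts
  \<open>(U, \<phi>)\<close> with values in a Euclidean space.\<close>

type_synonym ('m, 'e) atlas = "('m set \<times> ('m \<Rightarrow> 'e)) set"

definition smooth_manifold ::
  "('m::{t2_space, second_countable_topology}, 'e::euclidean_space) atlas \<Rightarrow> bool" where
  "smooth_manifold M \<longleftrightarrow>
     (\<Union>(U, \<phi>)\<in>M. U) = UNIV \<and>
     (\<forall>(U, \<phi>)\<in>M. open U \<and> open (\<phi> ` U) \<and> homeomorphism U (\<phi> ` U) \<phi> (inv_into U \<phi>)) \<and>
     (\<forall>(U, \<phi>)\<in>M. \<forall>(V, \<psi>)\<in>M. C_infinity_on (\<psi> \<circ> inv_into U \<phi>) (\<phi> ` (U \<inter> V)))"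

text \<open>Smoothness of a real function on an open subset of the manifold.\<close>

definition smooth_fun ::
  "('m::topological_space, 'e::euclidean_space) atlas \<Rightarrow> 'm set \<Rightarrow> ('m \<Rightarrow> real) \<Rightarrow> bool" where
  "smooth_fun M U f \<longleftrightarrow> (\<forall>(V, \<phi>)\<in>M. C_infinity_on (f \<circ> inv_into V \<phi>) (\<phi> ` (U \<inter> V)))"

definition smooth_near ::
  "('m::topological_space, 'e::euclidean_space) atlas \<Rightarrow> 'm \<Rightarrow> ('m \<Rightarrow> real) \<Rightarrow> bool" where
  "smooth_near M m f \<longleftrightarrow> (\<exists>U. open U \<and> m \<in> U \<and> smooth_fun M U f)"


section \<open>Real vector spaces and linear maps\<close>

text \<open>Fibres are vector spaces with explicit carriers, i.e. modules over the field of reals in the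
  sense of HOL-Algebra. The record fields \<open>mult\<close> and \<open>one\<close> play no role in a module.\<close>

definition real_ring :: "real ring" where
  "real_ring = \<lparr>carrier = UNIV, mult = (*), one = 1, zero = 0, add = (+)\<rparr>"

definition linear_map ::
  "(real, 'a, 'x) module_scheme \<Rightarrow> (real, 'b, 'y) module_scheme \<Rightarrow> ('a \<Rightarrow> 'b) \<Rightarrow> bool" where
  "linear_map V W f \<longleftrightarrow> f \<in> carrier V \<rightarrow> carrier W \<and>
     (\<forall>v\<in>carrier V. \<forall>w\<in>carrier V. f (v \<oplus>\<^bsub>V\<^esub> w) = f v \<oplus>\<^bsub>W\<^esub> f w) \<and>
     (\<forall>c. \<forall>v\<in>carrier V. f (c \<odot>\<^bsub>V\<^esub> v) = c \<odot>\<^bsub>W\<^esub> f v)"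

definition hom_space ::
  "(real, 'a, 'x) module_scheme \<Rightarrow> (real, 'b, 'y) module_scheme \<Rightarrow> (real, 'a \<Rightarrow> 'b) module" where
  "hom_space V W =
     \<lparr>carrier = {f \<in> extensional (carrier V). linear_map V W f},
      mult = undefined, one = undefined,
      zero = (\<lambda>v\<in>carrier V. \<zero>\<^bsub>W\<^esub>),
      add = (\<lambda>f g. \<lambda>v\<in>carrier V. f v \<oplus>\<^bsub>W\<^esub> g v),
      smult = (\<lambda>c f. \<lambda>v\<in>carrier V. c \<odot>\<^bsub>W\<^esub> f v)\<rparr>"


section \<open>Vector bundles\<close>

text \<open>A vector bundle is given by its fibres and, for each open \<open>U\<close>, the set of its smooth sections
  over \<open>U\<close>. A local section is a total function, of which only the values on \<open>U\<close> matter.\<close>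

record ('m, 'v) vbundle =
  fibre :: "'m \<Rightarrow> (real, 'v) module"
  sections :: "'m set \<Rightarrow> ('m \<Rightarrow> 'v) set"

definition sadd ::
  "('m, 'v, 'x) vbundle_scheme \<Rightarrow> ('m \<Rightarrow> 'v) \<Rightarrow> ('m \<Rightarrow> 'v) \<Rightarrow> 'm \<Rightarrow> 'v" where
  "sadd E X Y = (\<lambda>x. X x \<oplus>\<^bsub>fibre E x\<^esub> Y x)"

definition sscale ::
  "('m, 'v, 'x) vbundle_scheme \<Rightarrow> ('m \<Rightarrow> real) \<Rightarrow> ('m \<Rightarrow> 'v) \<Rightarrow> 'm \<Rightarrow> 'v" where
  "sscale E f X = (\<lambda>x. f x \<odot>\<^bsub>fibre E x\<^esub> X x)"

definition szero :: "('m, 'v, 'x) vbundle_scheme \<Rightarrow> 'm \<Rightarrow> 'v" where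
  "szero E = (\<lambda>x. \<zero>\<^bsub>fibre E x\<^esub>)"

definition scomb ::
  "('m, 'v, 'x) vbundle_scheme \<Rightarrow> nat \<Rightarrow> (nat \<Rightarrow> 'm \<Rightarrow> real) \<Rightarrow> (nat \<Rightarrow> 'm \<Rightarrow> 'v) \<Rightarrow> 'm \<Rightarrow> 'v" where
  "scomb E r c s = (\<lambda>x. \<Oplus>\<^bsub>fibre E x\<^esub>i\<in>{..<r}. c i x \<odot>\<^bsub>fibre E x\<^esub> s i x)"

text \<open>A local frame is the same as a local trivialization \<open>E|U \<cong> U \<times> \<real>\<^sup>r\<close>: pointwise a basis, such
  that the smooth sections are exactly those with smooth components.\<close>

definition local_frame ::
  "('m::topological_space, 'e::euclidean_space) atlas \<Rightarrow> ('m, 'v, 'x) vbundle_scheme \<Rightarrow>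
    'm set \<Rightarrow> nat \<Rightarrow> (nat \<Rightarrow> 'm \<Rightarrow> 'v) \<Rightarrow> bool" where
  "local_frame M E U r s \<longleftrightarrow> open U \<and>
     (\<forall>x\<in>U. \<forall>i<r. s i x \<in> carrier (fibre E x)) \<and>
     (\<forall>x\<in>U. bij_betw (\<lambda>c. \<Oplus>\<^bsub>fibre E x\<^esub>i\<in>{..<r}. c i \<odot>\<^bsub>fibre E x\<^esub> s i x)
                ({..<r} \<rightarrow>\<^sub>E UNIV) (carrier (fibre E x))) \<and>
     (\<forall>V \<sigma>. open V \<and> V \<subseteq> U \<longrightarrow>
        (\<sigma> \<in> sections E V \<longleftrightarrow>
           (\<exists>c. (\<forall>i<r. smooth_fun M V (c i)) \<and> (\<forall>x\<in>V. \<sigma> x = scomb E r c s x))))"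

definition vector_bundle ::
  "('m::topological_space, 'e::euclidean_space) atlas \<Rightarrow> ('m, 'v, 'x) vbundle_scheme \<Rightarrow> bool" where
  "vector_bundle M E \<longleftrightarrow>
     (\<forall>m. Module.module real_ring (fibre E m)) \<and>
     (\<exists>r. \<forall>m. \<exists>U s. m \<in> U \<and> local_frame M E U r s) \<and>
     (\<forall>U V \<sigma>. open U \<and> open V \<and> V \<subseteq> U \<and> \<sigma> \<in> sections E U \<longrightarrow> \<sigma> \<in> sections E V) \<and>
     (\<forall>U \<sigma>. open U \<and> (\<forall>m\<in>U. \<exists>V. open V \<and> m \<in> V \<and> V \<subseteq> U \<and> \<sigma> \<in> sections E V) \<longrightarrow>
        \<sigma> \<in> sections E U)"

definition bundle_morphism ::
  "('m::topological_space, 'v, 'x) vbundle_scheme \<Rightarrow> ('m, 'w, 'y) vbundle_scheme \<Rightarrow>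
    ('m \<Rightarrow> 'v \<Rightarrow> 'w) \<Rightarrow> bool" where
  "bundle_morphism E F \<Phi> \<longleftrightarrow>
     (\<forall>m. linear_map (fibre E m) (fibre F m) (\<Phi> m)) \<and>
     (\<forall>U \<sigma>. open U \<and> \<sigma> \<in> sections E U \<longrightarrow> (\<lambda>x. \<Phi> x (\<sigma> x)) \<in> sections F U)"

definition subbundle ::
  "('m::topological_space, 'v, 'x) vbundle_scheme \<Rightarrow> ('m \<Rightarrow> 'v set) \<Rightarrow> ('m, 'v, 'x) vbundle_scheme"
  where
  "subbundle E F = E
     \<lparr>fibre := (\<lambda>m. (fibre E m)\<lparr>carrier := F m\<rparr>),
      sections := (\<lambda>U. {\<sigma> \<in> sections E U. \<forall>x\<in>U. \<sigma> x \<in> F x})\<rparr>"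

definition is_subbundle ::
  "('m::topological_space, 'e::euclidean_space) atlas \<Rightarrow> ('m, 'v, 'x) vbundle_scheme \<Rightarrow>
    ('m \<Rightarrow> 'v set) \<Rightarrow> bool" where
  "is_subbundle M E F \<longleftrightarrow>
     (\<forall>m. submodule (F m) real_ring (fibre E m)) \<and> vector_bundle M (subbundle E F)"


section \<open>The tangent bundle\<close>

text \<open>Tangent vectors are directional derivatives, acting on functions that are smooth near the
  base point and, by convention, giving \<open>0\<close> on all other functions.\<close>

definition tangent_space ::
  "('m::topological_space, 'e::euclidean_space) atlas \<Rightarrow> 'm \<Rightarrow> (real, ('m \<Rightarrow> real) \<Rightarrow> real) module"
  where
  "tangent_space M m =
     \<lparr>carrier = {v. \<exists>(U, \<phi>)\<in>M. m \<in> U \<and> (\<exists>w. v =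
        (\<lambda>f. if smooth_near M m f
             then frechet_derivative (f \<circ> inv_into U \<phi>) (at (\<phi> m)) w else 0))},
      mult = undefined, one = undefined,
      zero = (\<lambda>f. 0),
      add = (\<lambda>v w f. v f + w f),
      smult = (\<lambda>c v f. c * v f)\<rparr>"

definition tangent_bundle ::
  "('m::topological_space, 'e::euclidean_space) atlas \<Rightarrow> ('m, ('m \<Rightarrow> real) \<Rightarrow> real) vbundle" where
  "tangent_bundle M =
     \<lparr>fibre = tangent_space M,
      sections = (\<lambda>U. {V. (\<forall>x\<in>U. V x \<in> carrier (tangent_space M x)) \<and>
        (\<forall>W f. open W \<and> W \<subseteq> U \<and> smooth_fun M W f \<longrightarrow> smooth_fun M W (\<lambda>x. V x f))})\<rparr>"


section \<open>Lie algebroids\<close>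

record ('m, 'v) lie_algebroid = "('m, 'v) vbundle" +
  anchor :: "'m \<Rightarrow> 'v \<Rightarrow> ('m \<Rightarrow> real) \<Rightarrow> real"
  bracket :: "('m \<Rightarrow> 'v) \<Rightarrow> ('m \<Rightarrow> 'v) \<Rightarrow> 'm \<Rightarrow> 'v"

text \<open>Only the values of the bracket on pairs of smooth global sections matter. Homogeneity over
  the reals is the Leibniz identity for constant functions.\<close>

definition lie_algebroid ::
  "('m::topological_space, 'e::euclidean_space) atlas \<Rightarrow> ('m, 'v) lie_algebroid \<Rightarrow> bool" where
  "lie_algebroid M A \<longleftrightarrow>
     vector_bundle M A \<and>
     bundle_morphism A (tangent_bundle M) (anchor A) \<and>
     (\<forall>X\<in>sections A UNIV. \<forall>Y\<in>sections A UNIV. bracket A X Y \<in> sections A UNIV) \<and>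
     (\<forall>X\<in>sections A UNIV. \<forall>Y\<in>sections A UNIV. \<forall>Z\<in>sections A UNIV.
        bracket A (sadd A X Y) Z = sadd A (bracket A X Z) (bracket A Y Z)) \<and>
     (\<forall>X\<in>sections A UNIV. \<forall>Y\<in>sections A UNIV.
        sadd A (bracket A X Y) (bracket A Y X) = szero A) \<and>
     (\<forall>X\<in>sections A UNIV. \<forall>Y\<in>sections A UNIV. \<forall>Z\<in>sections A UNIV.
        sadd A (bracket A X (bracket A Y Z))
          (sadd A (bracket A Y (bracket A Z X)) (bracket A Z (bracket A X Y))) = szero A) \<and>
     (\<forall>X\<in>sections A UNIV. \<forall>Y\<in>sections A UNIV. \<forall>f. smooth_fun M UNIV f \<longrightarrow>
        bracket A X (sscale A f Y) =
          sadd A (sscale A f (bracket A X Y)) (sscale A (\<lambda>x. anchor A x (X x) f) Y)) \<and>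
     (\<forall>X\<in>sections A UNIV. \<forall>Y\<in>sections A UNIV. \<forall>U f. open U \<and> smooth_fun M U f \<longrightarrow>
        (\<forall>x\<in>U. anchor A x (bracket A X Y x) f =
           anchor A x (X x) (\<lambda>y. anchor A y (Y y) f) - anchor A x (Y x) (\<lambda>y. anchor A y (X y) f)))"

definition transitive ::
  "('m::topological_space, 'e::euclidean_space) atlas \<Rightarrow> ('m, 'v) lie_algebroid \<Rightarrow> bool" where
  "transitive M A \<longleftrightarrow> (\<forall>m. anchor A m ` carrier (fibre A m) = carrier (tangent_space M m))"

text \<open>Morphisms of Lie algebroids over the identity of the base.\<close>

definition lie_algebroid_morphism ::
  "('m::topological_space, 'v) lie_algebroid \<Rightarrow> ('m, 'w) lie_algebroid \<Rightarrow>
    ('m \<Rightarrow> 'v \<Rightarrow> 'w) \<Rightarrow> bool" where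
  "lie_algebroid_morphism A B \<Phi> \<longleftrightarrow>
     bundle_morphism A B \<Phi> \<and>
     (\<forall>m. \<forall>v\<in>carrier (fibre A m). anchor B m (\<Phi> m v) = anchor A m v) \<and>
     (\<forall>X\<in>sections A UNIV. \<forall>Y\<in>sections A UNIV.
        (\<lambda>m. \<Phi> m (bracket A X Y m)) = bracket B (\<lambda>m. \<Phi> m (X m)) (\<lambda>m. \<Phi> m (Y m)))"

definition subalgebroid ::
  "('m::topological_space, 'e::euclidean_space) atlas \<Rightarrow> ('m, 'v) lie_algebroid \<Rightarrow>
    ('m \<Rightarrow> 'v set) \<Rightarrow> bool" where
  "subalgebroid M A F \<longleftrightarrow> is_subbundle M A F \<and>
     (\<forall>X\<in>sections (subbundle A F) UNIV. \<forall>Y\<in>sections (subbundle A F) UNIV.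
        bracket A X Y \<in> sections (subbundle A F) UNIV)"


section \<open>First jets\<close>

definition local_sections ::
  "('m::topological_space, 'v, 'x) vbundle_scheme \<Rightarrow> 'm \<Rightarrow> ('m \<Rightarrow> 'v) set" where
  "local_sections E m = {\<sigma>. \<exists>U. open U \<and> m \<in> U \<and> \<sigma> \<in> sections E U}"

text \<open>Agreement to first order at \<open>m\<close>: the components with respect to a frame have the same values
  and the same first derivatives at \<open>m\<close>.\<close>

definition jet_eq ::
  "('m::topological_space, 'e::euclidean_space) atlas \<Rightarrow> ('m, 'v, 'x) vbundle_scheme \<Rightarrow> 'm \<Rightarrow>
    ('m \<Rightarrow> 'v) \<Rightarrow> ('m \<Rightarrow> 'v) \<Rightarrow> bool" where
  "jet_eq M E m \<sigma> \<tau> \<longleftrightarrow> (\<exists>U r s c d. m \<in> U \<and> local_frame M E U r s \<and>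
     (\<forall>i<r. smooth_fun M U (c i) \<and> smooth_fun M U (d i)) \<and>
     (\<forall>x\<in>U. \<sigma> x = scomb E r c s x \<and> \<tau> x = scomb E r d s x) \<and>
     (\<forall>i<r. c i m = d i m \<and> (\<forall>v\<in>carrier (tangent_space M m). v (c i) = v (d i))))"

definition jet ::
  "('m::topological_space, 'e::euclidean_space) atlas \<Rightarrow> ('m, 'v, 'x) vbundle_scheme \<Rightarrow> 'm \<Rightarrow>
    ('m \<Rightarrow> 'v) \<Rightarrow> ('m \<Rightarrow> 'v) set" where
  "jet M E m \<sigma> = {\<tau> \<in> local_sections E m. jet_eq M E m \<sigma> \<tau>}"

text \<open>The prolongation \<open>J\<^sup>1\<sigma>\<close> of a (possibly local) section.\<close>

definition prolong ::
  "('m::topological_space, 'e::euclidean_space) atlas \<Rightarrow> ('m, 'v, 'x) vbundle_scheme \<Rightarrow>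
    ('m \<Rightarrow> 'v) \<Rightarrow> 'm \<Rightarrow> ('m \<Rightarrow> 'v) set" where
  "prolong M E \<sigma> = (\<lambda>m. jet M E m \<sigma>)"

definition jet_space ::
  "('m::topological_space, 'e::euclidean_space) atlas \<Rightarrow> ('m, 'v, 'x) vbundle_scheme \<Rightarrow> 'm \<Rightarrow>
    (real, ('m \<Rightarrow> 'v) set) module" where
  "jet_space M E m =
     \<lparr>carrier = jet M E m ` local_sections E m,
      mult = undefined, one = undefined,
      zero = jet M E m (szero E),
      add = (\<lambda>j k. \<Union>\<sigma>\<in>j. \<Union>\<tau>\<in>k. jet M E m (sadd E \<sigma> \<tau>)),
      smult = (\<lambda>c j. \<Union>\<sigma>\<in>j. jet M E m (sscale E (\<lambda>x. c) \<sigma>))\<rparr>"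

text \<open>The smooth structure of the jet bundle is the one generated by the prolongations: the smooth
  sections are locally the combinations of prolongations with smooth coefficients.\<close>

definition jet_sections ::
  "('m::topological_space, 'e::euclidean_space) atlas \<Rightarrow> ('m, 'v, 'x) vbundle_scheme \<Rightarrow>
    'm set \<Rightarrow> ('m \<Rightarrow> ('m \<Rightarrow> 'v) set) set" where
  "jet_sections M E U = {\<xi>. \<forall>m\<in>U. \<exists>V (n::nat) f \<sigma>. open V \<and> m \<in> V \<and> V \<subseteq> U \<and>
     (\<forall>i<n. smooth_fun M V (f i) \<and> \<sigma> i \<in> sections E V) \<and>
     (\<forall>x\<in>V. \<xi> x = (\<Oplus>\<^bsub>jet_space M E x\<^esub>i\<in>{..<n}. f i x \<odot>\<^bsub>jet_space M E x\<^esub> jet M E x (\<sigma> i)))}"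

definition jet_proj :: "'m \<Rightarrow> ('m \<Rightarrow> 'v) set \<Rightarrow> 'v" where
  "jet_proj m j = the_elem ((\<lambda>\<sigma>. \<sigma> m) ` j)"

text \<open>The Lie algebroid \<open>J\<^sup>1A\<close> of a Lie algebroid \<open>A\<close>. Its bracket is the unique one (on smooth
  sections) with \<open>[J\<^sup>1X, J\<^sup>1Y] = J\<^sup>1[X, Y]\<close>.\<close>

definition J1_with_bracket ::
  "('m::topological_space, 'e::euclidean_space) atlas \<Rightarrow> ('m, 'v) lie_algebroid \<Rightarrow>
    (('m \<Rightarrow> ('m \<Rightarrow> 'v) set) \<Rightarrow> ('m \<Rightarrow> ('m \<Rightarrow> 'v) set) \<Rightarrow> 'm \<Rightarrow> ('m \<Rightarrow> 'v) set) \<Rightarrow>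
    ('m, ('m \<Rightarrow> 'v) set) lie_algebroid" where
  "J1_with_bracket M A b =
     \<lparr>fibre = jet_space M A, sections = jet_sections M A,
      anchor = (\<lambda>m j. anchor A m (jet_proj m j)), bracket = b\<rparr>"

definition J1 ::
  "('m::topological_space, 'e::euclidean_space) atlas \<Rightarrow> ('m, 'v) lie_algebroid \<Rightarrow>
    ('m, ('m \<Rightarrow> 'v) set) lie_algebroid" where
  "J1 M A = J1_with_bracket M A
     (SOME b. lie_algebroid M (J1_with_bracket M A b) \<and>
        (\<forall>X\<in>sections A UNIV. \<forall>Y\<in>sections A UNIV.
           b (prolong M A X) (prolong M A Y) = prolong M A (bracket A X Y)))"

abbreviation cotensor ::
  "('m::topological_space, 'e::euclidean_space) atlas \<Rightarrow> 'm \<Rightarrow> (real, 'v, 'x) module_scheme \<Rightarrow>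
    (real, (('m \<Rightarrow> real) \<Rightarrow> real) \<Rightarrow> 'v) module" where
  "cotensor M m V \<equiv> hom_space (tangent_space M m) V"

text \<open>The inclusion \<open>T\<^sup>*M \<otimes> E \<rightarrow> J\<^sup>1E\<close> at \<open>m\<close>, which sends
  \<open>df \<otimes> X\<close> to \<open>f J\<^sup>1X - J\<^sup>1(f X)\<close>, on a linear map \<open>\<theta> = \<Sum>\<^sub>i df\<^sub>i \<otimes> X\<^sub>i\<close>.\<close>

definition cotensor_incl ::
  "('m::topological_space, 'e::euclidean_space) atlas \<Rightarrow> ('m, 'v, 'x) vbundle_scheme \<Rightarrow> 'm \<Rightarrow>
    ((('m \<Rightarrow> real) \<Rightarrow> real) \<Rightarrow> 'v) \<Rightarrow> ('m \<Rightarrow> 'v) set" where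
  "cotensor_incl M E m \<theta> = (THE j. \<exists>(n::nat) f X.
     (\<forall>i<n. smooth_near M m (f i) \<and> X i \<in> local_sections E m) \<and>
     (\<forall>v\<in>carrier (tangent_space M m).
        \<theta> v = (\<Oplus>\<^bsub>fibre E m\<^esub>i\<in>{..<n}. v (f i) \<odot>\<^bsub>fibre E m\<^esub> X i m)) \<and>
     j = (\<Oplus>\<^bsub>jet_space M E m\<^esub>i\<in>{..<n}.
            (f i m \<odot>\<^bsub>jet_space M E m\<^esub> jet M E m (X i))
              \<ominus>\<^bsub>jet_space M E m\<^esub> jet M E m (sscale E (f i) (X i))))"


section \<open>Cartan connections\<close>

definition linear_connection ::
  "('m::topological_space, 'e::euclidean_space) atlas \<Rightarrow> ('m, 'v, 'x) vbundle_scheme \<Rightarrow>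
    (('m \<Rightarrow> 'v) \<Rightarrow> 'm \<Rightarrow> (('m \<Rightarrow> real) \<Rightarrow> real) \<Rightarrow> 'v) \<Rightarrow> bool" where
  "linear_connection M E D \<longleftrightarrow>
     (\<forall>X\<in>sections E UNIV.
        (\<forall>m. D X m \<in> carrier (cotensor M m (fibre E m))) \<and>
        (\<forall>U V. open U \<and> V \<in> sections (tangent_bundle M) U \<longrightarrow> (\<lambda>x. D X x (V x)) \<in> sections E U)) \<and>
     (\<forall>X\<in>sections E UNIV. \<forall>Y\<in>sections E UNIV. \<forall>m. \<forall>v\<in>carrier (tangent_space M m).
        D (sadd E X Y) m v = D X m v \<oplus>\<^bsub>fibre E m\<^esub> D Y m v) \<and>
     (\<forall>X\<in>sections E UNIV. \<forall>f. smooth_fun M UNIV f \<longrightarrow>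
        (\<forall>m. \<forall>v\<in>carrier (tangent_space M m).
           D (sscale E f X) m v =
             (f m \<odot>\<^bsub>fibre E m\<^esub> D X m v) \<oplus>\<^bsub>fibre E m\<^esub> (v f \<odot>\<^bsub>fibre E m\<^esub> X m)))"

text \<open>The splitting \<open>X \<mapsto> J\<^sup>1X + \<nabla>X\<close>, as a map of fibres.\<close>

definition splitting ::
  "('m::topological_space, 'e::euclidean_space) atlas \<Rightarrow> ('m, 'v, 'x) vbundle_scheme \<Rightarrow>
    (('m \<Rightarrow> 'v) \<Rightarrow> 'm \<Rightarrow> (('m \<Rightarrow> real) \<Rightarrow> real) \<Rightarrow> 'v) \<Rightarrow> 'm \<Rightarrow> 'v \<Rightarrow> ('m \<Rightarrow> 'v) set" where
  "splitting M E D m v = (THE j. \<exists>X\<in>sections E UNIV. X m = v \<and>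
     j = jet M E m X \<oplus>\<^bsub>jet_space M E m\<^esub> cotensor_incl M E m (D X m))"

definition cartan_connection ::
  "('m::topological_space, 'e::euclidean_space) atlas \<Rightarrow> ('m, 'v) lie_algebroid \<Rightarrow>
    (('m \<Rightarrow> 'v) \<Rightarrow> 'm \<Rightarrow> (('m \<Rightarrow> real) \<Rightarrow> real) \<Rightarrow> 'v) \<Rightarrow> bool" where
  "cartan_connection M A D \<longleftrightarrow>
     linear_connection M A D \<and> lie_algebroid_morphism A (J1 M A) (splitting M A D)"

definition cartan_algebroid ::
  "('m::topological_space, 'e::euclidean_space) atlas \<Rightarrow> ('m, 'v) lie_algebroid \<Rightarrow>
    (('m \<Rightarrow> 'v) \<Rightarrow> 'm \<Rightarrow> (('m \<Rightarrow> real) \<Rightarrow> real) \<Rightarrow> 'v) \<Rightarrow> bool" where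
  "cartan_algebroid M A D \<longleftrightarrow> lie_algebroid M A \<and> cartan_connection M A D"

definition parallel_sections ::
  "('m::topological_space, 'e::euclidean_space) atlas \<Rightarrow> ('m, 'v, 'x) vbundle_scheme \<Rightarrow>
    (('m \<Rightarrow> 'v) \<Rightarrow> 'm \<Rightarrow> (('m \<Rightarrow> real) \<Rightarrow> real) \<Rightarrow> 'v) \<Rightarrow> ('m \<Rightarrow> 'v) set" where
  "parallel_sections M E D =
     {X \<in> sections E UNIV. \<forall>m. \<forall>v\<in>carrier (tangent_space M m). D X m v = \<zero>\<^bsub>fibre E m\<^esub>}"


section \<open>Infinitesimal geometric structures\<close>

definition infinitesimal_geometric_structure ::
  "('m::topological_space, 'e::euclidean_space) atlas \<Rightarrow> ('m, 'v) lie_algebroid \<Rightarrow>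
    ('m \<Rightarrow> ('m \<Rightarrow> 'v) set set) \<Rightarrow> bool" where
  "infinitesimal_geometric_structure M t G \<longleftrightarrow> subalgebroid M (J1 M t) G"

text \<open>The structure \<open>\<gg> \<subseteq> J\<^sup>1\<tt>\<close> as a Lie algebroid in its own right.\<close>

abbreviation structure_algebroid ::
  "('m::topological_space, 'e::euclidean_space) atlas \<Rightarrow> ('m, 'v) lie_algebroid \<Rightarrow>
    ('m \<Rightarrow> ('m \<Rightarrow> 'v) set set) \<Rightarrow> ('m, ('m \<Rightarrow> 'v) set) lie_algebroid" where
  "structure_algebroid M t G \<equiv> subbundle (J1 M t) G"

definition surjective_structure ::
  "('m::topological_space, 'v) lie_algebroid \<Rightarrow> ('m \<Rightarrow> ('m \<Rightarrow> 'v) set set) \<Rightarrow> bool" where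
  "surjective_structure t G \<longleftrightarrow> (\<forall>m. jet_proj m ` G m = carrier (fibre t m))"

text \<open>The kernel of \<open>\<gg> \<rightarrow> \<tt>\<close> at \<open>m\<close>, as a subspace of \<open>T\<^sup>*M \<otimes> \<tt>\<close>.\<close>

definition structure_kernel ::
  "('m::topological_space, 'e::euclidean_space) atlas \<Rightarrow> ('m, 'v) lie_algebroid \<Rightarrow>
    ('m \<Rightarrow> ('m \<Rightarrow> 'v) set set) \<Rightarrow> 'm \<Rightarrow> (real, (('m \<Rightarrow> real) \<Rightarrow> real) \<Rightarrow> 'v) module" where
  "structure_kernel M t G m = (cotensor M m (fibre t m))
     \<lparr>carrier := {\<theta> \<in> carrier (cotensor M m (fibre t m)). cotensor_incl M t m \<theta> \<in> G m}\<rparr>"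

text \<open>\<open>\<delta>(\<epsilon>)\<close> as an alternating bilinear map on the tangent space.\<close>

definition lower_coboundary ::
  "('m::topological_space, 'e::euclidean_space) atlas \<Rightarrow> ('m, 'v) lie_algebroid \<Rightarrow> 'm \<Rightarrow>
    ((('m \<Rightarrow> real) \<Rightarrow> real) \<Rightarrow> (('m \<Rightarrow> real) \<Rightarrow> real) \<Rightarrow> 'v) \<Rightarrow>
    (('m \<Rightarrow> real) \<Rightarrow> real) \<Rightarrow> (('m \<Rightarrow> real) \<Rightarrow> real) \<Rightarrow> 'v" where
  "lower_coboundary M t m \<epsilon> =
     (\<lambda>u\<^sub>1\<in>carrier (tangent_space M m). \<lambda>u\<^sub>2\<in>carrier (tangent_space M m).
        \<epsilon> u\<^sub>1 u\<^sub>2 \<ominus>\<^bsub>fibre t m\<^esub> \<epsilon> u\<^sub>2 u\<^sub>1)"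

definition symmetries ::
  "('m::topological_space, 'e::euclidean_space) atlas \<Rightarrow> ('m, 'v) lie_algebroid \<Rightarrow>
    ('m \<Rightarrow> ('m \<Rightarrow> 'v) set set) \<Rightarrow> ('m \<Rightarrow> 'v) set" where
  "symmetries M t G =
     {W \<in> sections t UNIV. prolong M t W \<in> sections (structure_algebroid M t G) UNIV}"

text \<open>The fibre of \<open>J\<^sup>2E\<close> at \<open>m\<close>, embedded in \<open>J\<^sup>1(J\<^sup>1E)\<close>.\<close>

definition second_jets ::
  "('m::topological_space, 'e::euclidean_space) atlas \<Rightarrow> ('m, 'v) lie_algebroid \<Rightarrow> 'm \<Rightarrow>
    ('m \<Rightarrow> ('m \<Rightarrow> 'v) set) set set" where
  "second_jets M A m = (\<lambda>W. jet M (J1 M A) m (prolong M A W)) ` local_sections A m"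

text \<open>The inclusion \<open>J\<^sup>1F \<rightarrow> J\<^sup>1E\<close> induced by a subbundle \<open>F \<subseteq> E\<close>. It is needed because the jet
  of a section of \<open>F\<close>, being an equivalence class, is not the same set in \<open>J\<^sup>1F\<close> and in \<open>J\<^sup>1E\<close>.\<close>

definition jet_extend ::
  "('m::topological_space, 'e::euclidean_space) atlas \<Rightarrow> ('m, 'v, 'x) vbundle_scheme \<Rightarrow> 'm \<Rightarrow>
    ('m \<Rightarrow> 'v) set \<Rightarrow> ('m \<Rightarrow> 'v) set" where
  "jet_extend M E m j = (\<Union>\<sigma>\<in>j. jet M E m \<sigma>)"

text \<open>The fibre at \<open>m\<close> of \<open>\<gg>\<^sup>(\<^sup>1\<^sup>) = J\<^sup>1\<gg> \<inter> J\<^sup>2\<tt>\<close>, as a subset of \<open>J\<^sup>1\<gg>\<close>.\<close>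

definition prolongation ::
  "('m::topological_space, 'e::euclidean_space) atlas \<Rightarrow> ('m, 'v) lie_algebroid \<Rightarrow>
    ('m \<Rightarrow> ('m \<Rightarrow> 'v) set set) \<Rightarrow> 'm \<Rightarrow> ('m \<Rightarrow> ('m \<Rightarrow> 'v) set) set set" where
  "prolongation M t G m =
     {j \<in> carrier (fibre (J1 M (structure_algebroid M t G)) m).
        jet_extend M (J1 M t) m j \<in> second_jets M t m}"

definition Theta_reduced ::
  "('m::topological_space, 'e::euclidean_space) atlas \<Rightarrow> ('m, 'v) lie_algebroid \<Rightarrow>
    ('m \<Rightarrow> ('m \<Rightarrow> 'v) set set) \<Rightarrow> bool" where
  "Theta_reduced M t G \<longleftrightarrow> (\<forall>m. jet_proj m ` prolongation M t G m = G m)"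

text \<open>The condition that determines the canonical connection: its splitting inverts the projection
  \<open>\<gg>\<^sup>(\<^sup>1\<^sup>) \<rightarrow> \<gg>\<close>.\<close>

definition canonical_connection ::
  "('m::topological_space, 'e::euclidean_space) atlas \<Rightarrow> ('m, 'v) lie_algebroid \<Rightarrow>
    ('m \<Rightarrow> ('m \<Rightarrow> 'v) set set) \<Rightarrow>
    (('m \<Rightarrow> ('m \<Rightarrow> 'v) set) \<Rightarrow> 'm \<Rightarrow> (('m \<Rightarrow> real) \<Rightarrow> real) \<Rightarrow> ('m \<Rightarrow> 'v) set) \<Rightarrow> bool" where
  "canonical_connection M t G D \<longleftrightarrow>
     linear_connection M (structure_algebroid M t G) D \<and>
     (\<forall>m. splitting M (structure_algebroid M t G) D m ` G m = prolongation M t G m)"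

end

theory Submission
  imports Defs "HOL-Computational_Algebra.Polynomial"
begin

text \<open>Over a transitive \<open>\<tt>\<close> the 1-jet of a section \<open>X\<close> at \<open>m\<close> amounts to the value \<open>X(m)\<close> together
  with the operator \<open>Y \<mapsto> [X, Y](m)\<close>. So a section \<open>U\<close> of \<open>J\<^sup>1\<tt>\<close> acts on sections of \<open>\<tt>\<close> by an operator
  \<open>D\<^sub>U\<close>, and the bracket of \<open>J\<^sup>1\<tt>\<close> is the commutator. With \<open>a\<close> denoting the projection to \<open>\<tt>\<close>, the torsion
  \<open>T(U, V) = D\<^sub>U aV - D\<^sub>V aU - [aU, aV]\<close> is a tensor. Let \<open>X\<close> be a section of \<open>\<gg>\<close>. If its jet at \<open>m\<close>, acting on
  sections of \<open>\<gg>\<close> by \<open>E\<close>, is corrected by an element of \<open>T\<^sup>*M \<otimes> \<gg>\<close> to lie in \<open>J\<^sup>2\<tt>\<close>, then at \<open>m\<close>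
  \<open>a E = D\<^sub>X a\<close> and \<open>D\<^sub>X T(U, V) = T(E U, V) + T(U, E V)\<close>, since \<open>E = [J\<^sup>1W, _]\<close> satisfies both.
  Two solutions \<open>E\<close> over the same \<open>X(m)\<close> differ by an element of \<open>T\<^sup>*M \<otimes> \<hh>\<close> on which \<open>\<delta>\<close> vanishes, so they
  coincide. As \<open>\<gg>\<close> is \<open>\<Theta>\<close>-reduced, solutions exist and make up \<open>\<gg>\<^sup>(\<^sup>1\<^sup>)\<close>, which is thus the image of a splitting
  of \<open>J\<^sup>1\<gg> \<rightarrow> \<gg>\<close>. It is smooth because its components solve an injective linear system with smooth
  coefficients, and a Lie algebroid morphism because the two equations are stable under
  commutators. A section \<open>X\<close> is parallel iff its jets lie in \<open>J\<^sup>2\<tt>\<close>, i.e. iff \<open>X = J\<^sup>1(aX)\<close>.\<close>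

subsection \<open>Calculus of smooth functions\<close>

text \<open>The bracket acts on global sections only, and fibres are modules on explicit carriers.
  Hence two devices: bump functions, which make every operator obeying a Leibniz rule local, and
  linear functionals, which turn an identity in a fibre into one between reals. Brackets see first
  derivatives because, for \<open>X\<close> the sum of \<open>c_i s_i\<close>, \<open>[X, Y]\<close>
  is the sum of \<open>c_i [s_i, Y] - #Y(c_i) s_i\<close>; surjectivity of the anchor makes all
  derivatives of the \<open>c_i\<close> visible. Surjectivity of \<open>a\<close> makes
  \<open>g\<close> transitive too, so one theory of jets serves \<open>t\<close>,
  \<open>J1 t\<close> and \<open>g\<close>. A jet in \<open>g\<close> and the corresponding jet in
  \<open>J1 t\<close> are different sets, so the passage between them needs an argument. Uniqueness
  of the solution over a given element of \<open>g\<close> settles three matters: linearity of the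
  splitting, its compatibility with brackets (the bracket of two lifts solves the equations over the
  bracket) and uniqueness of the connection. It says nothing about smoothness in the base point; for
  that the equations are rewritten so that their right sides contain no choice.\<close>

lemma times_differentiable_on_cong:
  assumes "open S" "\<And>x. x \<in> S \<Longrightarrow> f x = g x" "times_differentiable_on k f S"
  shows "times_differentiable_on k g S"
  using assms(2,3)
proof (induction k arbitrary: f g)
  case 0
  then show ?case
    unfolding times_differentiable_on.simps by (blast intro: continuous_on_eq)
next
  case (Suc k)
  have der: "(g has_derivative frechet_derivative f (at x)) (at x)" if "x \<in> S" for x
  proof (rule has_derivative_transform_within_open[OF _ assms(1) that])
    show "(f has_derivative frechet_derivative f (at x)) (at x)"
      using Suc.prems(2) that frechet_derivative_works by auto
  qed (rule Suc.prems(1))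
  have eq: "frechet_derivative f (at x) = frechet_derivative g (at x)" if "x \<in> S" for x
    using frechet_derivative_at[OF der[OF that]] .
  have "times_differentiable_on k (\<lambda>x. frechet_derivative g (at x) v) S" for v
  proof (rule Suc.IH[of "\<lambda>x. frechet_derivative f (at x) v"])
    show "frechet_derivative f (at x) v = frechet_derivative g (at x) v" if "x \<in> S" for x
      using eq[OF that] by simp
    show "times_differentiable_on k (\<lambda>x. frechet_derivative f (at x) v) S"
      using Suc.prems(2) by simp
  qed
  then show ?case
    using differentiableI[OF der] by simp
qed

lemma times_differentiable_on_SucI:
  assumes "open S" "\<And>x. x \<in> S \<Longrightarrow> (f has_derivative f' x) (at x)"
    "\<And>v. times_differentiable_on k (\<lambda>x. f' x v) S"
  shows "times_differentiable_on (Suc k) f S"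
proof -
  have "f' x = frechet_derivative f (at x)" if "x \<in> S" for x
    using frechet_derivative_at[OF assms(2)[OF that]] .
  then have "times_differentiable_on k (\<lambda>x. frechet_derivative f (at x) v) S" for v
    by (intro times_differentiable_on_cong[OF assms(1) _ assms(3)[of v]]) simp
  then show ?thesis
    using differentiableI[OF assms(2)] by simp
qed

lemma times_differentiable_on_SucD: "times_differentiable_on (Suc k) f S \<Longrightarrow> times_differentiable_on k f S"
proof (induction k arbitrary: f)
  case 0
  then show ?case
    by (auto intro!: continuous_at_imp_continuous_on differentiable_imp_continuous_within)
qed simp

lemma times_differentiable_on_subset:
  "times_differentiable_on k f S \<Longrightarrow> T \<subseteq> S \<Longrightarrow> times_differentiable_on k f T"
  by (induction k arbitrary: f) (auto intro: continuous_on_subset)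

lemma times_differentiable_on_local:
  assumes "\<And>x. x \<in> S \<Longrightarrow> \<exists>T. open T \<and> x \<in> T \<and> times_differentiable_on k f T"
  shows "times_differentiable_on k f S"
  using assms
proof (induction k arbitrary: f)
  case 0
  have "isCont f x" if "x \<in> S" for x
    using 0[OF that] continuous_on_eq_continuous_at by auto
  then show ?case
    by (simp add: continuous_at_imp_continuous_on)
next
  case (Suc k)
  show ?case
    using Suc.prems by (auto intro!: Suc.IH) fastforce+
qed

lemma times_differentiable_on_const: "open S \<Longrightarrow> times_differentiable_on k (\<lambda>x. c) S"
proof (induction k arbitrary: c)
  case (Suc k)
  show ?case
    by (rule times_differentiable_on_SucI[where f'="\<lambda>x v. 0"])
      (use Suc in auto)
qed simp

lemma times_differentiable_on_add:
  "open S \<Longrightarrow> times_differentiable_on k f S \<Longrightarrow> times_differentiable_on k g S \<Longrightarrow>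
    times_differentiable_on k (\<lambda>x. f x + g x) S"
proof (induction k arbitrary: f g)
  case 0
  then show ?case by (auto intro: continuous_on_add)
next
  case (Suc k)
  show ?case
  proof (rule times_differentiable_on_SucI[where f'="\<lambda>x v. frechet_derivative f (at x) v + frechet_derivative g (at x) v"])
    show "((\<lambda>x. f x + g x) has_derivative (\<lambda>v. frechet_derivative f (at x) v + frechet_derivative g (at x) v)) (at x)"
      if "x \<in> S" for x
      using that Suc.prems frechet_derivative_works by (intro has_derivative_add) auto
  qed (use Suc in auto)
qed

lemma times_differentiable_on_mult:
  fixes f g :: "'a::real_normed_vector \<Rightarrow> real"
  shows "open S \<Longrightarrow> times_differentiable_on k f S \<Longrightarrow> times_differentiable_on k g S \<Longrightarrow>
    times_differentiable_on k (\<lambda>x. f x * g x) S"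
proof (induction k arbitrary: f g)
  case 0
  then show ?case by (auto intro: continuous_on_mult)
next
  case (Suc k)
  show ?case
  proof (rule times_differentiable_on_SucI[where f'="\<lambda>x v. f x * frechet_derivative g (at x) v + frechet_derivative f (at x) v * g x"])
    show "((\<lambda>x. f x * g x) has_derivative (\<lambda>v. f x * frechet_derivative g (at x) v + frechet_derivative f (at x) v * g x)) (at x)"
      if "x \<in> S" for x
      using that Suc.prems frechet_derivative_works by (intro has_derivative_mult) auto
    show "times_differentiable_on k (\<lambda>x. f x * frechet_derivative g (at x) v + frechet_derivative f (at x) v * g x) S" for v
      using Suc.prems times_differentiable_on_SucD[OF Suc.prems(2)] times_differentiable_on_SucD[OF Suc.prems(3)]
      by (intro times_differentiable_on_add Suc.IH) simp_all
  qed (rule Suc.prems(1))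
qed

lemma times_differentiable_on_inner:
  "open S \<Longrightarrow> times_differentiable_on k f S \<Longrightarrow> times_differentiable_on k (\<lambda>x. f x \<bullet> b) S"
proof (induction k arbitrary: f)
  case 0
  then show ?case by (auto intro: continuous_on_inner)
next
  case (Suc k)
  show ?case
  proof (rule times_differentiable_on_SucI[where f'="\<lambda>x v. frechet_derivative f (at x) v \<bullet> b"])
    show "((\<lambda>x. f x \<bullet> b) has_derivative (\<lambda>v. frechet_derivative f (at x) v \<bullet> b)) (at x)" if "x \<in> S" for x
      using that Suc.prems frechet_derivative_works by (intro has_derivative_inner_left) auto
  qed (use Suc in auto)
qed

lemma times_differentiable_on_sum:
  assumes "open S" "finite I" "\<And>i. i \<in> I \<Longrightarrow> times_differentiable_on k (f i) S"
  shows "times_differentiable_on k (\<lambda>x. \<Sum>i\<in>I. f i x) S"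
  using assms(2,3)
  by (induction I) (auto intro: times_differentiable_on_const times_differentiable_on_add assms(1))

lemma C_infinity_onD: "C_infinity_on f S \<Longrightarrow> times_differentiable_on k f S"
  by (simp add: C_infinity_on_def)

lemma C_infinity_on_cong: "open S \<Longrightarrow> (\<And>x. x \<in> S \<Longrightarrow> f x = g x) \<Longrightarrow> C_infinity_on f S \<Longrightarrow> C_infinity_on g S"
  unfolding C_infinity_on_def using times_differentiable_on_cong by blast

lemma C_infinity_on_subset: "C_infinity_on f S \<Longrightarrow> T \<subseteq> S \<Longrightarrow> C_infinity_on f T"
  unfolding C_infinity_on_def using times_differentiable_on_subset by blast

lemma C_infinity_on_local:
  assumes "\<And>x. x \<in> S \<Longrightarrow> \<exists>T. open T \<and> x \<in> T \<and> C_infinity_on f T"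
  shows "C_infinity_on f S"
  unfolding C_infinity_on_def
proof (intro allI times_differentiable_on_local)
  show "\<exists>T. open T \<and> x \<in> T \<and> times_differentiable_on k f T" if "x \<in> S" for k x
    using assms[OF that] C_infinity_onD by metis
qed

lemma C_infinity_on_const: "open S \<Longrightarrow> C_infinity_on (\<lambda>x. c) S"
  by (simp add: C_infinity_on_def times_differentiable_on_const)

lemma C_infinity_on_add:
  "open S \<Longrightarrow> C_infinity_on f S \<Longrightarrow> C_infinity_on g S \<Longrightarrow> C_infinity_on (\<lambda>x. f x + g x) S"
  by (simp add: C_infinity_on_def times_differentiable_on_add)

lemma C_infinity_on_mult:
  fixes f g :: "'a::real_normed_vector \<Rightarrow> real"
  shows "open S \<Longrightarrow> C_infinity_on f S \<Longrightarrow> C_infinity_on g S \<Longrightarrow> C_infinity_on (\<lambda>x. f x * g x) S"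
  by (simp add: C_infinity_on_def times_differentiable_on_mult)

lemma C_infinity_on_inner: "open S \<Longrightarrow> C_infinity_on f S \<Longrightarrow> C_infinity_on (\<lambda>x. f x \<bullet> b) S"
  by (simp add: C_infinity_on_def times_differentiable_on_inner)

lemma C_infinity_on_frechet_derivative:
  "C_infinity_on f S \<Longrightarrow> C_infinity_on (\<lambda>x. frechet_derivative f (at x) v) S"
  unfolding C_infinity_on_def by (metis times_differentiable_on.simps(2))

lemma C_infinity_on_has_derivative:
  assumes "C_infinity_on f S" "x \<in> S"
  shows "(f has_derivative frechet_derivative f (at x)) (at x)"
  using C_infinity_onD[OF assms(1), of "Suc 0"] assms(2) frechet_derivative_works by auto

lemma C_infinity_on_id: "open S \<Longrightarrow> C_infinity_on (\<lambda>x. x) S"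
proof -
  assume S: "open S"
  have "times_differentiable_on k (\<lambda>x. x) S" for k
  proof (cases k)
    case (Suc l)
    show ?thesis
      unfolding Suc
      by (rule times_differentiable_on_SucI[where f'="\<lambda>x v. v"]) (auto simp: S times_differentiable_on_const)
  qed simp
  then show ?thesis by (simp add: C_infinity_on_def)
qed

lemma C_infinity_on_compose:
  fixes f :: "'a::real_normed_vector \<Rightarrow> 'b::euclidean_space" and g :: "'b \<Rightarrow> real"
  assumes "open S" "open T" "C_infinity_on g T" "C_infinity_on f S" "f ` S \<subseteq> T"
  shows "C_infinity_on (\<lambda>x. g (f x)) S"
proof -
  have "times_differentiable_on k (\<lambda>x. g (f x)) S" for k
    using assms(3)
  proof (induction k arbitrary: g)
    case 0
    have "continuous_on S (g \<circ> f)"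
      using C_infinity_onD[OF assms(4), of 0] C_infinity_onD[OF 0, of 0] assms(5)
      by (intro continuous_on_compose) (auto intro: continuous_on_subset)
    then show ?case by (simp add: o_def)
  next
    case (Suc k)
    \<comment> \<open>The differential of \<open>g\<close> is expanded in the standard basis: every
      term is then a product of real functions, and the induction hypothesis applies to the partial
      derivatives of \<open>g\<close>.\<close>
    let ?f' = "\<lambda>x v. \<Sum>b\<in>Basis. (frechet_derivative f (at x) v \<bullet> b) * frechet_derivative g (at (f x)) b"
    show ?case
    proof (rule times_differentiable_on_SucI[OF assms(1), where f'="?f'"])
      fix x assume x: "x \<in> S"
      have df: "(f has_derivative frechet_derivative f (at x)) (at x)"
        using C_infinity_on_has_derivative[OF assms(4) x] .
      have dg: "(g has_derivative frechet_derivative g (at (f x))) (at (f x))"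
        using C_infinity_on_has_derivative[OF Suc.prems] x assms(5) by blast
      have lin: "linear (frechet_derivative g (at (f x)))"
        using dg has_derivative_linear by blast
      have "?f' x v = frechet_derivative g (at (f x)) (frechet_derivative f (at x) v)" for v
      proof -
        have "frechet_derivative g (at (f x)) (\<Sum>b\<in>Basis. (frechet_derivative f (at x) v \<bullet> b) *\<^sub>R b) = ?f' x v"
          by (simp add: linear_sum[OF lin] linear_cmul[OF lin])
        then show ?thesis by (simp add: euclidean_representation)
      qed
      then show "((\<lambda>x. g (f x)) has_derivative ?f' x) (at x)"
        using has_derivative_compose[OF df dg] by presburger
    next
      fix v
      show "times_differentiable_on k (\<lambda>x. ?f' x v) S"
        using Suc.prems assms(4)
        by (intro times_differentiable_on_sum times_differentiable_on_mult Suc.IH assms(1)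
          times_differentiable_on_inner C_infinity_onD C_infinity_on_frechet_derivative) auto
    qed
  qed
  then show ?thesis by (simp add: C_infinity_on_def)
qed

text \<open>The derivative \<open>-v / x^2\<close> is a multiple of the square of the function
  itself, so the induction on the order of differentiability closes.\<close>

lemma C_infinity_on_inverse_pos:
  "C_infinity_on (inverse :: real \<Rightarrow> real) (- {0})"
proof -
  have "times_differentiable_on k (inverse :: real \<Rightarrow> real) (- {0})" for k
  proof (induction k)
    case 0
    show ?case by (auto intro!: continuous_intros)
  next
    case (Suc k)
    show ?case
    proof (rule times_differentiable_on_SucI[where f'="\<lambda>x v. - 1 * v * (inverse x * inverse x)"])
      show "(inverse has_derivative (\<lambda>v. - 1 * v * (inverse x * inverse x))) (at x)"
        if "x \<in> - {0}" for x :: real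
        using that by (auto intro!: derivative_eq_intros)
      show "times_differentiable_on k (\<lambda>x::real. - 1 * v * (inverse x * inverse x)) (- {0})" for v
        by (intro times_differentiable_on_mult times_differentiable_on_const Suc) auto
    qed auto
  qed
  then show ?thesis by (simp add: C_infinity_on_def)
qed

lemma C_infinity_on_inverse:
  fixes f :: "'a::real_normed_vector \<Rightarrow> real"
  assumes "open S" "C_infinity_on f S" "\<And>x. x \<in> S \<Longrightarrow> f x \<noteq> 0"
  shows "C_infinity_on (\<lambda>x. inverse (f x)) S"
  by (rule C_infinity_on_compose[OF assms(1) _ C_infinity_on_inverse_pos assms(2)]) (use assms(3) in auto)

section \<open>A smooth step function\<close>

definition flat_exp :: "real poly \<Rightarrow> real \<Rightarrow> real" where
  "flat_exp p t = (if t \<le> 0 then 0 else poly p (inverse t) * exp (- inverse t))"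

lemma poly_times_exp_tendsto_0: "((\<lambda>s::real. poly p s * exp (- s)) \<longlongrightarrow> 0) at_top"
proof -
  have "((\<lambda>s. \<Sum>i\<le>degree p. coeff p i * (s ^ i / exp s)) \<longlongrightarrow> (\<Sum>i\<le>degree p. coeff p i * 0)) at_top"
    by (intro tendsto_sum tendsto_mult tendsto_const tendsto_power_div_exp_0)
  moreover have "(\<Sum>i\<le>degree p. coeff p i * (s ^ i / exp s)) = poly p s * exp (- s)" for s
    by (simp add: poly_altdef sum_distrib_right exp_minus divide_inverse mult.assoc)
  ultimately show ?thesis by simp
qed

text \<open>The new polynomial comes from the chain rule with \<open>s = 1/t\<close> and
  \<open>ds/dt = -s^2\<close>: the derivative of \<open>p e^(-s)\<close> in \<open>s\<close> is
  \<open>(p' - p) e^(-s)\<close>. At \<open>0\<close> the exponential beats every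
  polynomial.\<close>

lemma flat_exp_deriv:
  "(flat_exp p has_real_derivative flat_exp ([:0, 0, 1:] * (p - pderiv p)) t) (at t)"
proof -
  consider "t < 0" | "t = 0" | "t > 0" by linarith
  then show ?thesis
  proof cases
    case 1
    have "((\<lambda>t. 0) has_real_derivative 0) (at t)" by simp
    then have "(flat_exp p has_real_derivative 0) (at t)"
      by (rule DERIV_cong_ev[THEN iffD1, rotated 3])
        (use 1 in \<open>auto simp: flat_exp_def intro!: eventually_mono[OF eventually_nhds_in_open[of "{..<0}"]]\<close>)
    then show ?thesis using 1 by (simp add: flat_exp_def)
  next
    case 3
    have "((\<lambda>t. poly p (inverse t) * exp (- inverse t)) has_real_derivative
        flat_exp ([:0, 0, 1:] * (p - pderiv p)) t) (at t)"
      using 3 unfolding flat_exp_def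
      by (auto intro!: derivative_eq_intros simp: algebra_simps power2_eq_square)
    then show ?thesis
      by (rule DERIV_cong_ev[THEN iffD1, rotated 3])
        (use 3 in \<open>auto simp: flat_exp_def intro!: eventually_mono[OF eventually_nhds_in_open[of "{0<..}"]]\<close>)
  next
    case 2
    have "((\<lambda>h. flat_exp p h / h) \<longlongrightarrow> 0) (at_right 0)"
    proof -
      \<comment> \<open>Dividing by \<open>h\<close> multiplies the polynomial by
        \<open>s = 1/h\<close>.\<close>
      have "((\<lambda>h. poly ([:0,1:] * p) (inverse h) * exp (- inverse h)) \<longlongrightarrow> 0) (at_right (0::real))"
        by (rule filterlim_compose[OF poly_times_exp_tendsto_0 filterlim_inverse_at_top_right])
      then show ?thesis
        by (rule Lim_transform_eventually)
          (auto simp: eventually_at_right_less flat_exp_def divide_inverse mult.assoc eventually_at_filter)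
    qed
    with filterlim_split_at have "((\<lambda>h. flat_exp p h / h) \<longlongrightarrow> 0) (at 0)"
      if "((\<lambda>h. flat_exp p h / h) \<longlongrightarrow> 0) (at_left 0)" using that by blast
    moreover have "((\<lambda>h. flat_exp p h / h) \<longlongrightarrow> 0) (at_left 0)"
      by (rule Lim_transform_eventually[OF tendsto_const])
        (auto simp: flat_exp_def eventually_at_filter)
    ultimately have "((\<lambda>h. flat_exp p h / h) \<longlongrightarrow> 0) (at 0)"
      by blast
    then show ?thesis
      using 2 by (simp add: DERIV_def flat_exp_def)
  qed
qed

lemma C_infinity_on_flat_exp: "C_infinity_on (flat_exp p) UNIV"
proof -
  have "times_differentiable_on k (flat_exp p) UNIV" for k
  proof (induction k arbitrary: p)
    case 0
    show ?case
      using DERIV_isCont[OF flat_exp_deriv] by (auto intro: continuous_at_imp_continuous_on)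
  next
    case (Suc k)
    show ?case
    proof (rule times_differentiable_on_SucI[where f'="\<lambda>x v. flat_exp ([:0, 0, 1:] * (p - pderiv p)) x * v"])
      show "(flat_exp p has_derivative (\<lambda>v. flat_exp ([:0, 0, 1:] * (p - pderiv p)) x * v)) (at x)" for x
        using flat_exp_deriv by (simp add: has_field_derivative_def)
    qed (auto intro!: times_differentiable_on_mult times_differentiable_on_const Suc simp del: mult_pCons_left)
  qed
  then show ?thesis by (simp add: C_infinity_on_def)
qed

text \<open>The classical quotient \<open>g(t) / (g(t) + g(1 - t))\<close> with \<open>g\<close> the
  flat exponential. Since \<open>t\<close> and \<open>1 - t\<close> are never both nonpositive, the
  denominator is positive.\<close>

lemma smooth_step_exists:
  obtains h :: "real \<Rightarrow> real"
  where "C_infinity_on h UNIV" "\<forall>t\<le>0. h t = 0" "\<forall>t\<ge>1. h t = 1"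
proof -
  let ?g = "flat_exp 1"
  let ?h = "\<lambda>t::real. ?g t * inverse (?g t + ?g (1 - t))"
  have pos: "?g t + ?g (1 - t) > 0" for t
    by (auto simp: flat_exp_def add_pos_pos)
  have g1: "C_infinity_on (\<lambda>t. ?g (1 - t)) UNIV"
  proof (rule C_infinity_on_compose[OF _ _ C_infinity_on_flat_exp])
    have "C_infinity_on (\<lambda>t::real. 1 + (- 1) * t) UNIV"
      by (intro C_infinity_on_add C_infinity_on_mult C_infinity_on_const C_infinity_on_id) auto
    then show "C_infinity_on (\<lambda>t::real. 1 - t) UNIV" by simp
  qed auto
  have "C_infinity_on ?h UNIV"
    by (intro C_infinity_on_mult C_infinity_on_inverse C_infinity_on_add C_infinity_on_flat_exp g1)
      (simp_all add: less_imp_neq[OF pos, symmetric])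
  moreover have "?h t = 0" if "t \<le> 0" for t using that by (simp add: flat_exp_def)
  moreover have "?h t = 1" if "t \<ge> 1" for t
    using that by (auto simp: flat_exp_def)
  ultimately show ?thesis using that[of ?h] by blast
qed

subsection \<open>Smooth functions and tangent vectors on a manifold\<close>

locale manifold =
  fixes M :: "('m::{t2_space, second_countable_topology}, 'e::euclidean_space) atlas"
  assumes smooth_manifold: "smooth_manifold M"
begin

lemmas manifold_axs = smooth_manifold[unfolded smooth_manifold_def]

lemma chart_at: obtains U \<phi> where "(U, \<phi>) \<in> M" "m \<in> U"
proof -
  obtain c where "c \<in> M" "m \<in> (case c of (U, \<phi>) \<Rightarrow> U)"
    using manifold_axs[THEN conjunct1] by (metis UNIV_I UN_E)
  then show ?thesis using that by (cases c) auto
qed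

lemma chartD:
  assumes "(U, \<phi>) \<in> M"
  shows chart_open: "open U" and chart_open_range: "open (\<phi> ` U)"
    and chart_homeomorphism: "homeomorphism U (\<phi> ` U) \<phi> (inv_into U \<phi>)"
  using bspec[OF manifold_axs[THEN conjunct2, THEN conjunct1] assms] by simp_all

lemma chart_compat:
  assumes "(U, \<phi>) \<in> M" "(V, \<psi>) \<in> M"
  shows "C_infinity_on (\<psi> \<circ> inv_into U \<phi>) (\<phi> ` (U \<inter> V))"
  using bspec[OF manifold_axs[THEN conjunct2, THEN conjunct2] assms(1)] assms(2) by auto

lemma chart_inverse: "(U, \<phi>) \<in> M \<Longrightarrow> x \<in> U \<Longrightarrow> inv_into U \<phi> (\<phi> x) = x"
  using chart_homeomorphism unfolding homeomorphism_def by blast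

lemma chart_open_image:
  assumes "(U, \<phi>) \<in> M" "open W"
  shows "open (\<phi> ` (W \<inter> U))"
proof -
  have "\<phi> ` (W \<inter> U) = \<phi> ` U \<inter> inv_into U \<phi> -` W"
    using chart_inverse[OF assms(1)] by force
  moreover have "continuous_on (\<phi> ` U) (inv_into U \<phi>)"
    using chart_homeomorphism[OF assms(1)] unfolding homeomorphism_def by blast
  ultimately show ?thesis
    using continuous_open_preimage chart_open_range[OF assms(1)] assms(2) by metis
qed

lemma smooth_funI:
  "(\<And>V \<phi>. (V, \<phi>) \<in> M \<Longrightarrow> open (\<phi> ` (W \<inter> V)) \<Longrightarrow> C_infinity_on (f \<circ> inv_into V \<phi>) (\<phi> ` (W \<inter> V)))
    \<Longrightarrow> open W \<Longrightarrow> smooth_fun M W f"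
  unfolding smooth_fun_def using chart_open_image by blast

lemma smooth_funD:
  "smooth_fun M W f \<Longrightarrow> (V, \<phi>) \<in> M \<Longrightarrow> C_infinity_on (f \<circ> inv_into V \<phi>) (\<phi> ` (W \<inter> V))"
  unfolding smooth_fun_def by blast

lemma smooth_fun_cong:
  assumes "open W" "\<And>x. x \<in> W \<Longrightarrow> f x = g x" "smooth_fun M W f"
  shows "smooth_fun M W g"
proof (rule smooth_funI[OF _ assms(1)])
  fix V \<phi> assume c: "(V, \<phi>) \<in> M" "open (\<phi> ` (W \<inter> V))"
  show "C_infinity_on (g \<circ> inv_into V \<phi>) (\<phi> ` (W \<inter> V))"
    by (rule C_infinity_on_cong[OF c(2) _ smooth_funD[OF assms(3) c(1)]])
      (use assms(2) chart_inverse[OF c(1)] in auto)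
qed

lemma smooth_fun_subset: "smooth_fun M W f \<Longrightarrow> W' \<subseteq> W \<Longrightarrow> smooth_fun M W' f"
  unfolding smooth_fun_def by (blast intro: C_infinity_on_subset)

lemma smooth_fun_local:
  assumes "open W" "\<And>x. x \<in> W \<Longrightarrow> \<exists>W'. open W' \<and> x \<in> W' \<and> smooth_fun M W' f"
  shows "smooth_fun M W f"
proof (rule smooth_funI[OF _ assms(1)])
  fix V \<phi> assume c: "(V, \<phi>) \<in> M"
  show "C_infinity_on (f \<circ> inv_into V \<phi>) (\<phi> ` (W \<inter> V))"
  proof (rule C_infinity_on_local)
    fix y assume "y \<in> \<phi> ` (W \<inter> V)"
    then obtain x where x: "x \<in> W" "x \<in> V" "y = \<phi> x" by blast
    then obtain W' where W': "open W'" "x \<in> W'" "smooth_fun M W' f" using assms(2) by blast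
    then show "\<exists>T. open T \<and> y \<in> T \<and> C_infinity_on (f \<circ> inv_into V \<phi>) T"
      using chart_open_image[OF c] x smooth_funD[OF _ c] by blast
  qed
qed

lemma smooth_fun_const: "open W \<Longrightarrow> smooth_fun M W (\<lambda>x. c)"
  by (rule smooth_funI) (simp_all add: o_def C_infinity_on_const)

lemma smooth_fun_add:
  "open W \<Longrightarrow> smooth_fun M W f \<Longrightarrow> smooth_fun M W g \<Longrightarrow> smooth_fun M W (\<lambda>x. f x + g x)"
  by (rule smooth_funI) (auto simp: o_def dest!: smooth_funD intro!: C_infinity_on_add)

lemma smooth_fun_mult:
  "open W \<Longrightarrow> smooth_fun M W f \<Longrightarrow> smooth_fun M W g \<Longrightarrow> smooth_fun M W (\<lambda>x. f x * g x)"
  by (rule smooth_funI) (auto simp: o_def dest!: smooth_funD intro!: C_infinity_on_mult)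

lemma smooth_fun_uminus: "open W \<Longrightarrow> smooth_fun M W f \<Longrightarrow> smooth_fun M W (\<lambda>x. - f x)"
  using smooth_fun_mult[OF _ smooth_fun_const[of W "-1"]] by simp

lemma smooth_fun_diff:
  "open W \<Longrightarrow> smooth_fun M W f \<Longrightarrow> smooth_fun M W g \<Longrightarrow> smooth_fun M W (\<lambda>x. f x - g x)"
  using smooth_fun_add[OF _ _ smooth_fun_uminus] by simp

lemma smooth_fun_sum:
  "open W \<Longrightarrow> (\<And>i. i \<in> I \<Longrightarrow> smooth_fun M W (f i)) \<Longrightarrow> smooth_fun M W (\<lambda>x. \<Sum>i\<in>I. f i x)"
  by (induction I rule: infinite_finite_induct) (auto intro: smooth_fun_const smooth_fun_add)

lemma smooth_fun_inverse:
  "open W \<Longrightarrow> smooth_fun M W f \<Longrightarrow> (\<And>x. x \<in> W \<Longrightarrow> f x \<noteq> 0) \<Longrightarrow> smooth_fun M W (\<lambda>x. inverse (f x))"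
  by (rule smooth_funI) (auto simp: o_def chart_inverse dest!: smooth_funD intro!: C_infinity_on_inverse)

lemma smooth_fun_compose:
  assumes "C_infinity_on h (UNIV :: real set)" "open W" "smooth_fun M W f"
  shows "smooth_fun M W (\<lambda>x. h (f x))"
proof (rule smooth_funI[OF _ assms(2)])
  fix V \<phi> assume "(V, \<phi>) \<in> M" and op: "open (\<phi> ` (W \<inter> V))"
  from smooth_funD[OF assms(3) this(1)]
  show "C_infinity_on ((\<lambda>x. h (f x)) \<circ> inv_into V \<phi>) (\<phi> ` (W \<inter> V))"
    unfolding o_def by (rule C_infinity_on_compose[OF op open_UNIV assms(1)]) simp
qed

lemma smooth_fun_coordinate:
  assumes "(U, \<phi>) \<in> M"
  shows "smooth_fun M U (\<lambda>x. \<phi> x \<bullet> b)"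
proof (rule smooth_funI[OF _ chart_open[OF assms]])
  fix V \<psi> assume c: "(V, \<psi>) \<in> M" and op: "open (\<psi> ` (U \<inter> V))"
  have "C_infinity_on (\<phi> \<circ> inv_into V \<psi>) (\<psi> ` (U \<inter> V))"
    using chart_compat[OF c assms] by (simp add: Int_commute)
  then show "C_infinity_on ((\<lambda>x. \<phi> x \<bullet> b) \<circ> inv_into V \<psi>) (\<psi> ` (U \<inter> V))"
    unfolding o_def by (rule C_infinity_on_inner[OF op])
qed

section \<open>Bump functions and extension of germs\<close>

text \<open>The closed set \<open>K\<close> is returned besides \<open>\<rho>\<close> because a
  product with a function defined on \<open>U\<close> only, continued by \<open>0\<close>, is smooth
  on the open sets \<open>U\<close> and \<open>- K\<close>, and these cover the manifold.\<close>

lemma bump_function: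
  assumes "open U" "m \<in> U"
  obtains \<rho> W K where "smooth_fun M UNIV \<rho>" "open W" "m \<in> W" "W \<subseteq> K" "closed K" "K \<subseteq> U"
    "\<forall>x\<in>W. \<rho> x = 1" "\<forall>x. x \<notin> K \<longrightarrow> \<rho> x = 0"
proof -
  obtain V \<phi> where c: "(V, \<phi>) \<in> M" "m \<in> V" by (rule chart_at)
  have "open (\<phi> ` (U \<inter> V))" using chart_open_image[OF c(1) assms(1)] .
  then obtain R where R: "R > 0" "cball (\<phi> m) R \<subseteq> \<phi> ` (U \<inter> V)"
    using open_contains_cball assms(2) c(2) by (metis IntI imageI)
  obtain h :: "real \<Rightarrow> real" where h: "C_infinity_on h UNIV" "\<forall>t\<le>0. h t = 0" "\<forall>t\<ge>1. h t = 1"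
    by (rule smooth_step_exists)
  define K where "K = inv_into V \<phi> ` cball (\<phi> m) R"
  \<comment> \<open>The squared distance from \<open>m\<close> in the chart; unlike the distance it
    is smooth at \<open>m\<close>.\<close>
  define q where "q x = (\<Sum>b\<in>Basis. (\<phi> x \<bullet> b + - (\<phi> m \<bullet> b)) * (\<phi> x \<bullet> b + - (\<phi> m \<bullet> b)))" for x
  \<comment> \<open>The argument of \<open>h\<close> is at most \<open>0\<close> outside the ball of
    radius \<open>R\<close> and at least \<open>1\<close> on the ball of radius
    \<open>R / sqrt 2\<close>.\<close>
  define \<rho> where "\<rho> x = (if x \<in> K then h (2 + (- 2 / R\<^sup>2) * q x) else 0)" for x
  have q: "q x = (dist (\<phi> m) (\<phi> x))\<^sup>2" for x
  proof -
    have "(norm (\<phi> x - \<phi> m))\<^sup>2 = (\<Sum>b\<in>Basis. ((\<phi> x - \<phi> m) \<bullet> b) * ((\<phi> x - \<phi> m) \<bullet> b))"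
      by (simp only: power2_norm_eq_inner euclidean_inner[of "\<phi> x - \<phi> m" "\<phi> x - \<phi> m"])
    then show ?thesis
      by (simp add: q_def dist_norm norm_minus_commute[of "\<phi> m"] inner_diff_left)
  qed
  have "continuous_on (cball (\<phi> m) R) (inv_into V \<phi>)"
    using chart_homeomorphism[OF c(1)] R(2) unfolding homeomorphism_def
    by (meson continuous_on_subset dual_order.trans image_mono inf_le2)
  \<comment> \<open>Compactness and the Hausdorff property make \<open>K\<close> closed in the whole
    manifold, not only in the chart domain.\<close>
  then have K: "closed K"
    unfolding K_def by (intro compact_imp_closed compact_continuous_image) auto
  have KU: "K \<subseteq> U \<inter> V"
    unfolding K_def using R(2) chart_inverse[OF c(1)] by force
  have K_iff: "x \<in> K \<longleftrightarrow> dist (\<phi> m) (\<phi> x) \<le> R" if "x \<in> V" for x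
  proof
    assume "x \<in> K"
    then obtain y where y: "y \<in> cball (\<phi> m) R" "x = inv_into V \<phi> y" unfolding K_def by blast
    then obtain z where "z \<in> V" "y = \<phi> z" using R(2) by blast
    then show "dist (\<phi> m) (\<phi> x) \<le> R" using y chart_inverse[OF c(1)] by simp
  next
    assume "dist (\<phi> m) (\<phi> x) \<le> R"
    then have "\<phi> x \<in> cball (\<phi> m) R" by simp
    then show "x \<in> K" unfolding K_def using chart_inverse[OF c(1) that] by force
  qed
  have rho_V: "\<rho> x = h (2 + (- 2 / R\<^sup>2) * q x)" if "x \<in> V" for x
  proof (cases "x \<in> K")
    case False
    then have "R < dist (\<phi> m) (\<phi> x)" using K_iff[OF that] by simp
    then have "R\<^sup>2 \<le> q x" using R(1) by (simp add: q power_mono)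
    then have "2 + (- 2 / R\<^sup>2) * q x \<le> 0" using R(1) by (simp add: field_simps)
    then show ?thesis using False h(2) by (simp add: \<rho>_def)
  qed (simp add: \<rho>_def)
  have smooth: "smooth_fun M UNIV \<rho>"
  proof (rule smooth_fun_local)
    fix x :: 'm
    have "smooth_fun M V (\<lambda>x. h (2 + (- 2 / R\<^sup>2) * q x))"
      unfolding q_def
      by (intro smooth_fun_compose[OF h(1)] smooth_fun_add smooth_fun_mult smooth_fun_const
        smooth_fun_sum smooth_fun_coordinate c(1) chart_open[OF c(1)])
    then have 1: "smooth_fun M V \<rho>"
      by (rule smooth_fun_cong[OF chart_open[OF c(1)], rotated]) (simp add: rho_V)
    have 2: "smooth_fun M (- K) \<rho>"
      by (rule smooth_fun_cong[OF _ _ smooth_fun_const[of _ 0]]) (use K in \<open>auto simp: \<rho>_def\<close>)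
    show "\<exists>W'. open W' \<and> x \<in> W' \<and> smooth_fun M W' \<rho>"
      using 1 2 K KU chart_open[OF c(1)] by (cases "x \<in> K") blast+
  qed simp
  define W where "W = inv_into V \<phi> ` ball (\<phi> m) (R / sqrt 2)"
  have W_eq: "W = V \<inter> \<phi> -` ball (\<phi> m) (R / sqrt 2)"
  proof -
    have "R / sqrt 2 \<le> R" using R(1) by (simp add: field_simps)
    then have "ball (\<phi> m) (R / sqrt 2) \<subseteq> cball (\<phi> m) R" by auto
    then have sub: "ball (\<phi> m) (R / sqrt 2) \<subseteq> \<phi> ` V" using R(2) by blast
    then show ?thesis unfolding W_def using chart_inverse[OF c(1)] by force
  qed
  show ?thesis
  proof (rule that[OF smooth])
    have "continuous_on V \<phi>" using chart_homeomorphism[OF c(1)] unfolding homeomorphism_def by blast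
    then show "open W" unfolding W_eq
      by (intro continuous_open_preimage chart_open[OF c(1)]) auto
    show "m \<in> W" using c(2) R(1) by (simp add: W_eq)
    have le: "R / sqrt 2 \<le> R" using R(1) by (simp add: field_simps)
    show "W \<subseteq> K" using K_iff le unfolding W_eq by force
    show "\<forall>x\<in>W. \<rho> x = 1"
    proof
      fix x assume that: "x \<in> W"
      have "x \<in> V" "dist (\<phi> m) (\<phi> x) \<le> R / sqrt 2" using that unfolding W_eq by auto
      then have "q x \<le> (R / sqrt 2)\<^sup>2" unfolding q by (intro power_mono) auto
      then have "2 * q x \<le> R\<^sup>2" by (simp add: power_divide)
      then have "2 + (- 2 / R\<^sup>2) * q x \<ge> 1" using R(1) by (simp add: field_simps)
      then show "\<rho> x = 1" using rho_V[OF \<open>x \<in> V\<close>] h(3) by simp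
    qed
    show "\<forall>x. x \<notin> K \<longrightarrow> \<rho> x = 0" by (simp add: \<rho>_def)
  qed (use K KU in auto)
qed

text \<open>The cutoff destroys values away from \<open>m\<close>, so agreement can be asked near
  \<open>m\<close> only. Derivatives and brackets at \<open>m\<close> see nothing more.\<close>

lemma smooth_fun_extend:
  assumes "open U" "m \<in> U" "smooth_fun M U f"
  obtains g W where "smooth_fun M UNIV g" "open W" "m \<in> W" "W \<subseteq> U" "\<forall>x\<in>W. g x = f x"
proof -
  obtain \<rho> W K where \<rho>: "smooth_fun M UNIV \<rho>" "open W" "m \<in> W" "W \<subseteq> K" "closed K" "K \<subseteq> U"
    "\<forall>x\<in>W. \<rho> x = 1" "\<forall>x. x \<notin> K \<longrightarrow> \<rho> x = 0"
    by (rule bump_function[OF assms(1,2)])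
  define g where "g x = (if x \<in> K then \<rho> x * f x else 0)" for x
  have "smooth_fun M UNIV g"
  proof (rule smooth_fun_local)
    fix x
    have "smooth_fun M U (\<lambda>x. \<rho> x * f x)"
      by (intro smooth_fun_mult assms smooth_fun_subset[OF \<rho>(1)]) simp
    then have 1: "smooth_fun M U g"
      by (rule smooth_fun_cong[OF assms(1), rotated]) (auto simp: g_def \<rho>)
    have 2: "smooth_fun M (- K) g"
      by (rule smooth_fun_cong[OF _ _ smooth_fun_const[of _ 0]]) (use \<rho>(5) in \<open>auto simp: g_def\<close>)
    show "\<exists>W'. open W' \<and> x \<in> W' \<and> smooth_fun M W' g"
      using 1 2 \<rho>(5,6) assms(1) by (cases "x \<in> K") blast+
  qed simp
  moreover have "\<forall>x\<in>W. g x = f x" using \<rho>(4,7) by (auto simp: g_def)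
  ultimately show ?thesis
    using that[of g W] \<rho> by blast
qed

lemma smooth_funs_extend:
  assumes "open U" "m \<in> U" "\<forall>i<n. smooth_fun M U (f i)"
  obtains g W where "\<forall>i<n. smooth_fun M UNIV (g i)" "open W" "m \<in> W" "W \<subseteq> U"
    "\<forall>i<(n::nat). \<forall>x\<in>W. g i x = f i x"
proof -
  have "\<exists>g W. i < n \<longrightarrow> smooth_fun M UNIV g \<and> open W \<and> m \<in> W \<and> W \<subseteq> U \<and> (\<forall>x\<in>W. g x = f i x)" for i
  proof (cases "i < n")
    case True
    then have "smooth_fun M U (f i)" using assms(3) by simp
    then obtain g W where "smooth_fun M UNIV g" "open W" "m \<in> W" "W \<subseteq> U" "\<forall>x\<in>W. g x = f i x"
      by (rule smooth_fun_extend[OF assms(1,2)])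
    then show ?thesis by (intro exI[of _ g] exI[of _ W]) simp
  qed simp
  then have "\<forall>i. \<exists>g W. i < n \<longrightarrow> smooth_fun M UNIV g \<and> open W \<and> m \<in> W \<and> W \<subseteq> U \<and> (\<forall>x\<in>W. g x = f i x)"
    by simp
  from choice[OF this] obtain g where "\<forall>i. \<exists>W. i < n \<longrightarrow> smooth_fun M UNIV (g i) \<and> open W \<and> m \<in> W \<and> W \<subseteq> U \<and> (\<forall>x\<in>W. g i x = f i x)"
    by (elim exE)
  from choice[OF this] obtain W where gW: "\<And>i. i < n \<Longrightarrow> smooth_fun M UNIV (g i) \<and> open (W i) \<and> m \<in> W i \<and> W i \<subseteq> U \<and> (\<forall>x\<in>W i. g i x = f i x)"
    by auto
  have "open (U \<inter> (\<Inter>i\<in>{..<n}. W i))" using assms(1) gW by (intro open_Int open_INT) auto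
  then show ?thesis
    using that[of g "U \<inter> (\<Inter>i\<in>{..<n}. W i)"] gW assms(2) by simp
qed

lemma smooth_nearI: "open U \<Longrightarrow> m \<in> U \<Longrightarrow> smooth_fun M U f \<Longrightarrow> smooth_near M m f"
  unfolding smooth_near_def by blast

lemma smooth_near_cong:
  assumes "open W" "m \<in> W" "\<And>x. x \<in> W \<Longrightarrow> f x = g x" "smooth_near M m f"
  shows "smooth_near M m g"
proof -
  obtain U where U: "open U" "m \<in> U" "smooth_fun M U f" using assms(4) unfolding smooth_near_def by blast
  have "smooth_fun M (U \<inter> W) g"
    by (rule smooth_fun_cong[OF _ _ smooth_fun_subset[OF U(3)]]) (use U(1) assms(1,3) in auto)
  then show ?thesis using U assms by (intro smooth_nearI[of "U \<inter> W"]) auto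
qed

lemma smooth_near_binop:
  assumes "\<And>W f g. open W \<Longrightarrow> smooth_fun M W f \<Longrightarrow> smooth_fun M W g \<Longrightarrow> smooth_fun M W (h f g)"
    "smooth_near M m f" "smooth_near M m g"
  shows "smooth_near M m (h f g)"
proof -
  obtain U V where "open U" "m \<in> U" "smooth_fun M U f" "open V" "m \<in> V" "smooth_fun M V g"
    using assms(2,3) unfolding smooth_near_def by blast
  then show ?thesis
    by (intro smooth_nearI[of "U \<inter> V"] assms(1)) (auto intro: smooth_fun_subset)
qed

lemma smooth_near_const: "smooth_near M m (\<lambda>x. c)"
  using smooth_nearI[OF open_UNIV _ smooth_fun_const] by simp

lemma smooth_near_add: "smooth_near M m f \<Longrightarrow> smooth_near M m g \<Longrightarrow> smooth_near M m (\<lambda>x. f x + g x)"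
  using smooth_near_binop[of "\<lambda>f g x. f x + g x"] smooth_fun_add by blast

lemma smooth_near_mult: "smooth_near M m f \<Longrightarrow> smooth_near M m g \<Longrightarrow> smooth_near M m (\<lambda>x. f x * g x)"
  using smooth_near_binop[of "\<lambda>f g x. f x * g x"] smooth_fun_mult by blast

lemma smooth_near_UNIV: "smooth_fun M UNIV f \<Longrightarrow> smooth_near M m f"
  using smooth_nearI[OF open_UNIV] by simp

lemma smooth_near_differentiable:
  assumes "smooth_near M m f" "(U, \<phi>) \<in> M" "m \<in> U"
  shows "(f \<circ> inv_into U \<phi> has_derivative frechet_derivative (f \<circ> inv_into U \<phi>) (at (\<phi> m))) (at (\<phi> m))"
proof -
  obtain W where "open W" "m \<in> W" "smooth_fun M W f" using assms(1) unfolding smooth_near_def by blast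
  then show ?thesis
    using C_infinity_on_has_derivative[OF smooth_funD[OF _ assms(2)]] assms(3) by blast
qed

section \<open>Tangent vectors in charts\<close>

text \<open>The vector with chart components \<open>w\<close>. The value \<open>0\<close> on
  functions that are not smooth near \<open>m\<close> copies the convention of
  \<open>tangent_space\<close>, so these are literally the elements of its carrier.\<close>

definition chart_vector :: "'m set \<Rightarrow> ('m \<Rightarrow> 'e) \<Rightarrow> 'e \<Rightarrow> 'm \<Rightarrow> ('m \<Rightarrow> real) \<Rightarrow> real" where
  "chart_vector U \<phi> w m = (\<lambda>f. if smooth_near M m f
     then frechet_derivative (f \<circ> inv_into U \<phi>) (at (\<phi> m)) w else 0)"

text \<open>By the chain rule \<open>w'\<close> is the image of \<open>w\<close> under the
  differential of the transition map. Hence all tangent vectors at \<open>m\<close> can be described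
  in one fixed chart.\<close>

lemma chart_vector_change:
  assumes "(U, \<phi>) \<in> M" "m \<in> U" "(V, \<psi>) \<in> M" "m \<in> V"
  shows "\<exists>w'. chart_vector V \<psi> w m = chart_vector U \<phi> w' m"
proof -
  let ?g = "\<phi> \<circ> inv_into V \<psi>"
  let ?w = "frechet_derivative ?g (at (\<psi> m)) w"
  have mem: "\<psi> m \<in> \<psi> ` (V \<inter> U)" using assms by blast
  have dg: "(?g has_derivative frechet_derivative ?g (at (\<psi> m))) (at (\<psi> m))"
    using C_infinity_on_has_derivative[OF chart_compat[OF assms(3,1)] mem] .
  have g: "?g (\<psi> m) = \<phi> m" using chart_inverse[OF assms(3,4)] by simp
  have "chart_vector V \<psi> w m f = chart_vector U \<phi> ?w m f" for f
  proof (cases "smooth_near M m f")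
    case True
    have "((f \<circ> inv_into U \<phi>) has_derivative frechet_derivative (f \<circ> inv_into U \<phi>) (at (\<phi> m))) (at (?g (\<psi> m)))"
      using smooth_near_differentiable[OF True assms(1,2)] g by simp
    from diff_chain_at[OF dg this]
    have "((f \<circ> inv_into U \<phi>) \<circ> ?g has_derivative
        frechet_derivative (f \<circ> inv_into U \<phi>) (at (\<phi> m)) \<circ> frechet_derivative ?g (at (\<psi> m))) (at (\<psi> m))" .
    then have "(f \<circ> inv_into V \<psi> has_derivative
        frechet_derivative (f \<circ> inv_into U \<phi>) (at (\<phi> m)) \<circ> frechet_derivative ?g (at (\<psi> m))) (at (\<psi> m))"
      by (rule has_derivative_transform_within_open[OF _ _ mem])
        (use chart_open_image[OF assms(3) chart_open[OF assms(1)]] chart_inverse[OF assms(3)]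
          chart_inverse[OF assms(1)] in \<open>auto simp: Int_commute\<close>)
    from frechet_derivative_at[OF this, symmetric] show ?thesis
      by (simp add: chart_vector_def True)
  qed (simp add: chart_vector_def)
  then show ?thesis by blast
qed

lemma tangent_carrier_iff:
  assumes "(U, \<phi>) \<in> M" "m \<in> U"
  shows "v \<in> carrier (tangent_space M m) \<longleftrightarrow> (\<exists>w. v = chart_vector U \<phi> w m)"
proof -
  have "v \<in> carrier (tangent_space M m) \<longleftrightarrow> (\<exists>(V, \<psi>)\<in>M. m \<in> V \<and> (\<exists>w. v = chart_vector V \<psi> w m))"
    by (simp add: tangent_space_def chart_vector_def)
  then show ?thesis using chart_vector_change[OF assms] assms by fastforce
qed

lemma tangent_space_simps [simp]:
  "\<zero>\<^bsub>tangent_space M m\<^esub> = (\<lambda>f. 0)"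
  "v \<oplus>\<^bsub>tangent_space M m\<^esub> w = (\<lambda>f. v f + w f)"
  "c \<odot>\<^bsub>tangent_space M m\<^esub> v = (\<lambda>f. c * v f)"
  by (simp_all add: tangent_space_def)

lemma frechet_derivative_linear:
  assumes "smooth_near M m f" "(U, \<phi>) \<in> M" "m \<in> U"
  shows "linear (frechet_derivative (f \<circ> inv_into U \<phi>) (at (\<phi> m)))"
  using smooth_near_differentiable[OF assms] has_derivative_linear by blast

lemma chart_vector_add:
  assumes "(U, \<phi>) \<in> M" "m \<in> U"
  shows "(\<lambda>f. chart_vector U \<phi> w m f + chart_vector U \<phi> w' m f) = chart_vector U \<phi> (w + w') m"
  using linear_add[OF frechet_derivative_linear[OF _ assms]] by (auto simp: chart_vector_def)

lemma chart_vector_scale: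
  assumes "(U, \<phi>) \<in> M" "m \<in> U"
  shows "(\<lambda>f. c * chart_vector U \<phi> w m f) = chart_vector U \<phi> (c *\<^sub>R w) m"
  using linear_cmul[OF frechet_derivative_linear[OF _ assms]] by (auto simp: chart_vector_def)

lemma tangent_add_closed:
  "v \<in> carrier (tangent_space M m) \<Longrightarrow> w \<in> carrier (tangent_space M m) \<Longrightarrow>
    (\<lambda>f. v f + w f) \<in> carrier (tangent_space M m)"
proof -
  obtain U \<phi> where c: "(U, \<phi>) \<in> M" "m \<in> U" by (rule chart_at)
  show "v \<in> carrier (tangent_space M m) \<Longrightarrow> w \<in> carrier (tangent_space M m) \<Longrightarrow> ?thesis"
    unfolding tangent_carrier_iff[OF c] using chart_vector_add[OF c] by blast
qed

lemma tangent_scale_closed: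
  "v \<in> carrier (tangent_space M m) \<Longrightarrow> (\<lambda>f. c * v f) \<in> carrier (tangent_space M m)"
proof -
  obtain U \<phi> where c: "(U, \<phi>) \<in> M" "m \<in> U" by (rule chart_at)
  show "v \<in> carrier (tangent_space M m) \<Longrightarrow> ?thesis"
    unfolding tangent_carrier_iff[OF c] using chart_vector_scale[OF c] by blast
qed

lemma tangent_zero_closed: "(\<lambda>f. 0) \<in> carrier (tangent_space M m)"
proof -
  obtain U \<phi> where c: "(U, \<phi>) \<in> M" "m \<in> U" by (rule chart_at)
  have "chart_vector U \<phi> 0 m = (\<lambda>f. 0)"
    using linear_0[OF frechet_derivative_linear[OF _ c]] by (auto simp: chart_vector_def)
  then show ?thesis unfolding tangent_carrier_iff[OF c] by metis
qed

lemma tangent_binop: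
  assumes v: "v \<in> carrier (tangent_space M m)" and "smooth_near M m f" "smooth_near M m g"
  shows tangent_apply_add: "v (\<lambda>x. f x + g x) = v f + v g"
    and tangent_apply_mult: "v (\<lambda>x. f x * g x) = f m * v g + g m * v f"
proof -
  obtain U \<phi> where c: "(U, \<phi>) \<in> M" "m \<in> U" by (rule chart_at)
  obtain w where w: "v = chart_vector U \<phi> w m" using v tangent_carrier_iff[OF c] by blast
  let ?D = "\<lambda>f. frechet_derivative (f \<circ> inv_into U \<phi>) (at (\<phi> m))"
  note df = smooth_near_differentiable[OF assms(2) c] and dg = smooth_near_differentiable[OF assms(3) c]
  have "((\<lambda>x. f x + g x) \<circ> inv_into U \<phi> has_derivative (\<lambda>h. ?D f h + ?D g h)) (at (\<phi> m))"
    using has_derivative_add[OF df dg] by (simp add: o_def)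
  from frechet_derivative_at[OF this, symmetric] show "v (\<lambda>x. f x + g x) = v f + v g"
    by (simp add: w chart_vector_def assms smooth_near_add)
  have "((\<lambda>x. f x * g x) \<circ> inv_into U \<phi> has_derivative (\<lambda>h. f m * ?D g h + ?D f h * g m)) (at (\<phi> m))"
    using has_derivative_mult[OF df dg] by (simp add: o_def chart_inverse[OF c])
  from frechet_derivative_at[OF this, symmetric] show "v (\<lambda>x. f x * g x) = f m * v g + g m * v f"
    by (simp add: w chart_vector_def assms smooth_near_mult)
qed

lemma tangent_apply_const:
  assumes "v \<in> carrier (tangent_space M m)"
  shows "v (\<lambda>x. c) = 0"
proof -
  have 1: "v (\<lambda>x. 1) = 0"
    using tangent_apply_mult[OF assms smooth_near_const[of _ 1] smooth_near_const[of _ 1]] by simp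
  obtain U \<phi> where ch: "(U, \<phi>) \<in> M" "m \<in> U" by (rule chart_at)
  obtain w where w: "v = chart_vector U \<phi> w m" using assms tangent_carrier_iff[OF ch] by blast
  have "frechet_derivative ((\<lambda>x. c) \<circ> inv_into U \<phi>) (at (\<phi> m)) = (\<lambda>h. 0)"
    using frechet_derivative_at[of "\<lambda>x. c" "\<lambda>h. 0" "\<phi> m"] by (simp add: o_def)
  then show ?thesis by (simp add: w chart_vector_def)
qed

lemma tangent_apply_scale:
  "v \<in> carrier (tangent_space M m) \<Longrightarrow> smooth_near M m f \<Longrightarrow> v (\<lambda>x. c * f x) = c * v f"
  using tangent_apply_mult[of v m "\<lambda>x. c" f] tangent_apply_const[of v m c] smooth_near_const by simp

text \<open>For functions that are not smooth near \<open>m\<close> both values are \<open>0\<close>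
  by convention; this is the reason for the case distinction.\<close>

lemma tangent_apply_cong:
  assumes "v \<in> carrier (tangent_space M m)" "open W" "m \<in> W" "\<And>x. x \<in> W \<Longrightarrow> f x = g x"
  shows "v f = v g"
proof (cases "smooth_near M m f")
  case True
  obtain U \<phi> where c: "(U, \<phi>) \<in> M" "m \<in> U" by (rule chart_at)
  obtain w where w: "v = chart_vector U \<phi> w m" using assms(1) tangent_carrier_iff[OF c] by blast
  have "(g \<circ> inv_into U \<phi> has_derivative frechet_derivative (f \<circ> inv_into U \<phi>) (at (\<phi> m))) (at (\<phi> m))"
    by (rule has_derivative_transform_within_open[OF smooth_near_differentiable[OF True c] chart_open_image[OF c(1) assms(2)]])
      (use c assms chart_inverse[OF c(1)] in auto)
  from frechet_derivative_at[OF this] show ?thesis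
    using True smooth_near_cong[OF assms(2-4) True] by (simp add: w chart_vector_def)
next
  case False
  then have "\<not> smooth_near M m g" using smooth_near_cong[OF assms(2,3)] assms(4) by metis
  moreover obtain U \<phi> where c: "(U, \<phi>) \<in> M" "m \<in> U" by (rule chart_at)
  ultimately show ?thesis using False assms(1) unfolding tangent_carrier_iff[OF c] chart_vector_def by auto
qed

lemma chart_vector_in_tangent: "(U, \<phi>) \<in> M \<Longrightarrow> m \<in> U \<Longrightarrow> chart_vector U \<phi> w m \<in> carrier (tangent_space M m)"
  using tangent_carrier_iff by blast

lemma chart_vector_coordinate:
  assumes "(U, \<phi>) \<in> M" "m \<in> U"
  shows "chart_vector U \<phi> w m (\<lambda>x. \<phi> x \<bullet> b) = w \<bullet> b"
proof -
  have "((\<lambda>x. \<phi> x \<bullet> b) \<circ> inv_into U \<phi> has_derivative (\<lambda>h. h \<bullet> b)) (at (\<phi> m))"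
  proof (rule has_derivative_transform_within_open[OF _ chart_open_range[OF assms(1)]])
    show "((\<lambda>y. y \<bullet> b) has_derivative (\<lambda>h. h \<bullet> b)) (at (\<phi> m))" by (auto intro!: derivative_eq_intros)
  qed (use assms chart_inverse[OF assms(1)] in auto)
  from frechet_derivative_at[OF this, symmetric] show ?thesis
    using smooth_nearI[OF chart_open assms(2) smooth_fun_coordinate] assms(1)
    by (simp add: chart_vector_def)
qed

text \<open>The coordinate functions read off the chart components of \<open>v\<close>; the rest is
  linearity of the Frechet derivative.\<close>

lemma tangent_expand:
  assumes "(U, \<phi>) \<in> M" "m \<in> U" "v \<in> carrier (tangent_space M m)"
  shows "v f = (\<Sum>b\<in>Basis. v (\<lambda>x. \<phi> x \<bullet> b) * chart_vector U \<phi> b m f)"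
proof -
  obtain w where w: "v = chart_vector U \<phi> w m" using assms(3) tangent_carrier_iff[OF assms(1,2)] by blast
  show ?thesis
  proof (cases "smooth_near M m f")
    case True
    note lin = frechet_derivative_linear[OF True assms(1,2)]
    have "frechet_derivative (f \<circ> inv_into U \<phi>) (at (\<phi> m)) (\<Sum>b\<in>Basis. (w \<bullet> b) *\<^sub>R b)
        = (\<Sum>b\<in>Basis. (w \<bullet> b) * frechet_derivative (f \<circ> inv_into U \<phi>) (at (\<phi> m)) b)"
      by (simp add: linear_sum[OF lin] linear_cmul[OF lin])
    then have "chart_vector U \<phi> w m f = (\<Sum>b\<in>Basis. (w \<bullet> b) * chart_vector U \<phi> b m f)"
      by (simp add: chart_vector_def True euclidean_representation)
    then show ?thesis by (simp add: w chart_vector_coordinate[OF assms(1,2)])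
  qed (simp add: w chart_vector_def)
qed

text \<open>In another chart the function is a directional derivative composed with the transition
  map.\<close>

lemma smooth_fun_chart_vector:
  assumes "(U, \<phi>) \<in> M" "open W" "W \<subseteq> U" "smooth_fun M W f"
  shows "smooth_fun M W (\<lambda>x. chart_vector U \<phi> w x f)"
proof (rule smooth_funI[OF _ assms(2)])
  fix V \<psi> assume c: "(V, \<psi>) \<in> M" and op: "open (\<psi> ` (W \<inter> V))"
  let ?D = "\<lambda>y. frechet_derivative (f \<circ> inv_into U \<phi>) (at y) w"
  have "C_infinity_on ?D (\<phi> ` (W \<inter> U))"
    by (rule C_infinity_on_frechet_derivative[OF smooth_funD[OF assms(4,1)]])
  moreover have "C_infinity_on (\<phi> \<circ> inv_into V \<psi>) (\<psi> ` (W \<inter> V))"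
    by (rule C_infinity_on_subset[OF chart_compat[OF c assms(1)]]) (use assms(3) in blast)
  ultimately have "C_infinity_on (\<lambda>y. ?D ((\<phi> \<circ> inv_into V \<psi>) y)) (\<psi> ` (W \<inter> V))"
    by (rule C_infinity_on_compose[OF op chart_open_image[OF assms(1,2)]])
      (use assms(3) chart_inverse[OF c] in auto)
  then show "C_infinity_on ((\<lambda>x. chart_vector U \<phi> w x f) \<circ> inv_into V \<psi>) (\<psi> ` (W \<inter> V))"
    by (rule C_infinity_on_cong[OF op, rotated])
      (auto simp: chart_vector_def chart_inverse[OF c] smooth_nearI[OF assms(2) _ assms(4)])
qed

end

subsection \<open>Real vector spaces with enough linear functionals\<close>

text \<open>Only values on the carrier are constrained, as a fibre is a subset of a type.
  Functionals serve as tests: an identity of fibre elements becomes an identity of reals after every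
  functional is applied.\<close>

definition linear_functional :: "(real, 'v, 'x) module_scheme \<Rightarrow> ('v \<Rightarrow> real) \<Rightarrow> bool" where
  "linear_functional V l \<longleftrightarrow>
     (\<forall>v\<in>carrier V. \<forall>w\<in>carrier V. l (v \<oplus>\<^bsub>V\<^esub> w) = l v + l w) \<and>
     (\<forall>c. \<forall>v\<in>carrier V. l (c \<odot>\<^bsub>V\<^esub> v) = c * l v)"

lemma real_ring_simps [simp]:
  "carrier real_ring = UNIV" "x \<otimes>\<^bsub>real_ring\<^esub> y = x * y" "\<one>\<^bsub>real_ring\<^esub> = 1"
  "\<zero>\<^bsub>real_ring\<^esub> = 0" "x \<oplus>\<^bsub>real_ring\<^esub> y = x + y"
  by (simp_all add: real_ring_def)

lemma cring_real_ring: "cring real_ring"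
proof (intro cringI abelian_groupI comm_monoidI)
  show "\<exists>y\<in>carrier real_ring. y \<oplus>\<^bsub>real_ring\<^esub> x = \<zero>\<^bsub>real_ring\<^esub>" for x
    by (auto intro: exI[of _ "- x"])
qed (auto simp: algebra_simps)

locale real_space =
  fixes V :: "(real, 'v, 'x) module_scheme"
  assumes real_module: "Module.module real_ring V"
begin

sublocale M: Module.module real_ring V by (rule real_module)

lemma smult_closed [simp, intro]: "v \<in> carrier V \<Longrightarrow> c \<odot>\<^bsub>V\<^esub> v \<in> carrier V"
  using M.smult_closed by simp

lemma lf_zero: "linear_functional V l \<Longrightarrow> l \<zero>\<^bsub>V\<^esub> = 0"
  unfolding linear_functional_def by (metis M.zero_closed M.l_zero add_cancel_right_right)

lemma lf_add: "linear_functional V l \<Longrightarrow> v \<in> carrier V \<Longrightarrow> w \<in> carrier V \<Longrightarrow> l (v \<oplus>\<^bsub>V\<^esub> w) = l v + l w"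
  unfolding linear_functional_def by blast

lemma lf_smult: "linear_functional V l \<Longrightarrow> v \<in> carrier V \<Longrightarrow> l (c \<odot>\<^bsub>V\<^esub> v) = c * l v"
  unfolding linear_functional_def by blast

lemma lf_neg: "linear_functional V l \<Longrightarrow> v \<in> carrier V \<Longrightarrow> l (\<ominus>\<^bsub>V\<^esub> v) = - l v"
  using lf_add[of l "\<ominus>\<^bsub>V\<^esub> v" v] lf_zero[of l] M.l_neg[of v] by simp

lemma lf_minus: "linear_functional V l \<Longrightarrow> v \<in> carrier V \<Longrightarrow> w \<in> carrier V \<Longrightarrow> l (v \<ominus>\<^bsub>V\<^esub> w) = l v - l w"
  by (simp add: a_minus_def lf_add lf_neg)

lemma lf_finsum:
  assumes "linear_functional V l" "\<And>i. i \<in> I \<Longrightarrow> f i \<in> carrier V"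
  shows "l (\<Oplus>\<^bsub>V\<^esub>i\<in>I. f i) = (\<Sum>i\<in>I. l (f i))"
  using assms(2)
proof (induction I rule: infinite_finite_induct)
  case (insert i I)
  then show ?case
    using assms(1) by (subst M.finsum_insert) (auto simp: lf_add)
qed (use assms(1) in \<open>auto simp: M.finsum_infinite lf_zero\<close>)

lemmas lf_simps = lf_zero lf_add lf_smult lf_neg lf_minus lf_finsum

lemma finsum_closed: "(\<And>i. i \<in> I \<Longrightarrow> f i \<in> carrier V) \<Longrightarrow> (\<Oplus>\<^bsub>V\<^esub>i\<in>I. f i) \<in> carrier V"
  by (intro M.finsum_closed) auto

end

text \<open>For the fibres of a bundle this follows from a frame. For jet spaces it is established
  before any frame is known, so it is an assumption in its own right.\<close>

locale separated_space = real_space +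
  assumes separated: "v \<in> carrier V \<Longrightarrow> w \<in> carrier V \<Longrightarrow> (\<And>l. linear_functional V l \<Longrightarrow> l v = l w) \<Longrightarrow> v = w"

definition is_basis :: "(real, 'v, 'x) module_scheme \<Rightarrow> nat \<Rightarrow> (nat \<Rightarrow> 'v) \<Rightarrow> bool" where
  "is_basis V r s \<longleftrightarrow> (\<forall>i<r. s i \<in> carrier V) \<and>
     bij_betw (\<lambda>c. \<Oplus>\<^bsub>V\<^esub>i\<in>{..<r}. c i \<odot>\<^bsub>V\<^esub> s i) ({..<r} \<rightarrow>\<^sub>E UNIV) (carrier V)"

definition coeff :: "(real, 'v, 'x) module_scheme \<Rightarrow> nat \<Rightarrow> (nat \<Rightarrow> 'v) \<Rightarrow> 'v \<Rightarrow> nat \<Rightarrow> real" where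
  "coeff V r s = inv_into ({..<r} \<rightarrow>\<^sub>E UNIV) (\<lambda>c. \<Oplus>\<^bsub>V\<^esub>i\<in>{..<r}. c i \<odot>\<^bsub>V\<^esub> s i)"

context real_space begin

lemma basis_expand:
  assumes "is_basis V r s" "v \<in> carrier V"
  shows "(\<Oplus>\<^bsub>V\<^esub>i\<in>{..<r}. coeff V r s v i \<odot>\<^bsub>V\<^esub> s i) = v"
proof -
  have "v \<in> (\<lambda>c. \<Oplus>\<^bsub>V\<^esub>i\<in>{..<r}. c i \<odot>\<^bsub>V\<^esub> s i) ` ({..<r} \<rightarrow>\<^sub>E UNIV)"
    using assms unfolding is_basis_def bij_betw_def by blast
  from f_inv_into_f[OF this] show ?thesis by (simp add: coeff_def)
qed

lemma finsum_cong:
  "(\<And>i. i \<in> I \<Longrightarrow> f i = g i) \<Longrightarrow> (\<And>i. i \<in> I \<Longrightarrow> g i \<in> carrier V) \<Longrightarrow> (\<Oplus>\<^bsub>V\<^esub>i\<in>I. f i) = (\<Oplus>\<^bsub>V\<^esub>i\<in>I. g i)"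
  by (intro M.finsum_cong') auto

lemma coeff_unique:
  assumes "is_basis V r s" "i < r"
  shows "coeff V r s (\<Oplus>\<^bsub>V\<^esub>i\<in>{..<r}. c i \<odot>\<^bsub>V\<^esub> s i) i = c i"
proof -
  have inj: "inj_on (\<lambda>c. \<Oplus>\<^bsub>V\<^esub>i\<in>{..<r}. c i \<odot>\<^bsub>V\<^esub> s i) ({..<r} \<rightarrow>\<^sub>E UNIV)"
    using assms unfolding is_basis_def bij_betw_def by blast
  have "(\<Oplus>\<^bsub>V\<^esub>i\<in>{..<r}. c i \<odot>\<^bsub>V\<^esub> s i) = (\<Oplus>\<^bsub>V\<^esub>i\<in>{..<r}. restrict c {..<r} i \<odot>\<^bsub>V\<^esub> s i)"
    using assms by (intro finsum_cong) (auto simp: is_basis_def)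
  then have "coeff V r s (\<Oplus>\<^bsub>V\<^esub>i\<in>{..<r}. c i \<odot>\<^bsub>V\<^esub> s i) = restrict c {..<r}"
    using inv_into_f_f[OF inj, of "restrict c {..<r}"] by (simp add: coeff_def)
  then show ?thesis using assms(2) by simp
qed

lemma linear_functional_coeff:
  assumes b: "is_basis V r s" and i: "i < r"
  shows "linear_functional V (\<lambda>v. coeff V r s v i)"
  unfolding linear_functional_def
proof (intro conjI ballI allI)
  have s: "s i \<in> carrier V" if "i < r" for i using b that by (simp add: is_basis_def)
  fix v w assume v: "v \<in> carrier V" and w: "w \<in> carrier V"
  have "v \<oplus>\<^bsub>V\<^esub> w = (\<Oplus>\<^bsub>V\<^esub>i\<in>{..<r}. coeff V r s v i \<odot>\<^bsub>V\<^esub> s i) \<oplus>\<^bsub>V\<^esub> (\<Oplus>\<^bsub>V\<^esub>i\<in>{..<r}. coeff V r s w i \<odot>\<^bsub>V\<^esub> s i)"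
    using basis_expand[OF b] v w by simp
  also have "\<dots> = (\<Oplus>\<^bsub>V\<^esub>i\<in>{..<r}. coeff V r s v i \<odot>\<^bsub>V\<^esub> s i \<oplus>\<^bsub>V\<^esub> coeff V r s w i \<odot>\<^bsub>V\<^esub> s i)"
    using s by (intro M.finsum_addf[symmetric]) auto
  also have "\<dots> = (\<Oplus>\<^bsub>V\<^esub>i\<in>{..<r}. (coeff V r s v i + coeff V r s w i) \<odot>\<^bsub>V\<^esub> s i)"
    using s M.smult_l_distr by (intro finsum_cong) auto
  finally show "coeff V r s (v \<oplus>\<^bsub>V\<^esub> w) i = coeff V r s v i + coeff V r s w i"
    using coeff_unique[OF b i, of "\<lambda>i. coeff V r s v i + coeff V r s w i"] by simp
next
  have s: "s i \<in> carrier V" if "i < r" for i using b that by (simp add: is_basis_def)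
  fix c v assume v: "v \<in> carrier V"
  have "c \<odot>\<^bsub>V\<^esub> v = c \<odot>\<^bsub>V\<^esub> (\<Oplus>\<^bsub>V\<^esub>i\<in>{..<r}. coeff V r s v i \<odot>\<^bsub>V\<^esub> s i)"
    using basis_expand[OF b] v by simp
  also have "\<dots> = (\<Oplus>\<^bsub>V\<^esub>i\<in>{..<r}. c \<odot>\<^bsub>V\<^esub> (coeff V r s v i \<odot>\<^bsub>V\<^esub> s i))"
    using s by (intro M.finsum_smult_ldistr) auto
  also have "\<dots> = (\<Oplus>\<^bsub>V\<^esub>i\<in>{..<r}. (c * coeff V r s v i) \<odot>\<^bsub>V\<^esub> s i)"
    using s M.smult_assoc1 by (intro finsum_cong) auto
  finally show "coeff V r s (c \<odot>\<^bsub>V\<^esub> v) i = c * coeff V r s v i"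
    using coeff_unique[OF b i, of "\<lambda>i. c * coeff V r s v i"] by simp
qed

lemma basis_eqI:
  assumes "is_basis V r s" "v \<in> carrier V" "w \<in> carrier V" "\<And>i. i < r \<Longrightarrow> coeff V r s v i = coeff V r s w i"
  shows "v = w"
proof -
  have "v = (\<Oplus>\<^bsub>V\<^esub>i\<in>{..<r}. coeff V r s v i \<odot>\<^bsub>V\<^esub> s i)" using basis_expand assms by metis
  also have "\<dots> = (\<Oplus>\<^bsub>V\<^esub>i\<in>{..<r}. coeff V r s w i \<odot>\<^bsub>V\<^esub> s i)"
    using assms by (intro finsum_cong) (auto simp: is_basis_def)
  also have "\<dots> = w" using basis_expand assms by metis
  finally show ?thesis .
qed

text \<open>Coordinates are linear functionals, and they determine a vector.\<close>

lemma separated_if_basis: "is_basis V r s \<Longrightarrow> separated_space V"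
  by (intro separated_space.intro real_space_axioms separated_space_axioms.intro)
    (metis basis_eqI linear_functional_coeff)

lemma coeff_basis:
  assumes b: "is_basis V r s" and i: "i < r" and j: "j < r"
  shows "coeff V r s (s i) j = (if i = j then 1 else 0)"
proof -
  interpret separated_space V using separated_if_basis[OF b] .
  have c: "s i \<in> carrier V" if "i < r" for i using b that by (simp add: is_basis_def)
  have "s i = (\<Oplus>\<^bsub>V\<^esub>k\<in>{..<r}. (if i = k then 1 else 0) \<odot>\<^bsub>V\<^esub> s k)"
  proof (rule separated)
    show "l (s i) = l (\<Oplus>\<^bsub>V\<^esub>k\<in>{..<r}. (if i = k then 1 else 0) \<odot>\<^bsub>V\<^esub> s k)"
      if l: "linear_functional V l" for l
    proof -
      have "l (\<Oplus>\<^bsub>V\<^esub>k\<in>{..<r}. (if i = k then 1 else 0) \<odot>\<^bsub>V\<^esub> s k)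
          = (\<Sum>k<r. l ((if i = k then 1 else 0) \<odot>\<^bsub>V\<^esub> s k))"
        using c by (intro lf_finsum[OF l] smult_closed) auto
      also have "\<dots> = (\<Sum>k<r. if i = k then l (s k) else 0)"
        using c by (intro sum.cong) (auto simp: lf_smult[OF l])
      finally show ?thesis using i by simp
    qed
  qed (use c i in \<open>auto intro!: finsum_closed\<close>)
  then show ?thesis
    using coeff_unique[OF b j, of "\<lambda>k. if i = k then 1 else 0"] by simp
qed

end

subsection \<open>Sections of vector bundles\<close>

locale smooth_bundle = manifold M
  for M :: "('m::{t2_space, second_countable_topology}, 'e::euclidean_space) atlas" +
  fixes E :: "('m, 'v, 'x) vbundle_scheme"
  assumes vector_bundle: "vector_bundle M E"
begin

lemmas vector_bundle_axs = vector_bundle[unfolded vector_bundle_def]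

lemma fibre_module: "Module.module real_ring (fibre E m)"
  using vector_bundle_axs[THEN conjunct1] by simp

lemma section_restrict:
  "\<sigma> \<in> sections E U \<Longrightarrow> open U \<Longrightarrow> open V \<Longrightarrow> V \<subseteq> U \<Longrightarrow> \<sigma> \<in> sections E V"
  using vector_bundle_axs[THEN conjunct2, THEN conjunct2, THEN conjunct1] by simp

lemma section_glue:
  assumes "open U" "\<And>m. m \<in> U \<Longrightarrow> \<exists>V. open V \<and> m \<in> V \<and> V \<subseteq> U \<and> \<sigma> \<in> sections E V"
  shows "\<sigma> \<in> sections E U"
  using vector_bundle_axs[THEN conjunct2, THEN conjunct2, THEN conjunct2] assms by simp

lemma local_frame_iff:
  "local_frame M E U r s \<longleftrightarrow> open U \<and> (\<forall>x\<in>U. is_basis (fibre E x) r (\<lambda>i. s i x)) \<and>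
     (\<forall>V \<sigma>. open V \<and> V \<subseteq> U \<longrightarrow> (\<sigma> \<in> sections E V \<longleftrightarrow>
        (\<exists>c. (\<forall>i<r. smooth_fun M V (c i)) \<and> (\<forall>x\<in>V. \<sigma> x = scomb E r c s x))))"
  unfolding local_frame_def is_basis_def by auto

lemma frame_at: obtains r where "\<And>m. \<exists>U s. m \<in> U \<and> local_frame M E U r s"
  using vector_bundle_axs[THEN conjunct2, THEN conjunct1] by auto

lemma frameD:
  assumes "local_frame M E U r s"
  shows frame_open: "open U" and frame_basis: "x \<in> U \<Longrightarrow> is_basis (fibre E x) r (\<lambda>i. s i x)"
  using assms unfolding local_frame_iff by blast+

lemma frame_section_iff:
  assumes "local_frame M E U r s" "open V" "V \<subseteq> U"
  shows "\<sigma> \<in> sections E V \<longleftrightarrow> (\<exists>c. (\<forall>i<r. smooth_fun M V (c i)) \<and> (\<forall>x\<in>V. \<sigma> x = scomb E r c s x))"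
  using assms unfolding local_frame_iff by blast

lemma separated_fibre: "separated_space (fibre E m)"
proof -
  obtain r where "\<And>m. \<exists>U s. m \<in> U \<and> local_frame M E U r s" by (rule frame_at) blast
  then obtain U s where "m \<in> U" "local_frame M E U r s" by blast
  then show ?thesis
    using frame_basis real_space.separated_if_basis[OF real_space.intro[OF fibre_module]] by blast
qed

sublocale F: separated_space "fibre E m" for m
  by (rule separated_fibre)

lemma frame_coeff_smooth:
  assumes f: "local_frame M E U r s" and V: "open V" "V \<subseteq> U" and "\<sigma> \<in> sections E V" "i < r"
  shows "smooth_fun M V (\<lambda>x. coeff (fibre E x) r (\<lambda>i. s i x) (\<sigma> x) i)"
proof -
  obtain c where c: "\<forall>i<r. smooth_fun M V (c i)" "\<forall>x\<in>V. \<sigma> x = scomb E r c s x"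
    using frame_section_iff[OF f V] assms(4) by blast
  have eq: "c i x = coeff (fibre E x) r (\<lambda>i. s i x) (\<sigma> x) i" if "x \<in> V" for x
    using c(2) that F.coeff_unique[OF frame_basis[OF f], of x i "\<lambda>i. c i x"] V assms(5)
    by (auto simp: scomb_def)
  show ?thesis by (rule smooth_fun_cong[OF V(1) eq]) (use c(1) assms(5) in auto)
qed

lemma scomb_in_carrier: "(\<And>i. i < r \<Longrightarrow> s i x \<in> carrier (fibre E x)) \<Longrightarrow> scomb E r c s x \<in> carrier (fibre E x)"
  unfolding scomb_def by (intro F.finsum_closed) auto

lemma frame_sectionI:
  assumes f: "local_frame M E U r s" and V: "open V" "V \<subseteq> U"
    and "\<And>x. x \<in> V \<Longrightarrow> \<sigma> x \<in> carrier (fibre E x)"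
    and "\<And>i. i < r \<Longrightarrow> smooth_fun M V (\<lambda>x. coeff (fibre E x) r (\<lambda>i. s i x) (\<sigma> x) i)"
  shows "\<sigma> \<in> sections E V"
  unfolding frame_section_iff[OF f V]
proof (intro exI conjI)
  show "\<forall>x\<in>V. \<sigma> x = scomb E r (\<lambda>i x. coeff (fibre E x) r (\<lambda>i. s i x) (\<sigma> x) i) s x"
    using F.basis_expand[OF frame_basis[OF f]] assms(4) V by (auto simp: scomb_def)
qed (use assms in auto)

lemma frame_near:
  assumes "open V" "m \<in> V"
  obtains U r s where "m \<in> U" "U \<subseteq> V" "local_frame M E U r s"
proof -
  obtain r where "\<And>m. \<exists>U s. m \<in> U \<and> local_frame M E U r s" by (rule frame_at) blast
  then obtain U s where U: "m \<in> U" "local_frame M E U r s" by blast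
  then have "local_frame M E (U \<inter> V) r s"
    using assms(1) unfolding local_frame_def by (auto intro!: open_Int)
  then show ?thesis using U assms that[of "U \<inter> V"] by blast
qed

lemma local_frame_subset:
  assumes "local_frame M E U r s" "open V" "V \<subseteq> U"
  shows "local_frame M E V r s"
  unfolding local_frame_iff
proof (intro conjI ballI allI impI)
  show "is_basis (fibre E x) r (\<lambda>i. s i x)" if "x \<in> V" for x
    using frame_basis[OF assms(1)] assms(3) that by blast
  show "\<sigma> \<in> sections E W \<longleftrightarrow> (\<exists>c. (\<forall>i<r. smooth_fun M W (c i)) \<and> (\<forall>x\<in>W. \<sigma> x = scomb E r c s x))"
    if "open W \<and> W \<subseteq> V" for W \<sigma>
    by (rule frame_section_iff[OF assms(1)]) (use that assms(3) in auto)
qed (rule assms(2))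

text \<open>\<open>vector_bundle\<close> does not state this for its sections; near each point it
  comes from the expansion in a frame.\<close>

lemma section_carrier:
  assumes "\<sigma> \<in> sections E U" "open U" "x \<in> U"
  shows "\<sigma> x \<in> carrier (fibre E x)"
proof -
  obtain W r s where W: "x \<in> W" "W \<subseteq> U" "local_frame M E W r s" by (rule frame_near[OF assms(2,3)])
  have "\<sigma> \<in> sections E W" using section_restrict[OF assms(1,2) frame_open[OF W(3)] W(2)] .
  then obtain c where "\<sigma> x = scomb E r c s x"
    using frame_section_iff[OF W(3) frame_open[OF W(3)]] W by blast
  then show ?thesis
    using scomb_in_carrier frame_basis[OF W(3,1)] by (simp add: is_basis_def)
qed

text \<open>Near each point membership is decided by an expansion in a frame, which sees only values
  on \<open>U\<close>; gluing does the rest.\<close>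

lemma section_cong:
  assumes "open U" "\<And>x. x \<in> U \<Longrightarrow> \<sigma> x = \<tau> x" "\<sigma> \<in> sections E U"
  shows "\<tau> \<in> sections E U"
proof (rule section_glue[OF assms(1)])
  fix m assume "m \<in> U"
  then obtain W r s where W: "m \<in> W" "W \<subseteq> U" "local_frame M E W r s" by (rule frame_near[OF assms(1)])
  have "\<sigma> \<in> sections E W" using section_restrict[OF assms(3,1) frame_open[OF W(3)] W(2)] .
  then obtain c where "\<forall>i<r. smooth_fun M W (c i)" "\<forall>x\<in>W. \<sigma> x = scomb E r c s x"
    unfolding frame_section_iff[OF W(3) frame_open[OF W(3)] order_refl] by (elim exE conjE)
  then have "\<tau> \<in> sections E W"
    unfolding frame_section_iff[OF W(3) frame_open[OF W(3)] order_refl]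
    using assms(2)[symmetric, OF subsetD[OF W(2)]] by (intro exI[of _ c]) auto
  then show "\<exists>V. open V \<and> m \<in> V \<and> V \<subseteq> U \<and> \<tau> \<in> sections E V"
    using W frame_open[OF W(3)] by (intro exI[of _ W]) simp
qed

lemma section_localI:
  assumes "open U" "\<And>x. x \<in> U \<Longrightarrow> \<tau> x \<in> carrier (fibre E x)"
    and "\<And>W r s i. local_frame M E W r s \<Longrightarrow> W \<subseteq> U \<Longrightarrow> i < r \<Longrightarrow>
      smooth_fun M W (\<lambda>x. coeff (fibre E x) r (\<lambda>i. s i x) (\<tau> x) i)"
  shows "\<tau> \<in> sections E U"
proof (rule section_glue[OF assms(1)])
  fix m assume "m \<in> U"
  then obtain W r s where W: "m \<in> W" "W \<subseteq> U" "local_frame M E W r s" by (rule frame_near[OF assms(1)])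
  have "\<tau> \<in> sections E W"
    by (rule frame_sectionI[OF W(3) frame_open[OF W(3)] order_refl]) (use W assms in auto)
  then show "\<exists>V. open V \<and> m \<in> V \<and> V \<subseteq> U \<and> \<tau> \<in> sections E V"
    using W frame_open[OF W(3)] by (intro exI[of _ W]) simp
qed

lemma section_finsum:
  assumes "open U" "\<And>i. i \<in> I \<Longrightarrow> smooth_fun M U (f i)" "\<And>i. i \<in> I \<Longrightarrow> \<sigma> i \<in> sections E U"
  shows "(\<lambda>x. \<Oplus>\<^bsub>fibre E x\<^esub>i\<in>I. f i x \<odot>\<^bsub>fibre E x\<^esub> \<sigma> i x) \<in> sections E U"
proof (rule section_localI[OF assms(1)])
  show "(\<Oplus>\<^bsub>fibre E x\<^esub>i\<in>I. f i x \<odot>\<^bsub>fibre E x\<^esub> \<sigma> i x) \<in> carrier (fibre E x)" if "x \<in> U" for x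
    using section_carrier[OF assms(3) assms(1) that] by (intro F.finsum_closed) auto
  fix W r s j assume W: "local_frame M E W r s" "W \<subseteq> U" "j < r"
  have "smooth_fun M W (\<lambda>x. \<Sum>i\<in>I. f i x * coeff (fibre E x) r (\<lambda>i. s i x) (\<sigma> i x) j)"
    using W frame_open[OF W(1)] assms
    by (intro smooth_fun_sum smooth_fun_mult frame_coeff_smooth[OF W(1) _ order_refl])
      (auto intro: smooth_fun_subset section_restrict)
  then show "smooth_fun M W (\<lambda>x. coeff (fibre E x) r (\<lambda>i. s i x)
      (\<Oplus>\<^bsub>fibre E x\<^esub>i\<in>I. f i x \<odot>\<^bsub>fibre E x\<^esub> \<sigma> i x) j)"
  proof (rule smooth_fun_cong[OF frame_open[OF W(1)], rotated])
    fix x assume x: "x \<in> W"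
    have "\<sigma> i x \<in> carrier (fibre E x)" if "i \<in> I" for i
      using section_carrier[OF assms(3)[OF that] assms(1)] x W(2) by blast
    then show "(\<Sum>i\<in>I. f i x * coeff (fibre E x) r (\<lambda>i. s i x) (\<sigma> i x) j) =
        coeff (fibre E x) r (\<lambda>i. s i x) (\<Oplus>\<^bsub>fibre E x\<^esub>i\<in>I. f i x \<odot>\<^bsub>fibre E x\<^esub> \<sigma> i x) j"
      by (simp add: F.lf_simps[OF F.linear_functional_coeff[OF frame_basis[OF W(1) x] W(3)]])
  qed
qed

lemma section_add:
  assumes "open U" "\<sigma> \<in> sections E U" "\<tau> \<in> sections E U"
  shows "sadd E \<sigma> \<tau> \<in> sections E U"
proof -
  \<comment> \<open>The sum of two sections as a sum over the truth values, to reuse the result on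
    finite combinations.\<close>
  let ?s = "\<lambda>i::bool. if i then \<sigma> else \<tau>"
  have "(\<lambda>x. \<Oplus>\<^bsub>fibre E x\<^esub>i\<in>UNIV. 1 \<odot>\<^bsub>fibre E x\<^esub> ?s i x) \<in> sections E U"
    using assms by (intro section_finsum smooth_fun_const) auto
  then show ?thesis
  proof (rule section_cong[OF assms(1), rotated])
    fix x assume "x \<in> U"
    then have c: "\<sigma> x \<in> carrier (fibre E x)" "\<tau> x \<in> carrier (fibre E x)"
      using section_carrier assms by blast+
    show "(\<Oplus>\<^bsub>fibre E x\<^esub>i\<in>UNIV. 1 \<odot>\<^bsub>fibre E x\<^esub> ?s i x) = sadd E \<sigma> \<tau> x"
    proof (rule F.separated)
      show "l (\<Oplus>\<^bsub>fibre E x\<^esub>i\<in>UNIV. 1 \<odot>\<^bsub>fibre E x\<^esub> ?s i x) = l (sadd E \<sigma> \<tau> x)"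
        if "linear_functional (fibre E x) l" for l
        using c by (simp add: sadd_def F.lf_simps[OF that] UNIV_bool)
    qed (use c in \<open>auto simp: sadd_def intro!: F.finsum_closed\<close>)
  qed
qed

lemma section_scale:
  assumes "open U" "smooth_fun M U f" "\<sigma> \<in> sections E U"
  shows "sscale E f \<sigma> \<in> sections E U"
proof -
  have "(\<lambda>x. \<Oplus>\<^bsub>fibre E x\<^esub>i\<in>{0::nat}. f x \<odot>\<^bsub>fibre E x\<^esub> \<sigma> x) \<in> sections E U"
    using assms by (intro section_finsum) auto
  then show ?thesis
  proof (rule section_cong[OF assms(1), rotated])
    fix x assume "x \<in> U"
    then have c: "\<sigma> x \<in> carrier (fibre E x)"
      using section_carrier assms by blast+
    show "(\<Oplus>\<^bsub>fibre E x\<^esub>i\<in>{0::nat}. f x \<odot>\<^bsub>fibre E x\<^esub> \<sigma> x) = sscale E f \<sigma> x"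
    proof (rule F.separated)
      show "l (\<Oplus>\<^bsub>fibre E x\<^esub>i\<in>{0::nat}. f x \<odot>\<^bsub>fibre E x\<^esub> \<sigma> x) = l (sscale E f \<sigma> x)"
        if "linear_functional (fibre E x) l" for l
        using c by (simp add: sscale_def F.lf_simps[OF that])
    qed (use c in \<open>auto simp: sscale_def intro!: F.finsum_closed\<close>)
  qed
qed

lemma section_zero: "open U \<Longrightarrow> szero E \<in> sections E U"
  using section_finsum[of U "{}"] by (simp add: szero_def)

section \<open>Global sections and frames\<close>

text \<open>The same cutoff as for functions. It is needed because brackets and connections act on
  global sections only.\<close>

lemma section_extend:
  assumes "open U" "m \<in> U" "\<sigma> \<in> sections E U"
  obtains X W where "X \<in> sections E UNIV" "open W" "m \<in> W" "W \<subseteq> U" "\<forall>x\<in>W. X x = \<sigma> x"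
proof -
  obtain \<rho> W K where \<rho>: "smooth_fun M UNIV \<rho>" "open W" "m \<in> W" "W \<subseteq> K" "closed K" "K \<subseteq> U"
    "\<forall>x\<in>W. \<rho> x = 1" "\<forall>x. x \<notin> K \<longrightarrow> \<rho> x = 0"
    by (rule bump_function[OF assms(1,2)])
  define X where "X x = (if x \<in> K then \<rho> x \<odot>\<^bsub>fibre E x\<^esub> \<sigma> x else \<zero>\<^bsub>fibre E x\<^esub>)" for x
  have sc: "\<sigma> x \<in> carrier (fibre E x)" if "x \<in> U" for x using section_carrier assms that by blast
  have "X \<in> sections E UNIV"
  proof (rule section_glue)
    fix x
    have 1: "X \<in> sections E U"
    proof (rule section_cong[OF assms(1) _ section_scale[OF assms(1) smooth_fun_subset[OF \<rho>(1)] assms(3)]])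
      show "sscale E \<rho> \<sigma> x = X x" if "x \<in> U" for x
        using \<rho>(8) sc[OF that] by (simp add: X_def sscale_def F.M.smult_l_null[simplified])
    qed simp
    have 2: "X \<in> sections E (- K)"
      by (rule section_cong[OF _ _ section_zero]) (use \<rho>(5) in \<open>auto simp: X_def szero_def\<close>)
    show "\<exists>V. open V \<and> x \<in> V \<and> V \<subseteq> UNIV \<and> X \<in> sections E V"
    proof (cases "x \<in> K")
      case True
      then show ?thesis using 1 assms(1) \<rho>(6) by (intro exI[of _ U]) auto
    next
      case False
      then show ?thesis using 2 \<rho>(5) by (intro exI[of _ "- K"]) auto
    qed
  qed simp
  moreover have "X x = \<sigma> x" if "x \<in> W" for x
  proof (rule F.separated)
    have x: "x \<in> U" "x \<in> K" using \<rho> that by blast+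
    show "X x \<in> carrier (fibre E x)" "\<sigma> x \<in> carrier (fibre E x)" using sc[OF x(1)] by (auto simp: X_def)
    show "l (X x) = l (\<sigma> x)" if "linear_functional (fibre E x) l" for l
      using sc[OF x(1)] x \<open>x \<in> W\<close> \<rho>(7) by (simp add: X_def F.lf_simps[OF that])
  qed
  ultimately show ?thesis using that[of X W] \<rho> by blast
qed

lemma local_frame_cong:
  assumes f: "local_frame M E U r s" and e: "\<And>i x. i < r \<Longrightarrow> x \<in> U \<Longrightarrow> s i x = s' i x"
  shows "local_frame M E U r s'"
proof -
  have b: "is_basis (fibre E x) r (\<lambda>i. s' i x)" if x: "x \<in> U" for x
  proof -
    have c: "s i x \<in> carrier (fibre E x)" if "i < r" for i
      using frame_basis[OF f x] that by (simp add: is_basis_def)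
    have "(\<Oplus>\<^bsub>fibre E x\<^esub>i\<in>{..<r}. c i \<odot>\<^bsub>fibre E x\<^esub> s' i x) = (\<Oplus>\<^bsub>fibre E x\<^esub>i\<in>{..<r}. c i \<odot>\<^bsub>fibre E x\<^esub> s i x)" for c
      using c e x by (intro F.finsum_cong) auto
    then show ?thesis using frame_basis[OF f x] e x by (auto simp: is_basis_def)
  qed
  have "scomb E r c s' x = scomb E r c s x" if x: "x \<in> U" for c x
    unfolding scomb_def using frame_basis[OF f x] e x
    by (intro F.finsum_cong) (auto simp: is_basis_def)
  then show ?thesis
    using f b unfolding local_frame_iff by (simp add: subset_iff cong: conj_cong)
qed

lemma frame_section:
  assumes U: "local_frame M E U r s" and i: "i < r"
  shows "s i \<in> sections E U"
proof (rule frame_sectionI[OF U frame_open[OF U] order_refl])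
  show "s i x \<in> carrier (fibre E x)" if "x \<in> U" for x
    using frame_basis[OF U that] i by (simp add: is_basis_def)
  show "smooth_fun M U (\<lambda>x. coeff (fibre E x) r (\<lambda>i. s i x) (s i x) j)" if j: "j < r" for j
    by (rule smooth_fun_cong[OF frame_open[OF U] _ smooth_fun_const[OF frame_open[OF U], of "if i = j then 1 else 0"]])
      (use F.coeff_basis[OF frame_basis[OF U] i j] in simp)
qed

lemma sections_extend:
  assumes "open U" "m \<in> U" "\<forall>i<n. \<sigma> i \<in> sections E U"
  obtains X W where "\<forall>i<n. X i \<in> sections E UNIV" "open W" "m \<in> W" "W \<subseteq> U"
    "\<forall>i<(n::nat). \<forall>x\<in>W. X i x = \<sigma> i x"
proof -
  have "\<exists>X W. i < n \<longrightarrow> X \<in> sections E UNIV \<and> open W \<and> m \<in> W \<and> W \<subseteq> U \<and> (\<forall>x\<in>W. X x = \<sigma> i x)" for i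
  proof (cases "i < n")
    case True
    then have "\<sigma> i \<in> sections E U" using assms(3) by simp
    then obtain X W where "X \<in> sections E UNIV" "open W" "m \<in> W" "W \<subseteq> U" "\<forall>x\<in>W. X x = \<sigma> i x"
      by (rule section_extend[OF assms(1,2)])
    then show ?thesis by (intro exI[of _ X] exI[of _ W]) simp
  qed simp
  then have "\<forall>i. \<exists>X W. i < n \<longrightarrow> X \<in> sections E UNIV \<and> open W \<and> m \<in> W \<and> W \<subseteq> U \<and> (\<forall>x\<in>W. X x = \<sigma> i x)"
    by simp
  from choice[OF this] obtain X where "\<forall>i. \<exists>W. i < n \<longrightarrow> X i \<in> sections E UNIV \<and> open W \<and> m \<in> W \<and> W \<subseteq> U \<and> (\<forall>x\<in>W. X i x = \<sigma> i x)"
    by (elim exE)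
  from choice[OF this] obtain W where XW: "\<And>i. i < n \<Longrightarrow> X i \<in> sections E UNIV \<and> open (W i) \<and> m \<in> W i \<and> W i \<subseteq> U \<and> (\<forall>x\<in>W i. X i x = \<sigma> i x)"
    by auto
  have "open (U \<inter> (\<Inter>i\<in>{..<n}. W i))" using assms(1) XW by (intro open_Int open_INT) auto
  then show ?thesis
    using that[of X "U \<inter> (\<Inter>i\<in>{..<n}. W i)"] XW assms(2) by simp
qed

text \<open>Frames made of global sections can be inserted into brackets. The rank is fixed before
  the point, which later gives the jet bundle a constant rank.\<close>

lemma global_frame_rank:
  obtains r where "\<And>V m. open V \<Longrightarrow> m \<in> V \<Longrightarrow> \<exists>U s. m \<in> U \<and> U \<subseteq> V \<and> local_frame M E U r s \<and> (\<forall>i<r. s i \<in> sections E UNIV)"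
proof -
  obtain r where r: "\<And>m. \<exists>U s. m \<in> U \<and> local_frame M E U r s" by (rule frame_at) blast
  show ?thesis
  proof (rule that[of r])
    fix V :: "'m set" and m assume V: "open V" "m \<in> V"
    obtain U s where U: "m \<in> U" "local_frame M E U r s" using r by blast
    have "open (U \<inter> V)" "m \<in> U \<inter> V" using U V frame_open by auto
    moreover have "local_frame M E (U \<inter> V) r s" using local_frame_subset[OF U(2)] calculation(1) by simp
    then have "\<forall>i<r. s i \<in> sections E (U \<inter> V)" using frame_section by simp
    ultimately obtain X W where XW: "\<forall>i<r. X i \<in> sections E UNIV" "open W" "m \<in> W" "W \<subseteq> U \<inter> V"
      "\<forall>i<r. \<forall>x\<in>W. X i x = s i x" by (rule sections_extend)
    have "local_frame M E W r s" using local_frame_subset[OF U(2) XW(2)] XW(4) by simp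
    then have "local_frame M E W r X" by (rule local_frame_cong) (use XW in simp)
    then show "\<exists>U s. m \<in> U \<and> U \<subseteq> V \<and> local_frame M E U r s \<and> (\<forall>i<r. s i \<in> sections E UNIV)"
      using XW by (intro exI[of _ W] exI[of _ X]) simp
  qed
qed

lemma global_frame:
  assumes "open V" "m \<in> V"
  obtains U r s where "m \<in> U" "U \<subseteq> V" "local_frame M E U r s" "\<forall>i<r. s i \<in> sections E UNIV"
proof -
  obtain r where r: "\<And>V m. open V \<Longrightarrow> m \<in> V \<Longrightarrow> \<exists>U s. m \<in> U \<and> U \<subseteq> V \<and> local_frame M E U r s \<and> (\<forall>i<r. s i \<in> sections E UNIV)"
    by (rule global_frame_rank) blast
  from r[OF assms] show ?thesis using that by blast
qed

text \<open>Only the equality is local: frame sections and coefficients are global, so that brackets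
  and connections can be applied term by term.\<close>

lemma section_expand:
  assumes "\<sigma> \<in> sections E U" "open U" "m \<in> U"
  obtains W r s c where "\<forall>i<r. s i \<in> sections E UNIV" "\<forall>i<r. smooth_fun M UNIV (c i)"
    "m \<in> W" "W \<subseteq> U" "local_frame M E W r s" "\<forall>x\<in>W. \<sigma> x = scomb E r c s x"
proof -
  obtain V r s where V: "m \<in> V" "V \<subseteq> U" "local_frame M E V r s" "\<forall>i<r. s i \<in> sections E UNIV"
    by (rule global_frame[OF assms(2,3)])
  have "\<sigma> \<in> sections E V" using section_restrict[OF assms(1,2) frame_open[OF V(3)] V(2)] .
  then obtain d where d: "\<forall>i<r. smooth_fun M V (d i)" "\<forall>x\<in>V. \<sigma> x = scomb E r d s x"
    unfolding frame_section_iff[OF V(3) frame_open[OF V(3)] order_refl] by (elim exE conjE)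
  obtain c W where c: "\<forall>i<r. smooth_fun M UNIV (c i)" "open W" "m \<in> W" "W \<subseteq> V" "\<forall>i<r. \<forall>x\<in>W. c i x = d i x"
    by (rule smooth_funs_extend[OF frame_open[OF V(3)] V(1) d(1)])
  have "scomb E r d s x = scomb E r c s x" if "x \<in> W" for x
    unfolding scomb_def using c(5) that V(4) section_carrier[OF _ open_UNIV]
    by (intro F.finsum_cong) auto
  then have "\<forall>x\<in>W. \<sigma> x = scomb E r c s x" using d(2) c(4) by (simp add: subset_iff)
  with V c show ?thesis
    by (intro that[of r s c W]) (auto intro: local_frame_subset[OF V(3) c(2)])
qed

lemma value_extend:
  assumes "v \<in> carrier (fibre E m)"
  obtains X where "X \<in> sections E UNIV" "X m = v"
proof -
  obtain U r s where f: "m \<in> U" "U \<subseteq> UNIV" "local_frame M E U r s" "\<forall>i<r. s i \<in> sections E UNIV"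
    by (rule global_frame[of UNIV m]) auto
  let ?c = "coeff (fibre E m) r (\<lambda>i. s i m) v"
  have "(\<lambda>x. \<Oplus>\<^bsub>fibre E x\<^esub>i\<in>{..<r}. ?c i \<odot>\<^bsub>fibre E x\<^esub> s i x) \<in> sections E UNIV"
    using f(4) by (intro section_finsum smooth_fun_const) auto
  then show ?thesis
    by (rule that) (use F.basis_expand[OF frame_basis[OF f(3,1)] assms] in simp)
qed

end

subsection \<open>Calculus in a Lie algebroid\<close>

locale algebroid = manifold M
  for M :: "('m::{t2_space, second_countable_topology}, 'e::euclidean_space) atlas" +
  fixes A :: "('m, 'v) lie_algebroid"
  assumes lie_algebroid: "lie_algebroid M A"
begin

lemmas lie_algebroid_axs = lie_algebroid[unfolded lie_algebroid_def]

sublocale smooth_bundle M A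
  by (rule smooth_bundle.intro[OF manifold_axioms smooth_bundle_axioms.intro[OF lie_algebroid_axs[THEN conjunct1]]])

abbreviation Sec :: "('m \<Rightarrow> 'v) set" where "Sec \<equiv> sections A UNIV"
abbreviation br :: "('m \<Rightarrow> 'v) \<Rightarrow> ('m \<Rightarrow> 'v) \<Rightarrow> 'm \<Rightarrow> 'v" where "br \<equiv> bracket A"
abbreviation anc :: "'m \<Rightarrow> 'v \<Rightarrow> ('m \<Rightarrow> real) \<Rightarrow> real" where "anc \<equiv> anchor A"

lemma sec_carrier [simp]: "X \<in> Sec \<Longrightarrow> X m \<in> carrier (fibre A m)"
  using section_carrier by simp

lemma sec_sadd [simp]: "X \<in> Sec \<Longrightarrow> Y \<in> Sec \<Longrightarrow> sadd A X Y \<in> Sec"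
  by (rule section_add) simp_all

lemma sec_sscale [simp]: "smooth_fun M UNIV f \<Longrightarrow> X \<in> Sec \<Longrightarrow> sscale A f X \<in> Sec"
  by (rule section_scale) simp_all

lemma sec_szero [simp]: "szero A \<in> Sec"
  by (rule section_zero) simp

lemma smooth_const [simp]: "smooth_fun M UNIV (\<lambda>x. c)"
  by (rule smooth_fun_const) simp

lemma sec_br [simp]: "X \<in> Sec \<Longrightarrow> Y \<in> Sec \<Longrightarrow> br X Y \<in> Sec"
  using lie_algebroid_axs by (elim conjE) simp

lemma anchor_tangent [simp]: "v \<in> carrier (fibre A m) \<Longrightarrow> anc m v \<in> carrier (tangent_space M m)"
  and anchor_add: "v \<in> carrier (fibre A m) \<Longrightarrow> w \<in> carrier (fibre A m) \<Longrightarrow>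
    anc m (v \<oplus>\<^bsub>fibre A m\<^esub> w) = (\<lambda>f. anc m v f + anc m w f)"
  and anchor_smult: "v \<in> carrier (fibre A m) \<Longrightarrow> anc m (c \<odot>\<^bsub>fibre A m\<^esub> v) = (\<lambda>f. c * anc m v f)"
proof -
  have "linear_map (fibre A m) (fibre (tangent_bundle M) m) (anc m)"
    using lie_algebroid_axs[THEN conjunct2, THEN conjunct1] unfolding bundle_morphism_def by simp
  then have "linear_map (fibre A m) (tangent_space M m) (anc m)"
    by (simp add: tangent_bundle_def)
  then show "v \<in> carrier (fibre A m) \<Longrightarrow> anc m v \<in> carrier (tangent_space M m)"
    "v \<in> carrier (fibre A m) \<Longrightarrow> w \<in> carrier (fibre A m) \<Longrightarrow>
      anc m (v \<oplus>\<^bsub>fibre A m\<^esub> w) = (\<lambda>f. anc m v f + anc m w f)"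
    "v \<in> carrier (fibre A m) \<Longrightarrow> anc m (c \<odot>\<^bsub>fibre A m\<^esub> v) = (\<lambda>f. c * anc m v f)"
    by (auto simp: linear_map_def)
qed

lemma anchor_const [simp]: "v \<in> carrier (fibre A m) \<Longrightarrow> anc m v (\<lambda>x. c) = 0"
  using tangent_apply_const[OF anchor_tangent] .

lemma linear_functional_anchor: "linear_functional (fibre A m) (\<lambda>v. anc m v f)"
  by (simp add: linear_functional_def anchor_add anchor_smult)

lemmas anchor_simps = F.lf_simps[OF linear_functional_anchor]

lemma anchor_smooth:
  assumes "\<sigma> \<in> sections A U" "open U" "open W" "W \<subseteq> U" "smooth_fun M W f"
  shows "smooth_fun M W (\<lambda>x. anc x (\<sigma> x) f)"
proof -
  have "(\<lambda>x. anc x (\<sigma> x)) \<in> sections (tangent_bundle M) U"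
    using lie_algebroid_axs[THEN conjunct2, THEN conjunct1] assms(1,2) unfolding bundle_morphism_def by simp
  then show ?thesis using assms(3-5) by (simp add: tangent_bundle_def)
qed

lemma sec_anchor_smooth [simp]: "X \<in> Sec \<Longrightarrow> smooth_fun M UNIV f \<Longrightarrow> smooth_fun M UNIV (\<lambda>x. anc x (X x) f)"
  by (rule anchor_smooth[OF _ open_UNIV open_UNIV subset_UNIV])

lemma br_sadd_left: "X \<in> Sec \<Longrightarrow> Y \<in> Sec \<Longrightarrow> Z \<in> Sec \<Longrightarrow> br (sadd A X Y) Z = sadd A (br X Z) (br Y Z)"
  using lie_algebroid_axs by (elim conjE) simp

lemma br_skew_sections: "X \<in> Sec \<Longrightarrow> Y \<in> Sec \<Longrightarrow> sadd A (br X Y) (br Y X) = szero A"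
  using lie_algebroid_axs by (elim conjE) simp

lemma br_jacobi_sections: "X \<in> Sec \<Longrightarrow> Y \<in> Sec \<Longrightarrow> Z \<in> Sec \<Longrightarrow>
    sadd A (br X (br Y Z)) (sadd A (br Y (br Z X)) (br Z (br X Y))) = szero A"
  using lie_algebroid_axs by (elim conjE) simp

lemma br_leibniz_sections: "X \<in> Sec \<Longrightarrow> Y \<in> Sec \<Longrightarrow> smooth_fun M UNIV f \<Longrightarrow>
    br X (sscale A f Y) = sadd A (sscale A f (br X Y)) (sscale A (\<lambda>x. anc x (X x) f) Y)"
  using lie_algebroid_axs by (elim conjE) simp

lemma anchor_br: "X \<in> Sec \<Longrightarrow> Y \<in> Sec \<Longrightarrow> open U \<Longrightarrow> smooth_fun M U f \<Longrightarrow> x \<in> U \<Longrightarrow>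
    anc x (br X Y x) f = anc x (X x) (\<lambda>y. anc y (Y y) f) - anc x (Y x) (\<lambda>y. anc y (X y) f)"
  using lie_algebroid_axs by (elim conjE) simp

text \<open>Written with the scalar \<open>-1\<close>, so that additivity and the Leibniz rule
  suffice to compute with it.\<close>

definition ssub :: "('m \<Rightarrow> 'v) \<Rightarrow> ('m \<Rightarrow> 'v) \<Rightarrow> 'm \<Rightarrow> 'v" where
  "ssub X Y = sadd A X (sscale A (\<lambda>x. -1) Y)"

lemma sec_ssub [simp]: "X \<in> Sec \<Longrightarrow> Y \<in> Sec \<Longrightarrow> ssub X Y \<in> Sec"
  by (simp add: ssub_def)

lemma szero_eq_sscale: "szero A = sscale A (\<lambda>x. 0) (szero A)"
  by (simp add: sscale_def szero_def)

section \<open>The bracket axioms, evaluated by linear functionals\<close>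

context
  fixes m :: 'm and l :: "'v \<Rightarrow> real"
  assumes l: "linear_functional (fibre A m) l"
begin

lemma lf_sadd: "X \<in> Sec \<Longrightarrow> Y \<in> Sec \<Longrightarrow> l (sadd A X Y m) = l (X m) + l (Y m)"
  by (simp add: sadd_def F.lf_simps[OF l])

lemma lf_sscale: "X \<in> Sec \<Longrightarrow> l (sscale A f X m) = f m * l (X m)"
  by (simp add: sscale_def F.lf_simps[OF l])

lemma lf_szero: "l (szero A m) = 0"
  by (simp add: szero_def F.lf_simps[OF l])

lemma lf_ssub: "X \<in> Sec \<Longrightarrow> Y \<in> Sec \<Longrightarrow> l (ssub X Y m) = l (X m) - l (Y m)"
  by (simp add: ssub_def lf_sadd lf_sscale)

lemma lf_br_skew: "X \<in> Sec \<Longrightarrow> Y \<in> Sec \<Longrightarrow> l (br Y X m) = - l (br X Y m)"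
  using arg_cong[OF fun_cong[OF br_skew_sections[of X Y], of m], of l]
  by (simp add: lf_sadd lf_szero)

lemma lf_br_sadd_left: "X \<in> Sec \<Longrightarrow> Y \<in> Sec \<Longrightarrow> Z \<in> Sec \<Longrightarrow> l (br (sadd A X Y) Z m) = l (br X Z m) + l (br Y Z m)"
  by (simp add: br_sadd_left lf_sadd)

lemma lf_br_sadd_right: "X \<in> Sec \<Longrightarrow> Y \<in> Sec \<Longrightarrow> Z \<in> Sec \<Longrightarrow> l (br Z (sadd A X Y) m) = l (br Z X m) + l (br Z Y m)"
  using lf_br_sadd_left[of X Y Z] lf_br_skew[of "sadd A X Y" Z] lf_br_skew[of X Z] lf_br_skew[of Y Z] by simp

lemma lf_br_sscale_right: "X \<in> Sec \<Longrightarrow> Y \<in> Sec \<Longrightarrow> smooth_fun M UNIV f \<Longrightarrow>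
    l (br X (sscale A f Y) m) = f m * l (br X Y m) + anc m (X m) f * l (Y m)"
  by (simp add: br_leibniz_sections lf_sadd lf_sscale)

lemma lf_br_sscale_left: "X \<in> Sec \<Longrightarrow> Y \<in> Sec \<Longrightarrow> smooth_fun M UNIV f \<Longrightarrow>
    l (br (sscale A f X) Y m) = f m * l (br X Y m) - anc m (Y m) f * l (X m)"
  using lf_br_sscale_right[of Y X f] lf_br_skew[of "sscale A f X" Y] lf_br_skew[of X Y] by simp

lemma lf_br_ssub_right: "X \<in> Sec \<Longrightarrow> Y \<in> Sec \<Longrightarrow> Z \<in> Sec \<Longrightarrow> l (br Z (ssub X Y) m) = l (br Z X m) - l (br Z Y m)"
  by (simp add: ssub_def lf_br_sadd_right lf_br_sscale_right)

lemma lf_br_ssub_left: "X \<in> Sec \<Longrightarrow> Y \<in> Sec \<Longrightarrow> Z \<in> Sec \<Longrightarrow> l (br (ssub X Y) Z m) = l (br X Z m) - l (br Y Z m)"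
  by (simp add: ssub_def lf_br_sadd_left lf_br_sscale_left)

text \<open>The Jacobi identity as a commutator rule, \<open>ad [X, Y] = [ad X, ad Y]\<close>. This
  is what matches prolongations with the commutator bracket on jets.\<close>

lemma lf_jacobi: "X \<in> Sec \<Longrightarrow> Y \<in> Sec \<Longrightarrow> Z \<in> Sec \<Longrightarrow>
    l (br (br X Y) Z m) = l (br X (br Y Z) m) - l (br Y (br X Z) m)"
proof -
  assume s: "X \<in> Sec" "Y \<in> Sec" "Z \<in> Sec"
  \<comment> \<open>\<open>br Z X\<close> occurs inside another bracket, so skew symmetry is needed
    as an equality of sections and not only after \<open>l\<close>.\<close>
  have "br Z X = sscale A (\<lambda>x. -1) (br X Z)"
  proof
    fix x show "br Z X x = sscale A (\<lambda>x. - 1) (br X Z) x"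
    proof (rule F.separated)
      show "l' (br Z X x) = l' (sscale A (\<lambda>x. - 1) (br X Z) x)" if "linear_functional (fibre A x) l'" for l'
        using arg_cong[OF fun_cong[OF br_skew_sections[OF s(1,3)], of x], of l'] s
        by (simp add: sadd_def szero_def sscale_def F.lf_simps[OF that])
    qed (use s in simp_all)
  qed
  then show ?thesis
    using arg_cong[OF fun_cong[OF br_jacobi_sections[OF s], of m], of l] s lf_br_skew[of "br X Y" Z]
    by (simp add: lf_sadd lf_szero lf_br_sscale_right)
qed

lemma lf_br_szero: "Y \<in> Sec \<Longrightarrow> l (br (szero A) Y m) = 0" "Y \<in> Sec \<Longrightarrow> l (br Y (szero A) m) = 0"
  using lf_br_sscale_left[of "szero A" Y "\<lambda>x. 0"] lf_br_skew[of Y "szero A"]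
  by (simp_all add: szero_eq_sscale[symmetric] lf_szero)

end

lemmas lf_sec = lf_br_szero lf_sadd lf_sscale lf_szero lf_ssub lf_br_sadd_left lf_br_sadd_right
  lf_br_sscale_left lf_br_sscale_right lf_br_ssub_left lf_br_ssub_right

lemma br_eqI:
  assumes "v \<in> carrier (fibre A m)" "w \<in> carrier (fibre A m)"
    "\<And>l. linear_functional (fibre A m) l \<Longrightarrow> l v = l w"
  shows "v = w"
  using F.separated assms by blast

section \<open>Locality of the bracket\<close>

text \<open>\<open>\<rho>\<close> is constant near \<open>m\<close>, so the derivative term of the
  Leibniz rule vanishes at \<open>m\<close>.\<close>

lemma lf_br_bump:
  assumes l: "linear_functional (fibre A m) l" and "X \<in> Sec" "Y \<in> Sec" "smooth_fun M UNIV \<rho>"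
    "open W" "m \<in> W" "\<forall>x\<in>W. \<rho> x = 1"
  shows "l (br (sscale A \<rho> X) Y m) = l (br X Y m)"
proof -
  have "anc m (Y m) \<rho> = anc m (Y m) (\<lambda>x. 1)"
    by (rule tangent_apply_cong[OF _ assms(5,6)]) (use assms in auto)
  then have "anc m (Y m) \<rho> = 0" using assms by simp
  then show ?thesis using assms by (simp add: lf_br_sscale_left[OF l])
qed

text \<open>Multiplication by a bump function makes the two sections equal everywhere without
  changing either bracket at \<open>m\<close>.\<close>

lemma br_cong_left:
  assumes "X \<in> Sec" "X' \<in> Sec" "Y \<in> Sec" "open W" "m \<in> W" "\<forall>x\<in>W. X x = X' x"
  shows "br X Y m = br X' Y m"
proof -
  obtain \<rho> W' K where \<rho>: "smooth_fun M UNIV \<rho>" "open W'" "m \<in> W'" "W' \<subseteq> K" "closed K" "K \<subseteq> W"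
    "\<forall>x\<in>W'. \<rho> x = 1" "\<forall>x. x \<notin> K \<longrightarrow> \<rho> x = 0"
    by (rule bump_function[OF assms(4,5)])
  have "sscale A \<rho> X = sscale A \<rho> X'"
  proof
    fix x show "sscale A \<rho> X x = sscale A \<rho> X' x"
    proof (cases "x \<in> K")
      case True
      then have "X x = X' x" using \<rho>(6) assms(6) by blast
      then show ?thesis by (simp add: sscale_def)
    next
      case False
      then show ?thesis using \<rho>(8) assms(1,2) by (simp add: sscale_def F.M.smult_l_null[simplified])
    qed
  qed
  then have "l (br X Y m) = l (br X' Y m)" if "linear_functional (fibre A m) l" for l
    using lf_br_bump[OF that assms(1,3) \<rho>(1,2,3,7)] lf_br_bump[OF that assms(2,3) \<rho>(1,2,3,7)] by simp
  then show ?thesis using assms by (intro br_eqI) auto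
qed

lemma br_swap_eq:
  assumes "X \<in> Sec" "Y \<in> Sec" "X' \<in> Sec" "Y' \<in> Sec" "br X Y m = br X' Y' m"
  shows "br Y X m = br Y' X' m"
proof (rule br_eqI)
  show "l (br Y X m) = l (br Y' X' m)" if "linear_functional (fibre A m) l" for l
    using lf_br_skew[OF that assms(1,2)] lf_br_skew[OF that assms(3,4)] assms(5) by simp
qed (use assms in simp_all)

lemma br_cong_right:
  assumes "X \<in> Sec" "Y \<in> Sec" "Y' \<in> Sec" "open W" "m \<in> W" "\<forall>x\<in>W. Y x = Y' x"
  shows "br X Y m = br X Y' m"
  using br_swap_eq[OF assms(2,1,3,1) br_cong_left[OF assms(2,3,1,4-6)]] .

lemma sec_finsum [simp]:
  "(\<And>i. i \<in> I \<Longrightarrow> smooth_fun M UNIV (c i)) \<Longrightarrow> (\<And>i. i \<in> I \<Longrightarrow> s i \<in> Sec) \<Longrightarrow>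
    (\<lambda>x. \<Oplus>\<^bsub>fibre A x\<^esub>i\<in>I. c i x \<odot>\<^bsub>fibre A x\<^esub> s i x) \<in> Sec"
  by (rule section_finsum) auto

lemma lf_br_finsum_left:
  assumes l: "linear_functional (fibre A m) l" and "finite I"
    "\<And>i. i \<in> I \<Longrightarrow> smooth_fun M UNIV (c i)" "\<And>i. i \<in> I \<Longrightarrow> s i \<in> Sec" "Y \<in> Sec"
  shows "l (br (\<lambda>x. \<Oplus>\<^bsub>fibre A x\<^esub>i\<in>I. c i x \<odot>\<^bsub>fibre A x\<^esub> s i x) Y m)
    = (\<Sum>i\<in>I. c i m * l (br (s i) Y m) - anc m (Y m) (c i) * l (s i m))"
  using assms(2-4)
proof (induction I)
  case empty
  have "(\<lambda>x. \<Oplus>\<^bsub>fibre A x\<^esub>i\<in>{}. c i x \<odot>\<^bsub>fibre A x\<^esub> s i x) = szero A"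
    by (simp add: szero_def)
  then show ?case using assms(5) by (simp add: lf_sec[OF l])
next
  case (insert i I)
  have "(\<lambda>x. \<Oplus>\<^bsub>fibre A x\<^esub>i\<in>insert i I. c i x \<odot>\<^bsub>fibre A x\<^esub> s i x)
    = sadd A (sscale A (c i) (s i)) (\<lambda>x. \<Oplus>\<^bsub>fibre A x\<^esub>i\<in>I. c i x \<odot>\<^bsub>fibre A x\<^esub> s i x)"
    unfolding sadd_def sscale_def
    using insert.prems insert.hyps by (intro ext F.M.finsum_insert) auto
  then show ?case
    using insert assms(5) by (simp add: lf_sec[OF l])
qed

text \<open>Locality and the Leibniz rule in the first argument. All later use of first derivatives
  goes through this formula: they occur as derivatives of coefficients along the anchor of
  \<open>Y\<close>.\<close>

lemma br_expand:
  assumes "X \<in> Sec" "Y \<in> Sec" "finite I" "open W" "m \<in> W"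
    "\<And>i. i \<in> I \<Longrightarrow> smooth_fun M UNIV (c i)" "\<And>i. i \<in> I \<Longrightarrow> s i \<in> Sec"
    "\<forall>x\<in>W. X x = (\<Oplus>\<^bsub>fibre A x\<^esub>i\<in>I. c i x \<odot>\<^bsub>fibre A x\<^esub> s i x)"
    and l: "linear_functional (fibre A m) l"
  shows "l (br X Y m) = (\<Sum>i\<in>I. c i m * l (br (s i) Y m) - anc m (Y m) (c i) * l (s i m))"
proof -
  have "br X Y m = br (\<lambda>x. \<Oplus>\<^bsub>fibre A x\<^esub>i\<in>I. c i x \<odot>\<^bsub>fibre A x\<^esub> s i x) Y m"
    by (rule br_cong_left[OF _ _ _ assms(4,5)]) (use assms in auto)
  then show ?thesis using lf_br_finsum_left[OF l assms(3) assms(6,7) assms(2)] by simp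
qed

text \<open>In the expansion of \<open>X\<close> all \<open>c i m\<close> vanish, and so does the
  anchor of \<open>Y\<close> at \<open>m\<close>; both kinds of terms disappear.\<close>

lemma br_zero_zero:
  assumes "X \<in> Sec" "Y \<in> Sec" "X m = \<zero>\<^bsub>fibre A m\<^esub>" "Y m = \<zero>\<^bsub>fibre A m\<^esub>"
  shows "br X Y m = \<zero>\<^bsub>fibre A m\<^esub>"
proof (rule br_eqI)
  fix l assume l: "linear_functional (fibre A m) l"
  obtain W r s c where W: "\<forall>i<r. s i \<in> Sec" "\<forall>i<r. smooth_fun M UNIV (c i)"
    "m \<in> W" "W \<subseteq> UNIV" "local_frame M A W r s" "\<forall>x\<in>W. X x = scomb A r c s x"
    by (rule section_expand[OF assms(1) open_UNIV UNIV_I])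
  note lin = F.linear_functional_coeff[OF frame_basis[OF W(5,3)]]
  have "c i m = 0" if i: "i < r" for i
  proof -
    have "coeff (fibre A m) r (\<lambda>i. s i m) (X m) i = c i m"
      using W(3,6) F.coeff_unique[OF frame_basis[OF W(5,3)] i, of "\<lambda>i. c i m"] by (simp add: scomb_def)
    then show ?thesis using F.lf_zero[OF lin[OF i]] assms(3) by simp
  qed
  moreover have "anc m (Y m) (c i) = 0" for i using assms(4) anchor_simps(1) by simp
  ultimately show "l (br X Y m) = l \<zero>\<^bsub>fibre A m\<^esub>"
    using br_expand[OF assms(1,2) finite_lessThan frame_open[OF W(5)] W(3) _ _ W(6)[unfolded scomb_def] l] W(1,2)
    by (simp add: F.lf_zero[OF l])
qed (use assms in simp_all)

text \<open>The difference of \<open>X\<close> and \<open>X'\<close> vanishes at \<open>m\<close>,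
  and so does \<open>Y\<close>.\<close>

lemma br_value:
  assumes "X \<in> Sec" "X' \<in> Sec" "Y \<in> Sec" "X m = X' m" "Y m = \<zero>\<^bsub>fibre A m\<^esub>"
  shows "br X Y m = br X' Y m"
proof (rule br_eqI)
  fix l assume l: "linear_functional (fibre A m) l"
  have "ssub X X' m = \<zero>\<^bsub>fibre A m\<^esub>"
    by (rule br_eqI) (use assms in \<open>auto simp: lf_ssub F.lf_zero\<close>)
  then have "br (ssub X X') Y m = \<zero>\<^bsub>fibre A m\<^esub>" using assms by (intro br_zero_zero) auto
  then show "l (br X Y m) = l (br X' Y m)"
    using assms lf_br_ssub_left[OF l assms(1,2,3)] F.lf_zero[OF l] by simp
qed (use assms in simp_all)

lemma jet_eq_cong:
  assumes W: "open W" "m \<in> W" "\<forall>x\<in>W. \<sigma> x = \<sigma>' x" "\<forall>x\<in>W. \<tau> x = \<tau>' x" and j: "jet_eq M A m \<sigma> \<tau>"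
  shows "jet_eq M A m \<sigma>' \<tau>'"
proof -
  obtain U r s c d where U: "m \<in> U" "local_frame M A U r s"
     "\<forall>i<r. smooth_fun M U (c i) \<and> smooth_fun M U (d i)"
     "\<forall>x\<in>U. \<sigma> x = scomb A r c s x \<and> \<tau> x = scomb A r d s x"
     "\<forall>i<r. c i m = d i m \<and> (\<forall>v\<in>carrier (tangent_space M m). v (c i) = v (d i))"
    using j unfolding jet_eq_def by (elim exE conjE)
  have op: "open (U \<inter> W)" using frame_open[OF U(2)] W(1) by (rule open_Int)
  have "\<forall>i<r. smooth_fun M (U \<inter> W) (c i) \<and> smooth_fun M (U \<inter> W) (d i)"
    using U(3) smooth_fun_subset[of U _ "U \<inter> W"] by simp
  moreover have "\<forall>x\<in>U \<inter> W. \<sigma>' x = scomb A r c s x \<and> \<tau>' x = scomb A r d s x"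
  proof
    fix x assume x: "x \<in> U \<inter> W"
    then have "\<sigma>' x = \<sigma> x" "\<tau>' x = \<tau> x" using W(3,4) by auto
    then show "\<sigma>' x = scomb A r c s x \<and> \<tau>' x = scomb A r d s x" using U(4) x by simp
  qed
  ultimately show ?thesis
    unfolding jet_eq_def
    by (intro exI[of _ "U \<inter> W"] exI[of _ r] exI[of _ s] exI[of _ c] exI[of _ d] conjI)
      (use U(1,5) W(2) local_frame_subset[OF U(2) op] in auto)
qed

lemma local_sections_extend:
  assumes "\<sigma> \<in> local_sections A m"
  obtains X W where "X \<in> Sec" "open W" "m \<in> W" "\<forall>x\<in>W. X x = \<sigma> x"
proof -
  obtain U where U: "open U" "m \<in> U" "\<sigma> \<in> sections A U" using assms unfolding local_sections_def by blast
  show ?thesis by (rule section_extend[OF U]) (rule that)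
qed

lemma sec_local: "X \<in> Sec \<Longrightarrow> X \<in> local_sections A m"
  unfolding local_sections_def using open_UNIV by blast

lemma jet_cong:
  assumes "open W" "m \<in> W" "\<forall>x\<in>W. \<sigma> x = \<sigma>' x"
  shows "jet M A m \<sigma> = jet M A m \<sigma>'"
proof -
  have "jet_eq M A m \<sigma> \<tau> \<longleftrightarrow> jet_eq M A m \<sigma>' \<tau>" for \<tau>
    using jet_eq_cong[OF assms(1,2,3), of \<tau> \<tau>] jet_eq_cong[OF assms(1,2), of \<sigma>' \<sigma> \<tau> \<tau>] assms(3) by auto
  then show ?thesis by (simp add: jet_def)
qed

end

subsection \<open>First jets of sections of a transitive Lie algebroid\<close>

lemma image_constant_singleton: "(\<And>x. x \<in> S \<Longrightarrow> f x = c) \<Longrightarrow> S \<noteq> {} \<Longrightarrow> f ` S = {c}"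
  by auto

locale transitive_algebroid = algebroid M A
  for M :: "('m::{t2_space, second_countable_topology}, 'e::euclidean_space) atlas"
    and A :: "('m, 'v) lie_algebroid" +
  assumes transitive: "transitive M A"
begin

lemma anchor_onto:
  assumes "v \<in> carrier (tangent_space M m)"
  obtains Y where "Y \<in> Sec" "anc m (Y m) = v"
proof -
  obtain w where w: "w \<in> carrier (fibre A m)" "anc m w = v"
    using transitive assms unfolding transitive_def by (metis imageE)
  obtain Y where "Y \<in> Sec" "Y m = w" by (rule value_extend[OF w(1)])
  then show ?thesis using that w by simp
qed

text \<open>By transitivity the 1-jet of \<open>X\<close> at \<open>m\<close> is determined by the value of \<open>X\<close> and the operator
  \<open>Y \<mapsto> [X, Y](m)\<close>. This replaces coordinates throughout.\<close>

lemma jet_eq_imp_br: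
  assumes X: "X \<in> Sec" "X' \<in> Sec" and j: "jet_eq M A m X X'"
  shows "X m = X' m" and "Y \<in> Sec \<Longrightarrow> br X Y m = br X' Y m"
proof -
  obtain U r s c d where U: "m \<in> U" "local_frame M A U r s"
     "\<forall>i<r. smooth_fun M U (c i) \<and> smooth_fun M U (d i)"
     "\<forall>x\<in>U. X x = scomb A r c s x \<and> X' x = scomb A r d s x"
     "\<forall>i<r. c i m = d i m \<and> (\<forall>v\<in>carrier (tangent_space M m). v (c i) = v (d i))"
    using j unfolding jet_eq_def by (elim exE conjE)
  note op = frame_open[OF U(2)]
  have "\<forall>i<r. s i \<in> sections A U" using frame_section[OF U(2)] by simp
  then obtain S W1 where S: "\<forall>i<r. S i \<in> Sec" "open W1" "m \<in> W1" "W1 \<subseteq> U" "\<forall>i<r. \<forall>x\<in>W1. S i x = s i x"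
    by (rule sections_extend[OF op U(1)])
  have "\<forall>i<r. smooth_fun M U (c i)" using U(3) by simp
  then obtain c' W2 where c': "\<forall>i<r. smooth_fun M UNIV (c' i)" "open W2" "m \<in> W2" "W2 \<subseteq> U" "\<forall>i<r. \<forall>x\<in>W2. c' i x = c i x"
    by (rule smooth_funs_extend[OF op U(1)])
  have "\<forall>i<r. smooth_fun M U (d i)" using U(3) by simp
  then obtain d' W3 where d': "\<forall>i<r. smooth_fun M UNIV (d' i)" "open W3" "m \<in> W3" "W3 \<subseteq> U" "\<forall>i<r. \<forall>x\<in>W3. d' i x = d i x"
    by (rule smooth_funs_extend[OF op U(1)])
  define W where "W = W1 \<inter> W2 \<inter> W3"
  have W: "open W" "m \<in> W" "W \<subseteq> U" unfolding W_def using S c' d' by auto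
  have sc: "S i x \<in> carrier (fibre A x)" if "i < r" for i x using S(1) that by simp
  have XW: "\<forall>x\<in>W. X x = (\<Oplus>\<^bsub>fibre A x\<^esub>i\<in>{..<r}. c' i x \<odot>\<^bsub>fibre A x\<^esub> S i x)"
  proof
    fix x assume x: "x \<in> W"
    have "X x = scomb A r c s x" using U(4) x W(3) by blast
    also have "\<dots> = (\<Oplus>\<^bsub>fibre A x\<^esub>i\<in>{..<r}. c' i x \<odot>\<^bsub>fibre A x\<^esub> S i x)"
      unfolding scomb_def
    proof (rule F.finsum_cong)
      fix i assume i: "i \<in> {..<r}"
      show "c i x \<odot>\<^bsub>fibre A x\<^esub> s i x = c' i x \<odot>\<^bsub>fibre A x\<^esub> S i x"
        using x i S(5) c'(5) by (simp add: W_def)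
      show "c' i x \<odot>\<^bsub>fibre A x\<^esub> S i x \<in> carrier (fibre A x)" using sc i by simp
    qed
    finally show "X x = \<dots>" .
  qed
  have X'W: "\<forall>x\<in>W. X' x = (\<Oplus>\<^bsub>fibre A x\<^esub>i\<in>{..<r}. d' i x \<odot>\<^bsub>fibre A x\<^esub> S i x)"
  proof
    fix x assume x: "x \<in> W"
    have "X' x = scomb A r d s x" using U(4) x W(3) by blast
    also have "\<dots> = (\<Oplus>\<^bsub>fibre A x\<^esub>i\<in>{..<r}. d' i x \<odot>\<^bsub>fibre A x\<^esub> S i x)"
      unfolding scomb_def
    proof (rule F.finsum_cong)
      fix i assume i: "i \<in> {..<r}"
      show "d i x \<odot>\<^bsub>fibre A x\<^esub> s i x = d' i x \<odot>\<^bsub>fibre A x\<^esub> S i x"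
        using x i S(5) d'(5) by (simp add: W_def)
      show "d' i x \<odot>\<^bsub>fibre A x\<^esub> S i x \<in> carrier (fibre A x)" using sc i by simp
    qed
    finally show "X' x = \<dots>" .
  qed
  have eqv: "c' i m = d' i m" if "i < r" for i
    using U(5) c'(3,5) d'(3,5) that by simp
  have eqd: "v (c' i) = v (d' i)" if "i < r" "v \<in> carrier (tangent_space M m)" for i v
  proof -
    have "v (c' i) = v (c i)" by (rule tangent_apply_cong[OF that(2) c'(2,3)]) (use c'(5) that in simp)
    moreover have "v (d' i) = v (d i)" by (rule tangent_apply_cong[OF that(2) d'(2,3)]) (use d'(5) that in simp)
    ultimately show ?thesis using U(5) that by simp
  qed
  show "X m = X' m"
    using XW X'W W(2) eqv sc by (auto intro!: F.finsum_cong)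
  show "br X Y m = br X' Y m" if Y: "Y \<in> Sec"
  proof (rule br_eqI)
    fix l assume l: "linear_functional (fibre A m) l"
    show "l (br X Y m) = l (br X' Y m)"
      using br_expand[OF X(1) Y finite_lessThan W(1,2) _ _ XW l]
        br_expand[OF X(2) Y finite_lessThan W(1,2) _ _ X'W l] S(1) c'(1) d'(1) eqv
        eqd[of _ "anc m (Y m)"] Y by simp
  qed (use X Y in simp_all)
qed

text \<open>Transitivity enters here: each tangent vector is the anchor of some \<open>Y m\<close>,
  and the bracket with \<open>Y\<close> then reveals the derivatives of the components along
  it.\<close>

lemma br_imp_jet_eq:
  assumes X: "X \<in> Sec" "X' \<in> Sec" and v: "X m = X' m" and b: "\<And>Y. Y \<in> Sec \<Longrightarrow> br X Y m = br X' Y m"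
  shows "jet_eq M A m X X'"
proof -
  obtain U r s where U: "m \<in> U" "U \<subseteq> UNIV" "local_frame M A U r s" "\<forall>i<r. s i \<in> Sec"
    by (rule global_frame[OF open_UNIV UNIV_I])
  note op = frame_open[OF U(3)]
  have sU: "X \<in> sections A U" "X' \<in> sections A U" using section_restrict[OF _ open_UNIV op] X by auto
  obtain c where c: "\<forall>i<r. smooth_fun M U (c i)" "\<forall>x\<in>U. X x = scomb A r c s x"
    using sU(1) unfolding frame_section_iff[OF U(3) op order_refl] by (elim exE conjE)
  obtain d where d: "\<forall>i<r. smooth_fun M U (d i)" "\<forall>x\<in>U. X' x = scomb A r d s x"
    using sU(2) unfolding frame_section_iff[OF U(3) op order_refl] by (elim exE conjE)
  obtain c' W2 where c': "\<forall>i<r. smooth_fun M UNIV (c' i)" "open W2" "m \<in> W2" "W2 \<subseteq> U" "\<forall>i<r. \<forall>x\<in>W2. c' i x = c i x"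
    by (rule smooth_funs_extend[OF op U(1) c(1)])
  obtain d' W3 where d': "\<forall>i<r. smooth_fun M UNIV (d' i)" "open W3" "m \<in> W3" "W3 \<subseteq> U" "\<forall>i<r. \<forall>x\<in>W3. d' i x = d i x"
    by (rule smooth_funs_extend[OF op U(1) d(1)])
  have sc: "s i x \<in> carrier (fibre A x)" if "i < r" for i x using U(4) that by simp
  have XW: "\<forall>x\<in>W2. X x = (\<Oplus>\<^bsub>fibre A x\<^esub>i\<in>{..<r}. c' i x \<odot>\<^bsub>fibre A x\<^esub> s i x)"
  proof
    fix x assume x: "x \<in> W2"
    have "X x = scomb A r c s x" using c(2) x c'(4) by blast
    also have "\<dots> = (\<Oplus>\<^bsub>fibre A x\<^esub>i\<in>{..<r}. c' i x \<odot>\<^bsub>fibre A x\<^esub> s i x)"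
      unfolding scomb_def using x c'(5) sc by (intro F.finsum_cong) auto
    finally show "X x = \<dots>" .
  qed
  have X'W: "\<forall>x\<in>W3. X' x = (\<Oplus>\<^bsub>fibre A x\<^esub>i\<in>{..<r}. d' i x \<odot>\<^bsub>fibre A x\<^esub> s i x)"
  proof
    fix x assume x: "x \<in> W3"
    have "X' x = scomb A r d s x" using d(2) x d'(4) by blast
    also have "\<dots> = (\<Oplus>\<^bsub>fibre A x\<^esub>i\<in>{..<r}. d' i x \<odot>\<^bsub>fibre A x\<^esub> s i x)"
      unfolding scomb_def using x d'(5) sc by (intro F.finsum_cong) auto
    finally show "X' x = \<dots>" .
  qed
  note basis = frame_basis[OF U(3,1)]
  have eqv: "c' i m = d' i m" if i: "i < r" for i
    using F.coeff_unique[OF basis i, of "\<lambda>i. c' i m"] F.coeff_unique[OF basis i, of "\<lambda>i. d' i m"]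
      XW X'W c'(3) d'(3) v by simp
  have eqd: "w (c' j) = w (d' j)" if j: "j < r" and w: "w \<in> carrier (tangent_space M m)" for j w
  proof -
    obtain Y where Y: "Y \<in> Sec" "anc m (Y m) = w" by (rule anchor_onto[OF w])
    let ?l = "\<lambda>v. coeff (fibre A m) r (\<lambda>i. s i m) v j"
    note l = F.linear_functional_coeff[OF basis j]
    have "?l (br X Y m) = (\<Sum>i<r. c' i m * ?l (br (s i) Y m) - w (c' i) * ?l (s i m))"
      using br_expand[OF X(1) Y(1) finite_lessThan c'(2,3) _ _ XW l] c'(1) U(4) Y(2) by simp
    moreover have "?l (br X' Y m) = (\<Sum>i<r. d' i m * ?l (br (s i) Y m) - w (d' i) * ?l (s i m))"
      using br_expand[OF X(2) Y(1) finite_lessThan d'(2,3) _ _ X'W l] d'(1) U(4) Y(2) by simp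
    \<comment> \<open>The values agree, so the terms with \<open>br (s i) Y\<close> cancel and only
      the derivative terms remain.\<close>
    ultimately have "(\<Sum>i<r. w (c' i) * ?l (s i m)) = (\<Sum>i<r. w (d' i) * ?l (s i m))"
      using b[OF Y(1)] eqv by (simp add: sum_subtractf)
    moreover have "?l (s i m) = (if i = j then 1 else 0)" if "i < r" for i
      using F.coeff_basis[OF basis that j] .
    ultimately show ?thesis using j by (simp add: mult_delta_right)
  qed
  have cc: "v (c i) = v (c' i)" "v (d i) = v (d' i)" if "i < r" "v \<in> carrier (tangent_space M m)" for i v
  proof -
    show "v (c i) = v (c' i)" by (rule tangent_apply_cong[OF that(2) c'(2,3)]) (use c'(5) that in simp)
    show "v (d i) = v (d' i)" by (rule tangent_apply_cong[OF that(2) d'(2,3)]) (use d'(5) that in simp)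
  qed
  have "v (c i) = v (d i)" if "i < r" "v \<in> carrier (tangent_space M m)" for i v
    using eqd[OF that] cc[OF that] by simp
  then have "\<forall>i<r. c i m = d i m \<and> (\<forall>v\<in>carrier (tangent_space M m). v (c i) = v (d i))"
    using eqv c'(3,5) d'(3,5) by simp
  then show ?thesis
    unfolding jet_eq_def
    by (intro exI[of _ U] exI[of _ r] exI[of _ s] exI[of _ c] exI[of _ d] conjI) (use U c d in auto)
qed

text \<open>\<open>jet_eq\<close> refers to some frame, so its transitivity is not evident. The
  characterization by brackets supplies it, and then equal data give equal classes.\<close>

lemma jet_eqI:
  assumes "X \<in> Sec" "X' \<in> Sec" "X m = X' m" "\<And>Y. Y \<in> Sec \<Longrightarrow> br X Y m = br X' Y m"
  shows "jet M A m X = jet M A m X'"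
proof -
  have "jet_eq M A m X \<tau> \<longleftrightarrow> jet_eq M A m X' \<tau>" if \<tau>: "\<tau> \<in> local_sections A m" for \<tau>
  proof -
    obtain T W where T: "T \<in> Sec" "open W" "m \<in> W" "\<forall>x\<in>W. T x = \<tau> x"
      by (rule local_sections_extend[OF \<tau>])
    have W: "\<forall>x\<in>W. \<tau> x = T x" using T(4) by simp
    have eq: "jet_eq M A m Z \<tau> \<longleftrightarrow> jet_eq M A m Z T" for Z
      using jet_eq_cong[OF T(2,3) _ T(4), of Z Z] jet_eq_cong[OF T(2,3) _ W, of Z Z] by blast
    show ?thesis unfolding eq
      using jet_eq_imp_br[OF assms(1) T(1)] jet_eq_imp_br[OF assms(2) T(1)] assms(3,4)
        br_imp_jet_eq[OF assms(1) T(1)] br_imp_jet_eq[OF assms(2) T(1)]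
      by metis
  qed
  then show ?thesis unfolding jet_def by blast
qed

lemma jet_self: "X \<in> Sec \<Longrightarrow> X \<in> jet M A m X"
  unfolding jet_def using sec_local br_imp_jet_eq by simp

lemma jet_eqD:
  assumes "X \<in> Sec" "X' \<in> Sec" "jet M A m X = jet M A m X'"
  shows "X m = X' m" and "Y \<in> Sec \<Longrightarrow> br X Y m = br X' Y m"
proof -
  have "X' \<in> jet M A m X" using jet_self[OF assms(2)] assms(3) by simp
  then have "jet_eq M A m X X'" by (simp add: jet_def)
  then show "X m = X' m" "Y \<in> Sec \<Longrightarrow> br X Y m = br X' Y m"
    using jet_eq_imp_br[OF assms(1,2)] by auto
qed

lemma jet_eq_lfI:
  assumes "X \<in> Sec" "X' \<in> Sec" "\<And>l. linear_functional (fibre A m) l \<Longrightarrow> l (X m) = l (X' m)"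
    "\<And>l Y. linear_functional (fibre A m) l \<Longrightarrow> Y \<in> Sec \<Longrightarrow> l (br X Y m) = l (br X' Y m)"
  shows "jet M A m X = jet M A m X'"
proof (rule jet_eqI[OF assms(1,2)])
  show "X m = X' m" by (rule br_eqI[of _ m]) (use assms in simp_all)
  show "br X Y m = br X' Y m" if "Y \<in> Sec" for Y by (rule br_eqI[of _ m]) (use assms that in simp_all)
qed

text \<open>The elements of a jet are local sections; each has the germ of a global one, to which
  the bracket applies.\<close>

lemma mem_jet:
  assumes "X \<in> Sec" "\<sigma> \<in> jet M A m X"
  obtains S W where "S \<in> Sec" "open W" "m \<in> W" "\<forall>x\<in>W. S x = \<sigma> x" "jet M A m S = jet M A m X"
proof -
  have \<sigma>: "\<sigma> \<in> local_sections A m" "jet_eq M A m X \<sigma>" using assms(2) by (auto simp: jet_def)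
  obtain S W where S: "S \<in> Sec" "open W" "m \<in> W" "\<forall>x\<in>W. S x = \<sigma> x"
    by (rule local_sections_extend[OF \<sigma>(1)])
  then have "\<forall>x\<in>W. \<sigma> x = S x" by simp
  from jet_eq_cong[OF S(2,3) _ this \<sigma>(2), of X] have "jet_eq M A m X S" by simp
  from jet_eq_imp_br[OF assms(1) S(1) this] have "jet M A m X = jet M A m S"
    by (intro jet_eqI assms(1) S(1)) auto
  then show ?thesis using that S by simp
qed

section \<open>The vector space of jets at a point\<close>

abbreviation J :: "'m \<Rightarrow> (real, ('m \<Rightarrow> 'v) set) module" where "J \<equiv> jet_space M A"

lemma jet_carrier: "carrier (J m) = jet M A m ` Sec"
proof -
  have "jet M A m \<sigma> \<in> jet M A m ` Sec" if \<sigma>: "\<sigma> \<in> local_sections A m" for \<sigma>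
  proof -
    obtain X W where "X \<in> Sec" "open W" "m \<in> W" "\<forall>x\<in>W. X x = \<sigma> x"
      by (rule local_sections_extend[OF \<sigma>])
    then show ?thesis using jet_cong[of W m X \<sigma>] by blast
  qed
  then show ?thesis using sec_local unfolding jet_space_def by auto
qed

lemma jet_in_carrier [simp]: "X \<in> Sec \<Longrightarrow> jet M A m X \<in> carrier (J m)"
  by (simp add: jet_carrier)

lemma jet_zero: "\<zero>\<^bsub>J m\<^esub> = jet M A m (szero A)"
  by (simp add: jet_space_def)

text \<open>The sum in \<open>jet_space\<close> is a union over all pairs of representatives. By the
  bracket criterion every pair yields the same jet, so the union collapses.\<close>

lemma jet_add:
  assumes "X \<in> Sec" "Y \<in> Sec"
  shows "jet M A m X \<oplus>\<^bsub>J m\<^esub> jet M A m Y = jet M A m (sadd A X Y)"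
proof -
  have "jet M A m (sadd A \<sigma> \<tau>) = jet M A m (sadd A X Y)"
    if \<sigma>: "\<sigma> \<in> jet M A m X" and \<tau>: "\<tau> \<in> jet M A m Y" for \<sigma> \<tau>
  proof -
    obtain S W where S: "S \<in> Sec" "open W" "m \<in> W" "\<forall>x\<in>W. S x = \<sigma> x" "jet M A m S = jet M A m X"
      by (rule mem_jet[OF assms(1) \<sigma>])
    obtain T W' where T: "T \<in> Sec" "open W'" "m \<in> W'" "\<forall>x\<in>W'. T x = \<tau> x" "jet M A m T = jet M A m Y"
      by (rule mem_jet[OF assms(2) \<tau>])
    have "open (W \<inter> W')" using S(2) T(2) by (rule open_Int)
    then have "jet M A m (sadd A \<sigma> \<tau>) = jet M A m (sadd A S T)"
      by (rule jet_cong) (use S T in \<open>auto simp: sadd_def\<close>)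
    also have "\<dots> = jet M A m (sadd A X Y)"
    proof (rule jet_eq_lfI)
      show "l (sadd A S T m) = l (sadd A X Y m)" if l: "linear_functional (fibre A m) l" for l
        using jet_eqD(1)[OF S(1) assms(1) S(5)] jet_eqD(1)[OF T(1) assms(2) T(5)] S(1) T(1) assms
        by (simp add: lf_sec[OF l])
      show "l (br (sadd A S T) Z m) = l (br (sadd A X Y) Z m)"
        if l: "linear_functional (fibre A m) l" and Z: "Z \<in> Sec" for l Z
        using jet_eqD(2)[OF S(1) assms(1) S(5) Z] jet_eqD(2)[OF T(1) assms(2) T(5) Z] S(1) T(1) assms Z
        by (simp add: lf_sec[OF l])
    qed (use S T assms in simp_all)
    finally show ?thesis .
  qed
  moreover have "jet M A m X \<noteq> {}" "jet M A m Y \<noteq> {}" using jet_self assms by auto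
  ultimately have "(\<Union>\<sigma>\<in>jet M A m X. \<Union>\<tau>\<in>jet M A m Y. jet M A m (sadd A \<sigma> \<tau>)) = jet M A m (sadd A X Y)"
    by simp
  then show ?thesis by (simp add: jet_space_def)
qed

lemma jet_smult:
  assumes "X \<in> Sec"
  shows "c \<odot>\<^bsub>J m\<^esub> jet M A m X = jet M A m (sscale A (\<lambda>x. c) X)"
proof -
  have "jet M A m (sscale A (\<lambda>x. c) \<sigma>) = jet M A m (sscale A (\<lambda>x. c) X)"
    if \<sigma>: "\<sigma> \<in> jet M A m X" for \<sigma>
  proof -
    obtain S W where S: "S \<in> Sec" "open W" "m \<in> W" "\<forall>x\<in>W. S x = \<sigma> x" "jet M A m S = jet M A m X"
      by (rule mem_jet[OF assms(1) \<sigma>])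
    have "jet M A m (sscale A (\<lambda>x. c) \<sigma>) = jet M A m (sscale A (\<lambda>x. c) S)"
      by (rule jet_cong[OF S(2,3)]) (use S in \<open>auto simp: sscale_def\<close>)
    also have "\<dots> = jet M A m (sscale A (\<lambda>x. c) X)"
    proof (rule jet_eq_lfI)
      show "l (sscale A (\<lambda>x. c) S m) = l (sscale A (\<lambda>x. c) X m)" if l: "linear_functional (fibre A m) l" for l
        using jet_eqD(1)[OF S(1) assms(1) S(5)] S(1) assms
        by (simp add: lf_sec[OF l])
      show "l (br (sscale A (\<lambda>x. c) S) Z m) = l (br (sscale A (\<lambda>x. c) X) Z m)"
        if l: "linear_functional (fibre A m) l" and Z: "Z \<in> Sec" for l Z
        using jet_eqD[OF S(1) assms(1) S(5)] S(1) assms Z by (simp add: lf_sec[OF l])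
    qed (use S assms in simp_all)
    finally show ?thesis .
  qed
  moreover have "jet M A m X \<noteq> {}" using jet_self assms by auto
  ultimately have "(\<Union>\<sigma>\<in>jet M A m X. jet M A m (sscale A (\<lambda>x. c) \<sigma>)) = jet M A m (sscale A (\<lambda>x. c) X)"
    by simp
  then show ?thesis by (simp add: jet_space_def)
qed

lemma jet_proj_jet [simp]:
  assumes "X \<in> Sec"
  shows "jet_proj m (jet M A m X) = X m"
proof -
  have "\<sigma> m = X m" if \<sigma>: "\<sigma> \<in> jet M A m X" for \<sigma>
  proof -
    obtain S W where S: "S \<in> Sec" "open W" "m \<in> W" "\<forall>x\<in>W. S x = \<sigma> x" "jet M A m S = jet M A m X"
      by (rule mem_jet[OF assms \<sigma>])
    then show ?thesis using jet_eqD(1)[OF S(1) assms S(5)] by auto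
  qed
  moreover have "jet M A m X \<noteq> {}" using jet_self assms by auto
  ultimately have "(\<lambda>\<sigma>. \<sigma> m) ` jet M A m X = {X m}"
    by (rule image_constant_singleton)
  then show ?thesis by (simp add: jet_proj_def)
qed

text \<open>The bracket with a jet in the first argument. The chosen representative is immaterial by
  \<open>jet_eqD\<close>.\<close>

definition jet_act :: "'m \<Rightarrow> ('m \<Rightarrow> 'v) set \<Rightarrow> ('m \<Rightarrow> 'v) \<Rightarrow> 'v" where
  "jet_act m j Y = br (SOME X. X \<in> Sec \<and> jet M A m X = j) Y m"

lemma jet_act_jet [simp]:
  assumes "X \<in> Sec" "Y \<in> Sec"
  shows "jet_act m (jet M A m X) Y = br X Y m"
proof -
  let ?X = "SOME X'. X' \<in> Sec \<and> jet M A m X' = jet M A m X"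
  have "?X \<in> Sec \<and> jet M A m ?X = jet M A m X" by (rule someI[of _ X]) (use assms in simp)
  then show ?thesis unfolding jet_act_def using jet_eqD(2)[of ?X X m Y] assms by simp
qed

lemma jet_carrierE:
  assumes "j \<in> carrier (J m)"
  obtains X where "X \<in> Sec" "j = jet M A m X"
  using assms unfolding jet_carrier by blast

text \<open>All axioms are reduced to identities between global representatives, tested by
  functionals on values and on brackets.\<close>

lemma jet_module: "Module.module real_ring (J m)"
proof (intro moduleI cring_real_ring abelian_groupI)
  fix x assume "x \<in> carrier (J m)"
  then obtain X where X: "X \<in> Sec" "x = jet M A m X" by (rule jet_carrierE)
  have "jet M A m (sscale A (\<lambda>x. -1) X) \<oplus>\<^bsub>J m\<^esub> x = \<zero>\<^bsub>J m\<^esub>"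
    using X by (simp add: jet_add jet_zero) (rule jet_eq_lfI; simp add: lf_sec)
  then show "\<exists>y\<in>carrier (J m). y \<oplus>\<^bsub>J m\<^esub> x = \<zero>\<^bsub>J m\<^esub>"
    using X by (intro bexI[of _ "jet M A m (sscale A (\<lambda>x. -1) X)"]) auto
  show "\<zero>\<^bsub>J m\<^esub> \<oplus>\<^bsub>J m\<^esub> x = x"
    using X by (simp add: jet_add jet_zero) (rule jet_eq_lfI; simp add: lf_sec)
  show "\<one>\<^bsub>real_ring\<^esub> \<odot>\<^bsub>J m\<^esub> x = x"
    using X by (simp add: jet_smult) (rule jet_eq_lfI; simp add: lf_sec)
  show "a \<odot>\<^bsub>J m\<^esub> x \<in> carrier (J m)" for a
    using X by (simp add: jet_smult)
  show "(a \<otimes>\<^bsub>real_ring\<^esub> b) \<odot>\<^bsub>J m\<^esub> x = a \<odot>\<^bsub>J m\<^esub> (b \<odot>\<^bsub>J m\<^esub> x)" for a b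
    using X by (simp add: jet_smult) (rule jet_eq_lfI; simp add: lf_sec)
  show "(a \<oplus>\<^bsub>real_ring\<^esub> b) \<odot>\<^bsub>J m\<^esub> x = a \<odot>\<^bsub>J m\<^esub> x \<oplus>\<^bsub>J m\<^esub> b \<odot>\<^bsub>J m\<^esub> x" for a b
    using X by (simp add: jet_smult jet_add) (rule jet_eq_lfI; simp add: lf_sec algebra_simps)
  fix y assume "y \<in> carrier (J m)"
  then obtain Y where Y: "Y \<in> Sec" "y = jet M A m Y" by (rule jet_carrierE)
  show "x \<oplus>\<^bsub>J m\<^esub> y \<in> carrier (J m)" using X Y by (simp add: jet_add)
  show "x \<oplus>\<^bsub>J m\<^esub> y = y \<oplus>\<^bsub>J m\<^esub> x"
    using X Y by (simp add: jet_add) (rule jet_eq_lfI; simp add: lf_sec)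
  show "a \<odot>\<^bsub>J m\<^esub> (x \<oplus>\<^bsub>J m\<^esub> y) = a \<odot>\<^bsub>J m\<^esub> x \<oplus>\<^bsub>J m\<^esub> a \<odot>\<^bsub>J m\<^esub> y" for a
    using X Y by (simp add: jet_smult jet_add) (rule jet_eq_lfI; simp add: lf_sec algebra_simps)
  fix z assume "z \<in> carrier (J m)"
  then obtain Z where Z: "Z \<in> Sec" "z = jet M A m Z" by (rule jet_carrierE)
  show "x \<oplus>\<^bsub>J m\<^esub> y \<oplus>\<^bsub>J m\<^esub> z = x \<oplus>\<^bsub>J m\<^esub> (y \<oplus>\<^bsub>J m\<^esub> z)"
    using X Y Z by (simp add: jet_add) (rule jet_eq_lfI; simp add: lf_sec)
qed (simp add: jet_zero)

lemma jet_proj_closed [simp]: "j \<in> carrier (J m) \<Longrightarrow> jet_proj m j \<in> carrier (fibre A m)"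
  by (erule jet_carrierE) simp

lemma jet_act_closed [simp]: "j \<in> carrier (J m) \<Longrightarrow> Y \<in> Sec \<Longrightarrow> jet_act m j Y \<in> carrier (fibre A m)"
  by (erule jet_carrierE) simp

lemma linear_functional_jet_proj:
  assumes l: "linear_functional (fibre A m) l"
  shows "linear_functional (J m) (\<lambda>j. l (jet_proj m j))"
  unfolding linear_functional_def
  by (auto simp: jet_add jet_smult lf_sec[OF l] elim!: jet_carrierE)

lemma linear_functional_jet_act:
  assumes l: "linear_functional (fibre A m) l" and "Y \<in> Sec"
  shows "linear_functional (J m) (\<lambda>j. l (jet_act m j Y))"
  unfolding linear_functional_def
  using assms(2)
  by (auto simp: jet_add jet_smult lf_sec[OF l] elim!: jet_carrierE)

lemma jet_space_eqI:
  assumes "j \<in> carrier (J m)" "k \<in> carrier (J m)" "jet_proj m j = jet_proj m k"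
    "\<And>Y. Y \<in> Sec \<Longrightarrow> jet_act m j Y = jet_act m k Y"
  shows "j = k"
proof -
  obtain X where X: "X \<in> Sec" "j = jet M A m X" by (rule jet_carrierE[OF assms(1)])
  obtain Y where Y: "Y \<in> Sec" "k = jet M A m Y" by (rule jet_carrierE[OF assms(2)])
  have "X m = Y m" using assms(3) X Y by simp
  moreover have "br X Z m = br Y Z m" if "Z \<in> Sec" for Z using assms(4)[OF that] X Y that by simp
  ultimately show ?thesis unfolding X(2) Y(2) by (intro jet_eqI X(1) Y(1))
qed

text \<open>The functionals \<open>l\<close> after \<open>jet_proj\<close> and \<open>l\<close>
  after \<open>jet_act\<close> already separate, so no basis has to be known.\<close>

lemma separated_jet_space: "separated_space (J m)"
proof (intro separated_space.intro separated_space_axioms.intro real_space.intro jet_module)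
  fix j k assume jk: "j \<in> carrier (J m)" "k \<in> carrier (J m)"
    "\<And>l. linear_functional (J m) l \<Longrightarrow> l j = l k"
  show "j = k"
  proof (rule jet_space_eqI[OF jk(1,2)])
    show "jet_proj m j = jet_proj m k"
      by (rule br_eqI) (use jk linear_functional_jet_proj in auto)
    show "jet_act m j Y = jet_act m k Y" if "Y \<in> Sec" for Y
      by (rule br_eqI) (use that jk linear_functional_jet_act in auto)
  qed
qed

sublocale J: separated_space "J m" for m
  by (rule separated_jet_space)

lemma jet_space_lfI:
  assumes "j \<in> carrier (J m)" "k \<in> carrier (J m)"
    "\<And>l. linear_functional (fibre A m) l \<Longrightarrow> l (jet_proj m j) = l (jet_proj m k)"
    "\<And>l Y. linear_functional (fibre A m) l \<Longrightarrow> Y \<in> Sec \<Longrightarrow> l (jet_act m j Y) = l (jet_act m k Y)"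
  shows "j = k"
proof (rule jet_space_eqI[OF assms(1,2)])
  show "jet_proj m j = jet_proj m k" by (rule br_eqI[of _ m]) (use assms in simp_all)
  show "jet_act m j Y = jet_act m k Y" if "Y \<in> Sec" for Y by (rule br_eqI[of _ m]) (use assms that in simp_all)
qed

end

subsection \<open>The bundle of first jets\<close>

text \<open>Biorthogonality gives independence, and separation by the \<open>k i\<close> forces the
  obvious expansion to hold. This is the tool for exhibiting a frame of jets.\<close>

lemma (in real_space) dual_basis:
  assumes e: "\<And>i. i < n \<Longrightarrow> e i \<in> carrier V"
    and k: "\<And>i. i < n \<Longrightarrow> linear_functional V (k i)"
    and d: "\<And>i j. i < n \<Longrightarrow> j < n \<Longrightarrow> k i (e j) = (if i = j then 1 else 0)"
    and sep: "\<And>v w. v \<in> carrier V \<Longrightarrow> w \<in> carrier V \<Longrightarrow> (\<And>i. i < n \<Longrightarrow> k i v = k i w) \<Longrightarrow> v = w"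
  shows "is_basis V n e" and "v \<in> carrier V \<Longrightarrow> i < n \<Longrightarrow> coeff V n e v i = k i v"
proof -
  have val: "k i (\<Oplus>\<^bsub>V\<^esub>j\<in>{..<n}. c j \<odot>\<^bsub>V\<^esub> e j) = c i" if i: "i < n" for i c
  proof -
    have "k i (\<Oplus>\<^bsub>V\<^esub>j\<in>{..<n}. c j \<odot>\<^bsub>V\<^esub> e j) = (\<Sum>j<n. k i (c j \<odot>\<^bsub>V\<^esub> e j))"
      using e by (intro lf_finsum[OF k[OF i]] smult_closed) auto
    also have "\<dots> = (\<Sum>j<n. if i = j then c j else 0)"
      using e d i by (intro sum.cong) (auto simp: lf_smult[OF k[OF i]])
    finally show ?thesis using i by simp
  qed
  have cl: "(\<Oplus>\<^bsub>V\<^esub>j\<in>{..<n}. c j \<odot>\<^bsub>V\<^esub> e j) \<in> carrier V" for c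
    using e by (intro finsum_closed) auto
  have expand: "(\<Oplus>\<^bsub>V\<^esub>j\<in>{..<n}. k j v \<odot>\<^bsub>V\<^esub> e j) = v" if "v \<in> carrier V" for v
    using val that cl by (intro sep) auto
  show b: "is_basis V n e"
    unfolding is_basis_def bij_betw_def
  proof (intro conjI allI impI e)
    show "inj_on (\<lambda>c. \<Oplus>\<^bsub>V\<^esub>i\<in>{..<n}. c i \<odot>\<^bsub>V\<^esub> e i) ({..<n} \<rightarrow>\<^sub>E UNIV)"
    proof (rule inj_onI)
      fix c c' assume c: "c \<in> {..<n} \<rightarrow>\<^sub>E UNIV" "c' \<in> {..<n} \<rightarrow>\<^sub>E UNIV"
        "(\<Oplus>\<^bsub>V\<^esub>i\<in>{..<n}. c i \<odot>\<^bsub>V\<^esub> e i) = (\<Oplus>\<^bsub>V\<^esub>i\<in>{..<n}. c' i \<odot>\<^bsub>V\<^esub> e i)"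
      have "c i = c' i" if "i < n" for i using val[OF that, of c] val[OF that, of c'] c(3) by simp
      then show "c = c'" using PiE_ext[OF c(1,2)] by simp
    qed
    show "(\<lambda>c. \<Oplus>\<^bsub>V\<^esub>i\<in>{..<n}. c i \<odot>\<^bsub>V\<^esub> e i) ` ({..<n} \<rightarrow>\<^sub>E UNIV) = carrier V"
    proof (intro subset_antisym image_subsetI cl subsetI)
      fix v assume v: "v \<in> carrier V"
      have "(\<Oplus>\<^bsub>V\<^esub>j\<in>{..<n}. restrict (\<lambda>i. k i v) {..<n} j \<odot>\<^bsub>V\<^esub> e j) = (\<Oplus>\<^bsub>V\<^esub>j\<in>{..<n}. k j v \<odot>\<^bsub>V\<^esub> e j)"
        using e by (intro finsum_cong) auto
      then have ve: "v = (\<Oplus>\<^bsub>V\<^esub>j\<in>{..<n}. restrict (\<lambda>i. k i v) {..<n} j \<odot>\<^bsub>V\<^esub> e j)" using expand[OF v] by simp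
      show "v \<in> (\<lambda>c. \<Oplus>\<^bsub>V\<^esub>i\<in>{..<n}. c i \<odot>\<^bsub>V\<^esub> e i) ` ({..<n} \<rightarrow>\<^sub>E UNIV)"
        by (rule image_eqI[where x="restrict (\<lambda>i. k i v) {..<n}"]) (use ve in simp_all)
    qed
  qed
  show "coeff V n e v i = k i v" if "v \<in> carrier V" "i < n"
    using coeff_unique[OF b that(2), of "\<lambda>i. k i v"] expand[OF that(1)] by simp
qed

context algebroid begin

text \<open>\<open>br_expand\<close> with the components of \<open>X\<close> as coefficients. These
  are smooth on \<open>U\<close> only, but the anchor sees just their germs.\<close>

lemma br_frame:
  assumes f: "local_frame M A U r s" "\<forall>i<r. s i \<in> Sec" and x: "x \<in> U" and X: "X \<in> Sec" "Y \<in> Sec"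
    and l: "linear_functional (fibre A x) l"
  shows "l (br X Y x) = (\<Sum>i<r. coeff (fibre A x) r (\<lambda>i. s i x) (X x) i * l (br (s i) Y x)
      - anc x (Y x) (\<lambda>y. coeff (fibre A y) r (\<lambda>i. s i y) (X y) i) * l (s i x))"
proof -
  let ?c = "\<lambda>i y. coeff (fibre A y) r (\<lambda>i. s i y) (X y) i"
  note op = frame_open[OF f(1)]
  have "X \<in> sections A U" using section_restrict[OF X(1) open_UNIV op] by simp
  then have c: "\<forall>i<r. smooth_fun M U (?c i)" using frame_coeff_smooth[OF f(1) op order_refl] by simp
  obtain c' W where c': "\<forall>i<r. smooth_fun M UNIV (c' i)" "open W" "x \<in> W" "W \<subseteq> U" "\<forall>i<r. \<forall>x\<in>W. c' i x = ?c i x"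
    by (rule smooth_funs_extend[OF op x c])
  have XW: "\<forall>x\<in>W. X x = (\<Oplus>\<^bsub>fibre A x\<^esub>i\<in>{..<r}. c' i x \<odot>\<^bsub>fibre A x\<^esub> s i x)"
  proof
    fix y assume y: "y \<in> W"
    have "X y = (\<Oplus>\<^bsub>fibre A y\<^esub>i\<in>{..<r}. ?c i y \<odot>\<^bsub>fibre A y\<^esub> s i y)"
      using F.basis_expand[OF frame_basis[OF f(1)], of y "X y"] y c'(4) X(1) by auto
    also have "\<dots> = (\<Oplus>\<^bsub>fibre A y\<^esub>i\<in>{..<r}. c' i y \<odot>\<^bsub>fibre A y\<^esub> s i y)"
      using f(2) c'(5) y by (intro F.finsum_cong) auto
    finally show "X y = \<dots>" .
  qed
  have "anc x (Y x) (c' i) = anc x (Y x) (?c i)" if "i < r" for i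
    by (rule tangent_apply_cong[OF _ c'(2,3)]) (use X c'(5) that in simp_all)
  then show ?thesis
    using br_expand[OF X finite_lessThan c'(2,3) _ _ XW l] c'(1,3,5) f(2) by simp
qed

end

context transitive_algebroid begin

lemma local_jet_in_carrier: "\<sigma> \<in> local_sections A m \<Longrightarrow> jet M A m \<sigma> \<in> carrier (J m)"
  by (simp add: jet_space_def)

lemma section_local: "\<sigma> \<in> sections A U \<Longrightarrow> open U \<Longrightarrow> m \<in> U \<Longrightarrow> \<sigma> \<in> local_sections A m"
  unfolding local_sections_def by blast

lemma jet_sections_local:
  assumes "\<xi> \<in> jet_sections M A U" "m \<in> U"
  obtains n f X W where "\<forall>i<n. smooth_fun M UNIV (f i)" "\<forall>i<n. X i \<in> Sec" "open W" "m \<in> W" "W \<subseteq> U"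
    "\<forall>x\<in>W. \<xi> x = (\<Oplus>\<^bsub>J x\<^esub>i\<in>{..<(n::nat)}. f i x \<odot>\<^bsub>J x\<^esub> jet M A x (X i))"
proof -
  obtain V n f \<sigma> where V: "open V" "m \<in> V" "V \<subseteq> U" "\<forall>i<n. smooth_fun M V (f i) \<and> \<sigma> i \<in> sections A V"
    "\<forall>x\<in>V. \<xi> x = (\<Oplus>\<^bsub>J x\<^esub>i\<in>{..<(n::nat)}. f i x \<odot>\<^bsub>J x\<^esub> jet M A x (\<sigma> i))"
    using bspec[OF assms(1)[unfolded jet_sections_def mem_Collect_eq] assms(2)] by (elim exE conjE)
  have "\<forall>i<n. smooth_fun M V (f i)" "\<forall>i<n. \<sigma> i \<in> sections A V" using V(4) by auto
  obtain g W1 where g: "\<forall>i<n. smooth_fun M UNIV (g i)" "open W1" "m \<in> W1" "W1 \<subseteq> V" "\<forall>i<n. \<forall>x\<in>W1. g i x = f i x"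
    by (rule smooth_funs_extend[OF V(1,2) \<open>\<forall>i<n. smooth_fun M V (f i)\<close>])
  obtain X W2 where X: "\<forall>i<n. X i \<in> Sec" "open W2" "m \<in> W2" "W2 \<subseteq> V" "\<forall>i<n. \<forall>x\<in>W2. X i x = \<sigma> i x"
    by (rule sections_extend[OF V(1,2) \<open>\<forall>i<n. \<sigma> i \<in> sections A V\<close>])
  have "\<forall>x\<in>W1 \<inter> W2. \<xi> x = (\<Oplus>\<^bsub>J x\<^esub>i\<in>{..<n}. g i x \<odot>\<^bsub>J x\<^esub> jet M A x (X i))"
  proof
    fix x assume x: "x \<in> W1 \<inter> W2"
    then have "\<xi> x = (\<Oplus>\<^bsub>J x\<^esub>i\<in>{..<n}. f i x \<odot>\<^bsub>J x\<^esub> jet M A x (\<sigma> i))" using V(5) g(4) by blast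
    also have "\<dots> = (\<Oplus>\<^bsub>J x\<^esub>i\<in>{..<n}. g i x \<odot>\<^bsub>J x\<^esub> jet M A x (X i))"
    proof (rule J.finsum_cong)
      fix i assume i: "i \<in> {..<n}"
      have "jet M A x (X i) = jet M A x (\<sigma> i)"
        by (rule jet_cong[OF X(2)]) (use x i X(5) in auto)
      then show "f i x \<odot>\<^bsub>J x\<^esub> jet M A x (\<sigma> i) = g i x \<odot>\<^bsub>J x\<^esub> jet M A x (X i)" using g(5) x i by simp
      show "g i x \<odot>\<^bsub>J x\<^esub> jet M A x (X i) \<in> carrier (J x)" using X(1) i by simp
    qed
    finally show "\<xi> x = \<dots>" .
  qed
  moreover have "open (W1 \<inter> W2)" using g(2) X(2) by (rule open_Int)
  ultimately show ?thesis
    using that[of n g X "W1 \<inter> W2"] g X V(3) by blast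
qed

lemma jet_sections_localI:
  assumes "\<And>m. m \<in> U \<Longrightarrow> \<exists>n f X W. (\<forall>i<n. smooth_fun M UNIV (f i)) \<and> (\<forall>i<n. X i \<in> Sec) \<and> open W \<and> m \<in> W \<and>
    W \<subseteq> U \<and> (\<forall>x\<in>W. \<xi> x = (\<Oplus>\<^bsub>J x\<^esub>i\<in>{..<(n::nat)}. f i x \<odot>\<^bsub>J x\<^esub> jet M A x (X i)))"
  shows "\<xi> \<in> jet_sections M A U"
  unfolding jet_sections_def mem_Collect_eq
proof
  fix m assume "m \<in> U"
  from assms[OF this] obtain n f X W where W: "\<forall>i<n. smooth_fun M UNIV (f i)" "\<forall>i<n. X i \<in> Sec" "open W" "m \<in> W"
    "W \<subseteq> U" "\<forall>x\<in>W. \<xi> x = (\<Oplus>\<^bsub>J x\<^esub>i\<in>{..<(n::nat)}. f i x \<odot>\<^bsub>J x\<^esub> jet M A x (X i))"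
    by (elim exE conjE)
  have "\<forall>i<n. smooth_fun M W (f i) \<and> X i \<in> sections A W"
    using W(1,2) smooth_fun_subset[of UNIV _ W] section_restrict[OF _ open_UNIV W(3)] by simp
  with W(3-6) show "\<exists>V n f \<sigma>. open V \<and> m \<in> V \<and> V \<subseteq> U \<and> (\<forall>i<n. smooth_fun M V (f i) \<and> \<sigma> i \<in> sections A V) \<and>
      (\<forall>x\<in>V. \<xi> x = (\<Oplus>\<^bsub>J x\<^esub>i\<in>{..<(n::nat)}. f i x \<odot>\<^bsub>J x\<^esub> jet M A x (\<sigma> i)))"
    by (intro exI[of _ W] exI[of _ n] exI[of _ f] exI[of _ X]) simp
qed

lemma jet_sections_restrict:
  assumes "\<xi> \<in> jet_sections M A U" "open V" "V \<subseteq> U"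
  shows "\<xi> \<in> jet_sections M A V"
proof (rule jet_sections_localI)
  fix m assume m: "m \<in> V"
  then have "m \<in> U" using assms(3) by blast
  obtain n f X W where W: "\<forall>i<n. smooth_fun M UNIV (f i)" "\<forall>i<n. X i \<in> Sec" "open W" "m \<in> W" "W \<subseteq> U"
    "\<forall>x\<in>W. \<xi> x = (\<Oplus>\<^bsub>J x\<^esub>i\<in>{..<(n::nat)}. f i x \<odot>\<^bsub>J x\<^esub> jet M A x (X i))"
    by (rule jet_sections_local[OF assms(1) \<open>m \<in> U\<close>])
  have "open (W \<inter> V)" using W(3) assms(2) by (rule open_Int)
  then show "\<exists>n f X W. (\<forall>i<n. smooth_fun M UNIV (f i)) \<and> (\<forall>i<n. X i \<in> Sec) \<and> open W \<and> m \<in> W \<and>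
    W \<subseteq> V \<and> (\<forall>x\<in>W. \<xi> x = (\<Oplus>\<^bsub>J x\<^esub>i\<in>{..<(n::nat)}. f i x \<odot>\<^bsub>J x\<^esub> jet M A x (X i)))"
    using W m by (intro exI[of _ n] exI[of _ f] exI[of _ X] exI[of _ "W \<inter> V"]) simp
qed

lemma jet_sections_glue:
  assumes "\<And>m. m \<in> U \<Longrightarrow> \<exists>V. open V \<and> m \<in> V \<and> V \<subseteq> U \<and> \<xi> \<in> jet_sections M A V"
  shows "\<xi> \<in> jet_sections M A U"
proof (rule jet_sections_localI)
  fix m assume "m \<in> U"
  from assms[OF this] obtain V where V: "m \<in> V" "V \<subseteq> U" "\<xi> \<in> jet_sections M A V" by (elim exE conjE)
  obtain n f X W where W: "\<forall>i<n. smooth_fun M UNIV (f i)" "\<forall>i<n. X i \<in> Sec" "open W" "m \<in> W" "W \<subseteq> V"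
    "\<forall>x\<in>W. \<xi> x = (\<Oplus>\<^bsub>J x\<^esub>i\<in>{..<(n::nat)}. f i x \<odot>\<^bsub>J x\<^esub> jet M A x (X i))"
    by (rule jet_sections_local[OF V(3,1)])
  have "W \<subseteq> U" using W(5) V(2) by (rule subset_trans)
  with W show "\<exists>n f X W. (\<forall>i<n. smooth_fun M UNIV (f i)) \<and> (\<forall>i<n. X i \<in> Sec) \<and> open W \<and> m \<in> W \<and>
    W \<subseteq> U \<and> (\<forall>x\<in>W. \<xi> x = (\<Oplus>\<^bsub>J x\<^esub>i\<in>{..<(n::nat)}. f i x \<odot>\<^bsub>J x\<^esub> jet M A x (X i)))"
    by (intro exI[of _ n] exI[of _ f] exI[of _ X] exI[of _ W]) simp
qed

lemma jet_sectionsI: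
  assumes "open U" "\<forall>i<n. smooth_fun M U (f i) \<and> \<sigma> i \<in> sections A U"
    "\<forall>x\<in>U. \<xi> x = (\<Oplus>\<^bsub>J x\<^esub>i\<in>{..<(n::nat)}. f i x \<odot>\<^bsub>J x\<^esub> jet M A x (\<sigma> i))"
  shows "\<xi> \<in> jet_sections M A U"
  unfolding jet_sections_def mem_Collect_eq
proof
  show "\<exists>V' n f \<sigma>. open V' \<and> m \<in> V' \<and> V' \<subseteq> U \<and> (\<forall>i<n. smooth_fun M V' (f i) \<and> \<sigma> i \<in> sections A V') \<and>
      (\<forall>x\<in>V'. \<xi> x = (\<Oplus>\<^bsub>J x\<^esub>i\<in>{..<(n::nat)}. f i x \<odot>\<^bsub>J x\<^esub> jet M A x (\<sigma> i)))" if "m \<in> U" for m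
    using assms that by (intro exI[of _ U] exI[of _ n] exI[of _ f] exI[of _ \<sigma>]) simp
qed

lemma jet_sections_carrier:
  assumes "\<xi> \<in> jet_sections M A U" "m \<in> U"
  shows "\<xi> m \<in> carrier (J m)"
proof -
  obtain n f X W where W: "\<forall>i<n. smooth_fun M UNIV (f i)" "\<forall>i<n. X i \<in> Sec" "open W" "m \<in> W" "W \<subseteq> U"
    "\<forall>x\<in>W. \<xi> x = (\<Oplus>\<^bsub>J x\<^esub>i\<in>{..<(n::nat)}. f i x \<odot>\<^bsub>J x\<^esub> jet M A x (X i))"
    by (rule jet_sections_local[OF assms])
  have "(\<Oplus>\<^bsub>J m\<^esub>i\<in>{..<n}. f i m \<odot>\<^bsub>J m\<^esub> jet M A m (X i)) \<in> carrier (J m)"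
    using W(2) by (intro J.finsum_closed) auto
  then show ?thesis using W(4,6) by simp
qed

section \<open>A local frame of the jet bundle\<close>

context
  fixes U :: "'m set" and V :: "'m set" and \<phi> :: "'m \<Rightarrow> 'e" and r :: nat and s :: "nat \<Rightarrow> 'm \<Rightarrow> 'v"
    and q :: "'e \<Rightarrow> 'm \<Rightarrow> real" and h :: "nat \<Rightarrow> 'e option \<times> nat" and n :: nat
  assumes frame: "local_frame M A U r s" and glob: "\<forall>i<r. s i \<in> Sec"
    and chart: "(V, \<phi>) \<in> M" and UV: "U \<subseteq> V"
    and q: "\<And>b. b \<in> Basis \<Longrightarrow> smooth_fun M UNIV (q b)" "\<And>b x. b \<in> Basis \<Longrightarrow> x \<in> U \<Longrightarrow> q b x = \<phi> x \<bullet> b"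
    and h: "bij_betw h {..<n} (insert None (Some ` Basis) \<times> {..<r})"
begin

text \<open>The sections \<open>s i\<close>, marked by \<open>None\<close>, and their products with
  global functions \<open>q b\<close> that equal the chart coordinates on \<open>U\<close>. Pairs
  are enumerated by \<open>h\<close> since frames are indexed by natural numbers.\<close>

definition jet_frame_section :: "'e option \<times> nat \<Rightarrow> 'm \<Rightarrow> 'v" where
  "jet_frame_section p = (case fst p of None \<Rightarrow> s (snd p) | Some b \<Rightarrow> sscale A (q b) (s (snd p)))"

definition frame_coeff :: "nat \<Rightarrow> 'm \<Rightarrow> 'v \<Rightarrow> real" where
  "frame_coeff i x v = coeff (fibre A x) r (\<lambda>i. s i x) v i"

text \<open>Partial derivatives of a jet are reached through brackets, so each coordinate vector
  needs a section having it as anchor.\<close>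

definition direction :: "'m \<Rightarrow> 'e \<Rightarrow> 'm \<Rightarrow> 'v" where
  "direction x b = (SOME Y. Y \<in> Sec \<and> anc x (Y x) = chart_vector V \<phi> b x)"

text \<open>The partial derivative along \<open>b\<close> of the \<open>i\<close>-th component. For
  \<open>Y\<close> over the coordinate vector, \<open>[X, Y]^i\<close> is the sum of the
  \<open>X^k [s_k, Y]^i\<close> minus the derivative of \<open>X^i\<close>; the formula is solved
  for the latter.\<close>

definition jet_deriv :: "'m \<Rightarrow> 'e \<Rightarrow> nat \<Rightarrow> ('m \<Rightarrow> 'v) set \<Rightarrow> real" where
  "jet_deriv x b i j = (\<Sum>k<r. frame_coeff k x (jet_proj x j) * frame_coeff i x (br (s k) (direction x b) x))
     - frame_coeff i x (jet_act x j (direction x b))"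

text \<open>Coordinates dual to the jets of \<open>jet_frame_section\<close>. As \<open>q b\<close>
  need not vanish at \<open>x\<close>, the products with \<open>q b\<close> also contribute to the
  value of a jet, and the \<open>None\<close> coordinate subtracts this contribution.\<close>

definition jet_coeff :: "'e option \<times> nat \<Rightarrow> 'm \<Rightarrow> ('m \<Rightarrow> 'v) set \<Rightarrow> real" where
  "jet_coeff p x j = (case fst p of
      None \<Rightarrow> frame_coeff (snd p) x (jet_proj x j) - (\<Sum>b\<in>Basis. q b x * jet_deriv x b (snd p) j)
    | Some b \<Rightarrow> jet_deriv x b (snd p) j)"

lemma frame_coeff_lf: "x \<in> U \<Longrightarrow> i < r \<Longrightarrow> linear_functional (fibre A x) (frame_coeff i x)"
  unfolding frame_coeff_def by (rule F.linear_functional_coeff[OF frame_basis[OF frame]])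

lemma frame_coeff_basis: "x \<in> U \<Longrightarrow> i < r \<Longrightarrow> k < r \<Longrightarrow> frame_coeff i x (s k x) = (if k = i then 1 else 0)"
  unfolding frame_coeff_def by (rule F.coeff_basis[OF frame_basis[OF frame]])

lemma direction:
  assumes "x \<in> U"
  shows "direction x b \<in> Sec" "anc x (direction x b x) = chart_vector V \<phi> b x"
proof -
  have "chart_vector V \<phi> b x \<in> carrier (tangent_space M x)"
    using chart_vector_in_tangent[OF chart] assms UV by blast
  then obtain Y where "Y \<in> Sec" "anc x (Y x) = chart_vector V \<phi> b x" by (rule anchor_onto)
  then have ex: "\<exists>Y. Y \<in> Sec \<and> anc x (Y x) = chart_vector V \<phi> b x" by (intro exI[of _ Y]) simp
  have "direction x b \<in> Sec \<and> anc x (direction x b x) = chart_vector V \<phi> b x"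
    unfolding direction_def by (rule someI_ex[OF ex])
  then show "direction x b \<in> Sec" "anc x (direction x b x) = chart_vector V \<phi> b x" by auto
qed

lemma frame_coeff_br:
  assumes x: "x \<in> U" and X: "X \<in> Sec" "Y \<in> Sec" and i: "i < r"
  shows "frame_coeff i x (br X Y x) =
    (\<Sum>k<r. frame_coeff k x (X x) * frame_coeff i x (br (s k) Y x)) - anc x (Y x) (\<lambda>y. frame_coeff i y (X y))"
  using br_frame[OF frame glob x X frame_coeff_lf[OF x i]] frame_coeff_basis[OF x i] i
  by (simp add: frame_coeff_def[symmetric] sum_subtractf mult_delta_right)

lemma jet_deriv_jet:
  assumes "x \<in> U" "X \<in> Sec" "i < r"
  shows "jet_deriv x b i (jet M A x X) = chart_vector V \<phi> b x (\<lambda>y. frame_coeff i y (X y))"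
  using frame_coeff_br[OF assms(1,2) direction(1)[OF assms(1)] assms(3)] direction[OF assms(1)] assms(2)
  by (simp add: jet_deriv_def)

lemma jet_deriv_lf:
  assumes x: "x \<in> U" and i: "i < r"
  shows "linear_functional (J x) (jet_deriv x b i)"
proof -
  have 1: "linear_functional (J x) (\<lambda>j. frame_coeff k x (jet_proj x j))" if "k < r" for k
    by (rule linear_functional_jet_proj[OF frame_coeff_lf[OF x that]])
  have 2: "linear_functional (J x) (\<lambda>j. frame_coeff i x (jet_act x j (direction x b)))"
    by (rule linear_functional_jet_act[OF frame_coeff_lf[OF x i] direction(1)[OF x]])
  show ?thesis
    unfolding linear_functional_def jet_deriv_def
    using 1 2 by (auto simp: J.lf_add[OF 1] J.lf_add[OF 2] J.lf_smult[OF 1] J.lf_smult[OF 2]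
        sum.distrib sum_distrib_left algebra_simps intro!: sum.cong)
qed

lemma jet_coeff_lf:
  assumes x: "x \<in> U" and p: "snd p < r"
  shows "linear_functional (J x) (jet_coeff p x)"
proof (cases "fst p")
  case None
  note 1 = linear_functional_jet_proj[OF frame_coeff_lf[OF x p]]
  note 2 = jet_deriv_lf[OF x p]
  show ?thesis
    unfolding linear_functional_def jet_coeff_def None
    by (simp add: J.lf_add[OF 1] J.lf_add[OF 2] J.lf_smult[OF 1] J.lf_smult[OF 2]
        sum.distrib sum_distrib_left algebra_simps)
next
  case (Some b)
  then have "jet_coeff p x = jet_deriv x b (snd p)" by (intro ext) (simp add: jet_coeff_def)
  then show ?thesis using jet_deriv_lf[OF x p] by simp
qed

lemma jet_frame_section_sec: "p \<in> insert None (Some ` Basis) \<times> {..<r} \<Longrightarrow> jet_frame_section p \<in> Sec"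
  using glob q(1) by (auto simp: jet_frame_section_def)

lemma chart_vector_q:
  assumes "x \<in> U" "b \<in> Basis" "b' \<in> Basis"
  shows "chart_vector V \<phi> b x (q b') = (if b = b' then 1 else 0)"
proof -
  have "chart_vector V \<phi> b x (q b') = chart_vector V \<phi> b x (\<lambda>x. \<phi> x \<bullet> b')"
    by (rule tangent_apply_cong[OF chart_vector_in_tangent[OF chart] frame_open[OF frame]])
      (use assms UV q(2) in auto)
  also have "\<dots> = b \<bullet> b'" by (rule chart_vector_coordinate[OF chart]) (use assms UV in auto)
  finally show ?thesis using assms by (simp add: inner_Basis)
qed

text \<open>On \<open>U\<close> the components of the frame sections are constants or constant
  multiples of some \<open>q b'\<close>, and the coordinate vector along \<open>b\<close> sends
  \<open>q b'\<close> to \<open>1\<close> or \<open>0\<close>.\<close>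

lemma jet_deriv_frame:
  assumes x: "x \<in> U" and b: "b \<in> Basis" and p: "p \<in> insert None (Some ` Basis) \<times> {..<r}" and i: "i < r"
  shows "jet_deriv x b i (jet M A x (jet_frame_section p)) = (if p = (Some b, i) then 1 else 0)"
proof -
  obtain o' k where p': "p = (o', k)" "k < r" using p by auto
  note fc = frame_coeff_basis[OF x]
  note ap = F.lf_smult[OF frame_coeff_lf[OF x i]]
  have tv: "chart_vector V \<phi> b x \<in> carrier (tangent_space M x)"
    using chart_vector_in_tangent[OF chart] x UV by blast
  note cg = tangent_apply_cong[OF tv frame_open[OF frame] x]
  have sn: "smooth_near M x (\<lambda>x. c)" for c by (rule smooth_near_const)
  show ?thesis
  proof (cases o')
    case None
    have "chart_vector V \<phi> b x (\<lambda>y. frame_coeff i y (s k y)) = chart_vector V \<phi> b x (\<lambda>y. if k = i then 1 else 0)"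
      by (rule cg) (use frame_coeff_basis p' i in auto)
    then show ?thesis
      using jet_deriv_jet[OF x, of "s k" i b] glob p' i None tangent_apply_const[OF tv]
      by (simp add: jet_frame_section_def)
  next
    case (Some b')
    then have b': "b' \<in> Basis" using p p' by auto
    have "frame_coeff i y (sscale A (q b') (s k) y) = (if k = i then 1 else 0) * q b' y" if "y \<in> U" for y
      using F.lf_smult[OF frame_coeff_lf[OF that i], of "s k y"] frame_coeff_basis[OF that i p'(2)] glob p'(2)
      by (simp add: sscale_def)
    then have "chart_vector V \<phi> b x (\<lambda>y. frame_coeff i y (sscale A (q b') (s k) y))
        = chart_vector V \<phi> b x (\<lambda>y. (if k = i then 1 else 0) * q b' y)"
      by (rule cg)
    also have "\<dots> = (if k = i then 1 else 0) * chart_vector V \<phi> b x (q b')"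
      by (rule tangent_apply_scale[OF tv smooth_near_UNIV[OF q(1)[OF b']]])
    also have "\<dots> = (if k = i \<and> b' = b then 1 else 0)" using chart_vector_q[OF x b b'] by auto
    finally show ?thesis
      using jet_deriv_jet[OF x, of "sscale A (q b') (s k)" i b] glob p' i Some q(1)[OF b']
      by (auto simp: jet_frame_section_def)
  qed
qed

lemma jet_coeff_frame:
  assumes x: "x \<in> U" and p: "p \<in> insert None (Some ` Basis) \<times> {..<r}"
    and p': "p' \<in> insert None (Some ` Basis) \<times> {..<r}"
  shows "jet_coeff p x (jet M A x (jet_frame_section p')) = (if p = p' then 1 else 0)"
proof (cases "fst p")
  case (Some b)
  then have "b \<in> Basis" "snd p < r" using p by (auto simp: mem_Times_iff)
  then show ?thesis
    using jet_deriv_frame[OF x _ p', of b "snd p"] Some by (auto simp: jet_coeff_def prod_eq_iff)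
next
  case None
  obtain k where k: "p = (None, k)" "k < r" using p None by auto
  have d: "jet_deriv x b k (jet M A x (jet_frame_section p')) = (if p' = (Some b, k) then 1 else 0)"
    if "b \<in> Basis" for b using jet_deriv_frame[OF x that p' k(2)] .
  obtain o' i where p2: "p' = (o', i)" "i < r" using p' by auto
  show ?thesis
  proof (cases o')
    case None
    then show ?thesis
      using d frame_coeff_basis[OF x k(2) p2(2)] p2 k glob
      by (auto simp: jet_coeff_def jet_frame_section_def)
  next
    case (Some b')
    then have b': "b' \<in> Basis" using p' p2 by auto
    have "(\<Sum>b\<in>Basis. q b x * jet_deriv x b k (jet M A x (jet_frame_section p')))
      = (\<Sum>b\<in>Basis. if b = b' then (if i = k then q b x else 0) else 0)"
      using d Some p2 by (intro sum.cong) auto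
    also have "\<dots> = (if i = k then q b' x else 0)" using b' by simp
    moreover have "frame_coeff k x (jet_proj x (jet M A x (jet_frame_section p'))) = (if i = k then q b' x else 0)"
      using jet_frame_section_sec[OF p'] F.lf_smult[OF frame_coeff_lf[OF x k(2)], of "s i x"]
        frame_coeff_basis[OF x k(2) p2(2)] glob p2 Some
      by (simp add: jet_frame_section_def sscale_def)
    ultimately show ?thesis using k p2 Some by (simp add: jet_coeff_def)
  qed
qed

text \<open>Values and partial derivatives are recovered from the coordinates;
  \<open>tangent_expand\<close> passes from coordinate vectors to all anchors and thus to all
  brackets.\<close>

lemma jet_coeff_separates:
  assumes x: "x \<in> U" and j: "j \<in> carrier (J x)" "j' \<in> carrier (J x)"
    and eq: "\<And>p. p \<in> insert None (Some ` Basis) \<times> {..<r} \<Longrightarrow> jet_coeff p x j = jet_coeff p x j'"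
  shows "j = j'"
proof -
  have d: "jet_deriv x b i j = jet_deriv x b i j'" if "b \<in> Basis" "i < r" for b i
    using eq[of "(Some b, i)"] that by (simp add: jet_coeff_def)
  have v: "frame_coeff i x (jet_proj x j) = frame_coeff i x (jet_proj x j')" if "i < r" for i
    using eq[of "(None, i)"] d that by (simp add: jet_coeff_def)
  obtain X where X: "X \<in> Sec" "j = jet M A x X" by (rule jet_carrierE[OF j(1)])
  obtain X' where X': "X' \<in> Sec" "j' = jet M A x X'" by (rule jet_carrierE[OF j(2)])
  note basis = frame_basis[OF frame x]
  have "anc x (Y x) (\<lambda>y. frame_coeff i y (X y)) = anc x (Y x) (\<lambda>y. frame_coeff i y (X' y))"
    if Y: "Y \<in> Sec" and i: "i < r" for Y i
  proof -
    have "x \<in> V" using x UV by blast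
    note ex = tangent_expand[OF chart this anchor_tangent[OF sec_carrier[OF Y]]]
    show ?thesis
      unfolding ex[of "\<lambda>y. frame_coeff i y (X y)"] ex[of "\<lambda>y. frame_coeff i y (X' y)"]
      using d[OF _ i] jet_deriv_jet[OF x X(1) i] jet_deriv_jet[OF x X'(1) i] X(2) X'(2)
      by (intro sum.cong) auto
  qed
  then have "frame_coeff i x (br X Y x) = frame_coeff i x (br X' Y x)" if "Y \<in> Sec" "i < r" for Y i
    using frame_coeff_br[OF x X(1) that] frame_coeff_br[OF x X'(1) that] v X X' that by simp
  then have "br X Y x = br X' Y x" if "Y \<in> Sec" for Y
    using that X(1) X'(1) by (intro F.basis_eqI[OF basis]) (auto simp: frame_coeff_def)
  moreover have "X x = X' x"
    using v X X' by (intro F.basis_eqI[OF basis]) (auto simp: frame_coeff_def)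
  ultimately show ?thesis unfolding X(2) X'(2) by (intro jet_eqI X(1) X'(1))
qed

lemma h_mem: "k < n \<Longrightarrow> h k \<in> insert None (Some ` Basis) \<times> {..<r}"
  using bij_betwE[OF h] by blast

lemma jet_basis:
  assumes x: "x \<in> U"
  shows "is_basis (J x) n (\<lambda>k. jet M A x (jet_frame_section (h k)))"
    and "j \<in> carrier (J x) \<Longrightarrow> k < n \<Longrightarrow>
      coeff (J x) n (\<lambda>k. jet M A x (jet_frame_section (h k))) j k = jet_coeff (h k) x j"
proof -
  have inj: "h i = h k \<longleftrightarrow> i = k" if "i < n" "k < n" for i k
    using h that unfolding bij_betw_def inj_on_def by auto
  have lf: "linear_functional (J x) (jet_coeff (h k) x)" if "k < n" for k
    using jet_coeff_lf[OF x] h_mem[OF that] by auto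
  have dual: "jet_coeff (h i) x (jet M A x (jet_frame_section (h k))) = (if i = k then 1 else 0)"
    if "i < n" "k < n" for i k
    using jet_coeff_frame[OF x h_mem h_mem] inj that by simp
  have sep: "j = j'" if "j \<in> carrier (J x)" "j' \<in> carrier (J x)" "\<And>i. i < n \<Longrightarrow> jet_coeff (h i) x j = jet_coeff (h i) x j'"
    for j j'
  proof (rule jet_coeff_separates[OF x that(1,2)])
    fix p :: "'e option \<times> nat" assume "p \<in> insert None (Some ` Basis) \<times> {..<r}"
    then obtain i where "i < n" "p = h i" using h unfolding bij_betw_def by (metis imageE lessThan_iff)
    then show "jet_coeff p x j = jet_coeff p x j'" using that(3) by simp
  qed
  have mem: "jet M A x (jet_frame_section (h k)) \<in> carrier (J x)" if "k < n" for k
    using jet_frame_section_sec[OF h_mem[OF that]] by simp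
  note db = J.dual_basis[of n "\<lambda>k. jet M A x (jet_frame_section (h k))" x "\<lambda>k. jet_coeff (h k) x"]
  show "is_basis (J x) n (\<lambda>k. jet M A x (jet_frame_section (h k)))"
    by (rule db(1)) (use mem lf dual sep in auto)
  show "coeff (J x) n (\<lambda>k. jet M A x (jet_frame_section (h k))) j k = jet_coeff (h k) x j"
    if "j \<in> carrier (J x)" "k < n"
    by (rule db(2)) (use mem lf dual sep that in auto)
qed

lemma jet_coeff_smooth:
  assumes X: "X \<in> Sec" and p: "snd p < r" "fst p \<in> insert None (Some ` Basis)"
  shows "smooth_fun M U (\<lambda>x. jet_coeff p x (jet M A x X))"
proof -
  note op = frame_open[OF frame]
  have "X \<in> sections A U" using section_restrict[OF X open_UNIV op] by simp
  then have c: "smooth_fun M U (\<lambda>y. frame_coeff i y (X y))" if "i < r" for i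
    unfolding frame_coeff_def using frame_coeff_smooth[OF frame op order_refl] that by simp
  then have d: "smooth_fun M U (\<lambda>x. chart_vector V \<phi> b x (\<lambda>y. frame_coeff i y (X y)))" if "i < r" for i b
    using smooth_fun_chart_vector[OF chart op UV] that by simp
  show ?thesis
  proof (cases "fst p")
    case None
    have "smooth_fun M U (\<lambda>x. frame_coeff (snd p) x (X x)
        - (\<Sum>b\<in>Basis. q b x * chart_vector V \<phi> b x (\<lambda>y. frame_coeff (snd p) y (X y))))"
      using c d p(1) by (intro smooth_fun_diff smooth_fun_sum smooth_fun_mult op)
        (auto intro: smooth_fun_subset[OF q(1) subset_UNIV])
    then show ?thesis
      by (rule smooth_fun_cong[OF op, rotated]) (use None X p jet_deriv_jet in \<open>simp add: jet_coeff_def\<close>)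
  next
    case (Some b)
    show ?thesis
      by (rule smooth_fun_cong[OF op _ d[OF p(1), of b]]) (use Some X p jet_deriv_jet in \<open>simp add: jet_coeff_def\<close>)
  qed
qed

text \<open>Stated for an arbitrary bracket, because the bundle structure must be known before the
  bracket of \<open>J1\<close> is constructed.\<close>

lemma jet_local_frame:
  "local_frame M (J1_with_bracket M A br') U n (\<lambda>k. prolong M A (jet_frame_section (h k)))"
  unfolding local_frame_def
proof (intro conjI ballI allI impI)
  note op = frame_open[OF frame]
  let ?B = "J1_with_bracket M A br'"
  let ?X = "\<lambda>k. jet_frame_section (h k)"
  have [simp]: "fibre ?B = J" "sections ?B = jet_sections M A" by (simp_all add: J1_with_bracket_def)
  show "open U" by (rule op)
  show "prolong M A (?X k) x \<in> carrier (fibre ?B x)" if "k < n" for k x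
    using jet_frame_section_sec[OF h_mem[OF that]] by (simp add: prolong_def)
  show "bij_betw (\<lambda>c. \<Oplus>\<^bsub>fibre ?B x\<^esub>i\<in>{..<n}. c i \<odot>\<^bsub>fibre ?B x\<^esub> prolong M A (?X i) x)
       ({..<n} \<rightarrow>\<^sub>E UNIV) (carrier (fibre ?B x))" if "x \<in> U" for x
    using jet_basis(1)[OF that] by (simp add: is_basis_def prolong_def)
  fix W \<xi> assume W: "open W \<and> W \<subseteq> U"
  show "\<xi> \<in> sections ?B W \<longleftrightarrow> (\<exists>c. (\<forall>i<n. smooth_fun M W (c i)) \<and>
      (\<forall>x\<in>W. \<xi> x = scomb ?B n c (\<lambda>k. prolong M A (?X k)) x))"
  proof
    assume "\<exists>c. (\<forall>i<n. smooth_fun M W (c i)) \<and> (\<forall>x\<in>W. \<xi> x = scomb ?B n c (\<lambda>k. prolong M A (?X k)) x)"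
    then obtain c where "\<forall>i<n. smooth_fun M W (c i)" "\<forall>x\<in>W. \<xi> x = scomb ?B n c (\<lambda>k. prolong M A (?X k)) x"
      by (elim exE conjE)
    then show "\<xi> \<in> sections ?B W"
      using W jet_frame_section_sec[OF h_mem] section_restrict[OF _ open_UNIV]
      by (auto simp: scomb_def prolong_def intro!: jet_sectionsI[of W n c ?X])
  next
    assume "\<xi> \<in> sections ?B W"
    then have \<xi>: "\<xi> \<in> jet_sections M A W" by simp
    \<comment> \<open>A section is only locally a combination of prolongations, so smoothness of its
      components is checked near each point.\<close>
    have sm: "smooth_fun M W (\<lambda>x. jet_coeff (h k) x (\<xi> x))" if k: "k < n" for k
    proof (rule smooth_fun_local)
      fix y assume y: "y \<in> W"
      obtain N f X W' where W': "\<forall>i<N. smooth_fun M UNIV (f i)" "\<forall>i<N. X i \<in> Sec" "open W'" "y \<in> W'" "W' \<subseteq> W"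
        "\<forall>x\<in>W'. \<xi> x = (\<Oplus>\<^bsub>J x\<^esub>i\<in>{..<(N::nat)}. f i x \<odot>\<^bsub>J x\<^esub> jet M A x (X i))"
        by (rule jet_sections_local[OF \<xi> y])
      have hk: "snd (h k) < r" "fst (h k) \<in> insert None (Some ` Basis)" using h_mem[OF k] by auto
      have W'U: "W' \<subseteq> U" using W W'(5) by blast
      have "smooth_fun M W' (\<lambda>x. \<Sum>i<N. f i x * jet_coeff (h k) x (jet M A x (X i)))"
        using W'(1,2) jet_coeff_smooth[OF _ hk]
        by (intro smooth_fun_sum smooth_fun_mult W'(3)) (auto intro: smooth_fun_subset[OF _ W'U] smooth_fun_subset[of UNIV])
      then have "smooth_fun M W' (\<lambda>x. jet_coeff (h k) x (\<xi> x))"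
      proof (rule smooth_fun_cong[OF W'(3), rotated])
        fix x assume x: "x \<in> W'"
        then have lf: "linear_functional (J x) (jet_coeff (h k) x)" using jet_coeff_lf hk W'U by blast
        have "jet_coeff (h k) x (\<xi> x) = (\<Sum>i<N. jet_coeff (h k) x (f i x \<odot>\<^bsub>J x\<^esub> jet M A x (X i)))"
        proof -
          have "\<xi> x = (\<Oplus>\<^bsub>J x\<^esub>i\<in>{..<N}. f i x \<odot>\<^bsub>J x\<^esub> jet M A x (X i))" using W'(6) x by simp
          then show ?thesis using W'(2) by (simp only:) (rule J.lf_finsum[OF lf], simp)
        qed
        then show "(\<Sum>i<N. f i x * jet_coeff (h k) x (jet M A x (X i))) = jet_coeff (h k) x (\<xi> x)"
          using W'(2) by (simp add: J.lf_smult[OF lf])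
      qed
      then show "\<exists>W'. open W' \<and> y \<in> W' \<and> smooth_fun M W' (\<lambda>x. jet_coeff (h k) x (\<xi> x))"
        using W'(3,4) by blast
    qed (use W in simp)
    have "\<xi> x = scomb ?B n (\<lambda>k x. jet_coeff (h k) x (\<xi> x)) (\<lambda>k. prolong M A (?X k)) x" if x: "x \<in> W" for x
    proof -
      have xU: "x \<in> U" and c: "\<xi> x \<in> carrier (J x)" using W x jet_sections_carrier[OF \<xi> x] by auto
      have "\<xi> x = (\<Oplus>\<^bsub>J x\<^esub>k\<in>{..<n}. coeff (J x) n (\<lambda>k. jet M A x (?X k)) (\<xi> x) k \<odot>\<^bsub>J x\<^esub> jet M A x (?X k))"
        using J.basis_expand[OF jet_basis(1)[OF xU] c] by simp
      also have "\<dots> = (\<Oplus>\<^bsub>J x\<^esub>k\<in>{..<n}. jet_coeff (h k) x (\<xi> x) \<odot>\<^bsub>J x\<^esub> jet M A x (?X k))"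
        using jet_basis(2)[OF xU c] jet_frame_section_sec[OF h_mem] by (intro J.finsum_cong) auto
      finally show ?thesis by (simp add: scomb_def prolong_def)
    qed
    then show "\<exists>c. (\<forall>i<n. smooth_fun M W (c i)) \<and> (\<forall>x\<in>W. \<xi> x = scomb ?B n c (\<lambda>k. prolong M A (?X k)) x)"
      using sm by (intro exI[of _ "\<lambda>k x. jet_coeff (h k) x (\<xi> x)"]) simp
  qed
qed

end

text \<open>The index set has \<open>(DIM('e) + 1) * r\<close> elements at every point, whence the
  constant rank.\<close>

lemma vector_bundle_jets: "vector_bundle M (J1_with_bracket M A br')"
proof -
  let ?B = "J1_with_bracket M A br'"
  have [simp]: "fibre ?B = J" "sections ?B = jet_sections M A" by (simp_all add: J1_with_bracket_def)
  obtain r where r: "\<And>V m. open V \<Longrightarrow> m \<in> V \<Longrightarrow> \<exists>U s. m \<in> U \<and> U \<subseteq> V \<and> local_frame M A U r s \<and> (\<forall>i<r. s i \<in> Sec)"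
    by (rule global_frame_rank) blast
  let ?I = "insert None (Some ` (Basis :: 'e set)) \<times> {..<r}"
  have "\<exists>U s. m \<in> U \<and> local_frame M ?B U (card ?I) s" for m
  proof -
    obtain V \<phi> where c: "(V, \<phi>) \<in> M" "m \<in> V" by (rule chart_at)
    have "\<exists>g W. smooth_fun M UNIV g \<and> open W \<and> m \<in> W \<and> W \<subseteq> V \<and> (\<forall>x\<in>W. g x = \<phi> x \<bullet> b)" for b
    proof -
      obtain g W where "smooth_fun M UNIV g" "open W" "m \<in> W" "W \<subseteq> V" "\<forall>x\<in>W. g x = \<phi> x \<bullet> b"
        by (rule smooth_fun_extend[OF chart_open[OF c(1)] c(2) smooth_fun_coordinate[OF c(1)]])
      then show ?thesis by blast
    qed
    then have "\<forall>b. \<exists>g W. smooth_fun M UNIV g \<and> open W \<and> m \<in> W \<and> W \<subseteq> V \<and> (\<forall>x\<in>W. g x = \<phi> x \<bullet> b)" by simp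
    from choice[OF this] obtain q where "\<forall>b. \<exists>W. smooth_fun M UNIV (q b) \<and> open W \<and> m \<in> W \<and> W \<subseteq> V \<and> (\<forall>x\<in>W. q b x = \<phi> x \<bullet> b)"
      by (elim exE)
    from choice[OF this] obtain W where W: "\<And>b. smooth_fun M UNIV (q b) \<and> open (W b) \<and> m \<in> W b \<and> W b \<subseteq> V \<and> (\<forall>x\<in>W b. q b x = \<phi> x \<bullet> b)"
      by auto
    \<comment> \<open>On this set all functions \<open>q b\<close> agree with the chart
      coordinates.\<close>
    let ?W = "V \<inter> (\<Inter>b\<in>Basis. W b)"
    have "open ?W" using W chart_open[OF c(1)] by (intro open_Int open_INT) auto
    moreover have "m \<in> ?W" using W c(2) by auto
    ultimately have "\<exists>U s. m \<in> U \<and> U \<subseteq> ?W \<and> local_frame M A U r s \<and> (\<forall>i<r. s i \<in> Sec)" by (rule r)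
    then obtain U s where U: "m \<in> U" "U \<subseteq> ?W" "local_frame M A U r s" "\<forall>i<r. s i \<in> Sec"
      by (elim exE conjE)
    have "finite ?I" by simp
    from ex_bij_betw_nat_finite[OF this] obtain h where h: "bij_betw h {..<card ?I} ?I"
      by (auto simp: atLeast0LessThan)
    have "local_frame M ?B U (card ?I) (\<lambda>k. prolong M A (jet_frame_section s q (h k)))"
      by (rule jet_local_frame[OF U(3,4) c(1) _ _ _ h]) (use U(2) W in auto)
    then show ?thesis using U(1) by blast
  qed
  then show ?thesis
    unfolding vector_bundle_def
  proof (intro conjI allI impI)
    show "Module.module real_ring (fibre ?B m)" for m using jet_module by simp
    show "\<exists>r. \<forall>m. \<exists>U s. m \<in> U \<and> local_frame M ?B U r s" if "\<And>m. \<exists>U s. m \<in> U \<and> local_frame M ?B U (card ?I) s"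
      using that by blast
    show "\<sigma> \<in> sections ?B V" if "open U \<and> open V \<and> V \<subseteq> U \<and> \<sigma> \<in> sections ?B U" for U V \<sigma>
      using that jet_sections_restrict[of \<sigma> U V] by simp
    show "\<sigma> \<in> sections ?B U"
      if "open U \<and> (\<forall>m\<in>U. \<exists>V. open V \<and> m \<in> V \<and> V \<subseteq> U \<and> \<sigma> \<in> sections ?B V)" for U \<sigma>
      using that jet_sections_glue[of U \<sigma>] by simp
  qed
qed

end

subsection \<open>The Lie algebroid of first jets\<close>

context transitive_algebroid begin

abbreviation JSec :: "('m \<Rightarrow> ('m \<Rightarrow> 'v) set) set" where "JSec \<equiv> jet_sections M A UNIV"

lemma J1_with_bracket_simps [simp]:
  "fibre (J1_with_bracket M A b) = J" "sections (J1_with_bracket M A b) = jet_sections M A"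
  "anchor (J1_with_bracket M A b) = (\<lambda>m j. anc m (jet_proj m j))" "bracket (J1_with_bracket M A b) = b"
  by (simp_all add: J1_with_bracket_def)

lemma J1_simps [simp]:
  "fibre (J1 M A) = J" "sections (J1 M A) = jet_sections M A"
  "anchor (J1 M A) = (\<lambda>m j. anc m (jet_proj m j))"
  by (simp_all add: J1_def)

lemma J1_with_bracket_ops [simp]:
  "sadd (J1_with_bracket M A b) = sadd (J1 M A)" "sscale (J1_with_bracket M A b) = sscale (J1 M A)"
  "szero (J1_with_bracket M A b) = szero (J1 M A)"
  by (intro ext; simp add: sadd_def sscale_def szero_def)+

sublocale JB: smooth_bundle M "J1 M A"
  using vector_bundle_jets
  by (intro smooth_bundle.intro manifold_axioms smooth_bundle_axioms.intro) (simp add: J1_def)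

section \<open>Sections of the jet bundle as operators\<close>

definition pr :: "('m \<Rightarrow> ('m \<Rightarrow> 'v) set) \<Rightarrow> 'm \<Rightarrow> 'v" where
  "pr \<xi> = (\<lambda>x. jet_proj x (\<xi> x))"

text \<open>\<open>act \<xi>\<close> is the operator \<open>D\<close> attached to
  \<open>\<xi>\<close>, and \<open>pr\<close> is the projection \<open>a\<close> on
  sections.\<close>

definition act :: "('m \<Rightarrow> ('m \<Rightarrow> 'v) set) \<Rightarrow> ('m \<Rightarrow> 'v) \<Rightarrow> 'm \<Rightarrow> 'v" where
  "act \<xi> Z = (\<lambda>x. jet_act x (\<xi> x) Z)"

lemma jsec_carrier [simp]: "\<xi> \<in> JSec \<Longrightarrow> \<xi> m \<in> carrier (J m)"
  by (rule jet_sections_carrier[OF _ UNIV_I])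

lemma jsec_sadd [simp]: "\<xi> \<in> JSec \<Longrightarrow> \<eta> \<in> JSec \<Longrightarrow> sadd (J1 M A) \<xi> \<eta> \<in> JSec"
  using JB.section_add[of UNIV \<xi> \<eta>] by simp

lemma jsec_sscale [simp]: "smooth_fun M UNIV f \<Longrightarrow> \<xi> \<in> JSec \<Longrightarrow> sscale (J1 M A) f \<xi> \<in> JSec"
  using JB.section_scale[of UNIV f \<xi>] by simp

lemma prolong_jet_section: "\<sigma> \<in> sections A U \<Longrightarrow> open U \<Longrightarrow> prolong M A \<sigma> \<in> jet_sections M A U"
proof (rule jet_sectionsI[of U 1 "\<lambda>i x. 1" "\<lambda>i. \<sigma>"])
  assume s: "\<sigma> \<in> sections A U" "open U"
  then show "\<forall>i<1. smooth_fun M U (\<lambda>x. 1) \<and> \<sigma> \<in> sections A U" by (simp add: smooth_fun_const)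
  show "\<forall>x\<in>U. prolong M A \<sigma> x = (\<Oplus>\<^bsub>J x\<^esub>i\<in>{..<(1::nat)}. 1 \<odot>\<^bsub>J x\<^esub> jet M A x \<sigma>)"
  proof
    fix x assume "x \<in> U"
    then have c: "jet M A x \<sigma> \<in> carrier (J x)" using local_jet_in_carrier section_local s by blast
    show "prolong M A \<sigma> x = (\<Oplus>\<^bsub>J x\<^esub>i\<in>{..<(1::nat)}. 1 \<odot>\<^bsub>J x\<^esub> jet M A x \<sigma>)"
    proof (rule J.separated)
      show "l (prolong M A \<sigma> x) = l (\<Oplus>\<^bsub>J x\<^esub>i\<in>{..<(1::nat)}. 1 \<odot>\<^bsub>J x\<^esub> jet M A x \<sigma>)"
        if l: "linear_functional (J x) l" for l
      proof -
        have "l (\<Oplus>\<^bsub>J x\<^esub>i\<in>{..<(1::nat)}. 1 \<odot>\<^bsub>J x\<^esub> jet M A x \<sigma>) = (\<Sum>i<(1::nat). l (1 \<odot>\<^bsub>J x\<^esub> jet M A x \<sigma>))"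
          by (rule J.lf_finsum[OF l]) (use c in simp)
        then show ?thesis using c by (simp add: prolong_def J.lf_smult[OF l])
      qed
    qed (use c in \<open>auto simp: prolong_def intro!: J.finsum_closed\<close>)
  qed
qed

lemma prolong_jsec [simp]: "X \<in> Sec \<Longrightarrow> prolong M A X \<in> JSec"
  by (rule prolong_jet_section) simp_all

lemma pr_prolong [simp]: "X \<in> Sec \<Longrightarrow> pr (prolong M A X) = X"
  by (simp add: pr_def prolong_def)

lemma act_prolong [simp]: "X \<in> Sec \<Longrightarrow> Z \<in> Sec \<Longrightarrow> act (prolong M A X) Z = br X Z"
  by (simp add: act_def prolong_def)

lemma jet_finsum_lf:
  assumes "\<forall>i<n. X i \<in> Sec" and l: "linear_functional (fibre A x) l"
  shows "l (jet_proj x (\<Oplus>\<^bsub>J x\<^esub>i\<in>{..<(n::nat)}. f i \<odot>\<^bsub>J x\<^esub> jet M A x (X i))) = (\<Sum>i<n. f i * l (X i x))"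
    and "Z \<in> Sec \<Longrightarrow>
      l (jet_act x (\<Oplus>\<^bsub>J x\<^esub>i\<in>{..<(n::nat)}. f i \<odot>\<^bsub>J x\<^esub> jet M A x (X i)) Z) = (\<Sum>i<n. f i * l (br (X i) Z x))"
proof -
  note 1 = linear_functional_jet_proj[OF l]
  have "l (jet_proj x (\<Oplus>\<^bsub>J x\<^esub>i\<in>{..<n}. f i \<odot>\<^bsub>J x\<^esub> jet M A x (X i)))
      = (\<Sum>i<n. l (jet_proj x (f i \<odot>\<^bsub>J x\<^esub> jet M A x (X i))))"
    by (rule J.lf_finsum[OF 1]) (use assms(1) in simp)
  also have "\<dots> = (\<Sum>i<n. f i * l (X i x))"
    using assms(1) J.lf_smult[OF 1] by (intro sum.cong) auto
  finally show "l (jet_proj x (\<Oplus>\<^bsub>J x\<^esub>i\<in>{..<n}. f i \<odot>\<^bsub>J x\<^esub> jet M A x (X i))) = (\<Sum>i<n. f i * l (X i x))" .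
  assume Z: "Z \<in> Sec"
  note 2 = linear_functional_jet_act[OF l Z]
  have "l (jet_act x (\<Oplus>\<^bsub>J x\<^esub>i\<in>{..<n}. f i \<odot>\<^bsub>J x\<^esub> jet M A x (X i)) Z)
      = (\<Sum>i<n. l (jet_act x (f i \<odot>\<^bsub>J x\<^esub> jet M A x (X i)) Z))"
    by (rule J.lf_finsum[OF 2]) (use assms(1) in simp)
  also have "\<dots> = (\<Sum>i<n. f i * l (br (X i) Z x))"
    using assms(1) Z J.lf_smult[OF 2] by (intro sum.cong) auto
  finally show "l (jet_act x (\<Oplus>\<^bsub>J x\<^esub>i\<in>{..<n}. f i \<odot>\<^bsub>J x\<^esub> jet M A x (X i)) Z) = (\<Sum>i<n. f i * l (br (X i) Z x))" .
qed

text \<open>Near each point \<open>\<xi>\<close> is a combination of prolongations; its images are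
  the same combinations of the sections \<open>X i\<close> and of the sections
  \<open>br (X i) Z\<close>.\<close>

lemma jet_sections_images:
  assumes "\<xi> \<in> jet_sections M A U" "open U"
  shows pr_section: "pr \<xi> \<in> sections A U" and act_section: "Z \<in> Sec \<Longrightarrow> act \<xi> Z \<in> sections A U"
proof -
  have *: "(\<exists>V. open V \<and> m \<in> V \<and> V \<subseteq> U \<and> pr \<xi> \<in> sections A V) \<and>
      (Z \<in> Sec \<longrightarrow> (\<exists>V. open V \<and> m \<in> V \<and> V \<subseteq> U \<and> act \<xi> Z \<in> sections A V))" if m: "m \<in> U" for m Z
  proof -
    obtain n f X W where W: "\<forall>i<n. smooth_fun M UNIV (f i)" "\<forall>i<n. X i \<in> Sec" "open W" "m \<in> W" "W \<subseteq> U"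
      "\<forall>x\<in>W. \<xi> x = (\<Oplus>\<^bsub>J x\<^esub>i\<in>{..<(n::nat)}. f i x \<odot>\<^bsub>J x\<^esub> jet M A x (X i))"
      by (rule jet_sections_local[OF assms(1) m])
    have "(\<lambda>x. \<Oplus>\<^bsub>fibre A x\<^esub>i\<in>{..<n}. f i x \<odot>\<^bsub>fibre A x\<^esub> X i x) \<in> Sec"
      by (rule sec_finsum) (use W(1,2) in auto)
    then have s: "(\<lambda>x. \<Oplus>\<^bsub>fibre A x\<^esub>i\<in>{..<n}. f i x \<odot>\<^bsub>fibre A x\<^esub> X i x) \<in> sections A W"
      by (rule section_restrict[OF _ open_UNIV W(3) subset_UNIV])
    have "pr \<xi> \<in> sections A W"
    proof (rule section_cong[OF W(3) _ s])
      fix x assume x: "x \<in> W"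
      show "(\<Oplus>\<^bsub>fibre A x\<^esub>i\<in>{..<n}. f i x \<odot>\<^bsub>fibre A x\<^esub> X i x) = pr \<xi> x"
      proof (rule br_eqI)
        fix l assume l: "linear_functional (fibre A x) l"
        have "l (\<Oplus>\<^bsub>fibre A x\<^esub>i\<in>{..<n}. f i x \<odot>\<^bsub>fibre A x\<^esub> X i x) = (\<Sum>i<n. l (f i x \<odot>\<^bsub>fibre A x\<^esub> X i x))"
          by (rule F.lf_finsum[OF l]) (use W(2) in simp)
        then show "l (\<Oplus>\<^bsub>fibre A x\<^esub>i\<in>{..<n}. f i x \<odot>\<^bsub>fibre A x\<^esub> X i x) = l (pr \<xi> x)"
          using jet_finsum_lf(1)[OF W(2) l, of "\<lambda>i. f i x"] W(2,6) x by (simp add: pr_def F.lf_smult[OF l])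
      qed (use W(2) jet_sections_carrier[OF assms(1)] W(5) x in \<open>auto simp: pr_def intro!: F.finsum_closed\<close>)
    qed
    moreover have "act \<xi> Z \<in> sections A W" if Z: "Z \<in> Sec"
    proof -
      have "(\<lambda>x. \<Oplus>\<^bsub>fibre A x\<^esub>i\<in>{..<n}. f i x \<odot>\<^bsub>fibre A x\<^esub> br (X i) Z x) \<in> Sec"
        by (rule sec_finsum) (use W(1,2) Z in auto)
      then have s: "(\<lambda>x. \<Oplus>\<^bsub>fibre A x\<^esub>i\<in>{..<n}. f i x \<odot>\<^bsub>fibre A x\<^esub> br (X i) Z x) \<in> sections A W"
        by (rule section_restrict[OF _ open_UNIV W(3) subset_UNIV])
      show ?thesis
      proof (rule section_cong[OF W(3) _ s])
        fix x assume x: "x \<in> W"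
        show "(\<Oplus>\<^bsub>fibre A x\<^esub>i\<in>{..<n}. f i x \<odot>\<^bsub>fibre A x\<^esub> br (X i) Z x) = act \<xi> Z x"
        proof (rule br_eqI)
          fix l assume l: "linear_functional (fibre A x) l"
          have "l (\<Oplus>\<^bsub>fibre A x\<^esub>i\<in>{..<n}. f i x \<odot>\<^bsub>fibre A x\<^esub> br (X i) Z x) = (\<Sum>i<n. l (f i x \<odot>\<^bsub>fibre A x\<^esub> br (X i) Z x))"
            by (rule F.lf_finsum[OF l]) (use W(2) Z in simp)
          then show "l (\<Oplus>\<^bsub>fibre A x\<^esub>i\<in>{..<n}. f i x \<odot>\<^bsub>fibre A x\<^esub> br (X i) Z x) = l (act \<xi> Z x)"
            using jet_finsum_lf(2)[OF W(2) l Z, of "\<lambda>i. f i x"] W(2,6) x Z by (simp add: act_def F.lf_smult[OF l])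
        qed (use W(2) jet_sections_carrier[OF assms(1)] W(5) x Z in \<open>auto simp: act_def intro!: F.finsum_closed\<close>)
      qed
    qed
    ultimately show ?thesis using W(3-5) by (intro conjI impI exI[of _ W]) simp_all
  qed
  show "pr \<xi> \<in> sections A U" by (rule section_glue[OF assms(2)]) (use * in simp)
  show "act \<xi> Z \<in> sections A U" if "Z \<in> Sec"
    by (rule section_glue[OF assms(2)]) (use * that in simp)
qed

lemma pr_sec [simp]: "\<xi> \<in> JSec \<Longrightarrow> pr \<xi> \<in> Sec"
  by (rule pr_section) simp_all

lemma act_sec [simp]: "\<xi> \<in> JSec \<Longrightarrow> Z \<in> Sec \<Longrightarrow> act \<xi> Z \<in> Sec"
  by (rule act_section) simp_all

lemma act_cong_right:
  assumes "j \<in> carrier (J m)" "Z \<in> Sec" "Z' \<in> Sec" "open W" "m \<in> W" "\<forall>x\<in>W. Z x = Z' x"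
  shows "jet_act m j Z = jet_act m j Z'"
proof -
  obtain X where X: "X \<in> Sec" "j = jet M A m X" by (rule jet_carrierE[OF assms(1)])
  show ?thesis using br_cong_right[OF X(1) assms(2-6)] X assms by simp
qed

context
  fixes m :: 'm and l :: "'v \<Rightarrow> real"
  assumes l: "linear_functional (fibre A m) l"
begin

lemma lf_pr_sadd: "\<xi> \<in> JSec \<Longrightarrow> \<eta> \<in> JSec \<Longrightarrow> l (pr (sadd (J1 M A) \<xi> \<eta>) m) = l (pr \<xi> m) + l (pr \<eta> m)"
  using J.lf_add[OF linear_functional_jet_proj[OF l]] by (simp add: pr_def sadd_def)

lemma lf_pr_sscale: "\<xi> \<in> JSec \<Longrightarrow> l (pr (sscale (J1 M A) f \<xi>) m) = f m * l (pr \<xi> m)"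
  using J.lf_smult[OF linear_functional_jet_proj[OF l]] by (simp add: pr_def sscale_def)

lemma lf_act_sadd: "\<xi> \<in> JSec \<Longrightarrow> \<eta> \<in> JSec \<Longrightarrow> Z \<in> Sec \<Longrightarrow>
    l (act (sadd (J1 M A) \<xi> \<eta>) Z m) = l (act \<xi> Z m) + l (act \<eta> Z m)"
  using J.lf_add[OF linear_functional_jet_act[OF l, of Z]] by (simp add: act_def sadd_def)

lemma lf_act_sscale: "\<xi> \<in> JSec \<Longrightarrow> Z \<in> Sec \<Longrightarrow> l (act (sscale (J1 M A) f \<xi>) Z m) = f m * l (act \<xi> Z m)"
  using J.lf_smult[OF linear_functional_jet_act[OF l, of Z]] by (simp add: act_def sscale_def)

lemma lf_pr_szero: "l (pr (szero (J1 M A)) m) = 0"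
  using J.lf_zero[OF linear_functional_jet_proj[OF l]] by (simp add: pr_def szero_def)

lemma lf_act_szero: "Z \<in> Sec \<Longrightarrow> l (act (szero (J1 M A)) Z m) = 0"
  using J.lf_zero[OF linear_functional_jet_act[OF l, of Z]] by (simp add: act_def szero_def)

text \<open>At \<open>m\<close> the section \<open>\<xi>\<close> may be replaced by a single
  prolongation, so \<open>act \<xi>\<close> inherits the derivation rule of a bracket, with the
  anchor of \<open>pr \<xi>\<close> as symbol.\<close>

lemma lf_act_arg:
  assumes "\<xi> \<in> JSec" "Z \<in> Sec"
  shows lf_act_arg_sadd: "Z' \<in> Sec \<Longrightarrow> l (act \<xi> (sadd A Z Z') m) = l (act \<xi> Z m) + l (act \<xi> Z' m)"
    and lf_act_arg_ssub: "Z' \<in> Sec \<Longrightarrow> l (act \<xi> (ssub Z Z') m) = l (act \<xi> Z m) - l (act \<xi> Z' m)"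
    and lf_act_arg_sscale: "smooth_fun M UNIV f \<Longrightarrow>
      l (act \<xi> (sscale A f Z) m) = f m * l (act \<xi> Z m) + anc m (pr \<xi> m) f * l (Z m)"
proof -
  obtain X where X: "X \<in> Sec" "\<xi> m = jet M A m X" by (rule jet_carrierE[of "\<xi> m" m]) (use assms in auto)
  show "Z' \<in> Sec \<Longrightarrow> l (act \<xi> (sadd A Z Z') m) = l (act \<xi> Z m) + l (act \<xi> Z' m)"
    "Z' \<in> Sec \<Longrightarrow> l (act \<xi> (ssub Z Z') m) = l (act \<xi> Z m) - l (act \<xi> Z' m)"
    "smooth_fun M UNIV f \<Longrightarrow>
      l (act \<xi> (sscale A f Z) m) = f m * l (act \<xi> Z m) + anc m (pr \<xi> m) f * l (Z m)"
    using X assms by (simp_all add: act_def pr_def lf_sec[OF l])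
qed

end

lemmas lf_jsec = lf_pr_sadd lf_pr_sscale lf_act_sadd lf_act_sscale lf_pr_szero lf_act_szero
  lf_act_arg_sadd lf_act_arg_ssub lf_act_arg_sscale

lemma jsec_eqI:
  assumes "\<xi> m \<in> carrier (J m)" "\<eta> m \<in> carrier (J m)"
    "\<And>l. linear_functional (fibre A m) l \<Longrightarrow> l (pr \<xi> m) = l (pr \<eta> m)"
    "\<And>l Z. linear_functional (fibre A m) l \<Longrightarrow> Z \<in> Sec \<Longrightarrow> l (act \<xi> Z m) = l (act \<eta> Z m)"
  shows "\<xi> m = \<eta> m"
  by (rule jet_space_lfI[OF assms(1,2)]) (use assms(3,4) in \<open>simp_all add: pr_def act_def\<close>)

lemma section_eqI:
  assumes "X \<in> Sec" "Y \<in> Sec" "\<And>l m. linear_functional (fibre A m) l \<Longrightarrow> l (X m) = l (Y m)"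
  shows "X = Y"
proof
  show "X m = Y m" for m by (rule br_eqI[of _ m]) (use assms in simp_all)
qed

lemma pr_sadd: "\<xi> \<in> JSec \<Longrightarrow> \<eta> \<in> JSec \<Longrightarrow> pr (sadd (J1 M A) \<xi> \<eta>) = sadd A (pr \<xi>) (pr \<eta>)"
  by (rule section_eqI) (simp_all add: lf_jsec lf_sec)

lemma pr_sscale: "smooth_fun M UNIV f \<Longrightarrow> \<xi> \<in> JSec \<Longrightarrow> pr (sscale (J1 M A) f \<xi>) = sscale A f (pr \<xi>)"
  by (rule section_eqI) (simp_all add: lf_jsec lf_sec)

lemma act_sadd: "\<xi> \<in> JSec \<Longrightarrow> \<eta> \<in> JSec \<Longrightarrow> Z \<in> Sec \<Longrightarrow>
    act (sadd (J1 M A) \<xi> \<eta>) Z = sadd A (act \<xi> Z) (act \<eta> Z)"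
  by (rule section_eqI) (simp_all add: lf_jsec lf_sec)

lemma act_sscale: "smooth_fun M UNIV f \<Longrightarrow> \<xi> \<in> JSec \<Longrightarrow> Z \<in> Sec \<Longrightarrow>
    act (sscale (J1 M A) f \<xi>) Z = sscale A f (act \<xi> Z)"
  by (rule section_eqI) (simp_all add: lf_jsec lf_sec)

text \<open>For properties that are local at \<open>m\<close>: near \<open>m\<close> every section
  is a finite combination of prolongations.\<close>

lemma jsec_induct [consumes 1, case_names germ prolong add scale]:
  assumes \<xi>: "\<xi> \<in> JSec"
    and germ: "\<And>\<xi> \<xi>' W. \<xi> \<in> JSec \<Longrightarrow> \<xi>' \<in> JSec \<Longrightarrow> open W \<Longrightarrow> m \<in> W \<Longrightarrow> \<forall>x\<in>W. \<xi> x = \<xi>' x \<Longrightarrow> R \<xi> \<Longrightarrow> R \<xi>'"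
    and prolong: "\<And>X. X \<in> Sec \<Longrightarrow> R (prolong M A X)"
    and add: "\<And>\<xi> \<eta>. \<xi> \<in> JSec \<Longrightarrow> \<eta> \<in> JSec \<Longrightarrow> R \<xi> \<Longrightarrow> R \<eta> \<Longrightarrow> R (sadd (J1 M A) \<xi> \<eta>)"
    and scale: "\<And>f \<xi>. smooth_fun M UNIV f \<Longrightarrow> \<xi> \<in> JSec \<Longrightarrow> R \<xi> \<Longrightarrow> R (sscale (J1 M A) f \<xi>)"
  shows "R \<xi>"
proof -
  obtain n f X W where W: "\<forall>i<n. smooth_fun M UNIV (f i)" "\<forall>i<n. X i \<in> Sec" "open W" "m \<in> W" "W \<subseteq> UNIV"
    "\<forall>x\<in>W. \<xi> x = (\<Oplus>\<^bsub>J x\<^esub>i\<in>{..<(n::nat)}. f i x \<odot>\<^bsub>J x\<^esub> jet M A x (X i))"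
    by (rule jet_sections_local[OF \<xi> UNIV_I])
  let ?s = "\<lambda>k x. \<Oplus>\<^bsub>J x\<^esub>i\<in>{..<(k::nat)}. f i x \<odot>\<^bsub>J x\<^esub> jet M A x (X i)"
  have "?s k \<in> JSec \<and> R (?s k)" if "k \<le> n" for k
    using that
  proof (induction k)
    case 0
    \<comment> \<open>The empty sum is reached as zero times a prolongation.\<close>
    have "?s 0 = sscale (J1 M A) (\<lambda>x. 0) (prolong M A (szero A))"
      using J.M.smult_l_null[simplified] by (simp add: sscale_def prolong_def)
    then show ?case using scale[of "\<lambda>x. 0" "prolong M A (szero A)"] prolong[of "szero A"] by simp
  next
    case (Suc k)
    then have k: "X k \<in> Sec" "smooth_fun M UNIV (f k)" and Xi: "\<And>i. i < k \<Longrightarrow> X i \<in> Sec"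
      using W(1,2) by auto
    have "?s (Suc k) = sadd (J1 M A) (sscale (J1 M A) (f k) (prolong M A (X k))) (?s k)"
      unfolding sadd_def sscale_def prolong_def J1_simps lessThan_Suc
      using k Xi by (intro ext J.M.finsum_insert) auto
    then show ?case using Suc k by (simp add: add scale prolong)
  qed
  then have "?s n \<in> JSec" "R (?s n)" by auto
  moreover have "\<forall>x\<in>W. ?s n x = \<xi> x" using W(6) by simp
  ultimately show ?thesis using germ[of "?s n" \<xi> W] W(3,4) \<xi> by blast
qed

section \<open>The commutator bracket on first jets\<close>

text \<open>Pointwise form: a jet is fixed by its projection and its action, so at most one
  \<open>j\<close> qualifies at each point and existence is the issue.\<close>

definition is_commutator :: "('m \<Rightarrow> ('m \<Rightarrow> 'v) set) \<Rightarrow> ('m \<Rightarrow> ('m \<Rightarrow> 'v) set) \<Rightarrow> 'm \<Rightarrow> ('m \<Rightarrow> 'v) set \<Rightarrow> bool" where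
  "is_commutator \<xi> \<eta> x j \<longleftrightarrow> j \<in> carrier (J x) \<and> jet_proj x j = br (pr \<xi>) (pr \<eta>) x \<and>
     (\<forall>Z\<in>Sec. jet_act x j Z = ssub (act \<xi> (act \<eta> Z)) (act \<eta> (act \<xi> Z)) x)"

lemma is_commutatorI:
  assumes "\<xi> \<in> JSec" "\<eta> \<in> JSec" "\<zeta> \<in> JSec"
    "\<And>l. linear_functional (fibre A x) l \<Longrightarrow> l (pr \<zeta> x) = l (br (pr \<xi>) (pr \<eta>) x)"
    "\<And>l Z. linear_functional (fibre A x) l \<Longrightarrow> Z \<in> Sec \<Longrightarrow>
      l (act \<zeta> Z x) = l (act \<xi> (act \<eta> Z) x) - l (act \<eta> (act \<xi> Z) x)"
  shows "is_commutator \<xi> \<eta> x (\<zeta> x)"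
  unfolding is_commutator_def
proof (intro conjI ballI)
  have "pr \<zeta> x = br (pr \<xi>) (pr \<eta>) x"
    by (rule br_eqI[of _ x]) (use assms in simp_all)
  then show "jet_proj x (\<zeta> x) = br (pr \<xi>) (pr \<eta>) x" unfolding pr_def[of \<zeta>] .
  show "jet_act x (\<zeta> x) Z = ssub (act \<xi> (act \<eta> Z)) (act \<eta> (act \<xi> Z)) x" if Z: "Z \<in> Sec" for Z
  proof -
    have "act \<zeta> Z x = ssub (act \<xi> (act \<eta> Z)) (act \<eta> (act \<xi> Z)) x"
      by (rule br_eqI[of _ x]) (use assms(1,2,3) Z assms(5)[OF _ Z] in \<open>simp_all add: lf_ssub\<close>)
    then show ?thesis unfolding act_def[of \<zeta>] .
  qed
qed (use assms in simp)

lemma is_commutatorD: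
  assumes "is_commutator \<xi> \<eta> x (\<zeta> x)" "\<xi> \<in> JSec" "\<eta> \<in> JSec" and l: "linear_functional (fibre A x) l"
  shows "l (pr \<zeta> x) = l (br (pr \<xi>) (pr \<eta>) x)"
    and "Z \<in> Sec \<Longrightarrow> l (act \<zeta> Z x) = l (act \<xi> (act \<eta> Z) x) - l (act \<eta> (act \<xi> Z) x)"
proof -
  have "pr \<zeta> x = br (pr \<xi>) (pr \<eta>) x" using assms(1) unfolding is_commutator_def pr_def[of \<zeta>] by blast
  then show "l (pr \<zeta> x) = l (br (pr \<xi>) (pr \<eta>) x)" by simp
  assume Z: "Z \<in> Sec"
  have "act \<zeta> Z x = ssub (act \<xi> (act \<eta> Z)) (act \<eta> (act \<xi> Z)) x"
    using assms(1) Z unfolding is_commutator_def act_def[of \<zeta>] by blast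
  then show "l (act \<zeta> Z x) = l (act \<xi> (act \<eta> Z) x) - l (act \<eta> (act \<xi> Z) x)"
    using assms(2,3) Z by (simp add: lf_ssub[OF l])
qed

lemma is_commutator_unique: "is_commutator \<xi> \<eta> x j \<Longrightarrow> is_commutator \<xi> \<eta> x k \<Longrightarrow> j = k"
  unfolding is_commutator_def by (rule jet_space_eqI[of j x k]) simp_all

text \<open>One smooth section must represent the commutator on a whole neighbourhood, since
  smoothness of the bracket is read off it.\<close>

definition has_commutator :: "'m \<Rightarrow> ('m \<Rightarrow> ('m \<Rightarrow> 'v) set) \<Rightarrow> ('m \<Rightarrow> ('m \<Rightarrow> 'v) set) \<Rightarrow> bool" where
  "has_commutator m \<xi> \<eta> \<longleftrightarrow> (\<exists>W \<zeta>. open W \<and> m \<in> W \<and> \<zeta> \<in> JSec \<and> (\<forall>x\<in>W. is_commutator \<xi> \<eta> x (\<zeta> x)))"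

lemma has_commutator_sym:
  assumes "\<xi> \<in> JSec" "\<eta> \<in> JSec" "has_commutator m \<xi> \<eta>"
  shows "has_commutator m \<eta> \<xi>"
proof -
  obtain W \<zeta> where W: "open W" "m \<in> W" "\<zeta> \<in> JSec" "\<forall>x\<in>W. is_commutator \<xi> \<eta> x (\<zeta> x)"
    using assms(3) unfolding has_commutator_def by (elim exE conjE)
  have "is_commutator \<eta> \<xi> x (sscale (J1 M A) (\<lambda>x. -1) \<zeta> x)" if x: "x \<in> W" for x
  proof (rule is_commutatorI)
    have c: "is_commutator \<xi> \<eta> x (\<zeta> x)" using W(4) x by blast
    fix l assume l: "linear_functional (fibre A x) l"
    show "l (pr (sscale (J1 M A) (\<lambda>x. - 1) \<zeta>) x) = l (br (pr \<eta>) (pr \<xi>) x)"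
      using is_commutatorD(1)[where \<zeta>=\<zeta>, OF c assms(1,2) l] lf_br_skew[OF l, of "pr \<xi>" "pr \<eta>"] assms W(3)
      by (simp add: lf_jsec[OF l])
    show "l (act (sscale (J1 M A) (\<lambda>x. - 1) \<zeta>) Z x) = l (act \<eta> (act \<xi> Z) x) - l (act \<xi> (act \<eta> Z) x)"
      if "Z \<in> Sec" for Z
      using is_commutatorD(2)[where \<zeta>=\<zeta>, OF c assms(1,2) l that] assms W(3) that
      by (simp add: lf_jsec[OF l])
  qed (use assms W(3) in simp_all)
  then show ?thesis
    using W(1-3) unfolding has_commutator_def
    by (intro exI[of _ W] exI[of _ "sscale (J1 M A) (\<lambda>x. -1) \<zeta>"]) simp
qed

text \<open>Existence of a commutator is stable under the closure steps of
  \<open>jsec_induct\<close> in the first argument, so prolongations suffice there.\<close>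

lemma has_commutator_left:
  assumes \<xi>: "\<xi> \<in> JSec" and \<eta>: "\<eta> \<in> JSec" and base: "\<And>X. X \<in> Sec \<Longrightarrow> has_commutator m (prolong M A X) \<eta>"
  shows "has_commutator m \<xi> \<eta>"
  using \<xi>
proof (induction rule: jsec_induct[where m=m])
  case (germ \<xi> \<xi>' V)
  obtain W \<zeta> where W: "open W" "m \<in> W" "\<zeta> \<in> JSec" "\<forall>x\<in>W. is_commutator \<xi> \<eta> x (\<zeta> x)"
    using germ(6) unfolding has_commutator_def by (elim exE conjE)
  have "is_commutator \<xi>' \<eta> x (\<zeta> x)" if x: "x \<in> W \<inter> V" for x
  proof (rule is_commutatorI)
    have c: "is_commutator \<xi> \<eta> x (\<zeta> x)" and V: "x \<in> V" using W(4) x by auto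
    fix l assume l: "linear_functional (fibre A x) l"
    have "\<forall>x\<in>V. pr \<xi> x = pr \<xi>' x" using germ(5) by (simp add: pr_def)
    then have "br (pr \<xi>) (pr \<eta>) x = br (pr \<xi>') (pr \<eta>) x"
      using germ(1,2) \<eta> by (intro br_cong_left[OF _ _ _ germ(3) V]) simp_all
    then show "l (pr \<zeta> x) = l (br (pr \<xi>') (pr \<eta>) x)"
      using is_commutatorD(1)[where \<zeta>=\<zeta>, OF c germ(1) \<eta> l] by simp
    fix Z assume Z: "Z \<in> Sec"
    have "\<forall>x\<in>V. act \<xi> Z x = act \<xi>' Z x" using germ(5) by (simp add: act_def)
    then have "jet_act x (\<eta> x) (act \<xi> Z) = jet_act x (\<eta> x) (act \<xi>' Z)"
      using germ(1,2) \<eta> Z by (intro act_cong_right[OF _ _ _ germ(3) V]) simp_all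
    then have "act \<eta> (act \<xi> Z) x = act \<eta> (act \<xi>' Z) x"
      by (simp add: act_def[of \<eta>])
    moreover have "act \<xi> (act \<eta> Z) x = act \<xi>' (act \<eta> Z) x"
      using germ(5) V by (simp add: act_def[of \<xi>] act_def[of \<xi>'])
    ultimately show "l (act \<zeta> Z x) = l (act \<xi>' (act \<eta> Z) x) - l (act \<eta> (act \<xi>' Z) x)"
      using is_commutatorD(2)[where \<zeta>=\<zeta>, OF c germ(1) \<eta> l Z] by simp
  qed (use germ \<eta> W(3) in simp_all)
  moreover have "open (W \<inter> V)" using W(1) germ(3) by (rule open_Int)
  ultimately show ?case
    using W(2,3) germ(4) unfolding has_commutator_def by (intro exI[of _ "W \<inter> V"] exI[of _ \<zeta>]) simp
next
  case (prolong X)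
  then show ?case by (rule base)
next
  case (add \<xi>1 \<xi>2)
  obtain W1 \<zeta>1 where W1: "open W1" "m \<in> W1" "\<zeta>1 \<in> JSec" "\<forall>x\<in>W1. is_commutator \<xi>1 \<eta> x (\<zeta>1 x)"
    using add(3) unfolding has_commutator_def by (elim exE conjE)
  obtain W2 \<zeta>2 where W2: "open W2" "m \<in> W2" "\<zeta>2 \<in> JSec" "\<forall>x\<in>W2. is_commutator \<xi>2 \<eta> x (\<zeta>2 x)"
    using add(4) unfolding has_commutator_def by (elim exE conjE)
  have "is_commutator (sadd (J1 M A) \<xi>1 \<xi>2) \<eta> x (sadd (J1 M A) \<zeta>1 \<zeta>2 x)" if x: "x \<in> W1 \<inter> W2" for x
  proof (rule is_commutatorI)
    have c: "is_commutator \<xi>1 \<eta> x (\<zeta>1 x)" "is_commutator \<xi>2 \<eta> x (\<zeta>2 x)" using W1(4) W2(4) x by auto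
    fix l assume l: "linear_functional (fibre A x) l"
    show "l (pr (sadd (J1 M A) \<zeta>1 \<zeta>2) x) = l (br (pr (sadd (J1 M A) \<xi>1 \<xi>2)) (pr \<eta>) x)"
      using is_commutatorD(1)[where \<zeta>=\<zeta>1, OF c(1) add(1) \<eta> l] is_commutatorD(1)[where \<zeta>=\<zeta>2, OF c(2) add(2) \<eta> l] add(1,2) \<eta> W1(3) W2(3)
      by (simp add: lf_jsec[OF l] lf_sec[OF l] pr_sadd)
    show "l (act (sadd (J1 M A) \<zeta>1 \<zeta>2) Z x) =
        l (act (sadd (J1 M A) \<xi>1 \<xi>2) (act \<eta> Z) x) - l (act \<eta> (act (sadd (J1 M A) \<xi>1 \<xi>2) Z) x)"
      if "Z \<in> Sec" for Z
      using is_commutatorD(2)[where \<zeta>=\<zeta>1, OF c(1) add(1) \<eta> l that] is_commutatorD(2)[where \<zeta>=\<zeta>2, OF c(2) add(2) \<eta> l that]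
        add(1,2) \<eta> W1(3) W2(3) that
      by (simp add: lf_jsec[OF l] lf_sec[OF l] act_sadd)
  qed (use add \<eta> W1(3) W2(3) in simp_all)
  moreover have "open (W1 \<inter> W2)" using W1(1) W2(1) by (rule open_Int)
  ultimately show ?case
    using W1(2,3) W2(2,3) unfolding has_commutator_def
    by (intro exI[of _ "W1 \<inter> W2"] exI[of _ "sadd (J1 M A) \<zeta>1 \<zeta>2"]) simp
next
  case (scale f \<xi>)
  obtain W \<zeta> where W: "open W" "m \<in> W" "\<zeta> \<in> JSec" "\<forall>x\<in>W. is_commutator \<xi> \<eta> x (\<zeta> x)"
    using scale(3) unfolding has_commutator_def by (elim exE conjE)
  \<comment> \<open>Leibniz rule in the first argument:
    \<open>[f \<xi>, \<eta>] = f [\<xi>, \<eta>] - #\<eta>(f) \<xi>\<close>.\<close>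
  let ?g = "\<lambda>x. - anc x (pr \<eta> x) f"
  let ?\<zeta> = "sadd (J1 M A) (sscale (J1 M A) f \<zeta>) (sscale (J1 M A) ?g \<xi>)"
  have g: "smooth_fun M UNIV ?g" using scale(1) \<eta> by (intro smooth_fun_uminus) simp_all
  have "is_commutator (sscale (J1 M A) f \<xi>) \<eta> x (?\<zeta> x)" if x: "x \<in> W" for x
  proof (rule is_commutatorI)
    have c: "is_commutator \<xi> \<eta> x (\<zeta> x)" using W(4) x by auto
    fix l assume l: "linear_functional (fibre A x) l"
    show "l (pr ?\<zeta> x) = l (br (pr (sscale (J1 M A) f \<xi>)) (pr \<eta>) x)"
      using is_commutatorD(1)[where \<zeta>=\<zeta>, OF c scale(2) \<eta> l] scale(1,2) \<eta> W(3) g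
      by (simp add: lf_jsec[OF l] lf_sec[OF l] pr_sscale)
    show "l (act ?\<zeta> Z x) = l (act (sscale (J1 M A) f \<xi>) (act \<eta> Z) x) - l (act \<eta> (act (sscale (J1 M A) f \<xi>) Z) x)"
      if "Z \<in> Sec" for Z
      using scale(1,2) \<eta> W(3) g that
      by (simp add: lf_jsec[OF l] lf_sec[OF l] act_sscale is_commutatorD(2)[where \<zeta>=\<zeta>, OF c scale(2) \<eta> l that] algebra_simps)
  qed (use scale \<eta> W(3) g in simp_all)
  then show ?case
    using W(1-3) g scale(1,2) unfolding has_commutator_def by (intro exI[of _ W] exI[of _ ?\<zeta>]) simp
qed

text \<open>Reduction to prolongations in one argument, then by symmetry in the other. For two
  prolongations \<open>lf_jacobi\<close> shows that the prolongation of the bracket works.\<close>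

lemma has_commutator:
  assumes "\<xi> \<in> JSec" "\<eta> \<in> JSec"
  shows "has_commutator m \<xi> \<eta>"
proof (rule has_commutator_left[OF assms])
  fix X assume X: "X \<in> Sec"
  have "has_commutator m \<eta> (prolong M A X)"
  proof (rule has_commutator_left[OF assms(2) prolong_jsec[OF X]])
    fix Y assume Y: "Y \<in> Sec"
    have "is_commutator (prolong M A Y) (prolong M A X) x (prolong M A (br Y X) x)" for x
      by (rule is_commutatorI) (use X Y in \<open>simp_all add: lf_jacobi\<close>)
    then show "has_commutator m (prolong M A Y) (prolong M A X)"
      unfolding has_commutator_def
      using X Y by (intro exI[of _ UNIV] exI[of _ "prolong M A (br Y X)"]) simp
  qed
  then show "has_commutator m (prolong M A X) \<eta>"
    using has_commutator_sym[of \<eta> "prolong M A X" m] assms(2) X by simp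
qed

definition jet_bracket :: "('m \<Rightarrow> ('m \<Rightarrow> 'v) set) \<Rightarrow> ('m \<Rightarrow> ('m \<Rightarrow> 'v) set) \<Rightarrow> 'm \<Rightarrow> ('m \<Rightarrow> 'v) set" where
  "jet_bracket \<xi> \<eta> = (\<lambda>x. THE j. is_commutator \<xi> \<eta> x j)"

lemma jet_bracket_eqI: "is_commutator \<xi> \<eta> x j \<Longrightarrow> jet_bracket \<xi> \<eta> x = j"
  unfolding jet_bracket_def by (rule the_equality, assumption) (rule is_commutator_unique)

lemma is_commutator_jet_bracket:
  assumes "\<xi> \<in> JSec" "\<eta> \<in> JSec"
  shows "is_commutator \<xi> \<eta> x (jet_bracket \<xi> \<eta> x)"
proof -
  obtain W \<zeta> where W: "open W" "x \<in> W" "\<zeta> \<in> JSec" "\<forall>x\<in>W. is_commutator \<xi> \<eta> x (\<zeta> x)"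
    using has_commutator[OF assms, of x] unfolding has_commutator_def by (elim exE conjE)
  then show ?thesis using jet_bracket_eqI[of \<xi> \<eta> x "\<zeta> x"] by simp
qed

lemma jet_bracket_sec:
  assumes "\<xi> \<in> JSec" "\<eta> \<in> JSec"
  shows "jet_bracket \<xi> \<eta> \<in> JSec"
proof (rule jet_sections_glue)
  fix m :: 'm
  obtain W \<zeta> where W: "open W" "m \<in> W" "\<zeta> \<in> JSec" "\<forall>x\<in>W. is_commutator \<xi> \<eta> x (\<zeta> x)"
    using has_commutator[OF assms, of m] unfolding has_commutator_def by (elim exE conjE)
  have "\<zeta> \<in> jet_sections M A W" using jet_sections_restrict[OF W(3,1)] by simp
  moreover have eq: "\<zeta> x = jet_bracket \<xi> \<eta> x" if "x \<in> W" for x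
    by (rule jet_bracket_eqI[symmetric]) (use W(4) that in simp)
  ultimately have "jet_bracket \<xi> \<eta> \<in> jet_sections M A W"
    using JB.section_cong[OF W(1) eq] by simp
  then show "\<exists>V. open V \<and> m \<in> V \<and> V \<subseteq> UNIV \<and> jet_bracket \<xi> \<eta> \<in> jet_sections M A V"
    using W(1,2) by (intro exI[of _ W]) simp
qed

lemma pr_jet_bracket: "\<xi> \<in> JSec \<Longrightarrow> \<eta> \<in> JSec \<Longrightarrow> pr (jet_bracket \<xi> \<eta>) = br (pr \<xi>) (pr \<eta>)"
  using is_commutator_jet_bracket unfolding is_commutator_def by (auto simp: pr_def[of "jet_bracket \<xi> \<eta>"])

lemma act_jet_bracket: "\<xi> \<in> JSec \<Longrightarrow> \<eta> \<in> JSec \<Longrightarrow> Z \<in> Sec \<Longrightarrow>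
    act (jet_bracket \<xi> \<eta>) Z = ssub (act \<xi> (act \<eta> Z)) (act \<eta> (act \<xi> Z))"
  using is_commutator_jet_bracket unfolding is_commutator_def by (auto simp: act_def[of "jet_bracket \<xi> \<eta>"])

lemma jet_bracket_prolong:
  assumes "X \<in> Sec" "Y \<in> Sec"
  shows "jet_bracket (prolong M A X) (prolong M A Y) = prolong M A (br X Y)"
proof
  fix x
  show "jet_bracket (prolong M A X) (prolong M A Y) x = prolong M A (br X Y) x"
    by (rule jet_bracket_eqI, rule is_commutatorI) (use assms in \<open>simp_all add: lf_jacobi\<close>)
qed

lemma br_jacobi_lf:
  assumes l: "linear_functional (fibre A m) l" and s: "X \<in> Sec" "Y \<in> Sec" "Z \<in> Sec"
  shows "l (br X (br Y Z) m) + (l (br Y (br Z X) m) + l (br Z (br X Y) m)) = 0"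
  using arg_cong[OF fun_cong[OF br_jacobi_sections[OF s], of m], of l] s by (simp add: lf_sec[OF l])

text \<open>Under \<open>pr\<close> each axiom becomes that of \<open>A\<close>; under
  \<open>act\<close> it becomes an identity for commutators of derivations. Jets are determined by
  the two images.\<close>

lemma lie_algebroid_jet_bracket: "lie_algebroid M (J1_with_bracket M A jet_bracket)"
  unfolding lie_algebroid_def J1_with_bracket_simps J1_with_bracket_ops
proof (intro conjI ballI allI impI vector_bundle_jets)
  show "bundle_morphism (J1_with_bracket M A jet_bracket) (tangent_bundle M) (\<lambda>m j. anc m (jet_proj m j))"
    unfolding bundle_morphism_def J1_with_bracket_simps
  proof (intro conjI allI impI)
    fix m
    have 1: "jet_proj m (j \<oplus>\<^bsub>J m\<^esub> k) = jet_proj m j \<oplus>\<^bsub>fibre A m\<^esub> jet_proj m k"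
      if j: "j \<in> carrier (J m)" and k: "k \<in> carrier (J m)" for j k
    proof -
      obtain X where X: "X \<in> Sec" "j = jet M A m X" by (rule jet_carrierE[OF j])
      obtain Y where Y: "Y \<in> Sec" "k = jet M A m Y" by (rule jet_carrierE[OF k])
      show ?thesis using jet_proj_jet[OF sec_sadd[OF X(1) Y(1)], of m] X Y by (simp add: jet_add sadd_def[of A X Y])
    qed
    have 2: "jet_proj m (c \<odot>\<^bsub>J m\<^esub> j) = c \<odot>\<^bsub>fibre A m\<^esub> jet_proj m j" if j: "j \<in> carrier (J m)" for j c
    proof -
      obtain X where X: "X \<in> Sec" "j = jet M A m X" by (rule jet_carrierE[OF j])
      show ?thesis
        using jet_proj_jet[OF sec_sscale[OF smooth_const X(1)], of m c] X
        by (simp add: jet_smult sscale_def[of A "\<lambda>x. c" X])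
    qed
    show "linear_map (J m) (fibre (tangent_bundle M) m) (\<lambda>j. anc m (jet_proj m j))"
      by (auto simp: linear_map_def tangent_bundle_def 1 2 anchor_add anchor_smult)
    show "(\<lambda>x. anc x (jet_proj x (\<sigma> x))) \<in> sections (tangent_bundle M) U"
      if "open U \<and> \<sigma> \<in> jet_sections M A U" for U \<sigma>
    proof -
      have "pr \<sigma> \<in> sections A U" using pr_section that by simp
      then have "(\<lambda>x. anc x (pr \<sigma> x)) \<in> sections (tangent_bundle M) U"
        using lie_algebroid_axs[THEN conjunct2, THEN conjunct1] that unfolding bundle_morphism_def by simp
      then show ?thesis by (simp add: pr_def)
    qed
  qed
next
  fix X Y assume X: "X \<in> JSec" "Y \<in> JSec"
  then show "jet_bracket X Y \<in> JSec" by (rule jet_bracket_sec)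
  note [simp] = pr_jet_bracket act_jet_bracket jet_bracket_sec pr_sadd pr_sscale act_sadd act_sscale
  show "sadd (J1 M A) (jet_bracket X Y) (jet_bracket Y X) = szero (J1 M A)"
  proof
    fix m
    show "sadd (J1 M A) (jet_bracket X Y) (jet_bracket Y X) m = szero (J1 M A) m"
    proof (rule jsec_eqI)
      fix l assume l: "linear_functional (fibre A m) l"
      show "l (pr (sadd (J1 M A) (jet_bracket X Y) (jet_bracket Y X)) m) = l (pr (szero (J1 M A)) m)"
        using X lf_br_skew[OF l, of "pr X" "pr Y"] by (simp add: lf_jsec[OF l] lf_sec[OF l])
      show "l (act (sadd (J1 M A) (jet_bracket X Y) (jet_bracket Y X)) Z m) = l (act (szero (J1 M A)) Z m)"
        if "Z \<in> Sec" for Z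
        using X that by (simp add: lf_jsec[OF l] lf_sec[OF l])
    qed (use X in \<open>simp_all add: szero_def\<close>)
  qed
  show "jet_bracket X (sscale (J1 M A) f Y) = sadd (J1 M A) (sscale (J1 M A) f (jet_bracket X Y))
      (sscale (J1 M A) (\<lambda>x. anc x (jet_proj x (X x)) f) Y)" if f: "smooth_fun M UNIV f" for f
  proof
    fix m
    have g: "smooth_fun M UNIV (\<lambda>x. anc x (jet_proj x (X x)) f)"
      using sec_anchor_smooth[OF pr_sec[OF X(1)] f] by (simp add: pr_def)
    have p: "jet_proj m (X m) = pr X m" by (simp add: pr_def)
    show "jet_bracket X (sscale (J1 M A) f Y) m = sadd (J1 M A) (sscale (J1 M A) f (jet_bracket X Y))
      (sscale (J1 M A) (\<lambda>x. anc x (jet_proj x (X x)) f) Y) m"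
    proof (rule jsec_eqI)
      fix l assume l: "linear_functional (fibre A m) l"
      show "l (pr (jet_bracket X (sscale (J1 M A) f Y)) m) =
        l (pr (sadd (J1 M A) (sscale (J1 M A) f (jet_bracket X Y)) (sscale (J1 M A) (\<lambda>x. anc x (jet_proj x (X x)) f) Y)) m)"
        using X f g by (simp add: lf_jsec[OF l] lf_sec[OF l] p)
      show "l (act (jet_bracket X (sscale (J1 M A) f Y)) Z m) =
        l (act (sadd (J1 M A) (sscale (J1 M A) f (jet_bracket X Y)) (sscale (J1 M A) (\<lambda>x. anc x (jet_proj x (X x)) f) Y)) Z m)"
        if "Z \<in> Sec" for Z
        using X f g that by (simp add: lf_jsec[OF l] lf_sec[OF l] p algebra_simps)
    qed (use X f g in simp_all)
  qed
  show "anc x (jet_proj x (jet_bracket X Y x)) f =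
      anc x (jet_proj x (X x)) (\<lambda>y. anc y (jet_proj y (Y y)) f) - anc x (jet_proj x (Y x)) (\<lambda>y. anc y (jet_proj y (X y)) f)"
    if U: "open U \<and> smooth_fun M U f" "x \<in> U" for U f x
  proof -
    have "jet_proj x (jet_bracket X Y x) = br (pr X) (pr Y) x"
      using fun_cong[OF pr_jet_bracket[OF X], of x] by (simp add: pr_def[of "jet_bracket X Y"])
    then show ?thesis
      using anchor_br[OF pr_sec[OF X(1)] pr_sec[OF X(2)], of U f x] U by (simp add: pr_def)
  qed
  fix Z assume Z: "Z \<in> JSec"
  show "jet_bracket (sadd (J1 M A) X Y) Z = sadd (J1 M A) (jet_bracket X Z) (jet_bracket Y Z)"
  proof
    fix m
    show "jet_bracket (sadd (J1 M A) X Y) Z m = sadd (J1 M A) (jet_bracket X Z) (jet_bracket Y Z) m"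
      by (rule jsec_eqI) (use X Z in \<open>simp_all add: lf_jsec lf_sec\<close>)
  qed
  show "sadd (J1 M A) (jet_bracket X (jet_bracket Y Z)) (sadd (J1 M A) (jet_bracket Y (jet_bracket Z X))
      (jet_bracket Z (jet_bracket X Y))) = szero (J1 M A)"
  proof
    fix m
    show "sadd (J1 M A) (jet_bracket X (jet_bracket Y Z)) (sadd (J1 M A) (jet_bracket Y (jet_bracket Z X))
      (jet_bracket Z (jet_bracket X Y))) m = szero (J1 M A) m"
    proof (rule jsec_eqI)
      fix l assume l: "linear_functional (fibre A m) l"
      show "l (pr (sadd (J1 M A) (jet_bracket X (jet_bracket Y Z)) (sadd (J1 M A) (jet_bracket Y (jet_bracket Z X))
        (jet_bracket Z (jet_bracket X Y)))) m) = l (pr (szero (J1 M A)) m)"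
        using X Z br_jacobi_lf[OF l, of "pr X" "pr Y" "pr Z"] by (simp add: lf_jsec[OF l] lf_sec[OF l])
      show "l (act (sadd (J1 M A) (jet_bracket X (jet_bracket Y Z)) (sadd (J1 M A) (jet_bracket Y (jet_bracket Z X))
        (jet_bracket Z (jet_bracket X Y)))) T m) = l (act (szero (J1 M A)) T m)" if "T \<in> Sec" for T
        using X Z that by (simp add: lf_jsec[OF l] lf_sec[OF l])
    qed (use X Z in \<open>simp_all add: szero_def\<close>)
  qed
qed

text \<open>\<open>J1\<close> picks its bracket by choice, so a witness is needed;
  \<open>jet_bracket\<close> is one.\<close>

lemma J1_bracket_spec:
  "lie_algebroid M (J1 M A)"
  "X \<in> Sec \<Longrightarrow> Y \<in> Sec \<Longrightarrow> bracket (J1 M A) (prolong M A X) (prolong M A Y) = prolong M A (br X Y)"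
proof -
  let ?P = "\<lambda>b. lie_algebroid M (J1_with_bracket M A b) \<and>
    (\<forall>X\<in>Sec. \<forall>Y\<in>Sec. b (prolong M A X) (prolong M A Y) = prolong M A (br X Y))"
  have "?P (SOME b. ?P b)"
    by (rule someI[of ?P jet_bracket]) (use lie_algebroid_jet_bracket jet_bracket_prolong in simp)
  then show "lie_algebroid M (J1 M A)"
    "X \<in> Sec \<Longrightarrow> Y \<in> Sec \<Longrightarrow> bracket (J1 M A) (prolong M A X) (prolong M A Y) = prolong M A (br X Y)"
    by (simp_all add: J1_def)
qed

text \<open>Makes the whole theory applicable to \<open>J1 M A\<close> itself, hence to jets of its
  sections.\<close>

lemma transitive_algebroid_J1: "transitive_algebroid M (J1 M A)"
proof (intro transitive_algebroid.intro algebroid.intro manifold_axioms algebroid_axioms.intro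
    transitive_algebroid_axioms.intro J1_bracket_spec(1))
  have "jet_proj m ` carrier (J m) = carrier (fibre A m)" for m
  proof (intro subset_antisym subsetI)
    fix v assume "v \<in> carrier (fibre A m)"
    then obtain X where "X \<in> Sec" "X m = v" by (rule value_extend)
    then show "v \<in> jet_proj m ` carrier (J m)"
      by (intro image_eqI[of _ _ "jet M A m X"]) simp_all
  qed auto
  then show "transitive M (J1 M A)"
    using transitive unfolding transitive_def by (simp add: image_image[symmetric])
qed

text \<open>Both brackets are local, additive, skew and obey the Leibniz rule, and they agree on
  prolongations, which generate. So on sections nothing depends on the choice made in
  \<open>J1\<close>.\<close>

lemma J1_bracket_unique:
  assumes "\<xi> \<in> JSec" "\<eta> \<in> JSec"
  shows "bracket (J1 M A) \<xi> \<eta> = jet_bracket \<xi> \<eta>"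
proof
  fix m
  interpret K: algebroid M "J1 M A"
    by (intro algebroid.intro manifold_axioms algebroid_axioms.intro J1_bracket_spec(1))
  interpret L: algebroid M "J1_with_bracket M A jet_bracket"
    by (intro algebroid.intro manifold_axioms algebroid_axioms.intro lie_algebroid_jet_bracket)
  have left: "K.br \<xi> \<eta> m = jet_bracket \<xi> \<eta> m"
    if \<xi>: "\<xi> \<in> JSec" and \<eta>: "\<eta> \<in> JSec" and base: "\<And>X. X \<in> Sec \<Longrightarrow> K.br (prolong M A X) \<eta> m = jet_bracket (prolong M A X) \<eta> m"
    for \<xi> \<eta>
    using \<xi>
  proof (induction rule: jsec_induct[where m=m])
    case (germ \<xi> \<xi>' W)
    then show ?case
      using K.br_cong_left[of \<xi> \<xi>' \<eta> W m] L.br_cong_left[of \<xi> \<xi>' \<eta> W m] \<eta> by simp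
  next
    case (prolong X)
    then show ?case by (rule base)
  next
    case (add \<xi>1 \<xi>2)
    then show ?case
      using K.br_sadd_left[of \<xi>1 \<xi>2 \<eta>] L.br_sadd_left[of \<xi>1 \<xi>2 \<eta>] \<eta> by (simp add: sadd_def)
  next
    case (scale f \<xi>)
    show ?case
    proof (rule J.separated)
      fix l assume l: "linear_functional (J m) l"
      show "l (K.br (sscale (J1 M A) f \<xi>) \<eta> m) = l (jet_bracket (sscale (J1 M A) f \<xi>) \<eta> m)"
        using K.lf_br_sscale_left[of m l \<xi> \<eta> f] L.lf_br_sscale_left[of m l \<xi> \<eta> f] scale \<eta> l by simp
    qed (use K.sec_br[of "sscale (J1 M A) f \<xi>" \<eta>] L.sec_br[of "sscale (J1 M A) f \<xi>" \<eta>] scale \<eta> in simp_all)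
  qed
  show "K.br \<xi> \<eta> m = jet_bracket \<xi> \<eta> m"
  proof (rule left[OF assms])
    fix X assume X: "X \<in> Sec"
    \<comment> \<open>The reduction works in the first argument only; skew symmetry carries it to
      the second.\<close>
    have "K.br \<eta> (prolong M A X) m = jet_bracket \<eta> (prolong M A X) m"
      by (rule left[OF assms(2)]) (use X in \<open>simp_all add: J1_bracket_spec(2) jet_bracket_prolong\<close>)
    moreover have "K.br (prolong M A X) \<eta> m = \<ominus>\<^bsub>J m\<^esub> K.br \<eta> (prolong M A X) m"
      using K.lf_br_skew[of m _ \<eta> "prolong M A X"] X assms(2) K.sec_br[of \<eta> "prolong M A X"] K.sec_br[of "prolong M A X" \<eta>]
      by (intro J.separated[where m=m]) (simp_all add: J.lf_neg)
    moreover have "jet_bracket (prolong M A X) \<eta> m = \<ominus>\<^bsub>J m\<^esub> jet_bracket \<eta> (prolong M A X) m"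
      using L.lf_br_skew[of m _ \<eta> "prolong M A X"] X assms(2) L.sec_br[of \<eta> "prolong M A X"] L.sec_br[of "prolong M A X" \<eta>]
      by (intro J.separated[where m=m]) (simp_all add: J.lf_neg)
    ultimately show "K.br (prolong M A X) \<eta> m = jet_bracket (prolong M A X) \<eta> m" by simp
  qed
qed

lemma pr_J1_bracket: "\<xi> \<in> JSec \<Longrightarrow> \<eta> \<in> JSec \<Longrightarrow> pr (bracket (J1 M A) \<xi> \<eta>) = br (pr \<xi>) (pr \<eta>)"
  by (simp add: J1_bracket_unique pr_jet_bracket)

lemma act_J1_bracket: "\<xi> \<in> JSec \<Longrightarrow> \<eta> \<in> JSec \<Longrightarrow> Z \<in> Sec \<Longrightarrow>
    act (bracket (J1 M A) \<xi> \<eta>) Z = ssub (act \<xi> (act \<eta> Z)) (act \<eta> (act \<xi> Z))"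
  by (simp add: J1_bracket_unique act_jet_bracket)

end

subsection \<open>Solutions of smooth linear systems\<close>

context manifold begin

lemma smooth_fun_continuous:
  assumes "open W" "smooth_fun M W f"
  shows "continuous_on W f"
proof -
  have "isCont f x" if x: "x \<in> W" for x
  proof -
    obtain V \<phi> where c: "(V, \<phi>) \<in> M" "x \<in> V" by (rule chart_at)
    have "continuous_on (\<phi> ` (W \<inter> V)) (f \<circ> inv_into V \<phi>)"
      using C_infinity_onD[OF smooth_funD[OF assms(2) c(1)], of 0] by simp
    moreover have "continuous_on (W \<inter> V) \<phi>"
      using chart_homeomorphism[OF c(1)] unfolding homeomorphism_def by (meson continuous_on_subset inf_le2)
    ultimately have "continuous_on (W \<inter> V) ((f \<circ> inv_into V \<phi>) \<circ> \<phi>)"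
      using continuous_on_compose[of "W \<inter> V" \<phi> "f \<circ> inv_into V \<phi>"] by blast
    then have "continuous_on (W \<inter> V) f"
      by (rule continuous_on_eq) (use chart_inverse[OF c(1)] in auto)
    moreover have "open (W \<inter> V)" using assms(1) chart_open[OF c(1)] by (rule open_Int)
    ultimately show ?thesis using x c(2) by (simp add: continuous_on_eq_continuous_at)
  qed
  then show ?thesis by (simp add: continuous_at_imp_continuous_on)
qed

text \<open>By Gaussian elimination. The unknowns \<open>c\<close> are arbitrary functions, and the index set \<open>E\<close> of the
  equations may be infinite.\<close>

lemma smooth_linear_system:
  assumes "finite J" "open U" "m \<in> U"
    "\<And>e j. e \<in> E \<Longrightarrow> j \<in> J \<Longrightarrow> smooth_fun M U (a e j)" "\<And>e. e \<in> E \<Longrightarrow> smooth_fun M U (b e)"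
    "\<And>e x. e \<in> E \<Longrightarrow> x \<in> U \<Longrightarrow> (\<Sum>j\<in>J. a e j x * c j x) = b e x"
    "\<And>y. (\<And>e. e \<in> E \<Longrightarrow> (\<Sum>j\<in>J. a e j m * y j) = 0) \<Longrightarrow> \<forall>j\<in>J. y j = (0::real)"
  shows "\<exists>W. open W \<and> m \<in> W \<and> W \<subseteq> U \<and> (\<forall>j\<in>J. smooth_fun M W (c j))"
  using assms
proof (induction J arbitrary: a b U)
  case empty
  then show ?case by (intro exI[of _ U]) simp
next
  case (insert k J)
  \<comment> \<open>A pivot: were the column of \<open>k\<close> zero at \<open>m\<close>, the unit
    vector at \<open>k\<close> would solve the homogeneous system there.\<close>
  have "\<exists>e\<in>E. a e k m \<noteq> 0"
  proof (rule ccontr)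
    assume "\<not> (\<exists>e\<in>E. a e k m \<noteq> 0)"
    then have "(\<Sum>j\<in>insert k J. a e j m * (if j = k then 1 else 0)) = 0" if "e \<in> E" for e
      using that by (intro sum.neutral) auto
    from insert.prems(6)[OF this] show False by simp
  qed
  then obtain e0 where e0: "e0 \<in> E" "a e0 k m \<noteq> 0" by blast
  define p where "p = a e0 k"
  have ps: "smooth_fun M U p" unfolding p_def using insert.prems(3) e0(1) by simp
  define U1 where "U1 = U \<inter> p -` (- {0})"
  have U1: "open U1" "m \<in> U1" "U1 \<subseteq> U"
    using continuous_open_preimage[OF smooth_fun_continuous[OF insert.prems(1) ps] insert.prems(1), of "- {0}"]
      insert.prems(2) e0(2) by (auto simp: U1_def p_def)
  have p0: "p x \<noteq> 0" if "x \<in> U1" for x using that by (simp add: U1_def)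
  have si: "smooth_fun M U1 (\<lambda>x. inverse (p x))"
    by (rule smooth_fun_inverse[OF U1(1) smooth_fun_subset[OF ps U1(3)] p0])
  \<comment> \<open>Equation \<open>e0\<close>, divided by its pivot, eliminates the unknown
    \<open>k\<close> from all equations.\<close>
  define a' where "a' e j x = a e j x - a e k x * (a e0 j x * inverse (p x))" for e j x
  define b' where "b' e x = b e x - a e k x * (b e0 x * inverse (p x))" for e x
  have as: "smooth_fun M U1 (a e j)" if "e \<in> E" "j \<in> insert k J" for e j
    by (rule smooth_fun_subset[OF _ U1(3)]) (use insert.prems(3) that in simp)
  have bs: "smooth_fun M U1 (b e)" if "e \<in> E" for e
    by (rule smooth_fun_subset[OF _ U1(3)]) (use insert.prems(4) that in simp)
  have eq: "p x * c k x = b e0 x - (\<Sum>j\<in>J. a e0 j x * c j x)" if "x \<in> U1" for x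
    using insert.prems(5)[OF e0(1), of x] that U1(3) insert.hyps by (auto simp: p_def)
  have "\<exists>W. open W \<and> m \<in> W \<and> W \<subseteq> U1 \<and> (\<forall>j\<in>J. smooth_fun M W (c j))"
  proof (rule insert.IH[OF U1(1,2)])
    show "smooth_fun M U1 (a' e j)" if "e \<in> E" "j \<in> J" for e j
      unfolding a'_def using that as e0(1) si by (intro smooth_fun_diff smooth_fun_mult U1(1)) auto
    show "smooth_fun M U1 (b' e)" if "e \<in> E" for e
      unfolding b'_def using that as bs e0(1) si by (intro smooth_fun_diff smooth_fun_mult U1(1)) auto
    show "(\<Sum>j\<in>J. a' e j x * c j x) = b' e x" if "e \<in> E" "x \<in> U1" for e x
    proof -
      have 1: "a e k x * c k x + (\<Sum>j\<in>J. a e j x * c j x) = b e x"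
        using insert.prems(5)[OF that(1), of x] that U1(3) insert.hyps by auto
      have 2: "(\<Sum>j\<in>J. a' e j x * c j x)
          = (\<Sum>j\<in>J. a e j x * c j x) - a e k x * inverse (p x) * (\<Sum>j\<in>J. a e0 j x * c j x)"
        by (simp add: a'_def sum_subtractf sum_distrib_left algebra_simps)
      have "c k x = inverse (p x) * (b e0 x - (\<Sum>j\<in>J. a e0 j x * c j x))"
        using eq[OF that(2)] p0[OF that(2)] by (simp add: field_simps)
      with 1 2 show ?thesis by (simp add: b'_def algebra_simps)
    qed
    show "\<forall>j\<in>J. y j = 0" if y: "\<And>e. e \<in> E \<Longrightarrow> (\<Sum>j\<in>J. a' e j m * y j) = 0" for y
    proof -
      \<comment> \<open>A solution of the reduced homogeneous system extends to one of the full
        system; the new entry is forced by equation \<open>e0\<close>.\<close>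
      define z where "z j = (if j = k then - inverse (p m) * (\<Sum>j\<in>J. a e0 j m * y j) else y j)" for j
      have "(\<Sum>j\<in>insert k J. a e j m * z j) = 0" if e: "e \<in> E" for e
      proof -
        have "(\<Sum>j\<in>J. a e j m * z j) = (\<Sum>j\<in>J. a e j m * y j)"
          using insert.hyps by (intro sum.cong) (auto simp: z_def)
        moreover have "(\<Sum>j\<in>J. a' e j m * y j)
          = (\<Sum>j\<in>J. a e j m * y j) - a e k m * inverse (p m) * (\<Sum>j\<in>J. a e0 j m * y j)"
          by (simp add: a'_def sum_subtractf sum_distrib_left algebra_simps)
        ultimately show ?thesis using y[OF e] insert.hyps by (simp add: z_def algebra_simps)
      qed
      from insert.prems(6)[OF this] have z0: "\<forall>j\<in>insert k J. z j = 0" .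
      show ?thesis
      proof
        fix j assume j: "j \<in> J"
        then have "j \<noteq> k" using insert.hyps by blast
        then have "z j = y j" by (simp add: z_def)
        moreover have "z j = 0" using z0 j by blast
        ultimately show "y j = 0" by simp
      qed
    qed
  qed
  then obtain W where W: "open W" "m \<in> W" "W \<subseteq> U1" "\<forall>j\<in>J. smooth_fun M W (c j)" by (elim exE conjE)
  \<comment> \<open>Back substitution in equation \<open>e0\<close>.\<close>
  have "smooth_fun M W (\<lambda>x. inverse (p x) * (b e0 x - (\<Sum>j\<in>J. a e0 j x * c j x)))"
    using W(4) as bs e0(1) si
    by (intro smooth_fun_mult smooth_fun_diff smooth_fun_sum W(1)) (auto intro: smooth_fun_subset[OF _ W(3)])
  then have "smooth_fun M W (c k)"
  proof (rule smooth_fun_cong[OF W(1), rotated])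
    show "inverse (p x) * (b e0 x - (\<Sum>j\<in>J. a e0 j x * c j x)) = c k x" if "x \<in> W" for x
      using eq[of x] p0[of x] that W(3) by (auto simp: field_simps)
  qed
  then show ?case using W U1(3) by (intro exI[of _ W]) auto
qed

end

subsection \<open>The kernel of the jet projection, and splittings\<close>

context algebroid begin

text \<open>The expansion of \<open>X\<close> involves \<open>Y\<close> in the derivative terms only
  through its anchor, and the other terms carry the factors \<open>c i m = 0\<close>. Hence a jet
  over zero acts through anchors.\<close>

lemma br_zero_anchor:
  assumes "X \<in> Sec" "Y \<in> Sec" "X m = \<zero>\<^bsub>fibre A m\<^esub>" "anc m (Y m) = (\<lambda>f. 0)"
  shows "br X Y m = \<zero>\<^bsub>fibre A m\<^esub>"
proof (rule br_eqI[of _ m])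
  fix l assume l: "linear_functional (fibre A m) l"
  obtain W r s c where W: "\<forall>i<r. s i \<in> Sec" "\<forall>i<r. smooth_fun M UNIV (c i)"
    "m \<in> W" "W \<subseteq> UNIV" "local_frame M A W r s" "\<forall>x\<in>W. X x = scomb A r c s x"
    by (rule section_expand[OF assms(1) open_UNIV UNIV_I])
  note lin = F.linear_functional_coeff[OF frame_basis[OF W(5,3)]]
  have "c i m = 0" if i: "i < r" for i
  proof -
    have "coeff (fibre A m) r (\<lambda>i. s i m) (X m) i = c i m"
      using W(3,6) F.coeff_unique[OF frame_basis[OF W(5,3)] i, of "\<lambda>i. c i m"] by (simp add: scomb_def)
    then show ?thesis using F.lf_zero[OF lin[OF i]] assms(3) by simp
  qed
  then show "l (br X Y m) = l \<zero>\<^bsub>fibre A m\<^esub>"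
    using br_expand[OF assms(1,2) finite_lessThan frame_open[OF W(5)] W(3) _ _ W(6)[unfolded scomb_def] l] W(1,2) assms(4)
    by (simp add: F.lf_zero[OF l])
qed (use assms in simp_all)

lemma smooth_near_extend:
  assumes "smooth_near M m f"
  obtains g W where "smooth_fun M UNIV g" "open W" "m \<in> W" "\<forall>x\<in>W. g x = f x"
proof -
  obtain U where U: "open U" "m \<in> U" "smooth_fun M U f" using assms unfolding smooth_near_def by blast
  show ?thesis by (rule smooth_fun_extend[OF U]) (rule that)
qed

context
  fixes m :: 'm and \<theta> :: "(('m \<Rightarrow> real) \<Rightarrow> real) \<Rightarrow> 'v"
  assumes \<theta>: "linear_map (tangent_space M m) (fibre A m) \<theta>"
begin

lemma lm_closed [simp]: "v \<in> carrier (tangent_space M m) \<Longrightarrow> \<theta> v \<in> carrier (fibre A m)"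
  using \<theta> unfolding linear_map_def by blast

lemma lm_add: "v \<in> carrier (tangent_space M m) \<Longrightarrow> w \<in> carrier (tangent_space M m) \<Longrightarrow>
    \<theta> (\<lambda>f. v f + w f) = \<theta> v \<oplus>\<^bsub>fibre A m\<^esub> \<theta> w"
  using \<theta> unfolding linear_map_def by simp

lemma lm_smult: "v \<in> carrier (tangent_space M m) \<Longrightarrow> \<theta> (\<lambda>f. c * v f) = c \<odot>\<^bsub>fibre A m\<^esub> \<theta> v"
  using \<theta> unfolding linear_map_def by simp

lemma lm_expand:
  assumes c: "(U, \<phi>) \<in> M" "m \<in> U" and v: "v \<in> carrier (tangent_space M m)" and l: "linear_functional (fibre A m) l"
  shows "l (\<theta> v) = (\<Sum>b\<in>Basis. v (\<lambda>x. \<phi> x \<bullet> b) * l (\<theta> (chart_vector U \<phi> b m)))"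
proof -
  let ?e = "\<lambda>b. chart_vector U \<phi> b m" and ?a = "\<lambda>b. v (\<lambda>x. \<phi> x \<bullet> b)"
  have e: "?e b \<in> carrier (tangent_space M m)" for b by (rule chart_vector_in_tangent[OF c])
  have "(\<lambda>f. \<Sum>b\<in>S. ?a b * ?e b f) \<in> carrier (tangent_space M m) \<and>
      l (\<theta> (\<lambda>f. \<Sum>b\<in>S. ?a b * ?e b f)) = (\<Sum>b\<in>S. ?a b * l (\<theta> (?e b)))" if "finite S" for S :: "'e set"
    using that
  proof induction
    case empty
    have "\<theta> (\<lambda>f. 0) = 0 \<odot>\<^bsub>fibre A m\<^esub> \<theta> (\<lambda>f. 0)"
      using lm_smult[of "\<lambda>f. 0" 0] tangent_zero_closed by simp
    then have "l (\<theta> (\<lambda>f. 0)) = 0"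
      using F.lf_smult[OF l lm_closed[OF tangent_zero_closed], of 0] by simp
    then show ?case using tangent_zero_closed by simp
  next
    case (insert b S)
    have 1: "(\<lambda>f. ?a b * ?e b f) \<in> carrier (tangent_space M m)" using tangent_scale_closed[OF e] .
    have "l (\<theta> (\<lambda>f. ?a b * ?e b f + (\<Sum>b\<in>S. ?a b * ?e b f)))
        = ?a b * l (\<theta> (?e b)) + (\<Sum>b\<in>S. ?a b * l (\<theta> (?e b)))"
      using insert 1 e by (subst lm_add) (auto simp: F.lf_add[OF l] lm_smult F.lf_smult[OF l])
    then show ?case using insert tangent_add_closed[OF 1] by simp
  qed
  from this[OF finite_Basis] have "l (\<theta> (\<lambda>f. \<Sum>b\<in>Basis. ?a b * ?e b f)) = (\<Sum>b\<in>Basis. ?a b * l (\<theta> (?e b)))" by blast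
  moreover have "(\<lambda>f. \<Sum>b\<in>Basis. ?a b * ?e b f) = v" by (intro ext) (rule tangent_expand[OF c v, symmetric])
  ultimately show ?thesis by simp
qed

end

end

context transitive_algebroid begin

section \<open>The inclusion of cotensors into first jets\<close>

text \<open>The property inside the definite description of \<open>cotensor_incl\<close>, which is
  meaningful once existence and uniqueness are known.\<close>

definition incl_rep :: "'m \<Rightarrow> ((('m \<Rightarrow> real) \<Rightarrow> real) \<Rightarrow> 'v) \<Rightarrow> ('m \<Rightarrow> 'v) set \<Rightarrow> bool" where
  "incl_rep m \<theta> j \<longleftrightarrow> (\<exists>(n::nat) f X.
     (\<forall>i<n. smooth_near M m (f i) \<and> X i \<in> local_sections A m) \<and>
     (\<forall>v\<in>carrier (tangent_space M m).
        \<theta> v = (\<Oplus>\<^bsub>fibre A m\<^esub>i\<in>{..<n}. v (f i) \<odot>\<^bsub>fibre A m\<^esub> X i m)) \<and>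
     j = (\<Oplus>\<^bsub>J m\<^esub>i\<in>{..<n}. (f i m \<odot>\<^bsub>J m\<^esub> jet M A m (X i)) \<ominus>\<^bsub>J m\<^esub> jet M A m (sscale A (f i) (X i))))"

text \<open>For \<open>\<theta> = df \<otimes> X\<close> the bracket of
  \<open>f J X - J (f X)\<close> with \<open>Y\<close> is \<open>f [X, Y] - [f X, Y]\<close>, that
  is \<open>#Y(f) X\<close>, which is the value of \<open>\<theta>\<close> on \<open>#Y\<close>. So
  projection and action depend on \<open>\<theta>\<close> alone, not on its representation.\<close>

lemma incl_rep_spec:
  assumes "incl_rep m \<theta> j"
  shows "j \<in> carrier (J m)" "jet_proj m j = \<zero>\<^bsub>fibre A m\<^esub>" "Y \<in> Sec \<Longrightarrow> jet_act m j Y = \<theta> (anc m (Y m))"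
proof -
  obtain n f X where r: "\<forall>i<n. smooth_near M m (f i) \<and> X i \<in> local_sections A m"
     "\<forall>v\<in>carrier (tangent_space M m). \<theta> v = (\<Oplus>\<^bsub>fibre A m\<^esub>i\<in>{..<(n::nat)}. v (f i) \<odot>\<^bsub>fibre A m\<^esub> X i m)"
     "j = (\<Oplus>\<^bsub>J m\<^esub>i\<in>{..<n}. (f i m \<odot>\<^bsub>J m\<^esub> jet M A m (X i)) \<ominus>\<^bsub>J m\<^esub> jet M A m (sscale A (f i) (X i)))"
    using assms unfolding incl_rep_def by (elim exE conjE)
  let ?k = "\<lambda>i. (f i m \<odot>\<^bsub>J m\<^esub> jet M A m (X i)) \<ominus>\<^bsub>J m\<^esub> jet M A m (sscale A (f i) (X i))"
  \<comment> \<open>Local data are replaced by global functions and sections with the same germs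
    before brackets are formed.\<close>
  have summand: "?k i \<in> carrier (J m) \<and> X i m \<in> carrier (fibre A m) \<and>
      (\<forall>l. linear_functional (fibre A m) l \<longrightarrow> l (jet_proj m (?k i)) = 0 \<and>
        (\<forall>Y\<in>Sec. l (jet_act m (?k i) Y) = anc m (Y m) (f i) * l (X i m)))" if i: "i < n" for i
  proof -
    have "smooth_near M m (f i)" "X i \<in> local_sections A m" using r(1) i by auto
    obtain g W where g: "smooth_fun M UNIV g" "open W" "m \<in> W" "\<forall>x\<in>W. g x = f i x"
      by (rule smooth_near_extend[OF \<open>smooth_near M m (f i)\<close>])
    obtain Z W' where Z: "Z \<in> Sec" "open W'" "m \<in> W'" "\<forall>x\<in>W'. Z x = X i x"
      by (rule local_sections_extend[OF \<open>X i \<in> local_sections A m\<close>])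
    have j1: "jet M A m (X i) = jet M A m Z"
      by (rule jet_cong[OF Z(2,3)]) (use Z(4) in simp)
    have j2: "jet M A m (sscale A (f i) (X i)) = jet M A m (sscale A g Z)"
      by (rule jet_cong[OF open_Int[OF g(2) Z(2)]]) (use g Z in \<open>auto simp: sscale_def\<close>)
    have c: "jet M A m Z \<in> carrier (J m)" "jet M A m (sscale A g Z) \<in> carrier (J m)" using g(1) Z(1) by auto
    have fm: "f i m = g m" "X i m = Z m" using g(3,4) Z(3,4) by auto
    have k: "?k i = (g m \<odot>\<^bsub>J m\<^esub> jet M A m Z) \<ominus>\<^bsub>J m\<^esub> jet M A m (sscale A g Z)" unfolding j1 j2 fm ..
    have cl: "?k i \<in> carrier (J m)" unfolding k using c by (intro J.M.minus_closed) auto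
    have "l (jet_proj m (?k i)) = 0 \<and> (\<forall>Y\<in>Sec. l (jet_act m (?k i) Y) = anc m (Y m) (f i) * l (X i m))"
      if l: "linear_functional (fibre A m) l" for l
    proof (intro conjI ballI)
      note lp = linear_functional_jet_proj[OF l]
      show "l (jet_proj m (?k i)) = 0"
        unfolding k using c Z(1) g(1) J.lf_minus[OF lp J.smult_closed[OF c(1)] c(2), of "g m"] J.lf_smult[OF lp c(1)]
        by (simp add: lf_sec[OF l])
      fix Y assume Y: "Y \<in> Sec"
      note la = linear_functional_jet_act[OF l Y]
      have "anc m (Y m) (f i) = anc m (Y m) g"
        by (rule tangent_apply_cong[OF _ g(2,3)]) (use Y g(4) in simp_all)
      moreover have "l (jet_act m ((g m \<odot>\<^bsub>J m\<^esub> jet M A m Z) \<ominus>\<^bsub>J m\<^esub> jet M A m (sscale A g Z)) Y) = anc m (Y m) g * l (Z m)"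
        using c Z(1) g(1) Y J.lf_minus[OF la J.smult_closed[OF c(1)] c(2), of "g m"] J.lf_smult[OF la c(1)]
        by (simp add: lf_sec[OF l])
      ultimately show "l (jet_act m (?k i) Y) = anc m (Y m) (f i) * l (X i m)"
        by (simp only: k fm(2))
    qed
    then show ?thesis using cl fm(2) Z(1) by simp
  qed
  have kc: "?k i \<in> carrier (J m)" if "i \<in> {..<n}" for i using summand that by simp
  show jc: "j \<in> carrier (J m)" unfolding r(3) by (rule J.finsum_closed[OF kc])
  show "jet_proj m j = \<zero>\<^bsub>fibre A m\<^esub>"
  proof (rule br_eqI[of _ m])
    fix l assume l: "linear_functional (fibre A m) l"
    have "l (jet_proj m j) = (\<Sum>i<n. l (jet_proj m (?k i)))"
      unfolding r(3) by (rule J.lf_finsum[OF linear_functional_jet_proj[OF l] kc])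
    also have "\<dots> = 0" using summand l by (intro sum.neutral) simp
    finally show "l (jet_proj m j) = l \<zero>\<^bsub>fibre A m\<^esub>" by (simp add: F.lf_zero[OF l])
  qed (use jc in simp_all)
  assume Y: "Y \<in> Sec"
  have th: "\<theta> (anc m (Y m)) = (\<Oplus>\<^bsub>fibre A m\<^esub>i\<in>{..<n}. anc m (Y m) (f i) \<odot>\<^bsub>fibre A m\<^esub> X i m)"
    using r(2) Y by simp
  have Xc: "X i m \<in> carrier (fibre A m)" if "i < n" for i using summand[OF that] by blast
  show "jet_act m j Y = \<theta> (anc m (Y m))"
  proof (rule br_eqI[of _ m])
    fix l assume l: "linear_functional (fibre A m) l"
    have "l (jet_act m j Y) = (\<Sum>i<n. l (jet_act m (?k i) Y))"
      unfolding r(3) by (rule J.lf_finsum[OF linear_functional_jet_act[OF l Y] kc])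
    also have "\<dots> = (\<Sum>i<n. l (anc m (Y m) (f i) \<odot>\<^bsub>fibre A m\<^esub> X i m))"
      using summand l Y Xc by (intro sum.cong) (simp_all add: F.lf_smult[OF l])
    also have "\<dots> = l (\<theta> (anc m (Y m)))"
      unfolding th by (rule F.lf_finsum[OF l, symmetric]) (use Xc in simp)
    finally show "l (jet_act m j Y) = l (\<theta> (anc m (Y m)))" .
  next
    show "\<theta> (anc m (Y m)) \<in> carrier (fibre A m)" unfolding th using Xc by (intro F.finsum_closed) simp
  qed (use jc Y in simp)
qed

text \<open>In a chart \<open>\<theta>\<close> is the sum of
  \<open>dx_b \<otimes> \<theta> e_b\<close>, where \<open>e_b\<close> are the coordinate
  vectors.\<close>

lemma incl_rep_exists:
  assumes \<theta>: "linear_map (tangent_space M m) (fibre A m) \<theta>"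
  shows "\<exists>j. incl_rep m \<theta> j"
proof -
  obtain U \<phi> where c: "(U, \<phi>) \<in> M" "m \<in> U" by (rule chart_at)
  obtain h where h: "bij_betw h {..<DIM('e)} (Basis :: 'e set)"
    using ex_bij_betw_nat_finite[OF finite_Basis] by (auto simp: atLeast0LessThan)
  let ?e = "\<lambda>b. chart_vector U \<phi> b m"
  have e: "?e b \<in> carrier (tangent_space M m)" for b by (rule chart_vector_in_tangent[OF c])
  have "\<forall>b. \<exists>X. X \<in> Sec \<and> X m = \<theta> (?e b)"
  proof
    fix b
    obtain X where "X \<in> Sec" "X m = \<theta> (?e b)" by (rule value_extend[OF lm_closed[OF \<theta> e]])
    then show "\<exists>X. X \<in> Sec \<and> X m = \<theta> (?e b)" by blast
  qed
  from choice[OF this] obtain X where X: "\<And>b. X b \<in> Sec" "\<And>b. X b m = \<theta> (?e b)" by auto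
  let ?f = "\<lambda>i x. \<phi> x \<bullet> h i"
  have "\<theta> v = (\<Oplus>\<^bsub>fibre A m\<^esub>i\<in>{..<DIM('e)}. v (?f i) \<odot>\<^bsub>fibre A m\<^esub> X (h i) m)"
    if v: "v \<in> carrier (tangent_space M m)" for v
  proof (rule br_eqI[of _ m])
    fix l assume l: "linear_functional (fibre A m) l"
    have "l (\<Oplus>\<^bsub>fibre A m\<^esub>i\<in>{..<DIM('e)}. v (?f i) \<odot>\<^bsub>fibre A m\<^esub> X (h i) m)
        = (\<Sum>i<DIM('e). l (v (?f i) \<odot>\<^bsub>fibre A m\<^esub> X (h i) m))"
      by (rule F.lf_finsum[OF l]) (use X(1) in simp)
    also have "\<dots> = (\<Sum>i<DIM('e). v (?f i) * l (\<theta> (?e (h i))))"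
      using X(1) by (simp add: F.lf_smult[OF l] X(2)[symmetric])
    also have "\<dots> = l (\<theta> v)"
      unfolding lm_expand[OF \<theta> c v l]
      by (rule sum.reindex_bij_betw[OF h, of "\<lambda>b. v (\<lambda>x. \<phi> x \<bullet> b) * l (\<theta> (?e b))"])
    finally show "l (\<theta> v) = l (\<Oplus>\<^bsub>fibre A m\<^esub>i\<in>{..<DIM('e)}. v (?f i) \<odot>\<^bsub>fibre A m\<^esub> X (h i) m)" by simp
  qed (use X(1) lm_closed[OF \<theta> v] in \<open>auto intro!: F.finsum_closed\<close>)
  moreover have "\<forall>i<DIM('e). smooth_near M m (?f i) \<and> X (h i) \<in> local_sections A m"
    using X(1) smooth_nearI[OF chart_open[OF c(1)] c(2) smooth_fun_coordinate[OF c(1)]] sec_local by simp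
  ultimately show ?thesis
    unfolding incl_rep_def
    by (intro exI[of _ "DIM('e)"] exI[of _ ?f] exI[of _ "\<lambda>i. X (h i)"] exI conjI) simp_all
qed

lemma cotensor_incl_spec:
  assumes \<theta>: "linear_map (tangent_space M m) (fibre A m) \<theta>"
  shows cotensor_incl_closed: "cotensor_incl M A m \<theta> \<in> carrier (J m)"
    and jet_proj_cotensor_incl: "jet_proj m (cotensor_incl M A m \<theta>) = \<zero>\<^bsub>fibre A m\<^esub>"
    and jet_act_cotensor_incl: "Y \<in> Sec \<Longrightarrow> jet_act m (cotensor_incl M A m \<theta>) Y = \<theta> (anc m (Y m))"
proof -
  obtain j where j: "incl_rep m \<theta> j" using incl_rep_exists[OF \<theta>] by blast
  have "k = j" if k: "incl_rep m \<theta> k" for k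
    by (rule jet_space_eqI[of _ m]) (use incl_rep_spec[OF j] incl_rep_spec[OF k] in simp_all)
  then have "(THE j. incl_rep m \<theta> j) = j" by (intro the_equality j)
  then have eq: "cotensor_incl M A m \<theta> = j" by (simp add: cotensor_incl_def incl_rep_def)
  show "cotensor_incl M A m \<theta> \<in> carrier (J m)" "jet_proj m (cotensor_incl M A m \<theta>) = \<zero>\<^bsub>fibre A m\<^esub>"
    "Y \<in> Sec \<Longrightarrow> jet_act m (cotensor_incl M A m \<theta>) Y = \<theta> (anc m (Y m))"
    unfolding eq using incl_rep_spec[OF j] by auto
qed

definition lift :: "'m \<Rightarrow> (('m \<Rightarrow> real) \<Rightarrow> real) \<Rightarrow> 'm \<Rightarrow> 'v" where
  "lift m v = (SOME Y. Y \<in> Sec \<and> anc m (Y m) = v)"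

lemma lift:
  assumes "v \<in> carrier (tangent_space M m)"
  shows lift_sec [simp]: "lift m v \<in> Sec" and anchor_lift [simp]: "anc m (lift m v m) = v"
proof -
  obtain Y where "Y \<in> Sec" "anc m (Y m) = v" by (rule anchor_onto[OF assms])
  then have ex: "\<exists>Y. Y \<in> Sec \<and> anc m (Y m) = v" by blast
  have "lift m v \<in> Sec \<and> anc m (lift m v m) = v" unfolding lift_def by (rule someI_ex[OF ex])
  then show "lift m v \<in> Sec" "anc m (lift m v m) = v" by auto
qed

text \<open>The inverse of \<open>cotensor_incl\<close> on jets over zero: such a jet acts on a
  section through its anchor, so any lift of \<open>v\<close> may be used.\<close>

definition cotensor_of_jet :: "'m \<Rightarrow> ('m \<Rightarrow> 'v) set \<Rightarrow> (('m \<Rightarrow> real) \<Rightarrow> real) \<Rightarrow> 'v" where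
  "cotensor_of_jet m j = (\<lambda>v\<in>carrier (tangent_space M m). jet_act m j (lift m v))"

lemma jet_act_kernel:
  assumes j: "j \<in> carrier (J m)" "jet_proj m j = \<zero>\<^bsub>fibre A m\<^esub>" and Y: "Y \<in> Sec" "Y' \<in> Sec" "anc m (Y m) = anc m (Y' m)"
  shows "jet_act m j Y = jet_act m j Y'"
proof -
  obtain X where X: "X \<in> Sec" "j = jet M A m X" by (rule jet_carrierE[OF j(1)])
  have "anc m (ssub Y Y' m) = (\<lambda>f. 0)"
    using Y by (intro ext) (simp add: lf_ssub[OF linear_functional_anchor])
  then have z: "br X (ssub Y Y') m = \<zero>\<^bsub>fibre A m\<^esub>" using X j(2) Y by (intro br_zero_anchor) auto
  show ?thesis
  proof (rule br_eqI[of _ m])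
    show "l (jet_act m j Y) = l (jet_act m j Y')" if l: "linear_functional (fibre A m) l" for l
      using arg_cong[OF z, of l] X Y by (simp add: lf_sec[OF l] F.lf_zero[OF l])
  qed (use j Y in simp_all)
qed

lemma cotensor_of_jet_apply:
  assumes "j \<in> carrier (J m)" "jet_proj m j = \<zero>\<^bsub>fibre A m\<^esub>" "Y \<in> Sec"
  shows "cotensor_of_jet m j (anc m (Y m)) = jet_act m j Y"
  using jet_act_kernel[OF assms(1,2), of "lift m (anc m (Y m))" Y] assms(3)
  by (simp add: cotensor_of_jet_def)

lemma anchor_sadd: "X \<in> Sec \<Longrightarrow> Y \<in> Sec \<Longrightarrow> anc m (sadd A X Y m) = (\<lambda>f. anc m (X m) f + anc m (Y m) f)"
  by (simp add: sadd_def anchor_add)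

lemma anchor_sscale: "X \<in> Sec \<Longrightarrow> anc m (sscale A c X m) = (\<lambda>f. c m * anc m (X m) f)"
  by (simp add: sscale_def anchor_smult)

lemma jet_act_sadd_arg: "j \<in> carrier (J m) \<Longrightarrow> Y \<in> Sec \<Longrightarrow> Z \<in> Sec \<Longrightarrow>
    jet_act m j (sadd A Y Z) = jet_act m j Y \<oplus>\<^bsub>fibre A m\<^esub> jet_act m j Z"
proof -
  assume a: "j \<in> carrier (J m)" "Y \<in> Sec" "Z \<in> Sec"
  obtain X where X: "X \<in> Sec" "j = jet M A m X" by (rule jet_carrierE[OF a(1)])
  show ?thesis
  proof (rule br_eqI[of _ m])
    show "l (jet_act m j (sadd A Y Z)) = l (jet_act m j Y \<oplus>\<^bsub>fibre A m\<^esub> jet_act m j Z)"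
      if l: "linear_functional (fibre A m) l" for l
      using X a by (simp add: lf_sec[OF l] F.lf_add[OF l])
  qed (use a in simp_all)
qed

lemma jet_act_sscale_arg: "j \<in> carrier (J m) \<Longrightarrow> Y \<in> Sec \<Longrightarrow>
    jet_act m j (sscale A (\<lambda>x. c) Y) = c \<odot>\<^bsub>fibre A m\<^esub> jet_act m j Y"
proof -
  assume a: "j \<in> carrier (J m)" "Y \<in> Sec"
  obtain X where X: "X \<in> Sec" "j = jet M A m X" by (rule jet_carrierE[OF a(1)])
  show ?thesis
  proof (rule br_eqI[of _ m])
    show "l (jet_act m j (sscale A (\<lambda>x. c) Y)) = l (c \<odot>\<^bsub>fibre A m\<^esub> jet_act m j Y)"
      if l: "linear_functional (fibre A m) l" for l
      using X a by (simp add: lf_sec[OF l] F.lf_smult[OF l])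
  qed (use a in simp_all)
qed

lemma cotensor_of_jet_linear:
  assumes j: "j \<in> carrier (J m)" "jet_proj m j = \<zero>\<^bsub>fibre A m\<^esub>"
  shows "linear_map (tangent_space M m) (fibre A m) (cotensor_of_jet m j)"
  unfolding linear_map_def
proof (intro conjI ballI allI Pi_I)
  fix v assume v: "v \<in> carrier (tangent_space M m)"
  show "cotensor_of_jet m j v \<in> carrier (fibre A m)" using v j(1) by (simp add: cotensor_of_jet_def)
  have "cotensor_of_jet m j (anc m (sscale A (\<lambda>x. c) (lift m v) m)) = jet_act m j (sscale A (\<lambda>x. c) (lift m v))" for c
    using v by (intro cotensor_of_jet_apply j) simp
  then show "cotensor_of_jet m j (c \<odot>\<^bsub>tangent_space M m\<^esub> v) = c \<odot>\<^bsub>fibre A m\<^esub> cotensor_of_jet m j v" for c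
    using v j by (simp add: anchor_sscale jet_act_sscale_arg) (simp add: cotensor_of_jet_def)
  fix w assume w: "w \<in> carrier (tangent_space M m)"
  have "cotensor_of_jet m j (anc m (sadd A (lift m v) (lift m w) m)) = jet_act m j (sadd A (lift m v) (lift m w))"
    using v w by (intro cotensor_of_jet_apply j) simp
  then show "cotensor_of_jet m j (v \<oplus>\<^bsub>tangent_space M m\<^esub> w) = cotensor_of_jet m j v \<oplus>\<^bsub>fibre A m\<^esub> cotensor_of_jet m j w"
    using v w j by (simp add: anchor_sadd jet_act_sadd_arg) (simp add: cotensor_of_jet_def)
qed

lemma cotensor_carrier_iff:
  "\<theta> \<in> carrier (cotensor M m (fibre A m)) \<longleftrightarrow>
    \<theta> \<in> extensional (carrier (tangent_space M m)) \<and> linear_map (tangent_space M m) (fibre A m) \<theta>"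
  by (simp add: hom_space_def)

lemma cotensor_of_jet_carrier:
  "j \<in> carrier (J m) \<Longrightarrow> jet_proj m j = \<zero>\<^bsub>fibre A m\<^esub> \<Longrightarrow> cotensor_of_jet m j \<in> carrier (cotensor M m (fibre A m))"
  using cotensor_of_jet_linear by (simp add: cotensor_carrier_iff cotensor_of_jet_def)

lemma cotensor_incl_of_jet:
  assumes j: "j \<in> carrier (J m)" "jet_proj m j = \<zero>\<^bsub>fibre A m\<^esub>"
  shows "cotensor_incl M A m (cotensor_of_jet m j) = j"
  by (rule jet_space_eqI[of _ m])
    (use j cotensor_incl_spec[OF cotensor_of_jet_linear[OF j]] cotensor_of_jet_apply[OF j] in simp_all)

subsection \<open>Linear connections\<close>

context
  fixes D :: "('m \<Rightarrow> 'v) \<Rightarrow> 'm \<Rightarrow> (('m \<Rightarrow> real) \<Rightarrow> real) \<Rightarrow> 'v"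
  assumes D: "linear_connection M A D"
begin

lemmas linear_connection_axs = D[unfolded linear_connection_def]

lemma connection_carrier: "X \<in> Sec \<Longrightarrow> D X m \<in> carrier (cotensor M m (fibre A m))"
  using linear_connection_axs[THEN conjunct1] by blast

lemma connection_linear: "X \<in> Sec \<Longrightarrow> linear_map (tangent_space M m) (fibre A m) (D X m)"
  using connection_carrier unfolding cotensor_carrier_iff by blast

lemma connection_smooth: "X \<in> Sec \<Longrightarrow> open U \<Longrightarrow> V \<in> sections (tangent_bundle M) U \<Longrightarrow>
    (\<lambda>x. D X x (V x)) \<in> sections A U"
  using linear_connection_axs[THEN conjunct1] by blast

lemma connection_add: "X \<in> Sec \<Longrightarrow> Y \<in> Sec \<Longrightarrow> v \<in> carrier (tangent_space M m) \<Longrightarrow>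
    D (sadd A X Y) m v = D X m v \<oplus>\<^bsub>fibre A m\<^esub> D Y m v"
  using linear_connection_axs[THEN conjunct2, THEN conjunct1] by blast

lemma connection_scale: "X \<in> Sec \<Longrightarrow> smooth_fun M UNIV f \<Longrightarrow> v \<in> carrier (tangent_space M m) \<Longrightarrow>
    D (sscale A f X) m v = (f m \<odot>\<^bsub>fibre A m\<^esub> D X m v) \<oplus>\<^bsub>fibre A m\<^esub> (v f \<odot>\<^bsub>fibre A m\<^esub> X m)"
  using linear_connection_axs[THEN conjunct2, THEN conjunct2] by blast

lemma connection_closed [simp]: "X \<in> Sec \<Longrightarrow> v \<in> carrier (tangent_space M m) \<Longrightarrow> D X m v \<in> carrier (fibre A m)"
  using lm_closed[OF connection_linear] .

text \<open>The cutoff argument used for brackets; the derivative term dies because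
  \<open>\<rho>\<close> is constant near \<open>m\<close>.\<close>

lemma connection_cong:
  assumes X: "X \<in> Sec" "X' \<in> Sec" and v: "v \<in> carrier (tangent_space M m)" and W: "open W" "m \<in> W" "\<forall>x\<in>W. X x = X' x"
  shows "D X m v = D X' m v"
proof -
  obtain \<rho> W' K where \<rho>: "smooth_fun M UNIV \<rho>" "open W'" "m \<in> W'" "W' \<subseteq> K" "closed K" "K \<subseteq> W"
    "\<forall>x\<in>W'. \<rho> x = 1" "\<forall>x. x \<notin> K \<longrightarrow> \<rho> x = 0"
    by (rule bump_function[OF W(1,2)])
  have eq: "sscale A \<rho> X = sscale A \<rho> X'"
  proof
    fix x show "sscale A \<rho> X x = sscale A \<rho> X' x"
    proof (cases "x \<in> K")
      case True
      then have "X x = X' x" using \<rho>(6) W(3) by blast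
      then show ?thesis by (simp add: sscale_def)
    next
      case False
      then show ?thesis using \<rho>(8) X by (simp add: sscale_def F.M.smult_l_null[simplified])
    qed
  qed
  have "v \<rho> = v (\<lambda>x. 1)" by (rule tangent_apply_cong[OF v \<rho>(2,3)]) (use \<rho>(7) in simp)
  then have v0: "v \<rho> = 0" using tangent_apply_const[OF v] by simp
  have "D (sscale A \<rho> Z) m v = D Z m v" if Z: "Z \<in> Sec" for Z
  proof (rule br_eqI[of _ m])
    show "l (D (sscale A \<rho> Z) m v) = l (D Z m v)" if l: "linear_functional (fibre A m) l" for l
      using Z v \<rho>(1,3,7) by (simp add: connection_scale F.lf_add[OF l] F.lf_smult[OF l] v0)
  qed (use Z v \<rho>(1) in simp_all)
  then show ?thesis using eq X by metis
qed

lemma connection_finsum: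
  assumes l: "linear_functional (fibre A m) l" and "finite I"
    "\<And>i. i \<in> I \<Longrightarrow> smooth_fun M UNIV (c i)" "\<And>i. i \<in> I \<Longrightarrow> s i \<in> Sec" and v: "v \<in> carrier (tangent_space M m)"
  shows "l (D (\<lambda>x. \<Oplus>\<^bsub>fibre A x\<^esub>i\<in>I. c i x \<odot>\<^bsub>fibre A x\<^esub> s i x) m v)
    = (\<Sum>i\<in>I. c i m * l (D (s i) m v) + v (c i) * l (s i m))"
  using assms(2-4)
proof (induction I)
  case empty
  have "(\<lambda>x. \<Oplus>\<^bsub>fibre A x\<^esub>i\<in>{}. c i x \<odot>\<^bsub>fibre A x\<^esub> s i x) = szero A"
    by (simp add: szero_def)
  moreover have e: "sscale A (\<lambda>x. 0) (szero A) = szero A" by (simp add: sscale_def szero_def)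
  have "D (szero A) m v = (0 \<odot>\<^bsub>fibre A m\<^esub> D (szero A) m v) \<oplus>\<^bsub>fibre A m\<^esub> (0 \<odot>\<^bsub>fibre A m\<^esub> szero A m)"
    using connection_scale[OF sec_szero smooth_const v, of 0] unfolding e tangent_apply_const[OF v] .
  then have "l (D (szero A) m v) = 0"
    using v F.lf_add[OF l, of "0 \<odot>\<^bsub>fibre A m\<^esub> D (szero A) m v" "0 \<odot>\<^bsub>fibre A m\<^esub> szero A m"]
      F.lf_smult[OF l, of "D (szero A) m v" 0] F.lf_smult[OF l, of "szero A m" 0] by simp
  ultimately show ?case by simp
next
  case (insert i I)
  have "(\<lambda>x. \<Oplus>\<^bsub>fibre A x\<^esub>i\<in>insert i I. c i x \<odot>\<^bsub>fibre A x\<^esub> s i x)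
    = sadd A (sscale A (c i) (s i)) (\<lambda>x. \<Oplus>\<^bsub>fibre A x\<^esub>i\<in>I. c i x \<odot>\<^bsub>fibre A x\<^esub> s i x)"
    unfolding sadd_def sscale_def
    using insert.prems insert.hyps by (intro ext F.M.finsum_insert) auto
  moreover have "(\<lambda>x. \<Oplus>\<^bsub>fibre A x\<^esub>i\<in>I. c i x \<odot>\<^bsub>fibre A x\<^esub> s i x) \<in> Sec"
    by (rule sec_finsum) (use insert.prems in auto)
  ultimately show ?case
    using insert v by (simp add: connection_add connection_scale F.lf_simps[OF l])
qed

text \<open>The difference of \<open>X\<close> and \<open>X'\<close> vanishes at \<open>m\<close>.
  Expanding it with coefficients \<open>c i\<close>, the bracket contributes minus the sum of the
  \<open>#Y(c i) s i\<close> and the connection plus the same sum. So \<open>J X + D X\<close> at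
  \<open>m\<close> depends on \<open>X m\<close> only, and \<open>splitting\<close> is well
  defined.\<close>

lemma connection_jet:
  assumes X: "X \<in> Sec" "X' \<in> Sec" "X m = X' m" and Y: "Y \<in> Sec" and l: "linear_functional (fibre A m) l"
  shows "l (br X Y m) + l (D X m (anc m (Y m))) = l (br X' Y m) + l (D X' m (anc m (Y m)))"
proof -
  let ?u = "ssub X X'" and ?v = "anc m (Y m)"
  have v: "?v \<in> carrier (tangent_space M m)" using Y by simp
  have u: "?u \<in> Sec" using X by simp
  have u0: "?u m = \<zero>\<^bsub>fibre A m\<^esub>" by (rule br_eqI[of _ m]) (use X in \<open>simp_all add: lf_ssub F.lf_zero\<close>)
  obtain W r s c where W: "\<forall>i<r. s i \<in> Sec" "\<forall>i<r. smooth_fun M UNIV (c i)"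
    "m \<in> W" "W \<subseteq> UNIV" "local_frame M A W r s" "\<forall>x\<in>W. ?u x = scomb A r c s x"
    by (rule section_expand[OF u open_UNIV UNIV_I])
  note lin = F.linear_functional_coeff[OF frame_basis[OF W(5,3)]]
  have c0: "c i m = 0" if i: "i < r" for i
  proof -
    have "coeff (fibre A m) r (\<lambda>i. s i m) (?u m) i = c i m"
      using W(3,6) F.coeff_unique[OF frame_basis[OF W(5,3)] i, of "\<lambda>i. c i m"] by (simp add: scomb_def)
    then show ?thesis using F.lf_zero[OF lin[OF i]] u0 by simp
  qed
  let ?s = "\<lambda>x. \<Oplus>\<^bsub>fibre A x\<^esub>i\<in>{..<r}. c i x \<odot>\<^bsub>fibre A x\<^esub> s i x"
  have s: "?s \<in> Sec" by (rule sec_finsum) (use W in auto)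
  have "D ?u m ?v = D ?s m ?v"
    by (rule connection_cong[OF u s v frame_open[OF W(5)] W(3)]) (use W(6) in \<open>simp add: scomb_def\<close>)
  then have 1: "l (D ?u m ?v) = (\<Sum>i<r. ?v (c i) * l (s i m))"
    using connection_finsum[OF l finite_lessThan _ _ v, of r c s] W(1,2) c0 by simp
  have 2: "l (br ?u Y m) = - (\<Sum>i<r. ?v (c i) * l (s i m))"
    using br_expand[OF u Y finite_lessThan frame_open[OF W(5)] W(3) _ _ W(6)[unfolded scomb_def] l] W(1,2) c0
    by (simp add: sum_negf)
  have 3: "l (D ?u m ?v) = l (D X m ?v) - l (D X' m ?v)"
    unfolding ssub_def using X v tangent_apply_const[OF v]
    by (simp add: connection_add connection_scale F.lf_simps[OF l])
  show ?thesis using 1 2 3 lf_br_ssub_left[OF l X(1,2) Y] by simp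
qed

lemma splitting_eq:
  assumes X: "X \<in> Sec"
  shows "splitting M A D m (X m) = jet M A m X \<oplus>\<^bsub>J m\<^esub> cotensor_incl M A m (D X m)"
proof -
  have spec: "jet_proj m (jet M A m Z \<oplus>\<^bsub>J m\<^esub> cotensor_incl M A m (D Z m)) = Z m"
    "\<And>Y. Y \<in> Sec \<Longrightarrow> jet_act m (jet M A m Z \<oplus>\<^bsub>J m\<^esub> cotensor_incl M A m (D Z m)) Y
      = br Z Y m \<oplus>\<^bsub>fibre A m\<^esub> D Z m (anc m (Y m))" if Z: "Z \<in> Sec" for Z
  proof -
    note ci = cotensor_incl_spec[OF connection_linear[OF Z, of m]]
    show "jet_proj m (jet M A m Z \<oplus>\<^bsub>J m\<^esub> cotensor_incl M A m (D Z m)) = Z m"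
    proof (rule br_eqI[of _ m])
      show "l (jet_proj m (jet M A m Z \<oplus>\<^bsub>J m\<^esub> cotensor_incl M A m (D Z m))) = l (Z m)"
        if l: "linear_functional (fibre A m) l" for l
        using J.lf_add[OF linear_functional_jet_proj[OF l] jet_in_carrier[OF Z] ci(1)] Z ci(2) by (simp add: F.lf_zero[OF l])
    qed (use Z ci in simp_all)
    fix Y assume Y: "Y \<in> Sec"
    show "jet_act m (jet M A m Z \<oplus>\<^bsub>J m\<^esub> cotensor_incl M A m (D Z m)) Y
      = br Z Y m \<oplus>\<^bsub>fibre A m\<^esub> D Z m (anc m (Y m))"
    proof (rule br_eqI[of _ m])
      show "l (jet_act m (jet M A m Z \<oplus>\<^bsub>J m\<^esub> cotensor_incl M A m (D Z m)) Y)
          = l (br Z Y m \<oplus>\<^bsub>fibre A m\<^esub> D Z m (anc m (Y m)))"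
        if l: "linear_functional (fibre A m) l" for l
        using J.lf_add[OF linear_functional_jet_act[OF l Y] jet_in_carrier[OF Z] ci(1)] Z Y ci(3)[OF Y]
        by (simp add: F.lf_add[OF l])
    qed (use Z Y ci in simp_all)
  qed
  show ?thesis
    unfolding splitting_def
  proof (rule the_equality)
    show "\<exists>Z\<in>Sec. Z m = X m \<and> jet M A m X \<oplus>\<^bsub>J m\<^esub> cotensor_incl M A m (D X m)
        = jet M A m Z \<oplus>\<^bsub>J m\<^esub> cotensor_incl M A m (D Z m)"
      using X by blast
    fix j assume "\<exists>Z\<in>Sec. Z m = X m \<and> j = jet M A m Z \<oplus>\<^bsub>J m\<^esub> cotensor_incl M A m (D Z m)"
    then obtain Z where Z: "Z \<in> Sec" "Z m = X m" "j = jet M A m Z \<oplus>\<^bsub>J m\<^esub> cotensor_incl M A m (D Z m)" by blast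
    show "j = jet M A m X \<oplus>\<^bsub>J m\<^esub> cotensor_incl M A m (D X m)"
      unfolding Z(3)
    proof (rule jet_space_lfI)
      show "l (jet_act m (jet M A m Z \<oplus>\<^bsub>J m\<^esub> cotensor_incl M A m (D Z m)) Y)
        = l (jet_act m (jet M A m X \<oplus>\<^bsub>J m\<^esub> cotensor_incl M A m (D X m)) Y)"
        if l: "linear_functional (fibre A m) l" and Y: "Y \<in> Sec" for l Y
        using connection_jet[OF Z(1) X Z(2) Y l] X Z(1) Y by (simp add: spec F.lf_add[OF l])
    qed (use X Z spec cotensor_incl_closed[OF connection_linear] in simp_all)
  qed
qed

lemma splitting_spec:
  assumes X: "X \<in> Sec"
  shows splitting_closed': "splitting M A D m (X m) \<in> carrier (J m)"
    and jet_proj_splitting': "jet_proj m (splitting M A D m (X m)) = X m"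
    and jet_act_splitting: "Y \<in> Sec \<Longrightarrow>
      jet_act m (splitting M A D m (X m)) Y = br X Y m \<oplus>\<^bsub>fibre A m\<^esub> D X m (anc m (Y m))"
proof -
  note ci = cotensor_incl_spec[OF connection_linear[OF X, of m]]
  show "splitting M A D m (X m) \<in> carrier (J m)" unfolding splitting_eq[OF X] using X ci(1) by simp
  show "jet_proj m (splitting M A D m (X m)) = X m"
    unfolding splitting_eq[OF X]
  proof (rule br_eqI[of _ m])
    show "l (jet_proj m (jet M A m X \<oplus>\<^bsub>J m\<^esub> cotensor_incl M A m (D X m))) = l (X m)"
      if l: "linear_functional (fibre A m) l" for l
      using J.lf_add[OF linear_functional_jet_proj[OF l] jet_in_carrier[OF X] ci(1)] X ci(2) by (simp add: F.lf_zero[OF l])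
  qed (use X ci in simp_all)
  assume Y: "Y \<in> Sec"
  show "jet_act m (splitting M A D m (X m)) Y = br X Y m \<oplus>\<^bsub>fibre A m\<^esub> D X m (anc m (Y m))"
    unfolding splitting_eq[OF X]
  proof (rule br_eqI[of _ m])
    show "l (jet_act m (jet M A m X \<oplus>\<^bsub>J m\<^esub> cotensor_incl M A m (D X m)) Y)
        = l (br X Y m \<oplus>\<^bsub>fibre A m\<^esub> D X m (anc m (Y m)))"
      if l: "linear_functional (fibre A m) l" for l
      using J.lf_add[OF linear_functional_jet_act[OF l Y] jet_in_carrier[OF X] ci(1)] X Y ci(3)[OF Y]
      by (simp add: F.lf_add[OF l])
  qed (use X Y ci in simp_all)
qed

lemma splitting_closed: "v \<in> carrier (fibre A m) \<Longrightarrow> splitting M A D m v \<in> carrier (J m)"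
  by (erule value_extend) (use splitting_closed' in auto)

lemma jet_proj_splitting: "v \<in> carrier (fibre A m) \<Longrightarrow> jet_proj m (splitting M A D m v) = v"
  by (erule value_extend) (use jet_proj_splitting' in auto)

lemma splitting_linear: "linear_map (fibre A m) (J m) (splitting M A D m)"
  unfolding linear_map_def
proof (intro conjI ballI allI Pi_I)
  fix v assume v: "v \<in> carrier (fibre A m)"
  show "splitting M A D m v \<in> carrier (J m)" by (rule splitting_closed[OF v])
  obtain X where X: "X \<in> Sec" "X m = v" by (rule value_extend[OF v])
  note sX = splitting_spec[OF X(1), where m=m, unfolded X(2)]
  show "splitting M A D m (c \<odot>\<^bsub>fibre A m\<^esub> v) = c \<odot>\<^bsub>J m\<^esub> splitting M A D m v" for c
  proof -
    have cX: "sscale A (\<lambda>x. c) X \<in> Sec" "sscale A (\<lambda>x. c) X m = c \<odot>\<^bsub>fibre A m\<^esub> v"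
      using X(1) by simp (simp add: sscale_def X(2))
    note scX = splitting_spec[OF cX(1), where m=m, unfolded cX(2)]
    show ?thesis
    proof (rule jet_space_lfI)
      fix l assume l: "linear_functional (fibre A m) l"
      show "l (jet_proj m (splitting M A D m (c \<odot>\<^bsub>fibre A m\<^esub> v))) = l (jet_proj m (c \<odot>\<^bsub>J m\<^esub> splitting M A D m v))"
        using J.lf_smult[OF linear_functional_jet_proj[OF l] sX(1), of c] v by (simp add: sX scX F.lf_smult[OF l])
      show "l (jet_act m (splitting M A D m (c \<odot>\<^bsub>fibre A m\<^esub> v)) Y) = l (jet_act m (c \<odot>\<^bsub>J m\<^esub> splitting M A D m v) Y)"
        if Y: "Y \<in> Sec" for Y
        using J.lf_smult[OF linear_functional_jet_act[OF l Y] sX(1), of c] X Y v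
        by (simp add: sX scX F.lf_simps[OF l] lf_sec[OF l] connection_scale algebra_simps)
    qed (use sX scX in simp_all)
  qed
  fix w assume w: "w \<in> carrier (fibre A m)"
  obtain Z where Z: "Z \<in> Sec" "Z m = w" by (rule value_extend[OF w])
  note sZ = splitting_spec[OF Z(1), where m=m, unfolded Z(2)]
  have aX: "sadd A X Z \<in> Sec" "sadd A X Z m = v \<oplus>\<^bsub>fibre A m\<^esub> w"
    using X(1) Z(1) by simp (simp add: sadd_def X(2) Z(2))
  note saX = splitting_spec[OF aX(1), where m=m, unfolded aX(2)]
  show "splitting M A D m (v \<oplus>\<^bsub>fibre A m\<^esub> w) = splitting M A D m v \<oplus>\<^bsub>J m\<^esub> splitting M A D m w"
  proof (rule jet_space_lfI)
    fix l assume l: "linear_functional (fibre A m) l"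
    show "l (jet_proj m (splitting M A D m (v \<oplus>\<^bsub>fibre A m\<^esub> w))) = l (jet_proj m (splitting M A D m v \<oplus>\<^bsub>J m\<^esub> splitting M A D m w))"
      using J.lf_add[OF linear_functional_jet_proj[OF l] sX(1) sZ(1)] v w by (simp add: sX sZ saX F.lf_add[OF l])
    show "l (jet_act m (splitting M A D m (v \<oplus>\<^bsub>fibre A m\<^esub> w)) Y) = l (jet_act m (splitting M A D m v \<oplus>\<^bsub>J m\<^esub> splitting M A D m w) Y)"
      if Y: "Y \<in> Sec" for Y
      using J.lf_add[OF linear_functional_jet_act[OF l Y] sX(1) sZ(1)] X Z Y
      by (simp add: sX sZ saX F.lf_simps[OF l] lf_sec[OF l] connection_add)
  qed (use sX sZ saX in simp_all)
qed

text \<open>In a chart the cotensor \<open>D X\<close> is the sum of the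
  \<open>dx_b \<otimes> D_b X\<close>, and the inclusion of each term is a combination of two
  prolongations.\<close>

lemma splitting_smooth:
  assumes "\<sigma> \<in> sections A U" "open U"
  shows "(\<lambda>x. splitting M A D x (\<sigma> x)) \<in> jet_sections M A U"
proof (rule jet_sections_glue)
  fix m assume m: "m \<in> U"
  obtain X W where X: "X \<in> Sec" "open W" "m \<in> W" "W \<subseteq> U" "\<forall>x\<in>W. X x = \<sigma> x"
    by (rule section_extend[OF assms(2) m assms(1)])
  obtain V \<phi> where c: "(V, \<phi>) \<in> M" "m \<in> V" by (rule chart_at)
  have "\<forall>b. \<exists>Y q N. Y \<in> Sec \<and> smooth_fun M UNIV q \<and> open N \<and> m \<in> N \<and> N \<subseteq> V \<and>
      (\<forall>x\<in>N. Y x = D X x (chart_vector V \<phi> b x) \<and> q x = \<phi> x \<bullet> b)"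
  proof
    fix b
    have "chart_vector V \<phi> b \<in> sections (tangent_bundle M) V"
      using chart_vector_in_tangent[OF c(1)] smooth_fun_chart_vector[OF c(1)] by (simp add: tangent_bundle_def)
    then have "(\<lambda>x. D X x (chart_vector V \<phi> b x)) \<in> sections A V"
      by (rule connection_smooth[OF X(1) chart_open[OF c(1)]])
    then obtain Y N1 where Y: "Y \<in> Sec" "open N1" "m \<in> N1" "N1 \<subseteq> V" "\<forall>x\<in>N1. Y x = D X x (chart_vector V \<phi> b x)"
      by (rule section_extend[OF chart_open[OF c(1)] c(2)])
    obtain q N2 where q: "smooth_fun M UNIV q" "open N2" "m \<in> N2" "N2 \<subseteq> V" "\<forall>x\<in>N2. q x = \<phi> x \<bullet> b"
      by (rule smooth_fun_extend[OF chart_open[OF c(1)] c(2) smooth_fun_coordinate[OF c(1)]])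
    have "open (N1 \<inter> N2)" using Y(2) q(2) by (rule open_Int)
    then show "\<exists>Y q N. Y \<in> Sec \<and> smooth_fun M UNIV q \<and> open N \<and> m \<in> N \<and> N \<subseteq> V \<and>
      (\<forall>x\<in>N. Y x = D X x (chart_vector V \<phi> b x) \<and> q x = \<phi> x \<bullet> b)"
      using Y q by (intro exI[of _ Y] exI[of _ q] exI[of _ "N1 \<inter> N2"]) auto
  qed
  from choice[OF this] obtain Y where "\<forall>b. \<exists>q N. Y b \<in> Sec \<and> smooth_fun M UNIV q \<and> open N \<and> m \<in> N \<and> N \<subseteq> V \<and>
      (\<forall>x\<in>N. Y b x = D X x (chart_vector V \<phi> b x) \<and> q x = \<phi> x \<bullet> b)" by (elim exE)
  from choice[OF this] obtain q where "\<forall>b. \<exists>N. Y b \<in> Sec \<and> smooth_fun M UNIV (q b) \<and> open N \<and> m \<in> N \<and> N \<subseteq> V \<and>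
      (\<forall>x\<in>N. Y b x = D X x (chart_vector V \<phi> b x) \<and> q b x = \<phi> x \<bullet> b)" by (elim exE)
  from choice[OF this] obtain N where N: "\<And>b. Y b \<in> Sec" "\<And>b. smooth_fun M UNIV (q b)" "\<And>b. open (N b)" "\<And>b. m \<in> N b"
      "\<And>b. N b \<subseteq> V" "\<And>b x. x \<in> N b \<Longrightarrow> Y b x = D X x (chart_vector V \<phi> b x)" "\<And>b x. x \<in> N b \<Longrightarrow> q b x = \<phi> x \<bullet> b" by auto
  let ?N = "W \<inter> V \<inter> (\<Inter>b\<in>Basis. N b)"
  have op: "open ?N" using X(2) chart_open[OF c(1)] N(3) by (intro open_Int open_INT) auto
  \<comment> \<open>The section \<open>f J Z - J (f Z)\<close> for \<open>f = q b\<close> and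
    \<open>Z = Y b\<close>: near \<open>m\<close> it is the inclusion of
    \<open>dx_b \<otimes> D_b X\<close>.\<close>
  let ?\<eta> = "\<lambda>b. sadd (J1 M A) (sscale (J1 M A) (q b) (prolong M A (Y b)))
    (sscale (J1 M A) (\<lambda>x. -1) (prolong M A (sscale A (q b) (Y b))))"
  have \<eta>: "?\<eta> b \<in> JSec" for b using N(1,2) by simp
  let ?S = "\<lambda>x. \<Oplus>\<^bsub>J x\<^esub>b\<in>Basis. 1 \<odot>\<^bsub>J x\<^esub> ?\<eta> b x"
  have S: "?S \<in> JSec" using JB.section_finsum[of UNIV Basis "\<lambda>b x. 1" ?\<eta>] \<eta> by simp
  let ?\<zeta> = "sadd (J1 M A) (prolong M A X) ?S"
  have \<zeta>: "?\<zeta> \<in> JSec" using S X(1) by simp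
  have eq: "?\<zeta> x = splitting M A D x (\<sigma> x)" if x: "x \<in> ?N" for x
  proof -
    have sx: "\<sigma> x = X x" using X(5) x by auto
    note sX = splitting_spec[OF X(1), where m=x]
    have xV: "x \<in> V" using x by blast
    have "?\<zeta> x = splitting M A D x (X x)"
    proof (rule jet_space_lfI)
      fix l assume l: "linear_functional (fibre A x) l"
      note lp = linear_functional_jet_proj[OF l]
      have 1: "l (pr (?\<eta> b) x) = 0" for b using N(1,2) by (simp add: lf_jsec[OF l] lf_sec[OF l])
      have "l (pr ?S x) = (\<Sum>b\<in>Basis. l (pr (?\<eta> b) x))"
      proof -
        have "l (jet_proj x (?S x)) = (\<Sum>b\<in>Basis. l (jet_proj x (1 \<odot>\<^bsub>J x\<^esub> ?\<eta> b x)))"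
          by (rule J.lf_finsum[OF lp]) (use \<eta> in simp)
        also have "\<dots> = (\<Sum>b\<in>Basis. l (jet_proj x (?\<eta> b x)))"
          using J.lf_smult[OF lp jsec_carrier[OF \<eta>]] by simp
        finally show ?thesis by (simp add: pr_def)
      qed
      then have "l (pr ?\<zeta> x) = l (X x)" using 1 S X(1) by (simp add: lf_pr_sadd[OF l])
      then show "l (jet_proj x (?\<zeta> x)) = l (jet_proj x (splitting M A D x (X x)))" unfolding sX(2) pr_def .
      fix Z assume Z: "Z \<in> Sec"
      note la = linear_functional_jet_act[OF l Z]
      have 2: "l (act (?\<eta> b) Z x) = anc x (Z x) (\<lambda>x. \<phi> x \<bullet> b) * l (D X x (chart_vector V \<phi> b x))" if b: "b \<in> Basis" for b
      proof -
        have "l (act (?\<eta> b) Z x) = anc x (Z x) (q b) * l (Y b x)"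
          using N(1,2) Z by (simp add: lf_jsec[OF l] lf_sec[OF l])
        moreover have "anc x (Z x) (q b) = anc x (Z x) (\<lambda>x. \<phi> x \<bullet> b)"
          by (rule tangent_apply_cong[OF _ N(3)[of b]]) (use Z x b N(7) in auto)
        ultimately show ?thesis using N(6)[of x b] x b by simp
      qed
      have "l (act ?S Z x) = (\<Sum>b\<in>Basis. l (act (?\<eta> b) Z x))"
      proof -
        have "l (jet_act x (?S x) Z) = (\<Sum>b\<in>Basis. l (jet_act x (1 \<odot>\<^bsub>J x\<^esub> ?\<eta> b x) Z))"
          by (rule J.lf_finsum[OF la]) (use \<eta> in simp)
        also have "\<dots> = (\<Sum>b\<in>Basis. l (jet_act x (?\<eta> b x) Z))"
          using J.lf_smult[OF la jsec_carrier[OF \<eta>]] by simp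
        finally show ?thesis by (simp add: act_def)
      qed
      also have "\<dots> = l (D X x (anc x (Z x)))"
        unfolding lm_expand[OF connection_linear[OF X(1)] c(1) xV anchor_tangent[OF sec_carrier[OF Z]] l]
        by (rule sum.cong) (simp_all add: 2)
      finally have "l (act ?\<zeta> Z x) = l (br X Z x) + l (D X x (anc x (Z x)))"
        using S X(1) Z by (simp add: lf_act_sadd[OF l])
      also have "\<dots> = l (jet_act x (splitting M A D x (X x)) Z)"
        unfolding sX(3)[OF Z] using X(1) Z by (simp add: F.lf_add[OF l])
      finally show "l (jet_act x (?\<zeta> x) Z) = l (jet_act x (splitting M A D x (X x)) Z)" unfolding act_def .
    qed (use jsec_carrier[OF \<zeta>] sX(1) in simp_all)
    then show ?thesis by (simp add: sx)
  qed
  have "?\<zeta> \<in> jet_sections M A ?N" by (rule jet_sections_restrict[OF \<zeta> op subset_UNIV])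
  then have "(\<lambda>x. splitting M A D x (\<sigma> x)) \<in> jet_sections M A ?N"
    using JB.section_cong[OF op eq] by simp
  moreover have "m \<in> ?N" using X(3) c(2) N(4) by blast
  ultimately show "\<exists>V. open V \<and> m \<in> V \<and> V \<subseteq> U \<and> (\<lambda>x. splitting M A D x (\<sigma> x)) \<in> jet_sections M A V"
    using op X(4) by (intro exI[of _ ?N]) blast
qed

end

end

subsection \<open>Subalgebroids\<close>

lemma subbundle_simps:
  "fibre (subbundle E F) m = (fibre E m)\<lparr>carrier := F m\<rparr>"
  "sections (subbundle E F) U = {\<sigma> \<in> sections E U. \<forall>x\<in>U. \<sigma> x \<in> F x}"
  by (simp_all add: subbundle_def)

lemma subbundle_algebroid_simps:
  "anchor (subbundle A F) = anchor A" "bracket (subbundle A F) = bracket A"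
  by (simp_all add: subbundle_def)

lemma subbundle_ops:
  "sadd (subbundle E F) = sadd E" "sscale (subbundle E F) = sscale E" "szero (subbundle E F) = szero E"
  by (intro ext; simp add: sadd_def sscale_def szero_def subbundle_def)+

context algebroid begin

lemma lie_algebroid_subbundle:
  assumes "subalgebroid M A F"
  shows "lie_algebroid M (subbundle A F)"
proof -
  have sub: "F m \<subseteq> carrier (fibre A m)" for m
    using assms submodule.axioms(1) subgroup.subset unfolding subalgebroid_def is_subbundle_def by fastforce
  have mor: "bundle_morphism A (tangent_bundle M) (anchor A)"
    using lie_algebroid_axs[THEN conjunct2, THEN conjunct1] .
  have "bundle_morphism (subbundle A F) (tangent_bundle M) (anchor A)"
    unfolding bundle_morphism_def
  proof (intro conjI allI impI)
    fix m
    have lm: "linear_map (fibre A m) (fibre (tangent_bundle M) m) (anchor A m)"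
      using mor unfolding bundle_morphism_def by simp
    show "linear_map (fibre (subbundle A F) m) (fibre (tangent_bundle M) m) (anchor A m)"
      using lm sub[of m] unfolding linear_map_def subbundle_simps by (auto simp: subset_iff Pi_iff)
    show "(\<lambda>x. anchor A x (\<sigma> x)) \<in> sections (tangent_bundle M) U"
      if "open U \<and> \<sigma> \<in> sections (subbundle A F) U" for U \<sigma>
      using mor that unfolding bundle_morphism_def subbundle_simps by simp
  qed
  moreover have "X \<in> Sec" if "X \<in> sections (subbundle A F) UNIV" for X
    using that by (simp add: subbundle_simps)
  ultimately show ?thesis
    using assms unfolding lie_algebroid_def subbundle_ops subbundle_algebroid_simps
    by (intro conjI ballI allI impI, simp_all add: subalgebroid_def is_subbundle_def br_sadd_left
        br_skew_sections br_jacobi_sections br_leibniz_sections) (rule anchor_br, simp_all)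
qed

end

subsection \<open>The torsion form on first jets\<close>

context transitive_algebroid begin

text \<open>Linear over functions in both arguments: the Leibniz terms of the bracket cancel those
  of \<open>act U (pr V)\<close> and of \<open>act V (pr U)\<close>.\<close>

definition torsion :: "('m \<Rightarrow> ('m \<Rightarrow> 'v) set) \<Rightarrow> ('m \<Rightarrow> ('m \<Rightarrow> 'v) set) \<Rightarrow> 'm \<Rightarrow> 'v" where
  "torsion U V = ssub (ssub (act U (pr V)) (act V (pr U))) (br (pr U) (pr V))"

lemma torsion_sec [simp]: "U \<in> JSec \<Longrightarrow> V \<in> JSec \<Longrightarrow> torsion U V \<in> Sec"
  by (simp add: torsion_def)

lemma lf_torsion:
  assumes "linear_functional (fibre A m) l" "U \<in> JSec" "V \<in> JSec"
  shows "l (torsion U V m) = l (act U (pr V) m) - l (act V (pr U) m) - l (br (pr U) (pr V) m)"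
  using assms by (simp add: torsion_def lf_ssub)

lemma lf_torsion_skew:
  assumes l: "linear_functional (fibre A m) l" and U: "U \<in> JSec" "V \<in> JSec"
  shows "l (torsion V U m) = - l (torsion U V m)"
  using lf_br_skew[OF l, of "pr U" "pr V"] U by (simp add: lf_torsion[OF l])

lemma lf_torsion_sadd:
  assumes l: "linear_functional (fibre A m) l" and U: "U \<in> JSec" "U' \<in> JSec" "V \<in> JSec"
  shows "l (torsion (sadd (J1 M A) U U') V m) = l (torsion U V m) + l (torsion U' V m)"
  using U by (simp add: lf_torsion[OF l] pr_sadd lf_jsec[OF l] lf_sec[OF l])

lemma lf_torsion_sscale:
  assumes l: "linear_functional (fibre A m) l" and U: "U \<in> JSec" "V \<in> JSec"
  shows "l (torsion (sscale (J1 M A) (\<lambda>x. c) U) V m) = c * l (torsion U V m)"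
  using U by (simp add: lf_torsion[OF l] pr_sscale lf_jsec[OF l] lf_sec[OF l] algebra_simps)

text \<open>On \<open>pr U\<close>, which vanishes at \<open>m\<close>, the jet \<open>V m\<close>
  acts like the bracket with any section of value \<open>pr V m\<close>; so the last two terms of
  the torsion cancel.\<close>

lemma lf_torsion_vertical:
  assumes l: "linear_functional (fibre A m) l" and U: "U \<in> JSec" "V \<in> JSec" and z: "pr U m = \<zero>\<^bsub>fibre A m\<^esub>"
  shows "l (torsion U V m) = l (act U (pr V) m)"
proof -
  obtain X where X: "X \<in> Sec" "V m = jet M A m X" by (rule jet_carrierE[of "V m" m]) (use U in auto)
  have "X m = pr V m" using X by (simp add: pr_def)
  then have "br X (pr U) m = br (pr V) (pr U) m" using X(1) U z by (intro br_value) auto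
  moreover have "act V (pr U) m = br X (pr U) m" using X U by (simp add: act_def)
  ultimately show ?thesis
    using lf_br_skew[OF l, of "pr U" "pr V"] U by (simp add: lf_torsion[OF l])
qed

text \<open>The difference of \<open>U\<close> and \<open>U'\<close> has zero projection and zero
  action at \<open>m\<close>, so the formula for vertical arguments gives \<open>0\<close>.\<close>

lemma torsion_cong_left:
  assumes l: "linear_functional (fibre A m) l" and U: "U \<in> JSec" "U' \<in> JSec" "V \<in> JSec" and eq: "U m = U' m"
  shows "l (torsion U V m) = l (torsion U' V m)"
proof -
  let ?U = "sadd (J1 M A) U (sscale (J1 M A) (\<lambda>x. -1) U')"
  have uS: "?U \<in> JSec" using U by simp
  have pU: "pr U m = pr U' m" using eq by (simp add: pr_def)
  have aU: "act U Z m = act U' Z m" for Z using eq by (simp add: act_def)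
  have "pr ?U m = \<zero>\<^bsub>fibre A m\<^esub>"
    by (rule br_eqI[of _ m]) (use U pU in \<open>simp_all add: lf_jsec F.lf_zero\<close>)
  from lf_torsion_vertical[OF l uS U(3) this] have "l (torsion ?U V m) = 0"
    using U aU by (simp add: lf_jsec[OF l])
  then show ?thesis using U by (simp add: lf_torsion_sadd[OF l] lf_torsion_sscale[OF l])
qed

text \<open>Bracketing with \<open>W\<close> is a derivation of everything the torsion is made of:
  \<open>pr\<close> intertwines the brackets, and \<open>act\<close> of a bracket is a
  commutator.\<close>

lemma lf_br_torsion:
  assumes l: "linear_functional (fibre A m) l" and W: "W \<in> Sec" and U: "U \<in> JSec" "V \<in> JSec"
    and K: "bracket (J1 M A) (prolong M A W) U = U'" "bracket (J1 M A) (prolong M A W) V = V'"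
      "U' \<in> JSec" "V' \<in> JSec"
  shows "l (br W (torsion U V) m) = l (torsion U' V m) + l (torsion U V' m)"
proof -
  have p: "pr U' = br W (pr U)" "pr V' = br W (pr V)"
    using pr_J1_bracket[of "prolong M A W" U] pr_J1_bracket[of "prolong M A W" V] W U K by simp_all
  have a: "act U' Z = ssub (br W (act U Z)) (act U (br W Z))" "act V' Z = ssub (br W (act V Z)) (act V (br W Z))"
    if "Z \<in> Sec" for Z
    using act_J1_bracket[of "prolong M A W" U Z] act_J1_bracket[of "prolong M A W" V Z] W U K that by simp_all
  show ?thesis
    using W U K(3,4) lf_jacobi[OF l W, of "pr U" "pr V"]
    unfolding lf_torsion[OF l K(3) U(2)] lf_torsion[OF l U(1) K(4)] torsion_def
    by (simp add: p a lf_sec[OF l])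
qed

end

subsection \<open>Infinitesimal geometric structures\<close>

locale geometric_structure = t: transitive_algebroid M t
  for M :: "('m::{t2_space, second_countable_topology}, 'e::euclidean_space) atlas"
    and t :: "('m, 'v) lie_algebroid" +
  fixes G :: "'m \<Rightarrow> ('m \<Rightarrow> 'v) set set" and g :: "('m, ('m \<Rightarrow> 'v) set) lie_algebroid"
  assumes geometric: "infinitesimal_geometric_structure M t G"
    and surjective: "surjective_structure t G"
    and reduced: "Theta_reduced M t G"
    and delta_inj: "\<And>m. inj_on (lower_coboundary M t m) (carrier (cotensor M m (structure_kernel M t G m)))"
    and g_def: "g = subbundle (J1 M t) G"
begin

lemma G_carrier: "G m \<subseteq> carrier (t.J m)"
  using geometric submodule.axioms(1) subgroup.subset
  unfolding infinitesimal_geometric_structure_def subalgebroid_def is_subbundle_def by fastforce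

lemma g_fibre [simp]: "carrier (fibre g m) = G m" "k \<oplus>\<^bsub>fibre g m\<^esub> k' = k \<oplus>\<^bsub>t.J m\<^esub> k'"
  "c \<odot>\<^bsub>fibre g m\<^esub> k = c \<odot>\<^bsub>t.J m\<^esub> k" "\<zero>\<^bsub>fibre g m\<^esub> = \<zero>\<^bsub>t.J m\<^esub>"
  by (simp_all add: g_def subbundle_simps)

lemma g_anchor [simp]: "anchor g m k = t.anc m (jet_proj m k)"
  by (simp add: g_def subbundle_algebroid_simps)

lemma g_bracket: "bracket g = bracket (J1 M t)"
  by (simp add: g_def subbundle_algebroid_simps)

lemma g_ops: "sadd g = sadd (J1 M t)" "sscale g = sscale (J1 M t)" "szero g = szero (J1 M t)"
  by (simp_all add: g_def subbundle_ops)

lemma g_sections: "\<sigma> \<in> sections g U \<longleftrightarrow> \<sigma> \<in> jet_sections M t U \<and> (\<forall>x\<in>U. \<sigma> x \<in> G x)"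
  by (simp add: g_def subbundle_simps)

text \<open>The anchor of \<open>g\<close> is a composite of two surjections. Hence jets of sections
  of \<open>g\<close> are governed by the same theory as those of \<open>t\<close>.\<close>

lemma transitive_algebroid_g: "transitive_algebroid M g"
proof -
  interpret j: transitive_algebroid M "J1 M t" by (rule t.transitive_algebroid_J1)
  have "lie_algebroid M g"
    unfolding g_def by (rule j.lie_algebroid_subbundle) (use geometric in \<open>simp add: infinitesimal_geometric_structure_def\<close>)
  moreover have "transitive M g"
    using t.transitive surjective unfolding transitive_def surjective_structure_def
    by (simp add: image_image[symmetric])
  ultimately show ?thesis
    by (intro transitive_algebroid.intro algebroid.intro t.manifold_axioms algebroid_axioms.intro
        transitive_algebroid_axioms.intro)
qed

sublocale g: transitive_algebroid M g by (rule transitive_algebroid_g)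

lemma g_sec_jet [simp]: "X \<in> g.Sec \<Longrightarrow> X \<in> t.JSec"
  by (simp add: g_sections)

lemma g_sec_G [simp]: "X \<in> g.Sec \<Longrightarrow> X m \<in> G m"
  by (simp add: g_sections)

lemma G_jet [simp]: "k \<in> G m \<Longrightarrow> k \<in> carrier (t.J m)"
  using G_carrier by blast

lemma jet_act_G [simp]: "k \<in> carrier (g.J m) \<Longrightarrow> U \<in> g.Sec \<Longrightarrow> g.jet_act m k U \<in> G m"
  using g.jet_act_closed by simp

lemma jet_proj_G [simp]: "k \<in> carrier (g.J m) \<Longrightarrow> jet_proj m k \<in> G m"
  using g.jet_proj_closed by simp

lemma linear_functional_g:
  assumes "linear_functional (t.J m) l"
  shows "linear_functional (fibre g m) l"
  using assms unfolding linear_functional_def by simp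

definition extension :: "'m \<Rightarrow> ('m \<Rightarrow> 'v) set \<Rightarrow> 'm \<Rightarrow> ('m \<Rightarrow> 'v) set" where
  "extension m k = (SOME U. U \<in> g.Sec \<and> U m = k)"

lemma extension:
  assumes "k \<in> G m"
  shows extension_sec [simp]: "extension m k \<in> g.Sec" and extension_value [simp]: "extension m k m = k"
proof -
  obtain U where "U \<in> g.Sec" "U m = k" by (rule g.value_extend[of k m]) (use assms in simp)
  then have ex: "\<exists>U. U \<in> g.Sec \<and> U m = k" by blast
  have "extension m k \<in> g.Sec \<and> extension m k m = k" unfolding extension_def by (rule someI_ex[OF ex])
  then show "extension m k \<in> g.Sec" "extension m k m = k" by auto
qed

text \<open>The torsion is tensorial, so the choice of the extension does not matter.\<close>

definition tors :: "('v \<Rightarrow> real) \<Rightarrow> 'm \<Rightarrow> ('m \<Rightarrow> ('m \<Rightarrow> 'v) set) \<Rightarrow> ('m \<Rightarrow> 'v) set \<Rightarrow> real" where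
  "tors l m V k = l (t.torsion (extension m k) V m)"

lemma tors_value:
  assumes "linear_functional (fibre t m) l" "U \<in> g.Sec" "V \<in> g.Sec"
  shows "tors l m V (U m) = l (t.torsion U V m)"
  unfolding tors_def using assms by (intro t.torsion_cong_left) simp_all

text \<open>As a functional on the fibre of \<open>g\<close>, the torsion against a fixed
  \<open>V\<close> can be applied to \<open>nabla X\<close> and to components in a frame.\<close>

lemma linear_functional_tors:
  assumes l: "linear_functional (fibre t m) l" and V: "V \<in> g.Sec"
  shows "linear_functional (fibre g m) (tors l m V)"
  unfolding linear_functional_def
proof (intro conjI ballI allI)
  fix k assume k: "k \<in> carrier (fibre g m)"
  have e: "extension m k \<in> g.Sec" using k by simp
  show "tors l m V (c \<odot>\<^bsub>fibre g m\<^esub> k) = c * tors l m V k" for c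
  proof -
    have s: "sscale (J1 M t) (\<lambda>x. c) (extension m k) \<in> g.Sec"
      using g.sec_sscale[OF t.smooth_const e, of c] by (simp add: g_ops)
    have "tors l m V (sscale (J1 M t) (\<lambda>x. c) (extension m k) m) = c * tors l m V k"
      using tors_value[OF l s V] V k e by (simp add: t.lf_torsion_sscale[OF l] tors_def)
    then show ?thesis using k by (simp add: sscale_def)
  qed
  fix k' assume k': "k' \<in> carrier (fibre g m)"
  have e': "extension m k' \<in> g.Sec" using k' by simp
  have s: "sadd (J1 M t) (extension m k) (extension m k') \<in> g.Sec"
    using g.sec_sadd[OF e e'] by (simp add: g_ops)
  have "tors l m V (sadd (J1 M t) (extension m k) (extension m k') m) = tors l m V k + tors l m V k'"
    using tors_value[OF l s V] V k k' e e' by (simp add: t.lf_torsion_sadd[OF l] tors_def)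
  then show "tors l m V (k \<oplus>\<^bsub>fibre g m\<^esub> k') = tors l m V k + tors l m V k'"
    using k k' by (simp add: sadd_def)
qed

lemma linear_functional_proj:
  assumes "linear_functional (fibre t m) l"
  shows "linear_functional (fibre g m) (\<lambda>k. l (jet_proj m k))"
  by (rule linear_functional_g[OF t.linear_functional_jet_proj[OF assms]])

lemma linear_functional_act:
  assumes "linear_functional (fibre t m) l" "Z \<in> t.Sec"
  shows "linear_functional (fibre g m) (\<lambda>k. l (t.jet_act m k Z))"
  by (rule linear_functional_g[OF t.linear_functional_jet_act[OF assms]])

section \<open>Vertical maps and the lower coboundary\<close>

text \<open>Recasts a map whose values are jets in the kernel of \<open>a\<close> as an element of
  \<open>T*M \<otimes> h\<close>, the form on which \<open>lower_coboundary\<close> acts.\<close>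

definition kernel_map :: "'m \<Rightarrow> ((('m \<Rightarrow> real) \<Rightarrow> real) \<Rightarrow> ('m \<Rightarrow> 'v) set) \<Rightarrow>
    (('m \<Rightarrow> real) \<Rightarrow> real) \<Rightarrow> (('m \<Rightarrow> real) \<Rightarrow> real) \<Rightarrow> 'v" where
  "kernel_map m \<theta> = (\<lambda>v\<in>carrier (tangent_space M m). t.cotensor_of_jet m (\<theta> v))"

lemma kernel_map_carrier:
  assumes \<theta>: "linear_map (tangent_space M m) (fibre g m) \<theta>"
    and vert: "\<And>v. v \<in> carrier (tangent_space M m) \<Longrightarrow> jet_proj m (\<theta> v) = \<zero>\<^bsub>fibre t m\<^esub>"
  shows "kernel_map m \<theta> \<in> carrier (cotensor M m (structure_kernel M t G m))"
proof -
  let ?T = "tangent_space M m"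
  have thG: "\<theta> v \<in> G m" if "v \<in> carrier ?T" for v using g.lm_closed[OF \<theta> that] by simp
  have mem: "t.cotensor_of_jet m (\<theta> v) \<in> carrier (structure_kernel M t G m)" if v: "v \<in> carrier ?T" for v
    using t.cotensor_of_jet_carrier[of "\<theta> v" m] t.cotensor_incl_of_jet[of "\<theta> v" m] thG[OF v] vert[OF v]
    by (simp add: structure_kernel_def)
  have add: "t.cotensor_of_jet m (\<theta> (\<lambda>f. v f + w f)) =
      t.cotensor_of_jet m (\<theta> v) \<oplus>\<^bsub>cotensor M m (fibre t m)\<^esub> t.cotensor_of_jet m (\<theta> w)"
    if v: "v \<in> carrier ?T" and w: "w \<in> carrier ?T" for v w
  proof (rule extensionalityI[of _ "carrier ?T"])
    fix u assume u: "u \<in> carrier ?T"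
    have "t.jet_act m (\<theta> (\<lambda>f. v f + w f)) (t.lift m u) =
        t.jet_act m (\<theta> v) (t.lift m u) \<oplus>\<^bsub>fibre t m\<^esub> t.jet_act m (\<theta> w) (t.lift m u)"
    proof (rule t.br_eqI[of _ m])
      fix l assume l: "linear_functional (fibre t m) l"
      note la = linear_functional_act[OF l t.lift_sec[OF u]]
      show "l (t.jet_act m (\<theta> (\<lambda>f. v f + w f)) (t.lift m u)) =
          l (t.jet_act m (\<theta> v) (t.lift m u) \<oplus>\<^bsub>fibre t m\<^esub> t.jet_act m (\<theta> w) (t.lift m u))"
        using g.F.lf_add[OF la, of "\<theta> v" "\<theta> w"] thG[OF v] thG[OF w] u g.lm_add[OF \<theta> v w]
        by (simp add: t.F.lf_add[OF l])
    qed (use u v w thG t.tangent_add_closed in simp_all)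
    then show "t.cotensor_of_jet m (\<theta> (\<lambda>f. v f + w f)) u =
      (t.cotensor_of_jet m (\<theta> v) \<oplus>\<^bsub>cotensor M m (fibre t m)\<^esub> t.cotensor_of_jet m (\<theta> w)) u"
      using u by (simp add: t.cotensor_of_jet_def hom_space_def)
  qed (simp_all add: t.cotensor_of_jet_def hom_space_def)
  have smult: "t.cotensor_of_jet m (\<theta> (\<lambda>f. c * v f)) = c \<odot>\<^bsub>cotensor M m (fibre t m)\<^esub> t.cotensor_of_jet m (\<theta> v)"
    if v: "v \<in> carrier ?T" for v c
  proof (rule extensionalityI[of _ "carrier ?T"])
    fix u assume u: "u \<in> carrier ?T"
    have "t.jet_act m (\<theta> (\<lambda>f. c * v f)) (t.lift m u) = c \<odot>\<^bsub>fibre t m\<^esub> t.jet_act m (\<theta> v) (t.lift m u)"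
    proof (rule t.br_eqI[of _ m])
      fix l assume l: "linear_functional (fibre t m) l"
      note la = linear_functional_act[OF l t.lift_sec[OF u]]
      show "l (t.jet_act m (\<theta> (\<lambda>f. c * v f)) (t.lift m u)) = l (c \<odot>\<^bsub>fibre t m\<^esub> t.jet_act m (\<theta> v) (t.lift m u))"
        using g.F.lf_smult[OF la, of "\<theta> v" c] thG[OF v] u g.lm_smult[OF \<theta> v]
        by (simp add: t.F.lf_smult[OF l])
    qed (use u v thG t.tangent_scale_closed in simp_all)
    then show "t.cotensor_of_jet m (\<theta> (\<lambda>f. c * v f)) u =
      (c \<odot>\<^bsub>cotensor M m (fibre t m)\<^esub> t.cotensor_of_jet m (\<theta> v)) u"
      using u by (simp add: t.cotensor_of_jet_def hom_space_def)
  qed (simp_all add: t.cotensor_of_jet_def hom_space_def)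
  have sk: "x \<oplus>\<^bsub>structure_kernel M t G m\<^esub> y = x \<oplus>\<^bsub>cotensor M m (fibre t m)\<^esub> y"
    "c \<odot>\<^bsub>structure_kernel M t G m\<^esub> x = c \<odot>\<^bsub>cotensor M m (fibre t m)\<^esub> x" for x y c
    by (simp_all add: structure_kernel_def)
  have "linear_map ?T (structure_kernel M t G m) (kernel_map m \<theta>)"
    unfolding linear_map_def sk
    using mem add smult t.tangent_add_closed t.tangent_scale_closed by (simp add: kernel_map_def)
  then show ?thesis by (simp add: hom_space_def kernel_map_def)
qed

text \<open>This is where the injectivity of \<open>\<delta>\<close> enters: a vertical \<open>\<theta>\<close> that is symmetric with respect
  to the torsion is an element of the kernel of \<open>\<delta>\<close>.\<close>

lemma vertical_symmetric_zero:
  assumes \<theta>: "linear_map (tangent_space M m) (fibre g m) \<theta>"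
    and vert: "\<And>v. v \<in> carrier (tangent_space M m) \<Longrightarrow> jet_proj m (\<theta> v) = \<zero>\<^bsub>fibre t m\<^esub>"
    and sym: "\<And>U V l. U \<in> g.Sec \<Longrightarrow> V \<in> g.Sec \<Longrightarrow> linear_functional (fibre t m) l \<Longrightarrow>
      tors l m V (\<theta> (g.anc m (U m))) = tors l m U (\<theta> (g.anc m (V m)))"
    and v: "v \<in> carrier (tangent_space M m)"
  shows "\<theta> v = \<zero>\<^bsub>fibre g m\<^esub>"
proof -
  let ?T = "tangent_space M m"
  let ?z = "\<lambda>v::('m \<Rightarrow> real) \<Rightarrow> real. \<zero>\<^bsub>fibre g m\<^esub>"
  have thG: "\<theta> v \<in> G m" if "v \<in> carrier ?T" for v using g.lm_closed[OF \<theta> that] by simp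
  have zG: "\<zero>\<^bsub>t.J m\<^esub> \<in> G m" using g.F.M.zero_closed[of m] by simp
  have zp: "jet_proj m \<zero>\<^bsub>t.J m\<^esub> = \<zero>\<^bsub>fibre t m\<^esub>"
    by (rule t.br_eqI[of _ m]) (use t.J.lf_zero[OF t.linear_functional_jet_proj] in \<open>simp_all add: t.F.lf_zero\<close>)
  have z: "linear_map ?T (fibre g m) ?z"
    using g.F.M.zero_closed[of m] t.J.M.l_zero[OF t.J.M.zero_closed, of m] t.J.M.smult_r_null[simplified]
    by (simp add: linear_map_def)
  have val: "kernel_map m \<theta> (g.anc m (U m)) (g.anc m (V m)) = t.jet_act m (\<theta> (g.anc m (U m))) (t.pr V)"
    if "linear_map ?T (fibre g m) \<theta>" "\<And>v. v \<in> carrier ?T \<Longrightarrow> jet_proj m (\<theta> v) = \<zero>\<^bsub>fibre t m\<^esub>"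
      "U \<in> g.Sec" "V \<in> g.Sec" for U V \<theta>
  proof -
    have a: "g.anc m (U m) \<in> carrier ?T" using g.anchor_tangent[OF g.sec_carrier[OF that(3)]] .
    have "\<theta> (g.anc m (U m)) \<in> carrier (t.J m)" using g.lm_closed[OF that(1) a] by simp
    moreover have "t.pr V m = jet_proj m (V m)" by (simp add: t.pr_def)
    ultimately show ?thesis
      using t.cotensor_of_jet_apply[OF _ that(2)[OF a], of "t.pr V"] that(3,4) a by (simp add: kernel_map_def)
  qed
  \<comment> \<open>The symmetry hypothesis says that the alternation of
    \<open>kernel_map m \<theta>\<close> vanishes. It is proved for a variable
    \<open>\<theta>\<close>, to serve the given map and the zero map alike.\<close>
  have lc: "lower_coboundary M t m (kernel_map m \<theta>) u1 u2 = \<zero>\<^bsub>fibre t m\<^esub>"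
    if th: "linear_map ?T (fibre g m) \<theta>" "\<And>v. v \<in> carrier ?T \<Longrightarrow> jet_proj m (\<theta> v) = \<zero>\<^bsub>fibre t m\<^esub>"
      and sym: "\<And>U V l. U \<in> g.Sec \<Longrightarrow> V \<in> g.Sec \<Longrightarrow> linear_functional (fibre t m) l \<Longrightarrow>
      tors l m V (\<theta> (g.anc m (U m))) = tors l m U (\<theta> (g.anc m (V m)))"
      and u: "u1 \<in> carrier ?T" "u2 \<in> carrier ?T" for \<theta> u1 u2
  proof -
    obtain U where U: "U \<in> g.Sec" "g.anc m (U m) = u1" by (rule g.anchor_onto[OF u(1)])
    obtain V where V: "V \<in> g.Sec" "g.anc m (V m) = u2" by (rule g.anchor_onto[OF u(2)])
    have G: "\<theta> u1 \<in> G m" "\<theta> u2 \<in> G m" using g.lm_closed[OF th(1)] u by simp_all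
    \<comment> \<open>The extension of \<open>\<theta> w\<close> has zero projection at
      \<open>m\<close>, so its torsion reduces to its action.\<close>
    have tv: "tors l m Z (\<theta> w) = l (t.jet_act m (\<theta> w) (t.pr Z))"
      if l: "linear_functional (fibre t m) l" and "Z \<in> g.Sec" "w \<in> carrier ?T" for l Z w
    proof -
      have wG: "\<theta> w \<in> G m" using g.lm_closed[OF th(1) that(3)] by simp
      have "t.pr (extension m (\<theta> w)) m = \<zero>\<^bsub>fibre t m\<^esub>" using th(2)[OF that(3)] wG by (simp add: t.pr_def)
      then show ?thesis
        unfolding tors_def using wG that(2) by (simp add: t.lf_torsion_vertical[OF l] t.act_def)
    qed
    have "t.jet_act m (\<theta> u1) (t.pr V) \<ominus>\<^bsub>fibre t m\<^esub> t.jet_act m (\<theta> u2) (t.pr U) = \<zero>\<^bsub>fibre t m\<^esub>"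
    proof (rule t.br_eqI[of _ m])
      fix l assume l: "linear_functional (fibre t m) l"
      show "l (t.jet_act m (\<theta> u1) (t.pr V) \<ominus>\<^bsub>fibre t m\<^esub> t.jet_act m (\<theta> u2) (t.pr U)) = l \<zero>\<^bsub>fibre t m\<^esub>"
        using sym[OF U(1) V(1) l] tv[OF l V(1) u(1)] tv[OF l U(1) u(2)] U V G by (simp add: t.F.lf_simps[OF l])
    next
      show "t.jet_act m (\<theta> u1) (t.pr V) \<ominus>\<^bsub>fibre t m\<^esub> t.jet_act m (\<theta> u2) (t.pr U) \<in> carrier (fibre t m)"
        using U(1) V(1) G by (intro t.F.M.minus_closed) simp_all
    qed simp
    then show ?thesis
      using val[OF th U(1) V(1)] val[OF th V(1) U(1)] U V u by (simp add: lower_coboundary_def)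
  qed
  have zsym: "tors l m V (?z (g.anc m (U m))) = tors l m U (?z (g.anc m (V m)))"
    if "U \<in> g.Sec" "V \<in> g.Sec" "linear_functional (fibre t m) l" for U V l
    using g.F.lf_zero[OF linear_functional_tors[OF that(3,2)]] g.F.lf_zero[OF linear_functional_tors[OF that(3,1)]] by simp
  have zvert: "jet_proj m (?z v) = \<zero>\<^bsub>fibre t m\<^esub>" for v :: "('m \<Rightarrow> real) \<Rightarrow> real" using zp by simp
  \<comment> \<open>\<open>inj_on\<close> compares two elements, so \<open>\<theta>\<close> is
    compared with the zero map.\<close>
  have "lower_coboundary M t m (kernel_map m \<theta>) = lower_coboundary M t m (kernel_map m ?z)"
  proof (intro ext)
    fix u1 u2
    show "lower_coboundary M t m (kernel_map m \<theta>) u1 u2 = lower_coboundary M t m (kernel_map m ?z) u1 u2"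
    proof (cases "u1 \<in> carrier ?T \<and> u2 \<in> carrier ?T")
      case True
      then have u: "u1 \<in> carrier ?T" "u2 \<in> carrier ?T" by simp_all
      have "lower_coboundary M t m (kernel_map m \<theta>) u1 u2 = \<zero>\<^bsub>fibre t m\<^esub>"
        by (rule lc[where \<theta>=\<theta>, OF \<theta> vert sym u])
      moreover have "lower_coboundary M t m (kernel_map m ?z) u1 u2 = \<zero>\<^bsub>fibre t m\<^esub>"
        by (rule lc[where \<theta>="?z", OF z zvert zsym u])
      ultimately show ?thesis by simp
    qed (auto simp: lower_coboundary_def)
  qed
  then have "kernel_map m \<theta> = kernel_map m ?z"
    by (rule inj_onD[OF delta_inj _ kernel_map_carrier[where \<theta>=\<theta>, OF \<theta> vert] kernel_map_carrier[where \<theta>="?z", OF z zvert]])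
  from fun_cong[OF this, of v] have "t.cotensor_of_jet m (\<theta> v) = t.cotensor_of_jet m \<zero>\<^bsub>t.J m\<^esub>"
    using v by (simp add: kernel_map_def)
  then have "cotensor_incl M t m (t.cotensor_of_jet m (\<theta> v)) =
      cotensor_incl M t m (t.cotensor_of_jet m \<zero>\<^bsub>t.J m\<^esub>)"
    by (rule arg_cong)
  then have "\<theta> v = \<zero>\<^bsub>t.J m\<^esub>"
    unfolding t.cotensor_incl_of_jet[OF G_jet[OF thG[OF v]] vert[OF v]]
      t.cotensor_incl_of_jet[OF G_jet[OF zG] zp] .
  then show ?thesis by simp
qed

subsection \<open>The prolongation as a splitting\<close>

text \<open>For the jet of a section of the form \<open>J\<^sup>1W\<close>, the two equations say that \<open>[J\<^sup>1W, _]\<close> and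
  \<open>[W, _]\<close> are intertwined by the projection and by the torsion. They turn out to characterize
  \<open>\<gg>\<^sup>(\<^sup>1\<^sup>)\<close>.\<close>

definition compatible :: "'m \<Rightarrow> ('m \<Rightarrow> ('m \<Rightarrow> 'v) set) set \<Rightarrow> bool" where
  "compatible m k \<longleftrightarrow> k \<in> carrier (g.J m) \<and>
     (\<forall>U\<in>g.Sec. jet_proj m (g.jet_act m k U) = t.jet_act m (jet_proj m k) (t.pr U)) \<and>
     (\<forall>U\<in>g.Sec. \<forall>V\<in>g.Sec. \<forall>l. linear_functional (fibre t m) l \<longrightarrow>
        l (t.jet_act m (jet_proj m k) (t.torsion U V)) =
        tors l m V (g.jet_act m k U) - tors l m U (g.jet_act m k V))"

lemma compatibleD:
  assumes "compatible m k"
  shows compatible_carrier: "k \<in> carrier (g.J m)"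
    and compatible_proj: "U \<in> g.Sec \<Longrightarrow> jet_proj m (g.jet_act m k U) = t.jet_act m (jet_proj m k) (t.pr U)"
    and compatible_torsion: "U \<in> g.Sec \<Longrightarrow> V \<in> g.Sec \<Longrightarrow> linear_functional (fibre t m) l \<Longrightarrow>
      l (t.jet_act m (jet_proj m k) (t.torsion U V)) =
      tors l m V (g.jet_act m k U) - tors l m U (g.jet_act m k V)"
  using assms unfolding compatible_def by blast+

lemma torsion_g_sec [simp]: "U \<in> g.Sec \<Longrightarrow> V \<in> g.Sec \<Longrightarrow> t.torsion U V \<in> t.Sec"
  by simp

lemma pr_g_sec [simp]: "U \<in> g.Sec \<Longrightarrow> t.pr U \<in> t.Sec"
  by simp

text \<open>Both equations are linear in \<open>k\<close>, so the solutions form a subspace of the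
  jets of \<open>g\<close> at \<open>m\<close>.\<close>

lemma compatible_add:
  assumes k: "compatible m k" "compatible m k'"
  shows "compatible m (k \<oplus>\<^bsub>g.J m\<^esub> k')"
proof -
  note c = compatible_carrier[OF k(1)] compatible_carrier[OF k(2)]
  have p: "jet_proj m (k \<oplus>\<^bsub>g.J m\<^esub> k') = jet_proj m k \<oplus>\<^bsub>fibre g m\<^esub> jet_proj m k'"
    by (rule g.br_eqI[of _ m]) (use c g.J.lf_add[OF g.linear_functional_jet_proj] in \<open>simp_all add: g.F.lf_add del: g_fibre\<close>)
  have a: "g.jet_act m (k \<oplus>\<^bsub>g.J m\<^esub> k') U = g.jet_act m k U \<oplus>\<^bsub>fibre g m\<^esub> g.jet_act m k' U" if U: "U \<in> g.Sec" for U
    by (rule g.br_eqI[of _ m]) (use c U g.J.lf_add[OF g.linear_functional_jet_act] in \<open>simp_all add: g.F.lf_add del: g_fibre\<close>)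
  have G: "jet_proj m k \<in> carrier (fibre g m)" "jet_proj m k' \<in> carrier (fibre g m)" using c by simp_all
  have GU: "g.jet_act m k U \<in> carrier (fibre g m)" "g.jet_act m k' U \<in> carrier (fibre g m)" if "U \<in> g.Sec" for U
    using c that by simp_all
  have lp: "l (jet_proj m (x \<oplus>\<^bsub>fibre g m\<^esub> y)) = l (jet_proj m x) + l (jet_proj m y)"
    if "linear_functional (fibre t m) l" "x \<in> carrier (fibre g m)" "y \<in> carrier (fibre g m)" for l x y
    using g.F.lf_add[OF linear_functional_proj[OF that(1)] that(2,3)] .
  have la: "l (t.jet_act m (jet_proj m k \<oplus>\<^bsub>fibre g m\<^esub> jet_proj m k') Z) =
      l (t.jet_act m (jet_proj m k) Z) + l (t.jet_act m (jet_proj m k') Z)"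
    if "linear_functional (fibre t m) l" "Z \<in> t.Sec" for l Z
    using g.F.lf_add[OF linear_functional_act[OF that] G] .
  show ?thesis
    unfolding compatible_def
  proof (intro conjI ballI allI impI)
    show kc: "k \<oplus>\<^bsub>g.J m\<^esub> k' \<in> carrier (g.J m)" using c by simp
    fix U assume U: "U \<in> g.Sec"
    show "jet_proj m (g.jet_act m (k \<oplus>\<^bsub>g.J m\<^esub> k') U) = t.jet_act m (jet_proj m (k \<oplus>\<^bsub>g.J m\<^esub> k')) (t.pr U)"
    proof (rule t.br_eqI[of _ m])
      fix l assume l: "linear_functional (fibre t m) l"
      show "l (jet_proj m (g.jet_act m (k \<oplus>\<^bsub>g.J m\<^esub> k') U)) = l (t.jet_act m (jet_proj m (k \<oplus>\<^bsub>g.J m\<^esub> k')) (t.pr U))"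
        unfolding p a[OF U] lp[OF l GU[OF U]] la[OF l pr_g_sec[OF U]]
        by (simp add: compatible_proj[OF k(1) U] compatible_proj[OF k(2) U])
    qed (use kc U in simp_all)
    fix V l assume V: "V \<in> g.Sec" and l: "linear_functional (fibre t m) l"
    show "l (t.jet_act m (jet_proj m (k \<oplus>\<^bsub>g.J m\<^esub> k')) (t.torsion U V)) =
      tors l m V (g.jet_act m (k \<oplus>\<^bsub>g.J m\<^esub> k') U) - tors l m U (g.jet_act m (k \<oplus>\<^bsub>g.J m\<^esub> k') V)"
      unfolding p a[OF U] a[OF V] la[OF l torsion_g_sec[OF U V]]
        g.F.lf_add[OF linear_functional_tors[OF l V] GU[OF U]] g.F.lf_add[OF linear_functional_tors[OF l U] GU[OF V]]
      by (simp add: compatible_torsion[OF k(1) U V l] compatible_torsion[OF k(2) U V l])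
  qed
qed

lemma compatible_smult:
  assumes k: "compatible m k"
  shows "compatible m (c \<odot>\<^bsub>g.J m\<^esub> k)"
proof -
  note kc = compatible_carrier[OF k]
  have p: "jet_proj m (c \<odot>\<^bsub>g.J m\<^esub> k) = c \<odot>\<^bsub>fibre g m\<^esub> jet_proj m k"
    by (rule g.br_eqI[of _ m]) (use kc g.J.lf_smult[OF g.linear_functional_jet_proj] in \<open>simp_all add: g.F.lf_smult del: g_fibre\<close>)
  have a: "g.jet_act m (c \<odot>\<^bsub>g.J m\<^esub> k) U = c \<odot>\<^bsub>fibre g m\<^esub> g.jet_act m k U" if U: "U \<in> g.Sec" for U
    by (rule g.br_eqI[of _ m]) (use kc U g.J.lf_smult[OF g.linear_functional_jet_act] in \<open>simp_all add: g.F.lf_smult del: g_fibre\<close>)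
  have G: "jet_proj m k \<in> carrier (fibre g m)" using kc by simp
  have GU: "g.jet_act m k U \<in> carrier (fibre g m)" if "U \<in> g.Sec" for U
    using kc that by simp
  show ?thesis
    unfolding compatible_def
  proof (intro conjI ballI allI impI)
    show cc: "c \<odot>\<^bsub>g.J m\<^esub> k \<in> carrier (g.J m)" using kc by simp
    fix U assume U: "U \<in> g.Sec"
    show "jet_proj m (g.jet_act m (c \<odot>\<^bsub>g.J m\<^esub> k) U) = t.jet_act m (jet_proj m (c \<odot>\<^bsub>g.J m\<^esub> k)) (t.pr U)"
    proof (rule t.br_eqI[of _ m])
      fix l assume l: "linear_functional (fibre t m) l"
      show "l (jet_proj m (g.jet_act m (c \<odot>\<^bsub>g.J m\<^esub> k) U)) = l (t.jet_act m (jet_proj m (c \<odot>\<^bsub>g.J m\<^esub> k)) (t.pr U))"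
        unfolding p a[OF U] g.F.lf_smult[OF linear_functional_proj[OF l] GU[OF U]]
          g.F.lf_smult[OF linear_functional_act[OF l pr_g_sec[OF U]] G]
        by (simp add: compatible_proj[OF k U])
    qed (use cc U in simp_all)
    fix V l assume V: "V \<in> g.Sec" and l: "linear_functional (fibre t m) l"
    show "l (t.jet_act m (jet_proj m (c \<odot>\<^bsub>g.J m\<^esub> k)) (t.torsion U V)) =
      tors l m V (g.jet_act m (c \<odot>\<^bsub>g.J m\<^esub> k) U) - tors l m U (g.jet_act m (c \<odot>\<^bsub>g.J m\<^esub> k) V)"
      unfolding p a[OF U] a[OF V] g.F.lf_smult[OF linear_functional_act[OF l torsion_g_sec[OF U V]] G]
        g.F.lf_smult[OF linear_functional_tors[OF l V] GU[OF U]] g.F.lf_smult[OF linear_functional_tors[OF l U] GU[OF V]]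
      by (simp add: compatible_torsion[OF k U V l] right_diff_distrib)
  qed
qed

text \<open>The difference \<open>d\<close> solves the equations over zero, so it is a cotensor. The
  first equation puts its values into the kernel of \<open>a\<close>, the second makes it symmetric
  with respect to the torsion, and injectivity of \<open>\<delta>\<close> finishes.\<close>

lemma compatible_unique:
  assumes k: "compatible m k" "compatible m k'" and eq: "jet_proj m k = jet_proj m k'"
  shows "k = k'"
proof -
  note c = compatible_carrier[OF k(1)] compatible_carrier[OF k(2)]
  define d where "d = k \<oplus>\<^bsub>g.J m\<^esub> ((-1) \<odot>\<^bsub>g.J m\<^esub> k')"
  have cd: "compatible m d" unfolding d_def by (intro compatible_add compatible_smult k)
  note dc = compatible_carrier[OF cd]
  have dl: "l d = l k - l k'" if "linear_functional (g.J m) l" for l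
    unfolding d_def using c by (simp add: g.J.lf_add[OF that] g.J.lf_smult[OF that])
  have pd: "jet_proj m d = \<zero>\<^bsub>fibre g m\<^esub>"
    by (rule g.br_eqI[of _ m])
      (use dc dl[OF g.linear_functional_jet_proj] eq in \<open>simp_all add: g.F.lf_zero del: g_fibre\<close>)
  let ?\<theta> = "g.cotensor_of_jet m d"
  note \<theta> = g.cotensor_of_jet_linear[OF dc pd]
  have val: "?\<theta> (g.anc m (U m)) = g.jet_act m d U" if "U \<in> g.Sec" for U
    by (rule g.cotensor_of_jet_apply[OF dc pd that])
  \<comment> \<open>Over zero the sides of both equations that involve \<open>jet_proj m d\<close>
    vanish.\<close>
  have act0: "l (t.jet_act m (jet_proj m d) Z) = 0" if l: "linear_functional (fibre t m) l" and Z: "Z \<in> t.Sec" for l Z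
    unfolding pd by (rule g.F.lf_zero[OF linear_functional_act[OF l Z]])
  have vert: "jet_proj m (?\<theta> v) = \<zero>\<^bsub>fibre t m\<^esub>" if v: "v \<in> carrier (tangent_space M m)" for v
  proof -
    obtain U where U: "U \<in> g.Sec" "g.anc m (U m) = v" by (rule g.anchor_onto[OF v])
    have "jet_proj m (g.jet_act m d U) = t.jet_act m (jet_proj m d) (t.pr U)" by (rule compatible_proj[OF cd U(1)])
    also have "\<dots> = \<zero>\<^bsub>fibre t m\<^esub>"
      by (rule t.br_eqI[of _ m]) (use act0 U(1) dc in \<open>simp_all add: t.F.lf_zero\<close>)
    finally show ?thesis using val[OF U(1)] U(2) by simp
  qed
  have sym: "tors l m V (?\<theta> (g.anc m (U m))) = tors l m U (?\<theta> (g.anc m (V m)))"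
    if "U \<in> g.Sec" "V \<in> g.Sec" "linear_functional (fibre t m) l" for U V l
    using compatible_torsion[OF cd that] act0[OF that(3) torsion_g_sec[OF that(1,2)]]
    unfolding val[OF that(1)] val[OF that(2)] by simp
  have "g.jet_act m d Y = \<zero>\<^bsub>fibre g m\<^esub>" if Y: "Y \<in> g.Sec" for Y
  proof -
    have "?\<theta> (g.anc m (Y m)) = \<zero>\<^bsub>fibre g m\<^esub>"
      by (rule vertical_symmetric_zero[where \<theta>="?\<theta>", OF \<theta> vert sym g.anchor_tangent[OF g.sec_carrier[OF Y]]])
    then show ?thesis unfolding val[OF Y] .
  qed
  then have "l (g.jet_act m d Y) = 0" if "linear_functional (fibre g m) l" "Y \<in> g.Sec" for l Y
    using g.F.lf_zero[OF that(1)] that(2) by (simp del: g_fibre)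
  then have "l (g.jet_act m k Y) = l (g.jet_act m k' Y)" if "linear_functional (fibre g m) l" "Y \<in> g.Sec" for l Y
    using dl[OF g.linear_functional_jet_act[OF that]] that by (metis eq_iff_diff_eq_0)
  then show ?thesis using eq c by (intro g.jet_space_lfI) auto
qed

text \<open>Equality of jets in \<open>g\<close> controls brackets with sections of \<open>g\<close>
  only, while jets in \<open>J1 t\<close> are tested with all its sections. As \<open>S\<close> and
  \<open>X\<close> agree at \<open>m\<close>, the brackets of their difference see only the anchor
  of the test section, and \<open>g\<close> has sections with any anchor.\<close>

lemma jet_extend_g:
  assumes X: "X \<in> g.Sec"
  shows "jet_extend M (J1 M t) m (jet M g m X) = jet M (J1 M t) m X"
proof -
  interpret j: transitive_algebroid M "J1 M t" by (rule t.transitive_algebroid_J1)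
  have js: "Z \<in> j.Sec" if "Z \<in> g.Sec" for Z using that by simp
  have "jet M (J1 M t) m \<sigma> = jet M (J1 M t) m X" if \<sigma>: "\<sigma> \<in> jet M g m X" for \<sigma>
  proof -
    obtain S W where S: "S \<in> g.Sec" "open W" "m \<in> W" "\<forall>x\<in>W. S x = \<sigma> x" "jet M g m S = jet M g m X"
      by (rule g.mem_jet[OF X \<sigma>])
    have eqm: "S m = X m" by (rule g.jet_eqD(1)[OF S(1) X S(5)])
    have "jet M (J1 M t) m \<sigma> = jet M (J1 M t) m S"
      by (rule j.jet_cong[OF S(2,3)]) (use S(4) in simp)
    also have "\<dots> = jet M (J1 M t) m X"
    proof (rule j.jet_eqI[OF js[OF S(1)] js[OF X] eqm])
      fix Y assume Y: "Y \<in> j.Sec"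
      have "j.anc m (Y m) \<in> carrier (tangent_space M m)" by (rule j.anchor_tangent[OF j.sec_carrier[OF Y]])
      then obtain Z where Z: "Z \<in> g.Sec" "g.anc m (Z m) = j.anc m (Y m)" by (rule g.anchor_onto)
      let ?u = "j.ssub S X" and ?w = "j.ssub Y Z"
      have u: "?u \<in> j.Sec" "?w \<in> j.Sec" using js S(1) X Y Z by (intro j.sec_ssub; simp)+
      have u0: "?u m = \<zero>\<^bsub>fibre (J1 M t) m\<^esub>"
      proof (rule j.br_eqI[of _ m])
        show "l (?u m) = l \<zero>\<^bsub>fibre (J1 M t) m\<^esub>" if l: "linear_functional (fibre (J1 M t) m) l" for l
          using j.lf_ssub[OF l js[OF S(1)] js[OF X]] t.J.lf_zero[of m l] l eqm by (simp only: t.J1_simps)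
      qed (use j.sec_carrier[OF u(1)] in simp_all)
      have "j.anc m (?w m) f = j.anc m (Y m) f - j.anc m (Z m) f" for f
        by (rule j.lf_ssub[OF j.linear_functional_anchor Y js[OF Z(1)]])
      then have w0: "j.anc m (?w m) = (\<lambda>f. 0)" using Z(2) by (intro ext) simp
      have "j.br ?u ?w m = \<zero>\<^bsub>fibre (J1 M t) m\<^esub>" by (rule j.br_zero_anchor[OF u u0 w0])
      moreover have "j.br S Z m = j.br X Z m" using g.jet_eqD(2)[OF S(1) X S(5) Z(1)] by (simp add: g_bracket)
      ultimately show "j.br S Y m = j.br X Y m"
      proof (intro j.br_eqI[of _ m])
        fix l assume z: "j.br ?u ?w m = \<zero>\<^bsub>fibre (J1 M t) m\<^esub>" and e: "j.br S Z m = j.br X Z m"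
          and l: "linear_functional (fibre (J1 M t) m) l"
        have "l (j.br ?u ?w m) = l (j.br S Y m) - l (j.br X Y m) - (l (j.br S Z m) - l (j.br X Z m))"
          using j.lf_br_ssub_right[OF l Y js[OF Z(1)] u(1)] j.lf_br_ssub_left[OF l js[OF S(1)] js[OF X] Y]
            j.lf_br_ssub_left[OF l js[OF S(1)] js[OF X] js[OF Z(1)]] by simp
        then show "l (j.br S Y m) = l (j.br X Y m)" using z e t.J.lf_zero[of m l] l by simp
      qed (use j.sec_carrier[OF j.sec_br[OF js[OF S(1)] Y]] j.sec_carrier[OF j.sec_br[OF js[OF X] Y]] in simp_all)
    qed
    finally show ?thesis .
  qed
  moreover have "jet M g m X \<noteq> {}" using g.jet_self[OF X] by blast
  ultimately show ?thesis unfolding jet_extend_def by simp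
qed

lemma second_jets_iff:
  "k \<in> second_jets M t m \<longleftrightarrow> (\<exists>W\<in>t.Sec. k = jet M (J1 M t) m (prolong M t W))"
proof -
  interpret j: transitive_algebroid M "J1 M t" by (rule t.transitive_algebroid_J1)
  have "\<exists>X\<in>t.Sec. jet M (J1 M t) m (prolong M t W) = jet M (J1 M t) m (prolong M t X)"
    if W: "W \<in> local_sections t m" for W
  proof -
    obtain X N where X: "X \<in> t.Sec" "open N" "m \<in> N" "\<forall>x\<in>N. X x = W x"
      by (rule t.local_sections_extend[OF W])
    have "prolong M t W x = prolong M t X x" if "x \<in> N" for x
      unfolding prolong_def by (rule t.jet_cong[OF X(2) that]) (use X(4) in simp)
    then show ?thesis using j.jet_cong[OF X(2,3), of "prolong M t W" "prolong M t X"] X(1) by blast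
  qed
  then show ?thesis unfolding second_jets_def using t.sec_local by blast
qed

lemma prolongation_iff:
  "k \<in> prolongation M t G m \<longleftrightarrow>
    (\<exists>X\<in>g.Sec. k = jet M g m X \<and> (\<exists>W\<in>t.Sec. jet M (J1 M t) m X = jet M (J1 M t) m (prolong M t W)))"
proof -
  have "fibre (J1 M g) m = g.J m" by simp
  then have "carrier (fibre (J1 M (subbundle (J1 M t) G)) m) = jet M g m ` g.Sec"
    by (simp only: g_def[symmetric] g.jet_carrier)
  then show ?thesis
    unfolding prolongation_def by (auto simp: second_jets_iff jet_extend_g) blast+
qed

lemma prolongation_jet:
  assumes X: "X \<in> g.Sec" and W: "W \<in> t.Sec" and eq: "jet M (J1 M t) m X = jet M (J1 M t) m (prolong M t W)"
  shows "X m = jet M t m W"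
    and "U \<in> t.JSec \<Longrightarrow> bracket (J1 M t) X U m = bracket (J1 M t) (prolong M t W) U m"
proof -
  interpret j: transitive_algebroid M "J1 M t" by (rule t.transitive_algebroid_J1)
  have s: "X \<in> j.Sec" "prolong M t W \<in> j.Sec" using X W by simp_all
  show "X m = jet M t m W" using j.jet_eqD(1)[OF s eq] by (simp add: prolong_def)
  show "U \<in> t.JSec \<Longrightarrow> bracket (J1 M t) X U m = bracket (J1 M t) (prolong M t W) U m"
    using j.jet_eqD(2)[OF s eq, of U] by simp
qed

text \<open>If the jet in question becomes that of \<open>prolong M t W\<close> in
  \<open>J1 t\<close>, then \<open>k\<close> acts as the bracket with \<open>prolong M t W\<close>;
  the two equations are then \<open>pr_J1_bracket\<close> and \<open>lf_br_torsion\<close>.\<close>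

lemma prolongation_compatible:
  assumes "k \<in> prolongation M t G m"
  shows "compatible m k"
proof -
  obtain X W where X: "X \<in> g.Sec" "k = jet M g m X" and W: "W \<in> t.Sec"
    and eq: "jet M (J1 M t) m X = jet M (J1 M t) m (prolong M t W)"
    using assms unfolding prolongation_iff by blast
  note pj = prolongation_jet[OF X(1) W eq]
  let ?B = "bracket (J1 M t) (prolong M t W)"
  have Bs: "?B U \<in> t.JSec" if "U \<in> t.JSec" for U
    using t.J1_bracket_unique[OF t.prolong_jsec[OF W] that] t.jet_bracket_sec[OF t.prolong_jsec[OF W] that] by simp
  have kU: "g.jet_act m k U = ?B U m" if "U \<in> g.Sec" for U
    using X that pj(2)[of U] by (simp add: g_bracket)
  have kp: "jet_proj m k = jet M t m W" using X pj(1) by simp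
  \<comment> \<open>\<open>?B U\<close> need not be a section of \<open>g\<close>; only its value at
    \<open>m\<close> lies in \<open>G m\<close>. Tensoriality of the torsion allows passing to an
    extension inside \<open>g\<close>.\<close>
  have ext: "l (t.torsion (extension m (?B U m)) V m) = l (t.torsion (?B U) V m)"
    if l: "linear_functional (fibre t m) l" and U: "U \<in> g.Sec" and V: "V \<in> t.JSec" for l U V
  proof -
    have "?B U m \<in> G m" using kU[OF U] g.jet_act_closed[of k m U] X U by simp
    then show ?thesis using U V Bs[of U] by (intro t.torsion_cong_left[OF l]) simp_all
  qed
  show ?thesis
    unfolding compatible_def
  proof (intro conjI ballI allI impI)
    show "k \<in> carrier (g.J m)" using X by simp
    fix U assume U: "U \<in> g.Sec"
    have "t.pr (?B U) = t.br W (t.pr U)" using t.pr_J1_bracket[of "prolong M t W" U] W U by simp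
    from fun_cong[OF this, of m] show "jet_proj m (g.jet_act m k U) = t.jet_act m (jet_proj m k) (t.pr U)"
      using W U by (simp add: kU[OF U] kp t.pr_def[of "?B U"])
    fix V l assume V: "V \<in> g.Sec" and l: "linear_functional (fibre t m) l"
    have "tors l m V (g.jet_act m k U) = l (t.torsion (?B U) V m)"
      unfolding kU[OF U] tors_def using V by (intro ext[OF l U]) simp
    moreover have "tors l m U (g.jet_act m k V) = l (t.torsion (?B V) U m)"
      unfolding kU[OF V] tors_def using U by (intro ext[OF l V]) simp
    moreover have "l (t.torsion (?B V) U m) = - l (t.torsion U (?B V) m)"
      using t.lf_torsion_skew[OF l, of U "?B V"] U V Bs by simp
    moreover have "l (t.br W (t.torsion U V) m) = l (t.torsion (?B U) V m) + l (t.torsion U (?B V) m)"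
      by (rule t.lf_br_torsion[OF l W _ _ refl refl]) (use U V Bs in simp_all)
    ultimately show "l (t.jet_act m (jet_proj m k) (t.torsion U V)) =
        tors l m V (g.jet_act m k U) - tors l m U (g.jet_act m k V)"
      using W U V by (simp add: kp)
  qed
qed

lemma prolongation_onto:
  assumes "v \<in> G m"
  obtains k where "k \<in> prolongation M t G m" "jet_proj m k = v"
  using reduced assms unfolding Theta_reduced_def by (metis imageE)

text \<open>\<open>\<Theta>\<close>-reducedness provides an element of the prolongation over the
  projection of any given solution, and uniqueness identifies the two.\<close>

lemma prolongation_eq: "prolongation M t G m = {k. compatible m k}"
proof (intro subset_antisym subsetI)
  fix k assume "k \<in> {k. compatible m k}"
  then have k: "compatible m k" by simp
  have "jet_proj m k \<in> G m" using compatible_carrier[OF k] by simp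
  then obtain k' where k': "k' \<in> prolongation M t G m" "jet_proj m k' = jet_proj m k" by (rule prolongation_onto)
  have "k' = k" by (rule compatible_unique[OF prolongation_compatible[OF k'(1)] k k'(2)])
  then show "k \<in> prolongation M t G m" using k'(1) by simp
qed (use prolongation_compatible in simp)

section \<open>The splitting and the connection it defines\<close>

text \<open>The inverse of the projection from the prolongation to \<open>g\<close>. Its linearity
  comes for free from uniqueness of solutions.\<close>

definition split :: "'m \<Rightarrow> ('m \<Rightarrow> 'v) set \<Rightarrow> ('m \<Rightarrow> ('m \<Rightarrow> 'v) set) set" where
  "split m v = (THE k. compatible m k \<and> jet_proj m k = v)"

lemma split_eqI: "compatible m k \<Longrightarrow> jet_proj m k = v \<Longrightarrow> split m v = k"
  unfolding split_def by (rule the_equality) (simp, elim conjE, rule compatible_unique, assumption+, simp)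

lemma split:
  assumes "v \<in> G m"
  shows compatible_split: "compatible m (split m v)" and jet_proj_split: "jet_proj m (split m v) = v"
proof -
  obtain k where k: "k \<in> prolongation M t G m" "jet_proj m k = v" by (rule prolongation_onto[OF assms])
  then have "compatible m k" "split m v = k"
    using prolongation_compatible split_eqI by auto
  then show "compatible m (split m v)" "jet_proj m (split m v) = v" using k by simp_all
qed

lemma split_carrier: "v \<in> G m \<Longrightarrow> split m v \<in> carrier (g.J m)"
  using compatible_carrier compatible_split by blast

lemma split_add: "v \<in> G m \<Longrightarrow> w \<in> G m \<Longrightarrow> split m (v \<oplus>\<^bsub>fibre g m\<^esub> w) = split m v \<oplus>\<^bsub>g.J m\<^esub> split m w"
proof (rule split_eqI)
  assume v: "v \<in> G m" "w \<in> G m"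
  then show "compatible m (split m v \<oplus>\<^bsub>g.J m\<^esub> split m w)" by (intro compatible_add compatible_split)
  note c = split_carrier[OF v(1)] split_carrier[OF v(2)]
  show "jet_proj m (split m v \<oplus>\<^bsub>g.J m\<^esub> split m w) = v \<oplus>\<^bsub>fibre g m\<^esub> w"
  proof (rule g.br_eqI[of _ m])
    show "l (jet_proj m (split m v \<oplus>\<^bsub>g.J m\<^esub> split m w)) = l (v \<oplus>\<^bsub>fibre g m\<^esub> w)"
      if l: "linear_functional (fibre g m) l" for l
      using g.J.lf_add[OF g.linear_functional_jet_proj[OF l] c] g.F.lf_add[OF l, of v w] v by (simp add: jet_proj_split)
    show "v \<oplus>\<^bsub>fibre g m\<^esub> w \<in> carrier (fibre g m)" using v by (intro g.F.M.add.m_closed) simp_all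
  qed (use g.jet_proj_closed[OF g.J.M.add.m_closed[OF c]] in simp)
qed

lemma split_smult: "v \<in> G m \<Longrightarrow> split m (c \<odot>\<^bsub>fibre g m\<^esub> v) = c \<odot>\<^bsub>g.J m\<^esub> split m v"
proof (rule split_eqI)
  assume v: "v \<in> G m"
  then show "compatible m (c \<odot>\<^bsub>g.J m\<^esub> split m v)" by (intro compatible_smult compatible_split)
  note cs = split_carrier[OF v]
  show "jet_proj m (c \<odot>\<^bsub>g.J m\<^esub> split m v) = c \<odot>\<^bsub>fibre g m\<^esub> v"
  proof (rule g.br_eqI[of _ m])
    show "l (jet_proj m (c \<odot>\<^bsub>g.J m\<^esub> split m v)) = l (c \<odot>\<^bsub>fibre g m\<^esub> v)"
      if l: "linear_functional (fibre g m) l" for l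
      using g.J.lf_smult[OF g.linear_functional_jet_proj[OF l] cs] g.F.lf_smult[OF l, of v] v by (simp add: jet_proj_split)
    show "c \<odot>\<^bsub>fibre g m\<^esub> v \<in> carrier (fibre g m)" using v by (intro g.F.smult_closed) simp
  qed (use g.jet_proj_closed[OF g.J.smult_closed[OF cs]] in simp)
qed

definition vertical_part :: "('m \<Rightarrow> ('m \<Rightarrow> 'v) set) \<Rightarrow> 'm \<Rightarrow> ('m \<Rightarrow> ('m \<Rightarrow> 'v) set) set" where
  "vertical_part X m = split m (X m) \<ominus>\<^bsub>g.J m\<^esub> jet M g m X"

text \<open>Solves \<open>split m (X m) = J X + nabla X\<close> for \<open>nabla X\<close>: the
  difference of two jets over \<open>X m\<close> is a cotensor.\<close>

definition nabla :: "('m \<Rightarrow> ('m \<Rightarrow> 'v) set) \<Rightarrow> 'm \<Rightarrow> (('m \<Rightarrow> real) \<Rightarrow> real) \<Rightarrow> ('m \<Rightarrow> 'v) set" where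
  "nabla X m = g.cotensor_of_jet m (vertical_part X m)"

context
  fixes X :: "'m \<Rightarrow> ('m \<Rightarrow> 'v) set" and m :: 'm
  assumes X: "X \<in> g.Sec"
begin

lemma split_X: "split m (X m) \<in> carrier (g.J m)"
  by (rule split_carrier) (use X in simp)

lemma vertical_part_carrier: "vertical_part X m \<in> carrier (g.J m)"
  unfolding vertical_part_def using split_X X by (intro g.J.M.minus_closed) simp_all

lemma vertical_part_proj: "jet_proj m (vertical_part X m) = \<zero>\<^bsub>fibre g m\<^esub>"
proof (rule g.br_eqI[of _ m])
  show "l (jet_proj m (vertical_part X m)) = l \<zero>\<^bsub>fibre g m\<^esub>" if l: "linear_functional (fibre g m) l" for l
    using g.J.lf_minus[OF g.linear_functional_jet_proj[OF l] split_X g.jet_in_carrier[OF X]] X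
      jet_proj_split[of "X m" m] g.F.lf_zero[OF l] by (simp add: vertical_part_def)
qed (use g.jet_proj_closed[OF vertical_part_carrier] g.F.M.zero_closed[of m] in simp_all)

lemma nabla_carrier: "nabla X m \<in> carrier (cotensor M m (fibre g m))"
  unfolding nabla_def by (rule g.cotensor_of_jet_carrier[OF vertical_part_carrier vertical_part_proj])

lemma nabla_linear: "linear_map (tangent_space M m) (fibre g m) (nabla X m)"
  unfolding nabla_def by (rule g.cotensor_of_jet_linear[OF vertical_part_carrier vertical_part_proj])

lemma nabla_incl: "jet M g m X \<oplus>\<^bsub>g.J m\<^esub> cotensor_incl M g m (nabla X m) = split m (X m)"
  unfolding nabla_def g.cotensor_incl_of_jet[OF vertical_part_carrier vertical_part_proj]
proof (rule g.J.separated)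
  show "l (jet M g m X \<oplus>\<^bsub>g.J m\<^esub> vertical_part X m) = l (split m (X m))" if l: "linear_functional (g.J m) l" for l
    using g.J.lf_add[OF l g.jet_in_carrier[OF X] vertical_part_carrier]
      g.J.lf_minus[OF l split_X g.jet_in_carrier[OF X]] by (simp add: vertical_part_def)
qed (use split_X vertical_part_carrier g.jet_in_carrier[OF X] in simp_all)

lemma lf_nabla:
  assumes l: "linear_functional (fibre g m) l" and Y: "Y \<in> g.Sec"
  shows "l (nabla X m (g.anc m (Y m))) = l (g.jet_act m (split m (X m)) Y) - l (g.br X Y m)"
  unfolding nabla_def g.cotensor_of_jet_apply[OF vertical_part_carrier vertical_part_proj Y]
  using g.J.lf_minus[OF g.linear_functional_jet_act[OF l Y] split_X g.jet_in_carrier[OF X]] X Y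
  by (simp add: vertical_part_def)

end

subsection \<open>Smoothness of the canonical connection\<close>

lemma nabla_closed: "X \<in> g.Sec \<Longrightarrow> v \<in> carrier (tangent_space M m) \<Longrightarrow> nabla X m v \<in> carrier (fibre g m)"
  using g.lm_closed[OF nabla_linear] .

lemma nabla_add:
  assumes X: "X \<in> g.Sec" and Y: "Y \<in> g.Sec" and v: "v \<in> carrier (tangent_space M m)"
  shows "nabla (sadd g X Y) m v = nabla X m v \<oplus>\<^bsub>fibre g m\<^esub> nabla Y m v"
proof (rule g.br_eqI[of _ m])
  fix l assume l: "linear_functional (fibre g m) l"
  obtain Z where Z: "Z \<in> g.Sec" "g.anc m (Z m) = v" by (rule g.anchor_onto[OF v])
  have XY: "sadd g X Y \<in> g.Sec" using X Y by simp
  have "split m (sadd g X Y m) = split m (X m) \<oplus>\<^bsub>g.J m\<^esub> split m (Y m)"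
    using split_add[OF g_sec_G[OF X] g_sec_G[OF Y]] by (simp only: sadd_def)
  then have "l (g.jet_act m (split m (sadd g X Y m)) Z) =
      l (g.jet_act m (split m (X m)) Z) + l (g.jet_act m (split m (Y m)) Z)"
    using g.J.lf_add[OF g.linear_functional_jet_act[OF l Z(1)] split_X[OF X] split_X[OF Y]] by simp
  then show "l (nabla (sadd g X Y) m v) = l (nabla X m v \<oplus>\<^bsub>fibre g m\<^esub> nabla Y m v)"
    unfolding Z(2)[symmetric] lf_nabla[OF XY l Z(1)] g.lf_br_sadd_left[OF l X Y Z(1)]
      g.F.lf_add[OF l nabla_closed[OF X g.anchor_tangent[OF g.sec_carrier[OF Z(1)]]]
        nabla_closed[OF Y g.anchor_tangent[OF g.sec_carrier[OF Z(1)]]]]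
      lf_nabla[OF X l Z(1)] lf_nabla[OF Y l Z(1)]
    by simp
next
  show "nabla (sadd g X Y) m v \<in> carrier (fibre g m)" by (rule nabla_closed[OF g.sec_sadd[OF X Y] v])
  show "nabla X m v \<oplus>\<^bsub>fibre g m\<^esub> nabla Y m v \<in> carrier (fibre g m)"
    by (rule g.F.M.add.m_closed[OF nabla_closed[OF X v] nabla_closed[OF Y v]])
qed

text \<open>\<open>split\<close> is linear in the value, so the term \<open>v f\<close> times
  \<open>X\<close> stems from the jet alone, through
  \<open>[f X, Z] = f [X, Z] - #Z(f) X\<close>.\<close>

lemma nabla_scale:
  assumes X: "X \<in> g.Sec" and f: "smooth_fun M UNIV f" and v: "v \<in> carrier (tangent_space M m)"
  shows "nabla (sscale g f X) m v = (f m \<odot>\<^bsub>fibre g m\<^esub> nabla X m v) \<oplus>\<^bsub>fibre g m\<^esub> (v f \<odot>\<^bsub>fibre g m\<^esub> X m)"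
proof (rule g.br_eqI[of _ m])
  fix l assume l: "linear_functional (fibre g m) l"
  obtain Z where Z: "Z \<in> g.Sec" "g.anc m (Z m) = v" by (rule g.anchor_onto[OF v])
  have fX: "sscale g f X \<in> g.Sec" using X f by simp
  note nX = nabla_closed[OF X v] and Xc = g.sec_carrier[OF X, of m]
  have "split m (sscale g f X m) = f m \<odot>\<^bsub>g.J m\<^esub> split m (X m)"
    using split_smult[OF g_sec_G[OF X]] by (simp only: sscale_def)
  then have "l (g.jet_act m (split m (sscale g f X m)) Z) = f m * l (g.jet_act m (split m (X m)) Z)"
    using g.J.lf_smult[OF g.linear_functional_jet_act[OF l Z(1)] split_X[OF X]] by simp
  moreover have "l (nabla (sscale g f X) m v) = l (g.jet_act m (split m (sscale g f X m)) Z) - l (g.br (sscale g f X) Z m)"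
    using lf_nabla[OF fX l Z(1)] unfolding Z(2) .
  moreover have "l (nabla X m v) = l (g.jet_act m (split m (X m)) Z) - l (g.br X Z m)"
    using lf_nabla[OF X l Z(1)] unfolding Z(2) .
  moreover have "l (g.br (sscale g f X) Z m) = f m * l (g.br X Z m) - v f * l (X m)"
    using g.lf_br_sscale_left[OF l X Z(1) f] unfolding Z(2) .
  ultimately show "l (nabla (sscale g f X) m v) =
      l ((f m \<odot>\<^bsub>fibre g m\<^esub> nabla X m v) \<oplus>\<^bsub>fibre g m\<^esub> (v f \<odot>\<^bsub>fibre g m\<^esub> X m))"
    unfolding g.F.lf_add[OF l g.F.smult_closed[OF nX] g.F.smult_closed[OF Xc]] g.F.lf_smult[OF l nX]
      g.F.lf_smult[OF l Xc] by (simp add: right_diff_distrib)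
next
  show "nabla (sscale g f X) m v \<in> carrier (fibre g m)" by (rule nabla_closed[OF g.sec_sscale[OF f X] v])
  show "(f m \<odot>\<^bsub>fibre g m\<^esub> nabla X m v) \<oplus>\<^bsub>fibre g m\<^esub> (v f \<odot>\<^bsub>fibre g m\<^esub> X m) \<in> carrier (fibre g m)"
    by (rule g.F.M.add.m_closed[OF g.F.smult_closed[OF nabla_closed[OF X v]] g.F.smult_closed[OF g.sec_carrier[OF X]]])
qed

text \<open>The first equation for \<open>split m (X m)\<close>, with the unknown moved into
  \<open>nabla\<close>: the right side is built from \<open>X\<close> and \<open>A\<close> by
  operations known to be smooth.\<close>

lemma nabla_proj:
  assumes X: "X \<in> g.Sec" and A: "A \<in> g.Sec" and l: "linear_functional (fibre t m) l"
  shows "l (jet_proj m (nabla X m (g.anc m (A m)))) = l (t.act X (t.pr A) m) - l (t.pr (g.br X A) m)"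
  using lf_nabla[OF X linear_functional_proj[OF l] A] compatible_proj[OF compatible_split[OF g_sec_G[OF X]] A]
    jet_proj_split[OF g_sec_G[OF X]] by (simp add: t.pr_def t.act_def del: g_anchor)

lemma nabla_torsion:
  assumes X: "X \<in> g.Sec" and A: "A \<in> g.Sec" and B: "B \<in> g.Sec" and l: "linear_functional (fibre t m) l"
  shows "tors l m B (nabla X m (g.anc m (A m))) - tors l m A (nabla X m (g.anc m (B m))) =
    l (t.act X (t.torsion A B) m) - l (t.torsion (g.br X A) B m) + l (t.torsion (g.br X B) A m)"
  using lf_nabla[OF X linear_functional_tors[OF l B] A] lf_nabla[OF X linear_functional_tors[OF l A] B]
    compatible_torsion[OF compatible_split[OF g_sec_G[OF X]] A B l]
    jet_proj_split[OF g_sec_G[OF X, of m]]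
    tors_value[OF l g.sec_br[OF X A] B] tors_value[OF l g.sec_br[OF X B] A]
  by (simp add: t.act_def del: g_anchor)

text \<open>The components of \<open>nabla X\<close> in local frames solve the linear system consisting of
  \<open>nabla_proj\<close> and \<open>nabla_torsion\<close>, whose coefficients are smooth and which is injective by
  \<open>vertical_symmetric_zero\<close>. The index \<open>(q, A, B, p)\<close> stands for the \<open>p\<close>-th component of the former
  equation for \<open>A\<close> if \<open>q\<close>, and of the latter for \<open>A\<close> and \<open>B\<close> otherwise.\<close>

context
  fixes X :: "'m \<Rightarrow> ('m \<Rightarrow> 'v) set" and m :: 'm and N :: "'m set" and \<phi> :: "'m \<Rightarrow> 'e"
    and U :: "'m set" and r s :: nat and u :: "nat \<Rightarrow> 'm \<Rightarrow> ('m \<Rightarrow> 'v) set" and z :: "nat \<Rightarrow> 'm \<Rightarrow> 'v"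
  assumes X: "X \<in> g.Sec" and chart: "(N, \<phi>) \<in> M" and U: "U \<subseteq> N"
    and u: "local_frame M g U r u" "\<forall>i<r. u i \<in> g.Sec"
    and z: "local_frame M t U s z"
begin

definition t_coeff :: "'m \<Rightarrow> nat \<Rightarrow> 'v \<Rightarrow> real" where
  "t_coeff x p v = coeff (fibre t x) s (\<lambda>i. z i x) v p"

definition nabla_coeff :: "'e \<times> nat \<Rightarrow> 'm \<Rightarrow> real" where
  "nabla_coeff j x = coeff (fibre g x) r (\<lambda>i. u i x) (nabla X x (t.chart_vector N \<phi> (fst j) x)) (snd j)"

lemma U_open: "open U" by (rule g.frame_open[OF u(1)])

lemma u_sec: "i < r \<Longrightarrow> u i \<in> g.Sec" using u(2) by blast

lemma lf_co: "x \<in> U \<Longrightarrow> p < s \<Longrightarrow> linear_functional (fibre t x) (t_coeff x p)"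
  using t.F.linear_functional_coeff[OF t.frame_basis[OF z]] unfolding t_coeff_def .

lemma smooth_co: "Z \<in> t.Sec \<Longrightarrow> p < s \<Longrightarrow> smooth_fun M U (\<lambda>x. t_coeff x p (Z x))"
  unfolding t_coeff_def by (rule t.frame_coeff_smooth[OF z U_open order_refl t.section_restrict[OF _ open_UNIV U_open subset_UNIV]])

lemma smooth_anchor_coordinate: "A \<in> g.Sec \<Longrightarrow> smooth_fun M U (\<lambda>x. g.anc x (A x) (\<lambda>y. \<phi> y \<bullet> b))"
  by (rule g.anchor_smooth[OF _ open_UNIV U_open subset_UNIV t.smooth_fun_subset[OF t.smooth_fun_coordinate[OF chart] U]])

text \<open>Every functional of \<open>nabla X\<close> is linear in the unknowns
  \<open>nabla_coeff\<close>, with coefficients \<open>v(x_b) L(u_i)\<close>. This turns the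
  equations into a linear system.\<close>

lemma nabla_expand:
  assumes x: "x \<in> U" and v: "v \<in> carrier (tangent_space M x)" and L: "linear_functional (fibre g x) L"
  shows "L (nabla X x v) = (\<Sum>j\<in>Basis \<times> {..<r}. v (\<lambda>y. \<phi> y \<bullet> fst j) * L (u (snd j) x) * nabla_coeff j x)"
proof -
  have xN: "x \<in> N" using x U by blast
  have 1: "L (nabla X x (t.chart_vector N \<phi> b x)) = (\<Sum>i\<in>{..<r}. L (u i x) * nabla_coeff (b, i) x)" for b
  proof -
    have nc: "nabla X x (t.chart_vector N \<phi> b x) \<in> carrier (fibre g x)"
      by (rule nabla_closed[OF X t.chart_vector_in_tangent[OF chart xN]])
    have uc: "u i x \<in> carrier (fibre g x)" if "i \<in> {..<r}" for i by (rule g.sec_carrier[OF u_sec]) (use that in simp)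
    have "L (nabla X x (t.chart_vector N \<phi> b x)) = L (\<Oplus>\<^bsub>fibre g x\<^esub>i\<in>{..<r}. nabla_coeff (b, i) x \<odot>\<^bsub>fibre g x\<^esub> u i x)"
      using g.F.basis_expand[OF g.frame_basis[OF u(1) x] nc] by (simp only: nabla_coeff_def fst_conv snd_conv)
    also have "\<dots> = (\<Sum>i\<in>{..<r}. L (nabla_coeff (b, i) x \<odot>\<^bsub>fibre g x\<^esub> u i x))"
      by (rule g.F.lf_finsum[OF L g.F.smult_closed[OF uc]])
    also have "\<dots> = (\<Sum>i\<in>{..<r}. L (u i x) * nabla_coeff (b, i) x)"
      by (rule sum.cong[OF refl]) (simp only: g.F.lf_smult[OF L uc] mult.commute)
    finally show ?thesis .
  qed
  have "L (nabla X x v) = (\<Sum>b\<in>Basis. v (\<lambda>y. \<phi> y \<bullet> b) * L (nabla X x (t.chart_vector N \<phi> b x)))"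
    by (rule g.lm_expand[OF nabla_linear[OF X] chart xN v L])
  also have "\<dots> = (\<Sum>b\<in>Basis. \<Sum>i\<in>{..<r}. v (\<lambda>y. \<phi> y \<bullet> b) * L (u i x) * nabla_coeff (b, i) x)"
    unfolding 1 by (simp only: sum_distrib_left mult.assoc)
  also have "\<dots> = (\<Sum>j\<in>Basis \<times> {..<r}. v (\<lambda>y. \<phi> y \<bullet> fst j) * L (u (snd j) x) * nabla_coeff j x)"
    by (simp add: sum.cartesian_product case_prod_beta)
  finally show ?thesis .
qed

definition sys_lhs :: "bool \<times> ('m \<Rightarrow> ('m \<Rightarrow> 'v) set) \<times> ('m \<Rightarrow> ('m \<Rightarrow> 'v) set) \<times> nat \<Rightarrow> 'e \<times> nat \<Rightarrow> 'm \<Rightarrow> real" where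
  "sys_lhs = (\<lambda>(q, A, B, p) j x.
     if q then g.anc x (A x) (\<lambda>y. \<phi> y \<bullet> fst j) * t_coeff x p (t.pr (u (snd j)) x)
     else g.anc x (A x) (\<lambda>y. \<phi> y \<bullet> fst j) * t_coeff x p (t.torsion (u (snd j)) B x) -
       g.anc x (B x) (\<lambda>y. \<phi> y \<bullet> fst j) * t_coeff x p (t.torsion (u (snd j)) A x))"

definition sys_rhs :: "bool \<times> ('m \<Rightarrow> ('m \<Rightarrow> 'v) set) \<times> ('m \<Rightarrow> ('m \<Rightarrow> 'v) set) \<times> nat \<Rightarrow> 'm \<Rightarrow> real" where
  "sys_rhs = (\<lambda>(q, A, B, p) x.
     if q then t_coeff x p (t.act X (t.pr A) x) - t_coeff x p (t.pr (g.br X A) x)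
     else t_coeff x p (t.act X (t.torsion A B) x) - t_coeff x p (t.torsion (g.br X A) B x) + t_coeff x p (t.torsion (g.br X B) A x))"

definition sys_index :: "(bool \<times> ('m \<Rightarrow> ('m \<Rightarrow> 'v) set) \<times> ('m \<Rightarrow> ('m \<Rightarrow> 'v) set) \<times> nat) set" where
  "sys_index = UNIV \<times> g.Sec \<times> g.Sec \<times> {..<s}"

lemma sys_smooth:
  assumes e: "e \<in> sys_index"
  shows "j \<in> Basis \<times> {..<r} \<Longrightarrow> smooth_fun M U (sys_lhs e j)" and "smooth_fun M U (sys_rhs e)"
proof -
  obtain q A B p where eq: "e = (q, A, B, p)" by (metis prod.collapse)
  have AB: "A \<in> g.Sec" "B \<in> g.Sec" "p < s" using e unfolding eq sys_index_def by simp_all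
  note op = U_open
  show "smooth_fun M U (sys_lhs e j)" if j: "j \<in> Basis \<times> {..<r}"
  proof -
    have uj: "u (snd j) \<in> g.Sec" using j u_sec by auto
    show ?thesis
    proof (cases q)
      case True
      have "smooth_fun M U (\<lambda>x. g.anc x (A x) (\<lambda>y. \<phi> y \<bullet> fst j) * t_coeff x p (t.pr (u (snd j)) x))"
        by (rule t.smooth_fun_mult[OF op smooth_anchor_coordinate[OF AB(1)] smooth_co[OF pr_g_sec[OF uj] AB(3)]])
      then show ?thesis using True by (simp only: sys_lhs_def eq prod.case if_True)
    next
      case False
      have "smooth_fun M U (\<lambda>x. g.anc x (A x) (\<lambda>y. \<phi> y \<bullet> fst j) * t_coeff x p (t.torsion (u (snd j)) B x) -
          g.anc x (B x) (\<lambda>y. \<phi> y \<bullet> fst j) * t_coeff x p (t.torsion (u (snd j)) A x))"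
        by (rule t.smooth_fun_diff[OF op
            t.smooth_fun_mult[OF op smooth_anchor_coordinate[OF AB(1)] smooth_co[OF torsion_g_sec[OF uj AB(2)] AB(3)]]
            t.smooth_fun_mult[OF op smooth_anchor_coordinate[OF AB(2)] smooth_co[OF torsion_g_sec[OF uj AB(1)] AB(3)]]])
      then show ?thesis using False by (simp only: sys_lhs_def eq prod.case if_False)
    qed
  qed
  show "smooth_fun M U (sys_rhs e)"
  proof (cases q)
    case True
    have "smooth_fun M U (\<lambda>x. t_coeff x p (t.act X (t.pr A) x) - t_coeff x p (t.pr (g.br X A) x))"
      using X AB by (intro t.smooth_fun_diff[OF op] smooth_co t.act_sec pr_g_sec g.sec_br g_sec_jet)
    then show ?thesis using True by (simp only: sys_rhs_def eq prod.case if_True)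
  next
    case False
    have "smooth_fun M U (\<lambda>x. t_coeff x p (t.act X (t.torsion A B) x) - t_coeff x p (t.torsion (g.br X A) B x) +
        t_coeff x p (t.torsion (g.br X B) A x))"
      using X AB by (intro t.smooth_fun_add[OF op] t.smooth_fun_diff[OF op] smooth_co t.act_sec torsion_g_sec g.sec_br g_sec_jet)
    then show ?thesis using False by (simp only: sys_rhs_def eq prod.case if_False)
  qed
qed

lemma sys_solution:
  assumes e: "e \<in> sys_index" and x: "x \<in> U"
  shows "(\<Sum>j\<in>Basis \<times> {..<r}. sys_lhs e j x * nabla_coeff j x) = sys_rhs e x"
proof -
  obtain q A B p where eq: "e = (q, A, B, p)" by (metis prod.collapse)
  have AB: "A \<in> g.Sec" "B \<in> g.Sec" "p < s" using e unfolding eq sys_index_def by simp_all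
  note l = lf_co[OF x AB(3)]
  have an: "g.anc x (Y x) \<in> carrier (tangent_space M x)" if "Y \<in> g.Sec" for Y
    by (rule g.anchor_tangent[OF g.sec_carrier[OF that]])
  show ?thesis
  proof (cases q)
    case True
    have "sys_rhs e x = (\<Sum>j\<in>Basis \<times> {..<r}. g.anc x (A x) (\<lambda>y. \<phi> y \<bullet> fst j) * t_coeff x p (jet_proj x (u (snd j) x)) * nabla_coeff j x)"
      using nabla_proj[OF X AB(1) l] nabla_expand[OF x an[OF AB(1)] linear_functional_proj[OF l]] True
      by (simp add: sys_rhs_def eq del: g_anchor)
    then show ?thesis using True by (simp add: sys_lhs_def eq t.pr_def del: g_anchor)
  next
    case False
    have tv: "tors (t_coeff x p) x C (u (snd j) x) = t_coeff x p (t.torsion (u (snd j)) C x)"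
      if "j \<in> Basis \<times> {..<r}" "C \<in> g.Sec" for j :: "'e \<times> nat" and C
      by (rule tors_value[OF l u_sec that(2)]) (use that(1) in auto)
    have ex: "tors (t_coeff x p) x C (nabla X x (g.anc x (Y x))) =
        (\<Sum>j\<in>Basis \<times> {..<r}. g.anc x (Y x) (\<lambda>y. \<phi> y \<bullet> fst j) * t_coeff x p (t.torsion (u (snd j)) C x) * nabla_coeff j x)"
      if C: "C \<in> g.Sec" and Y: "Y \<in> g.Sec" for C Y
      unfolding nabla_expand[OF x an[OF Y] linear_functional_tors[OF l C]]
      by (rule sum.cong[OF refl]) (simp only: tv[OF _ C])
    have "sys_rhs e x = tors (t_coeff x p) x B (nabla X x (g.anc x (A x))) - tors (t_coeff x p) x A (nabla X x (g.anc x (B x)))"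
      using nabla_torsion[OF X AB(1,2) l] False by (simp add: sys_rhs_def eq del: g_anchor)
    also have "\<dots> = (\<Sum>j\<in>Basis \<times> {..<r}. sys_lhs e j x * nabla_coeff j x)"
      unfolding ex[OF AB(2,1)] ex[OF AB(1,2)] using False
      by (simp add: sys_lhs_def eq left_diff_distrib sum_subtractf del: g_anchor)
    finally show ?thesis by simp
  qed
qed

text \<open>A homogeneous solution \<open>y\<close> is a linear map \<open>\<theta>\<close> from
  tangent vectors into \<open>g\<close> at \<open>m\<close>. The equations say that it is vertical
  and symmetric, so \<open>vertical_symmetric_zero\<close> applies.\<close>

lemma sys_injective:
  assumes m: "m \<in> U" and y: "\<And>e. e \<in> sys_index \<Longrightarrow> (\<Sum>j\<in>Basis \<times> {..<r}. sys_lhs e j m * y j) = 0"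
  shows "\<forall>j\<in>Basis \<times> {..<r}. y j = 0"
proof -
  have mN: "m \<in> N" using m U by blast
  \<comment> \<open>\<open>y\<close> is read as a matrix: \<open>\<theta>\<close> will send the
    coordinate vector along \<open>b\<close> to the sum of the \<open>u i m\<close> with weights
    \<open>y (b, i)\<close>.\<close>
  define k where "k v i = (\<Sum>b\<in>Basis. v (\<lambda>x. \<phi> x \<bullet> b) * y (b, i))" for v :: "('m \<Rightarrow> real) \<Rightarrow> real" and i
  define \<theta> where "\<theta> v = (\<Oplus>\<^bsub>fibre g m\<^esub>i\<in>{..<r}. k v i \<odot>\<^bsub>fibre g m\<^esub> u i m)" for v
  have uc: "u i m \<in> carrier (fibre g m)" if "i \<in> {..<r}" for i by (rule g.sec_carrier[OF u_sec]) (use that in simp)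
  have thc: "\<theta> v \<in> carrier (fibre g m)" for v
    unfolding \<theta>_def by (rule g.F.finsum_closed[OF g.F.smult_closed[OF uc]])
  have lth: "L (\<theta> v) = (\<Sum>i\<in>{..<r}. k v i * L (u i m))" if L: "linear_functional (fibre g m) L" for L v
  proof -
    have "L (\<theta> v) = (\<Sum>i\<in>{..<r}. L (k v i \<odot>\<^bsub>fibre g m\<^esub> u i m))"
      unfolding \<theta>_def by (rule g.F.lf_finsum[OF L g.F.smult_closed[OF uc]])
    also have "\<dots> = (\<Sum>i\<in>{..<r}. k v i * L (u i m))"
      by (rule sum.cong[OF refl]) (simp only: g.F.lf_smult[OF L uc])
    finally show ?thesis .
  qed
  have lth': "L (\<theta> v) = (\<Sum>j\<in>Basis \<times> {..<r}. v (\<lambda>x. \<phi> x \<bullet> fst j) * L (u (snd j) m) * y j)"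
    if L: "linear_functional (fibre g m) L" for L v
  proof -
    have "L (\<theta> v) = (\<Sum>i\<in>{..<r}. \<Sum>b\<in>Basis. v (\<lambda>x. \<phi> x \<bullet> b) * L (u i m) * y (b, i))"
      unfolding lth[OF L] k_def by (simp add: sum_distrib_right mult_ac sum_distrib_left)
    also have "\<dots> = (\<Sum>b\<in>Basis. \<Sum>i\<in>{..<r}. v (\<lambda>x. \<phi> x \<bullet> b) * L (u i m) * y (b, i))"
      by (rule sum.swap)
    also have "\<dots> = (\<Sum>j\<in>Basis \<times> {..<r}. v (\<lambda>x. \<phi> x \<bullet> fst j) * L (u (snd j) m) * y j)"
      by (simp add: sum.cartesian_product case_prod_beta)
    finally show ?thesis .
  qed
  have th: "linear_map (tangent_space M m) (fibre g m) \<theta>"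
    unfolding linear_map_def
  proof (intro conjI ballI allI Pi_I)
    fix v w c
    show "\<theta> v \<in> carrier (fibre g m)" by (rule thc)
    show "\<theta> (v \<oplus>\<^bsub>tangent_space M m\<^esub> w) = \<theta> v \<oplus>\<^bsub>fibre g m\<^esub> \<theta> w"
    proof (rule g.br_eqI[of _ m])
      show "L (\<theta> (v \<oplus>\<^bsub>tangent_space M m\<^esub> w)) = L (\<theta> v \<oplus>\<^bsub>fibre g m\<^esub> \<theta> w)"
        if L: "linear_functional (fibre g m) L" for L
        unfolding g.F.lf_add[OF L thc thc] lth[OF L] k_def t.tangent_space_simps
        by (simp add: sum.distrib distrib_right)
    qed (rule thc g.F.M.add.m_closed[OF thc thc])+
    show "\<theta> (c \<odot>\<^bsub>tangent_space M m\<^esub> v) = c \<odot>\<^bsub>fibre g m\<^esub> \<theta> v"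
    proof (rule g.br_eqI[of _ m])
      show "L (\<theta> (c \<odot>\<^bsub>tangent_space M m\<^esub> v)) = L (c \<odot>\<^bsub>fibre g m\<^esub> \<theta> v)"
        if L: "linear_functional (fibre g m) L" for L
        unfolding g.F.lf_smult[OF L thc] lth[OF L] k_def t.tangent_space_simps
        by (simp add: sum_distrib_left sum_distrib_right mult.assoc)
    qed (rule thc g.F.smult_closed[OF thc])+
  qed
  have vert: "jet_proj m (\<theta> v) = \<zero>\<^bsub>fibre t m\<^esub>" if v: "v \<in> carrier (tangent_space M m)" for v
  proof (rule t.F.basis_eqI[OF t.frame_basis[OF z m]])
    obtain A where A: "A \<in> g.Sec" "g.anc m (A m) = v" by (rule g.anchor_onto[OF v])
    fix p assume p: "p < s"
    note l = lf_co[OF m p]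
    have e: "(True, A, A, p) \<in> sys_index" using A(1) p by (simp add: sys_index_def)
    have "t_coeff m p (jet_proj m (\<theta> v)) = 0"
      using y[OF e] unfolding lth'[OF linear_functional_proj[OF l]] A(2)[symmetric]
      by (simp add: sys_lhs_def t.pr_def del: g_anchor)
    then show "coeff (fibre t m) s (\<lambda>i. z i m) (jet_proj m (\<theta> v)) p = coeff (fibre t m) s (\<lambda>i. z i m) \<zero>\<^bsub>fibre t m\<^esub> p"
      using t.F.lf_zero[OF l] unfolding t_coeff_def by simp
  qed (use thc in simp_all)
  have sym: "tors l m V (\<theta> (g.anc m (A m))) = tors l m A (\<theta> (g.anc m (V m)))"
    if A: "A \<in> g.Sec" and V: "V \<in> g.Sec" and l: "linear_functional (fibre t m) l" for A V l
  proof -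
    have G: "\<theta> v \<in> G m" for v using thc by simp
    have "t.torsion (extension m (\<theta> (g.anc m (A m)))) V m = t.torsion (extension m (\<theta> (g.anc m (V m)))) A m"
    proof (rule t.F.basis_eqI[OF t.frame_basis[OF z m]])
      fix p assume p: "p < s"
      note lp = lf_co[OF m p]
      have e: "(False, A, V, p) \<in> sys_index" using A V p by (simp add: sys_index_def)
      have tv: "tors (t_coeff m p) m C (u (snd j) m) = t_coeff m p (t.torsion (u (snd j)) C m)"
        if "j \<in> Basis \<times> {..<r}" "C \<in> g.Sec" for j :: "'e \<times> nat" and C
        by (rule tors_value[OF lp u_sec that(2)]) (use that(1) in auto)
      have ex: "tors (t_coeff m p) m C (\<theta> w) =
          (\<Sum>j\<in>Basis \<times> {..<r}. w (\<lambda>y. \<phi> y \<bullet> fst j) * t_coeff m p (t.torsion (u (snd j)) C m) * y j)"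
        if C: "C \<in> g.Sec" for C w
        unfolding lth'[OF linear_functional_tors[OF lp C]]
        by (rule sum.cong[OF refl]) (simp only: tv[OF _ C])
      have "tors (t_coeff m p) m V (\<theta> (g.anc m (A m))) - tors (t_coeff m p) m A (\<theta> (g.anc m (V m))) = 0"
        using y[OF e] unfolding ex[OF V] ex[OF A]
        by (simp add: sys_lhs_def left_diff_distrib sum_subtractf del: g_anchor)
      then show "coeff (fibre t m) s (\<lambda>i. z i m) (t.torsion (extension m (\<theta> (g.anc m (A m)))) V m) p =
          coeff (fibre t m) s (\<lambda>i. z i m) (t.torsion (extension m (\<theta> (g.anc m (V m)))) A m) p"
        unfolding tors_def t_coeff_def by simp
    next
      show "t.torsion (extension m (\<theta> (g.anc m (A m)))) V m \<in> carrier (fibre t m)"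
        by (rule t.sec_carrier[OF torsion_g_sec[OF extension_sec[OF G] V]])
      show "t.torsion (extension m (\<theta> (g.anc m (V m)))) A m \<in> carrier (fibre t m)"
        by (rule t.sec_carrier[OF torsion_g_sec[OF extension_sec[OF G] A]])
    qed
    then show ?thesis unfolding tors_def by simp
  qed
  show ?thesis
  proof
    fix j :: "'e \<times> nat" assume "j \<in> Basis \<times> {..<r}"
    then obtain b i where j: "j = (b, i)" "b \<in> Basis" "i < r" by auto
    let ?v = "t.chart_vector N \<phi> b m"
    have v: "?v \<in> carrier (tangent_space M m)" by (rule t.chart_vector_in_tangent[OF chart mN])
    have "\<theta> ?v = \<zero>\<^bsub>fibre g m\<^esub>" by (rule vertical_symmetric_zero[where \<theta>=\<theta>, OF th vert sym v])
    moreover have "coeff (fibre g m) r (\<lambda>i. u i m) (\<theta> ?v) i = k ?v i"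
      unfolding \<theta>_def by (rule g.F.coeff_unique[OF g.frame_basis[OF u(1) m] j(3)])
    ultimately have "k ?v i = 0"
      using g.F.lf_zero[OF g.F.linear_functional_coeff[OF g.frame_basis[OF u(1) m] j(3)]] by simp
    moreover have "k ?v i = (\<Sum>b'\<in>Basis. if b' = b then y (b', i) else 0)"
      unfolding k_def t.chart_vector_coordinate[OF chart mN]
      by (rule sum.cong[OF refl]) (use j(2) in \<open>simp add: inner_Basis\<close>)
    ultimately show "y j = 0" using j by simp
  qed
qed

lemma nabla_smooth_near:
  assumes m: "m \<in> U" and W: "open W" "m \<in> W" "W \<subseteq> U" and V: "V \<in> sections (tangent_bundle M) W"
  shows "\<exists>W'. open W' \<and> m \<in> W' \<and> W' \<subseteq> W \<and> (\<lambda>x. nabla X x (V x)) \<in> sections g W'"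
proof -
  have "\<exists>W. open W \<and> m \<in> W \<and> W \<subseteq> U \<and> (\<forall>j\<in>Basis \<times> {..<r}. smooth_fun M W (nabla_coeff j))"
    by (rule t.smooth_linear_system[where a=sys_lhs and b=sys_rhs and E=sys_index, OF _ U_open m])
      (simp, rule sys_smooth(1), assumption+, rule sys_smooth(2), assumption, rule sys_solution, assumption+,
        rule sys_injective[OF m])
  then obtain W1 where W1: "open W1" "m \<in> W1" "W1 \<subseteq> U" "\<And>j. j \<in> Basis \<times> {..<r} \<Longrightarrow> smooth_fun M W1 (nabla_coeff j)" by blast
  let ?W = "W \<inter> W1"
  have op: "open ?W" using W W1 by blast
  have sub: "?W \<subseteq> U" using W by blast
  have Vc: "V x \<in> carrier (tangent_space M x)" if "x \<in> ?W" for x using V that by (simp add: tangent_bundle_def)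
  have "(\<lambda>x. nabla X x (V x)) \<in> sections g ?W"
  proof (rule g.frame_sectionI[OF u(1) op sub])
    show "nabla X x (V x) \<in> carrier (fibre g x)" if "x \<in> ?W" for x by (rule nabla_closed[OF X Vc[OF that]])
    fix i assume i: "i < r"
    have "smooth_fun M ?W (\<lambda>x. \<Sum>b\<in>Basis. V x (\<lambda>y. \<phi> y \<bullet> b) * nabla_coeff (b, i) x)"
    proof (rule t.smooth_fun_sum[OF op t.smooth_fun_mult[OF op]])
      fix b :: 'e assume b: "b \<in> Basis"
      have "smooth_fun M ?W (\<lambda>y. \<phi> y \<bullet> b)"
        by (rule t.smooth_fun_subset[OF t.smooth_fun_coordinate[OF chart]]) (use sub U in blast)
      then show "smooth_fun M ?W (\<lambda>x. V x (\<lambda>y. \<phi> y \<bullet> b))" using V op by (simp add: tangent_bundle_def)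
      show "smooth_fun M ?W (nabla_coeff (b, i))"
        by (rule t.smooth_fun_subset[OF W1(4)]) (use b i in auto)
    qed
    then show "smooth_fun M ?W (\<lambda>x. coeff (fibre g x) r (\<lambda>i. u i x) (nabla X x (V x)) i)"
    proof (rule t.smooth_fun_cong[OF op, rotated])
      fix x assume x: "x \<in> ?W"
      show "(\<Sum>b\<in>Basis. V x (\<lambda>y. \<phi> y \<bullet> b) * nabla_coeff (b, i) x) =
        coeff (fibre g x) r (\<lambda>i. u i x) (nabla X x (V x)) i"
    proof -
      have xN: "x \<in> N" using x sub U by blast
      have xU: "x \<in> U" using x sub by blast
      show ?thesis
        using g.lm_expand[OF nabla_linear[OF X] chart xN Vc[OF x]
            g.F.linear_functional_coeff[OF g.frame_basis[OF u(1) xU] i]]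
        by (simp add: nabla_coeff_def)
    qed
    qed
  qed
  then show ?thesis using op W W1 by blast
qed

end

lemma nabla_smooth:
  assumes X: "X \<in> g.Sec" and W: "open W" and V: "V \<in> sections (tangent_bundle M) W"
  shows "(\<lambda>x. nabla X x (V x)) \<in> sections g W"
proof (rule g.section_glue[OF W])
  fix m assume m: "m \<in> W"
  obtain N \<phi> where c: "(N, \<phi>) \<in> M" "m \<in> N" by (rule t.chart_at)
  have "open (N \<inter> W)" "m \<in> N \<inter> W" using t.chart_open[OF c(1)] W c m by auto
  then obtain U1 r u where u: "m \<in> U1" "U1 \<subseteq> N \<inter> W" "local_frame M g U1 r u" "\<forall>i<r. u i \<in> g.Sec"
    by (rule g.global_frame)
  \<comment> \<open>The system needs one open set that lies in a chart and carries frames of both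
    \<open>g\<close> and \<open>t\<close>.\<close>
  obtain U s z where z: "m \<in> U" "U \<subseteq> U1" "local_frame M t U s z"
    by (rule t.frame_near[OF g.frame_open[OF u(3)] u(1)])
  have uU: "local_frame M g U r u"
    using g.local_frame_subset[OF u(3), of U] z t.frame_open[OF z(3)] by (simp add: Int_absorb1)
  have VU: "V \<in> sections (tangent_bundle M) U" using V z u by (auto simp: tangent_bundle_def)
  have "U \<subseteq> N" using z u by blast
  from nabla_smooth_near[OF X c(1) this uU u(4) z(3) z(1) t.frame_open[OF z(3)] z(1) order_refl VU]
  show "\<exists>V'. open V' \<and> m \<in> V' \<and> V' \<subseteq> W \<and> (\<lambda>x. nabla X x (V x)) \<in> sections g V'"
    using z u by blast
qed

lemma linear_connection_nabla: "linear_connection M g nabla"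
  unfolding linear_connection_def
  using nabla_carrier nabla_smooth nabla_add nabla_scale by simp

subsection \<open>The Cartan algebroid and its parallel sections\<close>

lemma splitting_nabla: "v \<in> G m \<Longrightarrow> splitting M g nabla m v = split m v"
proof -
  assume "v \<in> G m"
  then obtain X where X: "X \<in> g.Sec" "X m = v" by (rule g.value_extend[of v m, simplified])
  show ?thesis
    using g.splitting_eq[OF linear_connection_nabla X(1)] nabla_incl[OF X(1)] unfolding X(2)[symmetric] by simp
qed

lemma split_image: "split m ` G m = prolongation M t G m"
proof (intro subset_antisym subsetI)
  fix k assume "k \<in> prolongation M t G m"
  then have k: "compatible m k" by (rule prolongation_compatible)
  have "jet_proj m k \<in> G m" using compatible_carrier[OF k] by simp
  moreover have "k = split m (jet_proj m k)" using split_eqI[OF k refl] by simp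
  ultimately show "k \<in> split m ` G m" by (rule rev_image_eqI)
qed (use compatible_split prolongation_eq in auto)

lemma canonical_connection_nabla: "canonical_connection M t G nabla"
proof -
  have "splitting M g nabla m ` G m = prolongation M t G m" for m
    unfolding split_image[symmetric] by (rule image_cong) (simp_all add: splitting_nabla)
  then show ?thesis
    using linear_connection_nabla unfolding canonical_connection_def g_def by simp
qed

text \<open>Over \<open>X m\<close> there is only one element of the prolongation, so
  \<open>D\<close> and \<open>nabla\<close> have the same splitting, and a connection can be read
  off its splitting. Off the smooth sections a connection is unconstrained, hence the restriction to
  \<open>X\<close>.\<close>

lemma canonical_connection_unique:
  assumes "canonical_connection M t G D" and X: "X \<in> g.Sec"
  shows "D X = nabla X"
proof
  fix m
  have D: "linear_connection M g D" and im: "splitting M g D m ` G m = prolongation M t G m"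
    using assms(1) unfolding canonical_connection_def g_def by auto
  note sD = g.splitting_spec[OF D X, where m=m]
  have "splitting M g D m (X m) \<in> prolongation M t G m" unfolding im[symmetric] using X by simp
  from split_eqI[OF prolongation_compatible[OF this] sD(2)]
  have sp: "split m (X m) = splitting M g D m (X m)" .
  show "D X m = nabla X m"
  proof (rule extensionalityI[where A="carrier (tangent_space M m)"])
    show "D X m \<in> extensional (carrier (tangent_space M m))"
      using g.connection_carrier[OF D X, of m] by (simp add: hom_space_def)
    show "nabla X m \<in> extensional (carrier (tangent_space M m))"
      using nabla_carrier[OF X, of m] by (simp add: hom_space_def)
    fix v assume v: "v \<in> carrier (tangent_space M m)"
    obtain Y where Y: "Y \<in> g.Sec" "g.anc m (Y m) = v" by (rule g.anchor_onto[OF v])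
    note Dc = g.connection_closed[OF D X v]
    show "D X m v = nabla X m v"
    proof (rule g.br_eqI[of _ m])
      fix l assume l: "linear_functional (fibre g m) l"
      show "l (D X m v) = l (nabla X m v)"
        using lf_nabla[OF X l Y(1)] g.F.lf_add[OF l g.sec_carrier[OF g.sec_br[OF X Y(1)]] Dc]
        unfolding Y(2) sp sD(3)[OF Y(1)] by simp
    qed (rule Dc nabla_closed[OF X v])+
  qed
qed

section \<open>Stability of the equations under brackets\<close>

text \<open>Skew symmetry of the torsion turns the difference in \<open>compatible\<close> into a
  sum, so that the second equation reads as a Leibniz rule.\<close>

lemma compatible_sectionI:
  assumes \<xi>: "\<xi> \<in> g.JSec"
    and p: "\<And>U. U \<in> g.Sec \<Longrightarrow> t.pr (g.act \<xi> U) m = t.act (g.pr \<xi>) (t.pr U) m"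
    and T: "\<And>U V l. U \<in> g.Sec \<Longrightarrow> V \<in> g.Sec \<Longrightarrow> linear_functional (fibre t m) l \<Longrightarrow>
      l (t.act (g.pr \<xi>) (t.torsion U V) m) =
      l (t.torsion (g.act \<xi> U) V m) + l (t.torsion U (g.act \<xi> V) m)"
  shows "compatible m (\<xi> m)"
  unfolding compatible_def
proof (intro conjI ballI allI impI)
  show "\<xi> m \<in> carrier (g.J m)" by (rule g.jsec_carrier[OF \<xi>])
  fix U assume U: "U \<in> g.Sec"
  show "jet_proj m (g.jet_act m (\<xi> m) U) = t.jet_act m (jet_proj m (\<xi> m)) (t.pr U)"
    using p[OF U] unfolding t.pr_def g.pr_def t.act_def g.act_def .
  fix V l assume V: "V \<in> g.Sec" and l: "linear_functional (fibre t m) l"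
  note E = g.act_sec[OF \<xi> U] g.act_sec[OF \<xi> V]
  show "l (t.jet_act m (jet_proj m (\<xi> m)) (t.torsion U V)) =
      tors l m V (g.jet_act m (\<xi> m) U) - tors l m U (g.jet_act m (\<xi> m) V)"
    using T[OF U V l] tors_value[OF l E(1) V] tors_value[OF l E(2) U]
      t.lf_torsion_skew[OF l g_sec_jet[OF U] g_sec_jet[OF E(2)]]
    unfolding t.pr_def g.pr_def t.act_def g.act_def by simp
qed

lemma compatible_sectionD:
  assumes \<xi>: "\<xi> \<in> g.JSec" and k: "\<And>m. compatible m (\<xi> m)" and U: "U \<in> g.Sec"
  shows "t.pr (g.act \<xi> U) = t.act (g.pr \<xi>) (t.pr U)"
    and "V \<in> g.Sec \<Longrightarrow> t.act (g.pr \<xi>) (t.torsion U V) =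
      sadd t (t.torsion (g.act \<xi> U) V) (t.torsion U (g.act \<xi> V))"
proof -
  show "t.pr (g.act \<xi> U) = t.act (g.pr \<xi>) (t.pr U)"
    using compatible_proj[OF k U] unfolding t.pr_def g.pr_def t.act_def g.act_def by (rule ext)
  assume V: "V \<in> g.Sec"
  note E = g.act_sec[OF \<xi> U] g.act_sec[OF \<xi> V]
  note s = torsion_g_sec[OF E(1) V] torsion_g_sec[OF U E(2)]
  show "t.act (g.pr \<xi>) (t.torsion U V) = sadd t (t.torsion (g.act \<xi> U) V) (t.torsion U (g.act \<xi> V))"
  proof
    fix m
    show "t.act (g.pr \<xi>) (t.torsion U V) m = sadd t (t.torsion (g.act \<xi> U) V) (t.torsion U (g.act \<xi> V)) m"
    proof (rule t.br_eqI[of _ m])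
      fix l assume l: "linear_functional (fibre t m) l"
      have "l (t.act (g.pr \<xi>) (t.torsion U V) m) = l (t.torsion (g.act \<xi> U) V m) + l (t.torsion U (g.act \<xi> V) m)"
        using compatible_torsion[OF k U V l] tors_value[OF l E(1) V] tors_value[OF l E(2) U]
          t.lf_torsion_skew[OF l g_sec_jet[OF U] g_sec_jet[OF E(2)]]
        unfolding t.pr_def g.pr_def t.act_def g.act_def by simp
      then show "l (t.act (g.pr \<xi>) (t.torsion U V) m) = l (sadd t (t.torsion (g.act \<xi> U) V) (t.torsion U (g.act \<xi> V)) m)"
        unfolding t.lf_sadd[OF l s] .
    next
      show "t.act (g.pr \<xi>) (t.torsion U V) m \<in> carrier (fibre t m)"
        by (rule t.sec_carrier[OF t.act_sec[OF g_sec_jet[OF g.pr_sec[OF \<xi>]] torsion_g_sec[OF U V]]])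
      show "sadd t (t.torsion (g.act \<xi> U) V) (t.torsion U (g.act \<xi> V)) m \<in> carrier (fibre t m)"
        by (rule t.sec_carrier[OF t.sec_sadd[OF s]])
    qed
  qed
qed

text \<open>Commutators of intertwined derivations are intertwined, and the mixed terms of the
  twofold Leibniz rule are symmetric in \<open>\<xi>\<close> and \<open>\<eta>\<close>, hence
  cancel. Compatibility is required at all points because the second operator differentiates the
  result of the first.\<close>

lemma compatible_bracket:
  assumes \<xi>: "\<xi> \<in> g.JSec" "\<And>m. compatible m (\<xi> m)" and \<eta>: "\<eta> \<in> g.JSec" "\<And>m. compatible m (\<eta> m)"
    and \<zeta>: "bracket (J1 M g) \<xi> \<eta> = \<zeta>" "\<zeta> \<in> g.JSec"
  shows "compatible m (\<zeta> m)"
proof (rule compatible_sectionI[OF \<zeta>(2)])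
  note s = g.pr_sec[OF \<xi>(1)] g.pr_sec[OF \<eta>(1)]
  have e: "g.act \<xi> U \<in> g.Sec" "g.act \<eta> U \<in> g.Sec" if "U \<in> g.Sec" for U
    using g.act_sec[OF \<xi>(1) that] g.act_sec[OF \<eta>(1) that] .
  have pz: "g.pr \<zeta> = bracket (J1 M t) (g.pr \<xi>) (g.pr \<eta>)"
    using g.pr_J1_bracket[OF \<xi>(1) \<eta>(1)] unfolding \<zeta>(1) g_bracket .
  have az: "g.act \<zeta> U = g.ssub (g.act \<xi> (g.act \<eta> U)) (g.act \<eta> (g.act \<xi> U))" if "U \<in> g.Sec" for U
    using g.act_J1_bracket[OF \<xi>(1) \<eta>(1) that] unfolding \<zeta>(1) .
  have apz: "t.act (g.pr \<zeta>) Z = t.ssub (t.act (g.pr \<xi>) (t.act (g.pr \<eta>) Z)) (t.act (g.pr \<eta>) (t.act (g.pr \<xi>) Z))"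
    if "Z \<in> t.Sec" for Z
    unfolding pz by (rule t.act_J1_bracket[OF g_sec_jet[OF s(1)] g_sec_jet[OF s(2)] that])
  have sub: "g.ssub U V = sadd (J1 M t) U (sscale (J1 M t) (\<lambda>x. -1) V)" for U V
    by (simp add: g.ssub_def g_ops)
  note xd = compatible_sectionD[OF \<xi>] and yd = compatible_sectionD[OF \<eta>]
  have ta: "t.act (g.pr \<xi>) Z \<in> t.Sec" "t.act (g.pr \<eta>) Z \<in> t.Sec" if "Z \<in> t.Sec" for Z
    using t.act_sec[OF g_sec_jet[OF s(1)] that] t.act_sec[OF g_sec_jet[OF s(2)] that] .
  {
    fix U assume U: "U \<in> g.Sec"
    show "t.pr (g.act \<zeta> U) m = t.act (g.pr \<zeta>) (t.pr U) m"
    proof (rule t.br_eqI[of _ m])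
      fix l assume l: "linear_functional (fibre t m) l"
      note j = g_sec_jet[OF e(1)[OF e(2)[OF U]]] g_sec_jet[OF e(2)[OF e(1)[OF U]]]
      have "l (t.pr (g.act \<zeta> U) m) = l (t.pr (g.act \<xi> (g.act \<eta> U)) m) - l (t.pr (g.act \<eta> (g.act \<xi> U)) m)"
        unfolding az[OF U] sub using j by (simp add: t.lf_jsec[OF l])
      also have "\<dots> = l (t.act (g.pr \<zeta>) (t.pr U) m)"
        unfolding apz[OF pr_g_sec[OF U]] xd(1)[OF e(2)[OF U]] yd(1)[OF e(1)[OF U]] xd(1)[OF U] yd(1)[OF U]
          t.lf_ssub[OF l ta(1)[OF ta(2)[OF pr_g_sec[OF U]]] ta(2)[OF ta(1)[OF pr_g_sec[OF U]]]] ..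
      finally show "l (t.pr (g.act \<zeta> U) m) = l (t.act (g.pr \<zeta>) (t.pr U) m)" .
    next
      show "t.pr (g.act \<zeta> U) m \<in> carrier (fibre t m)"
        by (rule t.sec_carrier[OF pr_g_sec[OF g.act_sec[OF \<zeta>(2) U]]])
      show "t.act (g.pr \<zeta>) (t.pr U) m \<in> carrier (fibre t m)"
        by (rule t.sec_carrier[OF t.act_sec[OF g_sec_jet[OF g.pr_sec[OF \<zeta>(2)]] pr_g_sec[OF U]]])
    qed
    fix V l assume V: "V \<in> g.Sec" and l: "linear_functional (fibre t m) l"
    have tl: "l (t.torsion (g.act \<zeta> A) B m) =
        l (t.torsion (g.act \<xi> (g.act \<eta> A)) B m) - l (t.torsion (g.act \<eta> (g.act \<xi> A)) B m)"
      if A: "A \<in> g.Sec" and B: "B \<in> g.Sec" for A B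
    proof -
      note j = g_sec_jet[OF e(1)[OF e(2)[OF A]]] g_sec_jet[OF e(2)[OF e(1)[OF A]]] g_sec_jet[OF B]
      show ?thesis unfolding az[OF A] sub using j by (simp add: t.lf_torsion_sadd[OF l] t.lf_torsion_sscale[OF l])
    qed
    have sk: "l (t.torsion A B m) = - l (t.torsion B A m)" if "A \<in> g.Sec" "B \<in> g.Sec" for A B
      by (rule t.lf_torsion_skew[OF l g_sec_jet[OF that(2)] g_sec_jet[OF that(1)]])
    \<comment> \<open>The Leibniz rule applied twice; it is used below in both orders of
      \<open>\<xi>\<close> and \<open>\<eta>\<close>.\<close>
    have two: "l (t.act (g.pr \<xi>') (t.act (g.pr \<eta>') (t.torsion U V)) m) =
        l (t.torsion (g.act \<xi>' (g.act \<eta>' U)) V m) + l (t.torsion (g.act \<eta>' U) (g.act \<xi>' V) m) +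
        (l (t.torsion (g.act \<xi>' U) (g.act \<eta>' V) m) + l (t.torsion U (g.act \<xi>' (g.act \<eta>' V)) m))"
      if \<xi>': "\<xi>' \<in> g.JSec" "\<And>m. compatible m (\<xi>' m)" and \<eta>': "\<eta>' \<in> g.JSec" "\<And>m. compatible m (\<eta>' m)"
      for \<xi>' \<eta>'
    proof -
      note e' = g.act_sec[OF \<xi>'(1)] g.act_sec[OF \<eta>'(1)]
      note xd' = compatible_sectionD(2)[OF \<xi>'] and yd' = compatible_sectionD(2)[OF \<eta>']
      note ss = torsion_g_sec[OF e'(2)[OF U] V] torsion_g_sec[OF U e'(2)[OF V]]
      have "l (t.act (g.pr \<xi>') (t.act (g.pr \<eta>') (t.torsion U V)) m) =
          l (t.act (g.pr \<xi>') (t.torsion (g.act \<eta>' U) V) m) + l (t.act (g.pr \<xi>') (t.torsion U (g.act \<eta>' V)) m)"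
        unfolding yd'[OF U V] by (rule t.lf_act_arg_sadd[OF l]) (use ss g_sec_jet[OF g.pr_sec[OF \<xi>'(1)]] in simp_all)
      then show ?thesis
        unfolding xd'[OF e'(2)[OF U] V] xd'[OF U e'(2)[OF V]]
          t.lf_sadd[OF l torsion_g_sec[OF e'(1)[OF e'(2)[OF U]] V] torsion_g_sec[OF e'(2)[OF U] e'(1)[OF V]]]
          t.lf_sadd[OF l torsion_g_sec[OF e'(1)[OF U] e'(2)[OF V]] torsion_g_sec[OF U e'(1)[OF e'(2)[OF V]]]] .
    qed
    show "l (t.act (g.pr \<zeta>) (t.torsion U V) m) =
        l (t.torsion (g.act \<zeta> U) V m) + l (t.torsion U (g.act \<zeta> V) m)"
      unfolding apz[OF torsion_g_sec[OF U V]]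
        t.lf_ssub[OF l ta(1)[OF ta(2)[OF torsion_g_sec[OF U V]]] ta(2)[OF ta(1)[OF torsion_g_sec[OF U V]]]]
        two[OF \<xi> \<eta>] two[OF \<eta> \<xi>] sk[OF U g.act_sec[OF \<zeta>(2) V]] tl[OF U V] tl[OF V U]
      using sk[OF U e(1)[OF e(2)[OF V]]] sk[OF U e(2)[OF e(1)[OF V]]] by simp
  }
qed

text \<open>The bracket of two lifted sections solves the equations and projects to the bracket of
  \<open>X\<close> and \<open>Y\<close>; by uniqueness it is the lift of that bracket.\<close>

lemma cartan_algebroid_nabla: "cartan_algebroid M g nabla"
proof -
  let ?S = "splitting M g nabla"
  note lc = linear_connection_nabla
  interpret k: transitive_algebroid M "J1 M g" by (rule g.transitive_algebroid_J1)
  have S: "(\<lambda>m. ?S m (X m)) \<in> g.JSec" if "X \<in> g.Sec" for X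
    by (rule g.splitting_smooth[OF lc that open_UNIV])
  have "(\<lambda>m. ?S m (g.br X Y m)) = bracket (J1 M g) (\<lambda>m. ?S m (X m)) (\<lambda>m. ?S m (Y m))"
    if X: "X \<in> g.Sec" and Y: "Y \<in> g.Sec" for X Y
  proof
    fix m
    let ?\<zeta> = "bracket (J1 M g) (\<lambda>m. ?S m (X m)) (\<lambda>m. ?S m (Y m))"
    have z: "?\<zeta> \<in> g.JSec" using k.sec_br[of "\<lambda>m. ?S m (X m)" "\<lambda>m. ?S m (Y m)"] S[OF X] S[OF Y] by simp
    have c: "compatible x (?S x (Z x))" if "Z \<in> g.Sec" for Z x
      unfolding splitting_nabla[OF g_sec_G[OF that]] by (rule compatible_split[OF g_sec_G[OF that]])
    have p: "g.pr (\<lambda>m. ?S m (Z m)) = Z" if "Z \<in> g.Sec" for Z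
      unfolding g.pr_def by (rule ext, rule g.jet_proj_splitting[OF lc g.sec_carrier[OF that]])
    have "g.pr ?\<zeta> = g.br X Y"
      using g.pr_J1_bracket[OF S[OF X] S[OF Y]] unfolding p[OF X] p[OF Y] .
    from fun_cong[OF this, of m] have "jet_proj m (?\<zeta> m) = g.br X Y m" unfolding g.pr_def .
    from split_eqI[OF compatible_bracket[OF S[OF X] c[OF X] S[OF Y] c[OF Y] refl z] this]
    show "?S m (g.br X Y m) = ?\<zeta> m"
      unfolding splitting_nabla[OF g_sec_G[OF g.sec_br[OF X Y]]] .
  qed
  moreover have "bundle_morphism g (J1 M g) ?S"
    unfolding bundle_morphism_def using g.splitting_linear[OF lc] g.splitting_smooth[OF lc] by simp
  moreover have "anchor (J1 M g) m (?S m v) = anchor g m v" if "v \<in> carrier (fibre g m)" for m v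
    using g.jet_proj_splitting[OF lc that] by (simp del: g_anchor)
  ultimately show ?thesis
    using lc g.lie_algebroid unfolding cartan_algebroid_def cartan_connection_def lie_algebroid_morphism_def by simp
qed

section \<open>Parallel sections and symmetries\<close>

text \<open>\<open>nabla X\<close> vanishes at \<open>m\<close> exactly if
  \<open>split m (X m)\<close> is the jet of \<open>X\<close>, and the values of
  \<open>split\<close> make up the prolongation.\<close>

lemma parallel_iff:
  assumes X: "X \<in> g.Sec"
  shows "(\<forall>v\<in>carrier (tangent_space M m). nabla X m v = \<zero>\<^bsub>fibre g m\<^esub>) \<longleftrightarrow> jet M g m X \<in> prolongation M t G m"
proof
  assume n: "\<forall>v\<in>carrier (tangent_space M m). nabla X m v = \<zero>\<^bsub>fibre g m\<^esub>"
  have XG: "X m \<in> G m" by (rule g_sec_G[OF X])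
  have "split m (X m) = jet M g m X"
  proof (rule g.jet_space_lfI[OF split_X[OF X] g.jet_in_carrier[OF X]])
    show "l (jet_proj m (split m (X m))) = l (jet_proj m (jet M g m X))" for l
      using jet_proj_split[OF XG] X by simp
    fix l Y assume l: "linear_functional (fibre g m) l" and Y: "Y \<in> g.Sec"
    have "nabla X m (g.anc m (Y m)) = \<zero>\<^bsub>fibre g m\<^esub>" using n g.anchor_tangent[OF g.sec_carrier[OF Y]] by blast
    then show "l (g.jet_act m (split m (X m)) Y) = l (g.jet_act m (jet M g m X) Y)"
      using lf_nabla[OF X l Y] g.F.lf_zero[OF l] X Y by (simp del: g_fibre)
  qed
  then show "jet M g m X \<in> prolongation M t G m"
    using compatible_split[OF XG] by (simp add: prolongation_eq)
next
  assume "jet M g m X \<in> prolongation M t G m"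
  from split_eqI[OF prolongation_compatible[OF this], of "X m"] X
  have sp: "split m (X m) = jet M g m X" by simp
  show "\<forall>v\<in>carrier (tangent_space M m). nabla X m v = \<zero>\<^bsub>fibre g m\<^esub>"
  proof
    fix v assume v: "v \<in> carrier (tangent_space M m)"
    obtain Y where Y: "Y \<in> g.Sec" "g.anc m (Y m) = v" by (rule g.anchor_onto[OF v])
    show "nabla X m v = \<zero>\<^bsub>fibre g m\<^esub>"
    proof (rule g.br_eqI[of _ m])
      fix l assume l: "linear_functional (fibre g m) l"
      show "l (nabla X m v) = l \<zero>\<^bsub>fibre g m\<^esub>"
        using lf_nabla[OF X l Y(1)] X Y(1) unfolding Y(2) sp g.F.lf_zero[OF l] by simp
    qed (rule nabla_closed[OF X v] g.F.M.zero_closed)+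
  qed
qed

text \<open>Membership yields \<open>X m = jet M t m W\<close> for some \<open>W\<close>. That
  \<open>pr X\<close> may replace \<open>W\<close> is seen by projecting brackets with
  prolongations: \<open>[pr X, Z]\<close> and \<open>[W, Z]\<close> agree at \<open>m\<close> for
  all \<open>Z\<close>.\<close>

lemma jet_in_prolongation:
  assumes X: "X \<in> g.Sec" and k: "jet M g m X \<in> prolongation M t G m"
  shows "X m = jet M t m (t.pr X)"
proof -
  obtain X' W where X': "X' \<in> g.Sec" "jet M g m X = jet M g m X'" and W: "W \<in> t.Sec"
    and e: "jet M (J1 M t) m X' = jet M (J1 M t) m (prolong M t W)"
    using k unfolding prolongation_iff by blast
  have "jet M (J1 M t) m X = jet M (J1 M t) m X'"
    using jet_extend_g[OF X, of m] jet_extend_g[OF X'(1), of m] X'(2) by simp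
  note pj = prolongation_jet[OF X W trans[OF this e]]
  have p: "t.pr X \<in> t.Sec" by (rule pr_g_sec[OF X])
  show ?thesis
  proof (rule t.jet_space_lfI[OF t.jsec_carrier[OF g_sec_jet[OF X]] t.jet_in_carrier[OF p]])
    show "l (jet_proj m (X m)) = l (jet_proj m (jet M t m (t.pr X)))" for l
      using p by (simp add: t.pr_def)
    fix l Z assume l: "linear_functional (fibre t m) l" and Z: "Z \<in> t.Sec"
    have Zj: "prolong M t Z \<in> t.JSec" using Z by simp
    have "t.pr (bracket (J1 M t) X (prolong M t Z)) m = t.pr (bracket (J1 M t) (prolong M t W) (prolong M t Z)) m"
      using pj(2)[OF Zj] by (simp add: t.pr_def)
    then have "t.br (t.pr X) Z m = t.br W Z m"
      using t.pr_J1_bracket[OF g_sec_jet[OF X] Zj] t.pr_J1_bracket[OF t.prolong_jsec[OF W] Zj] W Z by simp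
    then show "l (t.jet_act m (X m) Z) = l (t.jet_act m (jet M t m (t.pr X)) Z)"
      using pj(1) p W Z by simp
  qed
qed

text \<open>For a symmetry \<open>W\<close> the jet of \<open>prolong M t W\<close> is a second jet
  by construction. Conversely a parallel \<open>X\<close> is the prolongation of \<open>pr X\<close>
  at every point, so \<open>pr\<close> is the inverse map.\<close>

lemma symmetries_parallel: "bij_betw (prolong M t) (symmetries M t G) (parallel_sections M g nabla)"
proof (rule bij_betwI[where g=t.pr])
  have sym: "W \<in> symmetries M t G \<longleftrightarrow> W \<in> t.Sec \<and> prolong M t W \<in> g.Sec" for W
    unfolding symmetries_def g_def by simp
  have par: "X \<in> parallel_sections M g nabla \<longleftrightarrow> X \<in> g.Sec \<and> (\<forall>m. jet M g m X \<in> prolongation M t G m)" for X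
    using parallel_iff[of X] unfolding parallel_sections_def by blast
  have prolong_pr: "prolong M t (t.pr X) = X" if "X \<in> parallel_sections M g nabla" for X
    using jet_in_prolongation[of X] that unfolding par prolong_def by auto
  show "prolong M t \<in> symmetries M t G \<rightarrow> parallel_sections M g nabla"
  proof
    fix W assume "W \<in> symmetries M t G"
    then have W: "W \<in> t.Sec" "prolong M t W \<in> g.Sec" unfolding sym by auto
    show "prolong M t W \<in> parallel_sections M g nabla"
      unfolding par prolongation_iff using W by blast
  qed
  show "t.pr \<in> parallel_sections M g nabla \<rightarrow> symmetries M t G"
  proof
    fix X assume X: "X \<in> parallel_sections M g nabla"
    then have "X \<in> g.Sec" unfolding par by blast
    then show "t.pr X \<in> symmetries M t G" unfolding sym prolong_pr[OF X] by simp
  qed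
  show "t.pr (prolong M t W) = W" if "W \<in> symmetries M t G" for W
    using that unfolding sym by simp
  show "prolong M t (t.pr X) = X" if "X \<in> parallel_sections M g nabla" for X by (rule prolong_pr[OF that])
qed

end

theorem theorem9p4:
  fixes M :: "('m::{t2_space, second_countable_topology}, 'e::euclidean_space) atlas"
    and t :: "('m, 'v) lie_algebroid"
    and G :: "'m \<Rightarrow> ('m \<Rightarrow> 'v) set set"
  assumes "smooth_manifold M"
    and "lie_algebroid M t"
    and "transitive M t"
    and "infinitesimal_geometric_structure M t G"
    and "surjective_structure t G"
    and "Theta_reduced M t G"
    and "\<forall>m. inj_on (lower_coboundary M t m) (carrier (cotensor M m (structure_kernel M t G m)))"
  shows "\<exists>D. canonical_connection M t G D \<and>
    (\<forall>D'. canonical_connection M t G D' \<longrightarrow>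
       (\<forall>X\<in>sections (structure_algebroid M t G) UNIV. D' X = D X)) \<and>
    cartan_algebroid M (structure_algebroid M t G) D \<and>
    bij_betw (prolong M t) (symmetries M t G)
      (parallel_sections M (structure_algebroid M t G) D)"
proof -
  interpret geometric_structure M t G "structure_algebroid M t G"
  proof (intro geometric_structure.intro geometric_structure_axioms.intro)
    show "transitive_algebroid M t"
      by (intro transitive_algebroid.intro algebroid.intro manifold.intro algebroid_axioms.intro
          transitive_algebroid_axioms.intro assms)
  qed (use assms in simp_all)
  show ?thesis
    using canonical_connection_nabla canonical_connection_unique cartan_algebroid_nabla symmetries_parallel
    by blast
qed

end
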